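(* Assume there are $\rho>1$ and $0<\delta\le1$ and a constant $C$ such that $\mathbb{E}(|Y_1|^{2+\delta})<\infty$ and $\alpha_Y(k)\le Ck^{-\rho(2+\delta)(1+\delta)/\delta^2}$ for all $k\in\mathbb{N}$. For $\ell_n=n^s$ let $$s>\max\left\{\frac{1}{1+\delta\frac{\rho-1}{\rho+1}},\ \frac{1+\frac{\delta^2}{\rho(2+\delta)(1+\delta)}}{2+\frac{\delta^2}{\rho(2+\delta)(1+\delta)}}\right\}.$$ Then, under the hypothesis that $\mu$ is constant (there is $\mu_H\in\mathbb{R}$ with $\mu(x)=\mu_H$ for almost all $x\in[0,1]$), as $n\to\infty$, $$\sqrt{b_n}\left(\frac{\sqrt{\ell_n}}{\kappa_Y}U(n)-\int_0^1\int_0^1\sqrt{\sigma^2(x)+\sigma^2(y)}\,\mathrm{d}x\,\mathrm{d}y\cdot\sqrt{\frac2\pi}\right)\xrightarrow{\ \mathcal{D}\ }\mathcal{N}(0,\psi^2),$$ where $$\psi^2=4\int_0^1\mathbb{E}\left(\left|\int_0^1\Big(\mathbb{E}\big(|\sigma(x)Z-\sigma(y)Z'|\,\big|\,Z\big)-\mathbb{E}\big(|\sigma(x)Z-\sigma(y)Z'|\big)\Big)\mathrm{d}y\right|^2\right)\mathrm{d}x$$ for two independent standard normal random variables $Z$ and $Z'$.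
   Context: $(Y_i)_{i\in\mathbb{N}}$ is a strictly stationary real-valued process with $\mathbb{E}(Y_1)=0$, $\mathrm{Var}(Y_1)=1$. For $\sigma$-fields $\mathcal{A},\mathcal{B}$ let $\alpha(\mathcal{A},\mathcal{B})=\sup\{|\mathbb{P}(A)\mathbb{P}(B)-\mathbb{P}(A\cap B)|:A\in\mathcal{A},B\in\mathcal{B}\}$ and $\alpha_Y(k)=\sup_{m\in\mathbb{N}}\alpha(\sigma(Y_1,\dots,Y_m),\sigma(Y_{k+m},Y_{k+m+1},\dots))$; $(Y_i)$ is $\alpha$-mixing, i.e. $\alpha_Y(k)\to0$. The long run variance $\kappa_Y^2=\mathrm{Var}(Y_1)+2\sum_{k=1}^\infty\mathrm{Cov}(Y_1,Y_{k+1})$ (finite under the moment and mixing assumptions made) satisfies $\kappa_Y^2>0$. Observations: $X_i=X_{i,n}=\mu(i/n)+\sigma(i/n)Y_i$, $i=1,\dots,n$, where $\mu:[0,1]\to\mathbb{R}$ is càdlàg and $\sigma:[0,1]\to(0,\infty)$ is càdlàg and piecewise Lipschitz-continuous (the sum of a Lipschitz-continuous function and a piecewise constant function with a fixed finite number of jumps), with $\sigma(x)\ge\sigma_0$ for all $x\in[0,1]$ and some $\sigma_0>0$. Blocks: $\ell_n=n^s$, $b_n=n^{1-s}$ with $s\in(0.5,1)$; both are assumed to be integers. Local means $\hat\mu_j=\hat\mu_{j,n}=\frac1{\ell_n}\sum_{i=(j-1)\ell_n+1}^{j\ell_n}X_i$, $1\le j\le b_n$, and $$U(n)=\frac{1}{b_n(b_n-1)}\sum_{1\le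 j\ne k\le b_n}|\hat\mu_j-\hat\mu_k| .$$ *)

theory Defs
  imports "HOL-Probability.Probability"
begin

text \<open>
  Processes \<open>(Y\<^sub>i)\<close> are indexed by \<open>i \<ge> 1\<close>; the value at index \<open>0\<close> is never used.  Functions on
  \<open>[0,1]\<close> are functions on the reals of which only the values on \<open>{0..1}\<close> matter.
\<close>

definition strictly_stationary :: "'a measure \<Rightarrow> (nat \<Rightarrow> 'a \<Rightarrow> real) \<Rightarrow> bool" where
  "strictly_stationary M Y \<longleftrightarrow>
     (\<forall>i\<ge>1. Y i \<in> borel_measurable M) \<and>
     (\<forall>J k. finite J \<and> J \<subseteq> {1..} \<longrightarrow>
        distr M (Pi\<^sub>M J (\<lambda>_. borel)) (\<lambda>w. \<lambda>j\<in>J. Y (j + k) w)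
      = distr M (Pi\<^sub>M J (\<lambda>_. borel)) (\<lambda>w. \<lambda>j\<in>J. Y j w))"

definition sigma_gen :: "'a measure \<Rightarrow> (nat \<Rightarrow> 'a \<Rightarrow> real) \<Rightarrow> nat set \<Rightarrow> 'a set set" where
  "sigma_gen M Y I =
     sigma_sets (space M) (\<Union>i\<in>I. {Y i -` B \<inter> space M | B. B \<in> sets borel})"

definition alpha_dep :: "'a measure \<Rightarrow> 'a set set \<Rightarrow> 'a set set \<Rightarrow> real" where
  "alpha_dep M \<A> \<B> =
     Sup {\<bar>measure M A * measure M B - measure M (A \<inter> B)\<bar> | A B. A \<in> \<A> \<and> B \<in> \<B>}"

definition alpha_mix :: "'a measure \<Rightarrow> (nat \<Rightarrow> 'a \<Rightarrow> real) \<Rightarrow> nat \<Rightarrow> real" where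
  "alpha_mix M Y k =
     (SUP m\<in>{1..}. alpha_dep M (sigma_gen M Y {1..m}) (sigma_gen M Y {k + m..}))"

definition covariance :: "'a measure \<Rightarrow> ('a \<Rightarrow> real) \<Rightarrow> ('a \<Rightarrow> real) \<Rightarrow> real" where
  "covariance M V W =
     (\<integral>w. (V w - (\<integral>v. V v \<partial>M)) * (W w - (\<integral>v. W v \<partial>M)) \<partial>M)"

text \<open>The series over lags \<open>k \<ge> 1\<close> is written with \<open>k\<close> shifted by one.\<close>

definition long_run_variance :: "'a measure \<Rightarrow> (nat \<Rightarrow> 'a \<Rightarrow> real) \<Rightarrow> real" where
  "long_run_variance M Y =
     covariance M (Y 1) (Y 1) + 2 * (\<Sum>k. covariance M (Y 1) (Y (Suc k + 1)))"

definition cadlag01 :: "(real \<Rightarrow> real) \<Rightarrow> bool" where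
  "cadlag01 f \<longleftrightarrow>
     (\<forall>x\<in>{0..<1}. (f \<longlongrightarrow> f x) (at_right x)) \<and>
     (\<forall>x\<in>{0<..1}. \<exists>l. (f \<longlongrightarrow> l) (at_left x))"

text \<open>
  A function is piecewise constant if it is constant on every subinterval that avoids a
  finite set \<open>D\<close> of jump points.
\<close>

definition piecewise_constant01 :: "(real \<Rightarrow> real) \<Rightarrow> bool" where
  "piecewise_constant01 p \<longleftrightarrow>
     (\<exists>D. finite D \<and>
        (\<forall>x\<in>{0..1}. \<forall>y\<in>{0..1}. x \<le> y \<and> {x..y} \<inter> D = {} \<longrightarrow> p x = p y))"

definition piecewise_lipschitz01 :: "(real \<Rightarrow> real) \<Rightarrow> bool" where
  "piecewise_lipschitz01 f \<longleftrightarrow>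
     (\<exists>g p L. L-lipschitz_on {0..1} g \<and> piecewise_constant01 p \<and>
        (\<forall>x\<in>{0..1}. f x = g x + p x))"

definition observation ::
    "(real \<Rightarrow> real) \<Rightarrow> (real \<Rightarrow> real) \<Rightarrow> (nat \<Rightarrow> 'a \<Rightarrow> real) \<Rightarrow> nat \<Rightarrow> nat \<Rightarrow> 'a \<Rightarrow> real" where
  "observation \<mu> \<sigma> Y n i w = \<mu> (real i / real n) + \<sigma> (real i / real n) * Y i w"

definition local_mean :: "(nat \<Rightarrow> 'a \<Rightarrow> real) \<Rightarrow> nat \<Rightarrow> nat \<Rightarrow> 'a \<Rightarrow> real" where
  "local_mean X l j w = (\<Sum>i = (j - 1) * l + 1..j * l. X i w) / real l"

text \<open>Gini's mean difference of the \<open>b\<close> local means over blocks of length \<open>l\<close>.\<close>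

definition U_stat :: "(nat \<Rightarrow> 'a \<Rightarrow> real) \<Rightarrow> nat \<Rightarrow> nat \<Rightarrow> 'a \<Rightarrow> real" where
  "U_stat X l b w =
     (\<Sum>(j, k)\<in>{(j, k). j \<in> {1..b} \<and> k \<in> {1..b} \<and> j \<noteq> k}.
        \<bar>local_mean X l j w - local_mean X l k w\<bar>) / (real b * (real b - 1))"

text \<open>
  \<open>E(|\<sigma>(x) Z - \<sigma>(y) Z'| | Z)\<close> is integrated over \<open>y\<close> pointwise in the sample point \<open>w\<close>, so a
  version that is jointly measurable in \<open>(y, w)\<close> is needed; the library's constant
  \<open>real_cond_exp\<close> chooses an arbitrary version for each \<open>y\<close> separately and does not guarantee
  this.  \<open>G x y\<close> below is such a version; one exists, namely \<open>G x y w = h x y (Z w)\<close> with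
  \<open>h x y z = E|\<sigma>(x) z - \<sigma>(y) Z'|\<close>, and \<open>psi_sq\<close> does not depend on the choice, by Fubini.
\<close>

definition cond_exp_version ::
    "'b measure \<Rightarrow> ('b \<Rightarrow> real) \<Rightarrow> ('b \<Rightarrow> real) \<Rightarrow> (real \<Rightarrow> real) \<Rightarrow>
     (real \<Rightarrow> real \<Rightarrow> 'b \<Rightarrow> real) \<Rightarrow> bool" where
  "cond_exp_version N Z Z' \<sigma> G \<longleftrightarrow>
     (\<forall>x\<in>{0..1}.
        (\<lambda>(y, w). G x y w) \<in> borel_measurable
           (restrict_space borel {0..1} \<Otimes>\<^sub>M vimage_algebra (space N) Z borel) \<and>
        (\<forall>y\<in>{0..1}. AE w in N. G x y w =
           real_cond_exp N (vimage_algebra (space N) Z borel)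
             (\<lambda>v. \<bar>\<sigma> x * Z v - \<sigma> y * Z' v\<bar>) w))"

definition psi_sq ::
    "'b measure \<Rightarrow> ('b \<Rightarrow> real) \<Rightarrow> ('b \<Rightarrow> real) \<Rightarrow> (real \<Rightarrow> real) \<Rightarrow>
     (real \<Rightarrow> real \<Rightarrow> 'b \<Rightarrow> real) \<Rightarrow> real" where
  "psi_sq N Z Z' \<sigma> G =
     4 * (LBINT x:{0..1}. (\<integral>w. \<bar>LBINT y:{0..1}.
            (G x y w - (\<integral>v. \<bar>\<sigma> x * Z v - \<sigma> y * Z' v\<bar> \<partial>N))\<bar>\<^sup>2 \<partial>N))"

end

theory Submission
  imports Defs
begin

text \<open>
  Up to a negligible error, the centred and scaled \<open>j\<close>-th local mean is \<open>\<sigma>(j/b) B\<^sub>j\<close>, where \<open>B\<^sub>j\<close> is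
  the sum of the \<open>Y\<^sub>i\<close> over the \<open>j\<close>-th block divided by its asymptotic standard deviation: \<open>\<sigma>\<close> has
  bounded total oscillation over the blocks.  Lindeberg's method, with sub-blocks of slowly growing
  length in the place of single summands and a test function smoothed by a Gaussian convolution,
  bounds the Wasserstein distance of \<open>B\<^sub>j\<close> from the standard normal distribution; the first lower
  bound on \<open>s\<close> makes \<open>\<surd>b\<close> times this rate vanish.

  In the Hoeffding decomposition of \<open>|x - y|\<close> with respect to the Gaussian limits, the kernel is
  conditionally negative definite, so the sum of its degenerate part over all pairs has a constant
  sign.  Its \<open>L\<^sup>1\<close> norm is therefore the modulus of its expectation, where mixing and the
  Wasserstein rate apply pair by pair, and no variance bound with fourth order mixing is needed.

  What remains is a sum over \<open>j\<close> of Lipschitz functions of \<open>B\<^sub>j\<close>.  Short gaps between the blocks make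
  its characteristic function factorise up to the mixing coefficients, which is where the second
  lower bound on \<open>s\<close> enters, and the factors are compared with Gaussian ones.
\<close>

section \<open>Gaussian integrals\<close>

text \<open>Gaussian comparison is tested throughout on Lipschitz functions only. This class
  contains everything that the later steps insert: the projections \<open>gdist\<close>, their
  averages, and cosine and sine of Lipschitz functions. The test function receives no artificial
  smoothing: when one sub-block is exchanged, the later ones are Gaussian already, and their
  variance does the smoothing. With j of them left the Taylor remainder costs a multiple of
  \<open>j powr (- (1 + \<delta>) / 2)\<close>, since only 2 + \<delta> moments exist. Summing over
  j and normalising gives the order \<open>n powr (- \<delta> / 2)\<close>, up to a logarithm and
  powers of the sub-block length. Both lower bounds on s are conditions on the number b of blocks,
  written as the power \<open>l powr \<beta>\<close> of the block length with \<beta> = (1 - s) / s.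
  A further obstacle is the value of \<mu> at 1: a cadlag function that is almost everywhere
  constant on [0,1] is constant on [0,1), but its value at the right end is free, so the very last
  observation is treated separately.\<close>

abbreviation gauss :: "real measure" where "gauss \<equiv> std_normal_distribution"

interpretation gauss: prob_space gauss
  using real_dist_normal_dist by (simp add: real_distribution_def)

lemma gauss_integrable_iff:
  fixes f :: "real \<Rightarrow> real"
  assumes "f \<in> borel_measurable borel"
  shows "integrable gauss f \<longleftrightarrow> integrable lborel (\<lambda>z. std_normal_density z * f z)"
  using assms by (subst integrable_density) auto

lemma gauss_integral_eq:
  fixes f :: "real \<Rightarrow> real"
  assumes "f \<in> borel_measurable borel"
  shows "(\<integral>z. f z \<partial>gauss) = (\<integral>z. std_normal_density z * f z \<partial>lborel)"
  using assms by (subst integral_density) auto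

text \<open>Change of variables and completing the square (the Cameron-Martin formula).\<close>

lemma gauss_shift:
  fixes f :: "real \<Rightarrow> real"
  assumes [measurable]: "f \<in> borel_measurable borel"
  shows "(\<integral>z. f (z + h) \<partial>gauss) = (\<integral>z. f z * exp (h * z - h\<^sup>2 / 2) \<partial>gauss)"
proof -
  have "(\<integral>z. f (z + h) \<partial>gauss) = (\<integral>z. std_normal_density z * f (z + h) \<partial>lborel)"
    by (rule gauss_integral_eq) simp
  also have "\<dots> = (\<integral>z. std_normal_density (- h + 1 * z) * f ((- h + 1 * z) + h) \<partial>lborel)"
    by (subst lborel_integral_real_affine[where c = 1 and t = "- h"]) auto
  also have "\<dots> = (\<integral>z. std_normal_density z * (f z * exp (h * z - h\<^sup>2 / 2)) \<partial>lborel)"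
    by (intro Bochner_Integration.integral_cong)
       (auto simp: std_normal_density_def exp_add[symmetric] power2_eq_square field_simps
         mult_exp_exp)
  also have "\<dots> = (\<integral>z. f z * exp (h * z - h\<^sup>2 / 2) \<partial>gauss)"
    by (rule gauss_integral_eq[symmetric]) simp
  finally show ?thesis .
qed

lemma gauss_integrable_exp: "integrable gauss (\<lambda>z. exp (c * z))"
proof -
  have "integrable lborel (\<lambda>z. std_normal_density (- c + 1 * z))"
    by (subst lborel_integrable_real_affine_iff) auto
  then have "integrable lborel (\<lambda>z. exp (c\<^sup>2 / 2) * std_normal_density (- c + 1 * z))"
    by (rule integrable_mult_right)
  also have "(\<lambda>z. exp (c\<^sup>2 / 2) * std_normal_density (- c + 1 * z))
      = (\<lambda>z. std_normal_density z * exp (c * z))"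
    by (auto simp: std_normal_density_def exp_add[symmetric] power2_eq_square field_simps
         mult_exp_exp fun_eq_iff)
  finally show ?thesis
    by (subst gauss_integrable_iff) auto
qed

lemma gauss_integrable_exp_abs: "integrable gauss (\<lambda>z. exp (c * \<bar>z\<bar>))"
proof (rule Bochner_Integration.integrable_bound)
  show "integrable gauss (\<lambda>z. exp (c * z) + exp (- c * z))"
    by (intro Bochner_Integration.integrable_add gauss_integrable_exp)
  show "AE z in gauss. norm (exp (c * \<bar>z\<bar>)) \<le> norm (exp (c * z) + exp (- c * z))"
    by (intro AE_I2) (auto simp: abs_if add_nonneg_nonneg less_le_not_le)
qed simp

lemma power_le_fact_exp: "(x::real) \<ge> 0 \<Longrightarrow> x ^ k \<le> fact k * exp x"
proof -
  assume x: "x \<ge> 0"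
  have "x ^ k / fact k = (\<Sum>i\<in>{k}. x ^ i /\<^sub>R fact i)" by (simp add: divide_inverse mult.commute)
  also have "\<dots> \<le> (\<Sum>i. x ^ i /\<^sub>R fact i)"
    using x by (intro sum_le_suminf summable_exp_generic) auto
  finally show ?thesis by (simp add: exp_def field_simps)
qed

lemma gauss_integrable_abs_power_exp: "integrable gauss (\<lambda>z. \<bar>z\<bar> ^ k * exp (c * \<bar>z\<bar>))"
proof (rule Bochner_Integration.integrable_bound)
  show "integrable gauss (\<lambda>z. fact k * exp ((c + 1) * \<bar>z\<bar>))"
    by (intro integrable_mult_right gauss_integrable_exp_abs)
  show "AE z in gauss. norm (\<bar>z\<bar> ^ k * exp (c * \<bar>z\<bar>)) \<le> norm (fact k * exp ((c + 1) * \<bar>z\<bar>) :: real)"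
  proof (intro AE_I2)
    fix z :: real
    have "\<bar>z\<bar> ^ k * exp (c * \<bar>z\<bar>) \<le> (fact k * exp \<bar>z\<bar>) * exp (c * \<bar>z\<bar>)"
      by (intro mult_right_mono power_le_fact_exp) auto
    also have "\<dots> = fact k * exp ((c + 1) * \<bar>z\<bar>)"
      by (simp add: mult_exp_exp algebra_simps)
    finally show "norm (\<bar>z\<bar> ^ k * exp (c * \<bar>z\<bar>)) \<le> norm (fact k * exp ((c + 1) * \<bar>z\<bar>) :: real)"
      by simp
  qed
qed simp

lemma gauss_integrable_abs_power: "integrable gauss (\<lambda>z. \<bar>z\<bar> ^ k)"
  using gauss_integrable_abs_power_exp[of k 0] by simp

lemma gauss_integrable_power [simp]: "integrable gauss (\<lambda>z. z ^ k)"
  by (rule integrable_std_normal_distribution_moment)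

lemma gauss_integrable_id [simp]: "integrable gauss (\<lambda>z. z)"
  using gauss_integrable_power[of 1] by simp

lemma gauss_integrable_abs [simp]: "integrable gauss (\<lambda>z. \<bar>z\<bar>)"
  using gauss_integrable_abs_power[of 1] by simp

lemma gauss_integral_id [simp]: "(\<integral>z. z \<partial>gauss) = 0"
  using integral_std_normal_distribution_moment_odd[of 1] by simp

lemma gauss_integral_square [simp]: "(\<integral>z. z\<^sup>2 \<partial>gauss) = 1"
  using std_normal_distribution_even_moments(1)[of 1] by simp

lemma gauss_integral_abs: "(\<integral>z. \<bar>z\<bar> \<partial>gauss) = sqrt (2 / pi)"
  using std_normal_distribution_odd_moments_abs[of 0] by simp

section \<open>Growth, measurability and integrability of Lipschitz functions\<close>

lemma lipschitz_absD:
  fixes f :: "real \<Rightarrow> real"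
  shows "L-lipschitz_on UNIV f \<Longrightarrow> \<bar>f x - f y\<bar> \<le> L * \<bar>x - y\<bar>"
  using lipschitz_onD[of L UNIV f x y] by (simp add: dist_real_def)

lemma lipschitz_absI:
  fixes f :: "real \<Rightarrow> real"
  shows "(\<And>x y. \<bar>f x - f y\<bar> \<le> L * \<bar>x - y\<bar>) \<Longrightarrow> 0 \<le> L \<Longrightarrow> L-lipschitz_on UNIV f"
  by (rule lipschitz_onI) (auto simp: dist_real_def)

lemma lipschitz_borel [measurable_dest]:
  fixes f :: "real \<Rightarrow> real"
  shows "L-lipschitz_on UNIV f \<Longrightarrow> f \<in> borel_measurable borel"
  by (intro borel_measurable_continuous_onI lipschitz_on_continuous_on)

lemma lipschitz_abs_growth:
  fixes f :: "real \<Rightarrow> real"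
  assumes "L-lipschitz_on UNIV f"
  shows "\<bar>f x\<bar> \<le> \<bar>f 0\<bar> + L * \<bar>x\<bar>"
  using lipschitz_absD[OF assms, of x 0] by simp

lemma (in prob_space) integrable_lipschitz:
  fixes f :: "real \<Rightarrow> real"
  assumes f: "L-lipschitz_on UNIV f" and X: "integrable M X"
  shows "integrable M (\<lambda>w. f (X w))"
proof (rule Bochner_Integration.integrable_bound)
  show "integrable M (\<lambda>w. \<bar>f 0\<bar> + L * \<bar>X w\<bar>)" using X by auto
  show "(\<lambda>w. f (X w)) \<in> borel_measurable M"
    using lipschitz_borel[OF f] X by (auto intro: measurable_compose)
  show "AE w in M. norm (f (X w)) \<le> norm (\<bar>f 0\<bar> + L * \<bar>X w\<bar>)"
  proof (intro AE_I2)
    fix w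
    show "norm (f (X w)) \<le> norm (\<bar>f 0\<bar> + L * \<bar>X w\<bar>)"
      using lipschitz_abs_growth[OF f, of "X w"] by simp
  qed
qed

section \<open>Gaussian smoothing of Lipschitz functions\<close>

text \<open>As a function of \<open>z\<close>, \<open>exp (h * z - h\<^sup>2 / 2)\<close> is the density of the normal distribution with
  mean \<open>h\<close> relative to the standard one: expanding it in \<open>h\<close> expands a Gaussian convolution without
  differentiating the convolved function.\<close>

lemma hermite_weight_derivs:
  fixes z h :: real
  defines "w \<equiv> (\<lambda>h. exp (h * z - h\<^sup>2 / 2))"
  shows "(w has_real_derivative (z - h) * w h) (at h)"
    and "((\<lambda>h. (z - h) * w h) has_real_derivative ((z - h)\<^sup>2 - 1) * w h) (at h)"
    and "((\<lambda>h. ((z - h)\<^sup>2 - 1) * w h) has_real_derivative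
           ((z - h) ^ 3 - 3 * (z - h)) * w h) (at h)"
  unfolding w_def
  by (auto intro!: derivative_eq_intros simp: algebra_simps power2_eq_square power3_eq_cube)

text \<open>The cubic is at most 4 * (|z| + 1)^3, and 4 * 3! = 24 enters through
  \<open>power_le_fact_exp\<close>. One factor \<open>exp \<bar>z\<bar>\<close> stems from this, the
  other one from the weight itself. The result is uniform in h and integrable against
  \<open>gauss\<close>.\<close>

lemma hermite_weight_bound:
  fixes z h :: real
  assumes "\<bar>h\<bar> \<le> 1"
  shows "\<bar>((z - h) ^ 3 - 3 * (z - h)) * exp (h * z - h\<^sup>2 / 2)\<bar> \<le> 24 * exp 1 * exp (2 * \<bar>z\<bar>)"
proof -
  let ?u = "\<bar>z\<bar> + 1"
  have u: "\<bar>z - h\<bar> \<le> ?u" using assms by linarith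
  have 3: "\<bar>z - h\<bar> ^ 3 \<le> ?u ^ 3" using u by (rule power_mono) simp
  have "?u ^ 1 \<le> ?u ^ 3" by (rule power_increasing) auto
  then have "\<bar>z - h\<bar> \<le> ?u ^ 3" using u by simp
  moreover have "\<bar>3 * (z - h)\<bar> = 3 * \<bar>z - h\<bar>" by (simp only: abs_mult abs_numeral)
  ultimately have "\<bar>(z - h) ^ 3 - 3 * (z - h)\<bar> \<le> 4 * ?u ^ 3"
    using 3 abs_triangle_ineq4[of "(z - h) ^ 3" "3 * (z - h)"] unfolding power_abs by linarith
  also have "\<dots> \<le> 4 * (fact 3 * exp ?u)"
    by (intro mult_left_mono power_le_fact_exp) auto
  also have "\<dots> = 24 * exp 1 * exp \<bar>z\<bar>"
    by (simp add: fact_numeral exp_add)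
  finally have 1: "\<bar>(z - h) ^ 3 - 3 * (z - h)\<bar> \<le> 24 * exp 1 * exp \<bar>z\<bar>" .
  have "h * z \<le> \<bar>h\<bar> * \<bar>z\<bar>" by (metis abs_ge_self abs_mult)
  also have "\<dots> \<le> 1 * \<bar>z\<bar>" using assms by (intro mult_right_mono) auto
  finally have "h * z \<le> \<bar>z\<bar>" by simp
  moreover have "0 \<le> h\<^sup>2" by simp
  ultimately have "exp (h * z - h\<^sup>2 / 2) \<le> exp \<bar>z\<bar>" unfolding exp_le_cancel_iff by linarith
  with 1 have "\<bar>(z - h) ^ 3 - 3 * (z - h)\<bar> * exp (h * z - h\<^sup>2 / 2)
       \<le> (24 * exp 1 * exp \<bar>z\<bar>) * exp \<bar>z\<bar>"
    by (intro mult_mono) auto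
  also have "\<dots> = 24 * exp 1 * exp (2 * \<bar>z\<bar>)"
    by (simp add: mult_exp_exp)
  finally show ?thesis by (simp add: abs_mult)
qed

text \<open>Maclaurin expansions of the weight and of its first two derivatives. All three stop at
  the third derivative, so that one bound \<open>B\<close> serves them all.\<close>

lemma hermite_weight_taylor:
  fixes z h :: real
  assumes h: "\<bar>h\<bar> \<le> 1"
  defines "B \<equiv> 24 * exp 1 * exp (2 * \<bar>z\<bar>)" and "w \<equiv> (\<lambda>h. exp (h * z - h\<^sup>2 / 2))"
  shows "\<bar>w h - 1 - z * h - (z\<^sup>2 - 1) * h\<^sup>2 / 2\<bar> \<le> B * \<bar>h\<bar> ^ 3"
    and "\<bar>(z - h) * w h - z - (z\<^sup>2 - 1) * h\<bar> \<le> B * \<bar>h\<bar> ^ 2"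
    and "\<bar>((z - h)\<^sup>2 - 1) * w h - (z\<^sup>2 - 1)\<bar> \<le> B * \<bar>h\<bar>"
proof -
  \<comment> \<open>The m-th derivative of \<open>w\<close> in h for m up to 3; its value for larger
    m never enters.\<close>
  define d where "d m = (\<lambda>h. (if m = 0 then 1 else if m = 1 then z - h
     else if m = (2::nat) then (z - h)\<^sup>2 - 1 else (z - h) ^ 3 - 3 * (z - h)) * w h)" for m
  have der: "DERIV (d m) t :> d (Suc m) t" if "m < 3" for m t
  proof -
    have "m = 0 \<or> m = 1 \<or> m = 2" using that by auto
    then show ?thesis
      using hermite_weight_derivs[of z t] by (auto simp: d_def w_def)
  qed
  have d3: "\<bar>d 3 t\<bar> \<le> B" if "\<bar>t\<bar> \<le> \<bar>h\<bar>" for t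
    using hermite_weight_bound[of t z] that h by (simp add: d_def w_def B_def)
  have B0: "B \<ge> 0" by (simp add: B_def)
  have d30: "\<bar>d 3 t\<bar> * \<bar>h\<bar> ^ k / c \<le> B * \<bar>h\<bar> ^ k" if "\<bar>t\<bar> \<le> \<bar>h\<bar>" "c \<ge> 1" for t k c
  proof -
    have "\<bar>d 3 t\<bar> * \<bar>h\<bar> ^ k / c \<le> \<bar>d 3 t\<bar> * \<bar>h\<bar> ^ k / 1"
      using that by (intro divide_left_mono) auto
    also have "\<dots> \<le> B * \<bar>h\<bar> ^ k"
      using d3[OF that(1)] by (simp add: mult_right_mono)
    finally show ?thesis .
  qed
  have dv: "d 0 h = w h" "d (Suc 0) h = (z - h) * w h" "d 2 h = ((z - h)\<^sup>2 - 1) * w h"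
    "d 0 0 = 1" "d (Suc 0) 0 = z" "d 2 0 = z\<^sup>2 - 1"
    by (auto simp: d_def w_def)
  have sums: "(\<Sum>m<3. d m 0 / fact m * h ^ m) = 1 + z * h + (z\<^sup>2 - 1) * h\<^sup>2 / 2"
    "(\<Sum>m<2. d (Suc m) 0 / fact m * h ^ m) = z + (z\<^sup>2 - 1) * h"
    "(\<Sum>m<1. d (m + 2) 0 / fact m * h ^ m) = z\<^sup>2 - 1"
    using dv by (simp_all add: numeral_3_eq_3 lessThan_Suc numeral_2_eq_2 fact_numeral)
  obtain t where t: "\<bar>t\<bar> \<le> \<bar>h\<bar>"
    "d 0 h = (\<Sum>m<3. d m 0 / fact m * h ^ m) + d 3 t / fact 3 * h ^ 3"
    using Maclaurin_bi_le[of d "d 0" 3 h] der by blast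
  have "\<bar>w h - 1 - z * h - (z\<^sup>2 - 1) * h\<^sup>2 / 2\<bar> = \<bar>d 3 t / fact 3 * h ^ 3\<bar>"
    using t(2) dv unfolding sums by simp
  also have "\<dots> = \<bar>d 3 t\<bar> * \<bar>h\<bar> ^ 3 / fact 3" by (simp add: abs_mult power_abs)
  also have "\<dots> \<le> B * \<bar>h\<bar> ^ 3" using t(1) by (intro d30) (auto simp: fact_ge_1)
  finally show "\<bar>w h - 1 - z * h - (z\<^sup>2 - 1) * h\<^sup>2 / 2\<bar> \<le> B * \<bar>h\<bar> ^ 3" .
  obtain t where t: "\<bar>t\<bar> \<le> \<bar>h\<bar>"
    "d 1 h = (\<Sum>m<2. d (Suc m) 0 / fact m * h ^ m) + d 3 t / fact 2 * h ^ 2"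
    using Maclaurin_bi_le[of "\<lambda>m. d (Suc m)" "d 1" 2 h] der by (auto simp: numeral_3_eq_3 numeral_2_eq_2)
  have "\<bar>(z - h) * w h - z - (z\<^sup>2 - 1) * h\<bar> = \<bar>d 3 t / fact 2 * h ^ 2\<bar>"
    using t(2) dv unfolding sums by simp
  also have "\<dots> = \<bar>d 3 t\<bar> * \<bar>h\<bar> ^ 2 / fact 2" by (simp add: abs_mult power_abs)
  also have "\<dots> \<le> B * \<bar>h\<bar> ^ 2" using t(1) by (intro d30) (auto simp: fact_ge_1)
  finally show "\<bar>(z - h) * w h - z - (z\<^sup>2 - 1) * h\<bar> \<le> B * \<bar>h\<bar> ^ 2" .
  obtain t where t: "\<bar>t\<bar> \<le> \<bar>h\<bar>"
    "d 2 h = (\<Sum>m<1. d (m + 2) 0 / fact m * h ^ m) + d 3 t / fact 1 * h ^ 1"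
    using Maclaurin_bi_le[of "\<lambda>m. d (m + 2)" "d 2" 1 h] der by (auto simp: numeral_3_eq_3 numeral_2_eq_2)
  have "\<bar>((z - h)\<^sup>2 - 1) * w h - (z\<^sup>2 - 1)\<bar> = \<bar>d 3 t / fact 1 * h ^ 1\<bar>"
    using t(2) dv unfolding sums by simp
  also have "\<dots> = \<bar>d 3 t\<bar> * \<bar>h\<bar> ^ 1 / fact 1" by (simp add: abs_mult power_abs)
  also have "\<dots> \<le> B * \<bar>h\<bar> ^ 1" using t(1) by (intro d30) (auto simp: fact_ge_1)
  finally show "\<bar>((z - h)\<^sup>2 - 1) * w h - (z\<^sup>2 - 1)\<bar> \<le> B * \<bar>h\<bar>" by simp
qed

lemma gauss_prob_UNIV [simp]: "measure gauss UNIV = 1"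
  using gauss.prob_space by simp

text \<open>The heat semigroup: \<open>t\<close> is the variance of the added noise, so that
  parameters add under composition.\<close>

definition gauss_smooth :: "real \<Rightarrow> (real \<Rightarrow> real) \<Rightarrow> real \<Rightarrow> real" where
  "gauss_smooth t f x = (\<integral>z. f (x + sqrt t * z) \<partial>gauss)"

lemma gauss_smooth_lipschitz:
  assumes f: "1-lipschitz_on UNIV f"
  shows "1-lipschitz_on UNIV (gauss_smooth t f)"
proof (rule lipschitz_absI)
  fix x y :: real
  let ?d = "\<lambda>z. f (x + sqrt t * z) - f (y + sqrt t * z)"
  have intf: "integrable gauss (\<lambda>z. f (x + sqrt t * z))" for x
    by (rule gauss.integrable_lipschitz[OF f]) simp
  have I: "integrable gauss ?d"
    by (rule Bochner_Integration.integrable_diff[OF intf intf])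
  have "gauss_smooth t f x - gauss_smooth t f y = (\<integral>z. ?d z \<partial>gauss)"
    unfolding gauss_smooth_def
    by (rule Bochner_Integration.integral_diff[OF intf intf, symmetric])
  then have "\<bar>gauss_smooth t f x - gauss_smooth t f y\<bar> \<le> (\<integral>z. \<bar>?d z\<bar> \<partial>gauss)"
    using integral_abs_bound[of gauss ?d] by simp
  also have "\<dots> \<le> (\<integral>z. \<bar>x - y\<bar> \<partial>gauss)"
  proof (rule integral_mono)
    show "integrable gauss (\<lambda>z. \<bar>?d z\<bar>)" using I by (rule integrable_abs)
    fix z show "\<bar>?d z\<bar> \<le> \<bar>x - y\<bar>"
      using lipschitz_absD[OF f, of "x + sqrt t * z" "y + sqrt t * z"] by simp
  qed simp
  finally show "\<bar>gauss_smooth t f x - gauss_smooth t f y\<bar> \<le> 1 * \<bar>x - y\<bar>" by simp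
qed simp

text \<open>The two integrals bound the second derivative and the Taylor remainders of a smoothed
  function. The summand 2 keeps the constant large enough to absorb the additive terms that arise
  for increments beyond sqrt t.\<close>

definition smooth_const :: real where
  "smooth_const = 2 + (\<integral>z. \<bar>z\<bar> * \<bar>z\<^sup>2 - 1\<bar> \<partial>gauss)
     + 24 * exp 1 * (\<integral>z. \<bar>z\<bar> * exp (2 * \<bar>z\<bar>) \<partial>gauss)"

lemma gauss_integrable_lipschitz_poly:
  fixes f :: "real \<Rightarrow> real"
  assumes "1-lipschitz_on UNIV f"
  shows "integrable gauss (\<lambda>z. (f (x + c * z) - f x) * z ^ k * exp (h * z))"
proof (rule Bochner_Integration.integrable_bound)
  show "integrable gauss (\<lambda>z. \<bar>c\<bar> * (\<bar>z\<bar> ^ Suc k * exp (\<bar>h\<bar> * \<bar>z\<bar>)))"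
    by (intro integrable_mult_right gauss_integrable_abs_power_exp)
  show "(\<lambda>z. (f (x + c * z) - f x) * z ^ k * exp (h * z)) \<in> borel_measurable gauss"
    using lipschitz_borel[OF assms] by measurable
  show "AE z in gauss. norm ((f (x + c * z) - f x) * z ^ k * exp (h * z))
      \<le> norm (\<bar>c\<bar> * (\<bar>z\<bar> ^ Suc k * exp (\<bar>h\<bar> * \<bar>z\<bar>)))"
  proof (intro AE_I2)
    fix z :: real
    have "\<bar>f (x + c * z) - f x\<bar> \<le> \<bar>c\<bar> * \<bar>z\<bar>"
      using lipschitz_absD[OF assms, of "x + c * z" x] by (simp add: abs_mult)
    moreover have "h * z \<le> \<bar>h\<bar> * \<bar>z\<bar>" by (metis abs_ge_self abs_mult)
    ultimately have "\<bar>f (x + c * z) - f x\<bar> * \<bar>z\<bar> ^ k * exp (h * z)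
        \<le> (\<bar>c\<bar> * \<bar>z\<bar>) * \<bar>z\<bar> ^ k * exp (\<bar>h\<bar> * \<bar>z\<bar>)"
      by (intro mult_mono) auto
    then show "norm ((f (x + c * z) - f x) * z ^ k * exp (h * z))
      \<le> norm (\<bar>c\<bar> * (\<bar>z\<bar> ^ Suc k * exp (\<bar>h\<bar> * \<bar>z\<bar>)))"
      by (simp add: abs_mult power_abs mult_ac)
  qed
qed

text \<open>\<open>g1\<close> and \<open>g2\<close> are the first two derivatives of the smoothed
  function, written as integrals of \<open>f\<close> against the Hermite weights z and z^2 - 1.
  Moving the base point by sqrt t * h only multiplies the weights by
  \<open>exp (h * z - h^2 / 2)\<close>, so the expansion of the weights in h yields the expansions
  of \<open>g\<close>, \<open>g1\<close> and \<open>g2\<close>.\<close>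

lemma gauss_smooth_taylor:
  fixes f :: "real \<Rightarrow> real"
  assumes f: "1-lipschitz_on UNIV f" and t: "t > 0"
  defines "g \<equiv> gauss_smooth t f"
  obtains g1 g2 where
    "\<And>x. \<bar>g1 x\<bar> \<le> 1"
    "\<And>x. \<bar>g2 x\<bar> \<le> smooth_const / sqrt t"
    "\<And>x h. \<bar>h\<bar> \<le> 1 \<Longrightarrow> \<bar>g (x + sqrt t * h) - g x - g1 x * (sqrt t * h) - g2 x * (sqrt t * h)\<^sup>2 / 2\<bar>
        \<le> smooth_const * sqrt t * \<bar>h\<bar> ^ 3"
    "\<And>x h. \<bar>h\<bar> \<le> 1 \<Longrightarrow> \<bar>g1 (x + sqrt t * h) - g1 x - g2 x * (sqrt t * h)\<bar> \<le> smooth_const * \<bar>h\<bar> ^ 2"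
    "\<And>x h. \<bar>h\<bar> \<le> 1 \<Longrightarrow> \<bar>g2 (x + sqrt t * h) - g2 x\<bar> \<le> smooth_const / sqrt t * \<bar>h\<bar>"
proof -
  have [measurable]: "f \<in> borel_measurable borel" by (rule lipschitz_borel[OF f])
  \<comment> \<open>Subtracting \<open>f x\<close> makes the Lipschitz bound supply a factor sqrt t.
    The constant by which \<open>F\<close> changes when the base point moves disappears because the
    shifted Hermite weights have mean zero (\<open>W1\<close>, \<open>W2\<close>).\<close>
  define F where "F x z = f (x + sqrt t * z) - f x" for x z
  have [measurable]: "F x \<in> borel_measurable borel" for x
    unfolding F_def by measurable
  have Fb: "\<bar>F x z\<bar> \<le> sqrt t * \<bar>z\<bar>" for x z
    using lipschitz_absD[OF f, of "x + sqrt t * z" x] t by (simp add: F_def abs_mult)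
  define W where "W h z = exp (h * z - h\<^sup>2 / 2)" for h z :: real
  have [measurable]: "W h \<in> borel_measurable borel" for h
    unfolding W_def by measurable
  have W_alt: "W h z = exp (- h\<^sup>2 / 2) * exp (h * z)" for h z
    by (simp add: W_def mult_exp_exp)
  have int_k: "integrable gauss (\<lambda>z. F x z * z ^ k * W h z)" for x k h
  proof -
    have "integrable gauss (\<lambda>z. exp (- h\<^sup>2 / 2) * (F x z * z ^ k * exp (h * z)))"
      unfolding F_def by (intro integrable_mult_right gauss_integrable_lipschitz_poly f)
    then show ?thesis
      by (simp add: W_alt mult_ac)
  qed
  have int_0: "integrable gauss (\<lambda>z. F x z * z ^ k)" for x k
    using int_k[of x k 0] by (simp add: W_def)
  have W0: "(\<integral>z. W h z \<partial>gauss) = 1" for h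
    using gauss_shift[of "\<lambda>_. 1" h] by (simp add: W_def)
  have W1: "(\<integral>z. (z - h) * W h z \<partial>gauss) = 0" for h
    using gauss_shift[of "\<lambda>z. z - h" h] by (simp add: W_def)
  define g1 where "g1 x = (\<integral>z. F x z * z \<partial>gauss) / sqrt t" for x
  define g2 where "g2 x = (\<integral>z. F x z * (z\<^sup>2 - 1) \<partial>gauss) / t" for x
  have i1: "integrable gauss (\<lambda>z. F x z * z * W h z)" for x h using int_k[of x 1 h] by simp
  have i0: "integrable gauss (\<lambda>z. F x z * W h z)" for x h using int_k[of x 0 h] by simp
  have i2: "integrable gauss (\<lambda>z. F x z * (z\<^sup>2 - 1) * W h z)" for x h
  proof -
    have "integrable gauss (\<lambda>z. F x z * z ^ 2 * W h z - F x z * W h z)"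
      by (intro Bochner_Integration.integrable_diff int_k i0)
    then show ?thesis by (simp add: algebra_simps)
  qed
  have j1: "integrable gauss (\<lambda>z. F x z * z)" for x using int_0[of x 1] by simp
  have j0: "integrable gauss (\<lambda>z. F x z)" for x using int_0[of x 0] by simp
  have j2: "integrable gauss (\<lambda>z. F x z * (z\<^sup>2 - 1))" for x
    using i2[of x 0] by (simp add: W_def)
  have intf: "integrable gauss (\<lambda>z. f (x + sqrt t * z))" for x
    using Bochner_Integration.integrable_add[OF j0[of x] gauss.integrable_const[of "f x"]]
    by (simp add: F_def)
  have WIk: "integrable gauss (\<lambda>z. z ^ k * W h z)" for k h
  proof -
    have "integrable gauss (\<lambda>z. exp (- h\<^sup>2 / 2) * (z ^ k * exp (h * z)))"
    proof (intro integrable_mult_right Bochner_Integration.integrable_bound[OF gauss_integrable_abs_power_exp[of k "\<bar>h\<bar>"]] AE_I2)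
      fix z :: real
      have "h * z \<le> \<bar>h\<bar> * \<bar>z\<bar>" by (metis abs_ge_self abs_mult)
      then show "norm (z ^ k * exp (h * z)) \<le> norm (\<bar>z\<bar> ^ k * exp (\<bar>h\<bar> * \<bar>z\<bar>))"
        by (simp add: abs_mult power_abs mult_left_mono)
    qed simp
    then show ?thesis
      by (simp add: W_alt[abs_def] mult_ac)
  qed
  have WI: "integrable gauss (W h)" and WI1: "integrable gauss (\<lambda>z. z * W h z)" for h
    using WIk[of 0 h] WIk[of 1 h] by simp_all
  note II = Bochner_Integration.integrable_diff Bochner_Integration.integrable_add integrable_mult_right i2 i1 i0 WI WI1 WIk
  have s1: "integrable gauss (\<lambda>z. F x z * ((z - h) * W h z))" for x h
  proof -
    have "integrable gauss (\<lambda>z. F x z * z * W h z - h * (F x z * W h z))" by (intro II)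
    then show ?thesis by (simp add: algebra_simps)
  qed
  have s2: "integrable gauss (\<lambda>z. F x z * (((z - h)\<^sup>2 - 1) * W h z))" for x h
  proof -
    have "integrable gauss (\<lambda>z. F x z * (z\<^sup>2 - 1) * W h z - 2 * h * (F x z * z * W h z) + h\<^sup>2 * (F x z * W h z))"
      by (intro II)
    then show ?thesis by (simp add: algebra_simps power2_diff)
  qed
  have W2: "(\<integral>z. ((z - h)\<^sup>2 - 1) * W h z \<partial>gauss) = 0" for h
    using gauss_shift[of "\<lambda>z. (z - h)\<^sup>2 - 1" h] by (simp add: W_def)
  have g_shift: "g (x + sqrt t * h) - f x = (\<integral>z. F x z * W h z \<partial>gauss)" for x h
  proof -
    have "g (x + sqrt t * h) - f x = (\<integral>z. f (x + sqrt t * h + sqrt t * z) - f x \<partial>gauss)"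
      unfolding g_def gauss_smooth_def using intf[of "x + sqrt t * h"] by (simp)
    also have "\<dots> = (\<integral>z. F x (z + h) \<partial>gauss)"
      by (simp add: F_def algebra_simps)
    also have "\<dots> = (\<integral>z. F x z * W h z \<partial>gauss)"
      unfolding W_def by (rule gauss_shift) simp
    finally show ?thesis .
  qed
  have g0: "g x - f x = (\<integral>z. F x z \<partial>gauss)" for x
    using g_shift[of x 0] by (simp add: W_def)
  have F_shift: "F (x + sqrt t * h) z = F x (z + h) - F x h" for x h z
    by (simp add: F_def algebra_simps)
  have g1_shift: "g1 (x + sqrt t * h) = (\<integral>z. F x z * ((z - h) * W h z) \<partial>gauss) / sqrt t" for x h
  proof -
    have "(\<integral>z. F (x + sqrt t * h) z * z \<partial>gauss) = (\<integral>z. (F x (z + h) - F x h) * ((z + h) - h) \<partial>gauss)"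
      by (simp add: F_shift)
    also have "\<dots> = (\<integral>z. (F x z - F x h) * (z - h) * W h z \<partial>gauss)"
      unfolding W_def by (rule gauss_shift) simp
    also have "\<dots> = (\<integral>z. F x z * ((z - h) * W h z) - F x h * ((z - h) * W h z) \<partial>gauss)"
      by (intro Bochner_Integration.integral_cong) (auto simp: algebra_simps)
    also have "\<dots> = (\<integral>z. F x z * ((z - h) * W h z) \<partial>gauss)"
    proof (subst Bochner_Integration.integral_diff)
      show "integrable gauss (\<lambda>z. F x z * ((z - h) * W h z))" by (rule s1)
      have "integrable gauss (\<lambda>z. F x h * (z * W h z - h * W h z))" by (intro II)
      then show "integrable gauss (\<lambda>z. F x h * ((z - h) * W h z))" by (simp add: algebra_simps)
    qed (simp add: W1)
    finally show ?thesis by (simp add: g1_def)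
  qed
  have g2_shift: "g2 (x + sqrt t * h) = (\<integral>z. F x z * (((z - h)\<^sup>2 - 1) * W h z) \<partial>gauss) / t" for x h
  proof -
    have "(\<integral>z. F (x + sqrt t * h) z * (z\<^sup>2 - 1) \<partial>gauss)
        = (\<integral>z. (F x (z + h) - F x h) * (((z + h) - h)\<^sup>2 - 1) \<partial>gauss)"
      by (simp add: F_shift)
    also have "\<dots> = (\<integral>z. (F x z - F x h) * ((z - h)\<^sup>2 - 1) * W h z \<partial>gauss)"
      unfolding W_def by (rule gauss_shift) simp
    also have "\<dots> = (\<integral>z. F x z * (((z - h)\<^sup>2 - 1) * W h z) - F x h * (((z - h)\<^sup>2 - 1) * W h z) \<partial>gauss)"
      by (intro Bochner_Integration.integral_cong) (auto simp: algebra_simps)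
    also have "\<dots> = (\<integral>z. F x z * (((z - h)\<^sup>2 - 1) * W h z) \<partial>gauss)"
    proof (subst Bochner_Integration.integral_diff)
      show "integrable gauss (\<lambda>z. F x z * (((z - h)\<^sup>2 - 1) * W h z))" by (rule s2)
      have "integrable gauss (\<lambda>z. F x h * (z ^ 2 * W h z - 2 * h * (z * W h z) + (h\<^sup>2 - 1) * W h z))"
        by (intro II)
      then show "integrable gauss (\<lambda>z. F x h * (((z - h)\<^sup>2 - 1) * W h z))"
        by (simp add: algebra_simps power2_diff)
    qed (simp add: W2)
    finally show ?thesis by (simp add: g2_def)
  qed
  have ia: "integrable gauss (\<lambda>z. \<bar>z\<bar> * \<bar>z\<^sup>2 - 1\<bar>)"
  proof (rule Bochner_Integration.integrable_bound[where f = "\<lambda>z. \<bar>z\<bar> ^ 3 + \<bar>z\<bar>"])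
    show "integrable gauss (\<lambda>z. \<bar>z\<bar> ^ 3 + \<bar>z\<bar>)"
      by (intro Bochner_Integration.integrable_add gauss_integrable_abs_power gauss_integrable_abs)
    show "AE z in gauss. norm (\<bar>z\<bar> * \<bar>z\<^sup>2 - 1\<bar>) \<le> norm (\<bar>z\<bar> ^ 3 + \<bar>z\<bar>)"
    proof (intro AE_I2)
      fix z :: real
      have "\<bar>z\<^sup>2 - 1\<bar> \<le> \<bar>z\<bar> ^ 2 + 1" by (simp add: abs_if)
      then have "\<bar>z\<bar> * \<bar>z\<^sup>2 - 1\<bar> \<le> \<bar>z\<bar> * (\<bar>z\<bar> ^ 2 + 1)" by (rule mult_left_mono) simp
      then show "norm (\<bar>z\<bar> * \<bar>z\<^sup>2 - 1\<bar>) \<le> norm (\<bar>z\<bar> ^ 3 + \<bar>z\<bar>)"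
        by (simp add: abs_mult power3_eq_cube power2_eq_square algebra_simps)
    qed
  qed simp
  have ib: "integrable gauss (\<lambda>z. \<bar>z\<bar> * exp (2 * \<bar>z\<bar>))"
    using gauss_integrable_abs_power_exp[of 1 2] by simp
  let ?a = "\<integral>z. \<bar>z\<bar> * \<bar>z\<^sup>2 - 1\<bar> \<partial>gauss" and ?b = "\<integral>z. \<bar>z\<bar> * exp (2 * \<bar>z\<bar>) \<partial>gauss"
  have ab0: "?a \<ge> 0" "?b \<ge> 0" by (auto intro!: integral_nonneg_AE)
  have e24: "24 * exp 1 * ?b \<ge> 0" using ab0 by simp
  have sc: "smooth_const \<ge> 1" "?a \<le> smooth_const" "24 * exp 1 * ?b \<le> smooth_const"
    unfolding smooth_const_def using ab0 e24 by simp_all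
  \<comment> \<open>All three remainders are integrals of \<open>F\<close> against a weight of the
    kind that \<open>hermite_weight_taylor\<close> controls, with c a power of |h|.\<close>
  have key: "\<bar>\<integral>z. F x z * u z \<partial>gauss\<bar> \<le> sqrt t * smooth_const * c"
    if u: "integrable gauss (\<lambda>z. F x z * u z)" "\<And>z. \<bar>u z\<bar> \<le> 24 * exp 1 * exp (2 * \<bar>z\<bar>) * c" and c: "c \<ge> 0"
    for x u c
  proof -
    have "\<bar>\<integral>z. F x z * u z \<partial>gauss\<bar> \<le> (\<integral>z. \<bar>F x z * u z\<bar> \<partial>gauss)"
      by (rule integral_abs_bound)
    also have "\<dots> \<le> (\<integral>z. (sqrt t * 24 * exp 1 * c) * (\<bar>z\<bar> * exp (2 * \<bar>z\<bar>)) \<partial>gauss)"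
    proof (intro integral_mono integrable_abs u integrable_mult_right ib)
      fix z
      have "\<bar>F x z\<bar> * \<bar>u z\<bar> \<le> (sqrt t * \<bar>z\<bar>) * (24 * exp 1 * exp (2 * \<bar>z\<bar>) * c)"
        using t c by (intro mult_mono Fb u(2)) auto
      then show "\<bar>F x z * u z\<bar> \<le> (sqrt t * 24 * exp 1 * c) * (\<bar>z\<bar> * exp (2 * \<bar>z\<bar>))"
        by (simp add: abs_mult mult_ac)
    qed
    also have "\<dots> = sqrt t * c * (24 * exp 1 * ?b)" by simp
    also have "\<dots> \<le> sqrt t * c * smooth_const" using sc t c by (intro mult_left_mono) auto
    finally show ?thesis by (simp add: mult_ac)
  qed
  show ?thesis
  proof (rule that[of g1 g2])
    fix x
    have "\<bar>\<integral>z. F x z * z \<partial>gauss\<bar> \<le> (\<integral>z. \<bar>F x z * z\<bar> \<partial>gauss)"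
      by (rule integral_abs_bound)
    also have "\<dots> \<le> (\<integral>z. sqrt t * z\<^sup>2 \<partial>gauss)"
    proof (intro integral_mono integrable_abs j1 integrable_mult_right)
      fix z
      have "\<bar>F x z\<bar> * \<bar>z\<bar> \<le> (sqrt t * \<bar>z\<bar>) * \<bar>z\<bar>" by (intro mult_right_mono Fb) auto
      then show "\<bar>F x z * z\<bar> \<le> sqrt t * z\<^sup>2" by (simp add: abs_mult power2_eq_square mult.assoc)
    qed simp
    also have "\<dots> = sqrt t" by simp
    finally show "\<bar>g1 x\<bar> \<le> 1" using t by (simp add: g1_def)
  next
    fix x
    have "\<bar>\<integral>z. F x z * (z\<^sup>2 - 1) \<partial>gauss\<bar> \<le> (\<integral>z. \<bar>F x z * (z\<^sup>2 - 1)\<bar> \<partial>gauss)"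
      by (rule integral_abs_bound)
    also have "\<dots> \<le> (\<integral>z. sqrt t * (\<bar>z\<bar> * \<bar>z\<^sup>2 - 1\<bar>) \<partial>gauss)"
    proof (intro integral_mono integrable_abs j2 integrable_mult_right ia)
      fix z
      have "\<bar>F x z\<bar> * \<bar>z\<^sup>2 - 1\<bar> \<le> (sqrt t * \<bar>z\<bar>) * \<bar>z\<^sup>2 - 1\<bar>" by (intro mult_right_mono Fb) auto
      then show "\<bar>F x z * (z\<^sup>2 - 1)\<bar> \<le> sqrt t * (\<bar>z\<bar> * \<bar>z\<^sup>2 - 1\<bar>)" by (simp add: abs_mult mult.assoc)
    qed
    also have "\<dots> = sqrt t * ?a" by simp
    also have "\<dots> \<le> sqrt t * smooth_const" using sc t by (intro mult_left_mono) auto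
    finally have "\<bar>g2 x\<bar> \<le> sqrt t * smooth_const / t"
      using t by (simp add: g2_def divide_right_mono)
    also have "\<dots> = smooth_const / sqrt t" using t by (simp add: real_div_sqrt field_simps)
    finally show "\<bar>g2 x\<bar> \<le> smooth_const / sqrt t" .
  next
    fix x h :: real assume h: "\<bar>h\<bar> \<le> 1"
    let ?u = "\<lambda>z. W h z - 1 - z * h - (z\<^sup>2 - 1) * h\<^sup>2 / 2"
    have E: "F x z * ?u z = F x z * W h z - F x z - h * (F x z * z) - h\<^sup>2 / 2 * (F x z * (z\<^sup>2 - 1))" for z
      by (simp add: field_simps)
    have I: "integrable gauss (\<lambda>z. F x z * ?u z)"
      unfolding E by (intro Bochner_Integration.integrable_diff integrable_mult_right i0 j0 j1 j2)
    have "(\<integral>z. F x z * ?u z \<partial>gauss) = g (x + sqrt t * h) - g x - g1 x * (sqrt t * h) - g2 x * (sqrt t * h)\<^sup>2 / 2"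
      unfolding E using i0[of x h] j0[of x] j1[of x] j2[of x] t
      by (simp add: g1_def g2_def power_mult_distrib g_shift[of x h, symmetric] g0[symmetric])
    then show "\<bar>g (x + sqrt t * h) - g x - g1 x * (sqrt t * h) - g2 x * (sqrt t * h)\<^sup>2 / 2\<bar>
        \<le> smooth_const * sqrt t * \<bar>h\<bar> ^ 3"
      using key[OF I, of "\<bar>h\<bar> ^ 3"] hermite_weight_taylor(1)[OF h] by (simp add: W_def mult_ac)
  next
    fix x h :: real assume h: "\<bar>h\<bar> \<le> 1"
    let ?u = "\<lambda>z. (z - h) * W h z - z - (z\<^sup>2 - 1) * h"
    have E: "F x z * ?u z = F x z * ((z - h) * W h z) - F x z * z - h * (F x z * (z\<^sup>2 - 1))" for z
      by (simp add: algebra_simps)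
    note I0 = s1[of x h]
    have I: "integrable gauss (\<lambda>z. F x z * ?u z)" unfolding E using I0 j1 j2 by auto
    have "(\<integral>z. F x z * ?u z \<partial>gauss) = sqrt t * (g1 (x + sqrt t * h) - g1 x - g2 x * (sqrt t * h))"
    proof -
      have *: "sqrt t * (a / sqrt t - b / sqrt t - c / t * (sqrt t * h)) = a - b - h * c" for a b c
      proof -
        have "sqrt t * (c / t * (sqrt t * h)) = (sqrt t * sqrt t) * (c / t * h)" by (simp only: mult_ac)
        also have "\<dots> = h * c" using t by simp
        finally show ?thesis using t by (simp add: right_diff_distrib)
      qed
      show ?thesis
        unfolding E g1_shift unfolding g1_def g2_def * using I0 j1[of x] j2[of x] by simp
    qed
    moreover have "\<bar>\<integral>z. F x z * ?u z \<partial>gauss\<bar> \<le> sqrt t * smooth_const * \<bar>h\<bar> ^ 2"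
      using key[OF I, of "\<bar>h\<bar> ^ 2"] hermite_weight_taylor(2)[OF h] by (simp add: W_def mult_ac)
    ultimately show "\<bar>g1 (x + sqrt t * h) - g1 x - g2 x * (sqrt t * h)\<bar> \<le> smooth_const * \<bar>h\<bar> ^ 2"
      using t by (simp add: abs_mult mult.assoc)
  next
    fix x h :: real assume h: "\<bar>h\<bar> \<le> 1"
    let ?u = "\<lambda>z. ((z - h)\<^sup>2 - 1) * W h z - (z\<^sup>2 - 1)"
    have E: "F x z * ?u z = F x z * (((z - h)\<^sup>2 - 1) * W h z) - F x z * (z\<^sup>2 - 1)" for z
      by (simp add: algebra_simps)
    note I0 = s2[of x h]
    have I: "integrable gauss (\<lambda>z. F x z * ?u z)" unfolding E using I0 j2 by auto
    have eq: "(\<integral>z. F x z * ?u z \<partial>gauss) = t * (g2 (x + sqrt t * h) - g2 x)"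
      unfolding E g2_shift using I0 j2[of x] t by (simp add: g2_def right_diff_distrib)
    have le: "\<bar>\<integral>z. F x z * ?u z \<partial>gauss\<bar> \<le> sqrt t * smooth_const * \<bar>h\<bar>"
      using key[OF I, of "\<bar>h\<bar>"] hermite_weight_taylor(3)[OF h] by (simp add: W_def mult_ac)
    have "\<bar>g2 (x + sqrt t * h) - g2 x\<bar> \<le> sqrt t * smooth_const * \<bar>h\<bar> / t"
    proof -
      have "t * \<bar>g2 (x + sqrt t * h) - g2 x\<bar> \<le> sqrt t * smooth_const * \<bar>h\<bar>"
        using le t unfolding eq abs_mult by simp
      then show ?thesis using t by (subst pos_le_divide_eq) (simp_all only: mult.commute)
    qed
    also have "\<dots> = (sqrt t / t) * (smooth_const * \<bar>h\<bar>)" by simp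
    also have "\<dots> = smooth_const / sqrt t * \<bar>h\<bar>"
      using t by (subst sqrt_divide_self_eq) (simp_all add: divide_inverse mult_ac)
    finally show "\<bar>g2 (x + sqrt t * h) - g2 x\<bar> \<le> smooth_const / sqrt t * \<bar>h\<bar>" .
  qed
qed

lemma smooth_const_ge: "smooth_const \<ge> 2"
proof -
  have "(\<integral>z. \<bar>z\<bar> * \<bar>z\<^sup>2 - 1\<bar> \<partial>gauss) \<ge> 0" "(\<integral>z. \<bar>z\<bar> * exp (2 * \<bar>z\<bar>) \<partial>gauss) \<ge> 0"
    by (auto intro!: integral_nonneg_AE)
  then have "24 * exp 1 * (\<integral>z. \<bar>z\<bar> * exp (2 * \<bar>z\<bar>) \<partial>gauss) \<ge> 0" by simp
  with \<open>(\<integral>z. \<bar>z\<bar> * \<bar>z\<^sup>2 - 1\<bar> \<partial>gauss) \<ge> 0\<close> show ?thesis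
    unfolding smooth_const_def by linarith
qed

text \<open>With moments of order 2 + \<delta> only, a remainder may not grow faster than |d| to
  that power. For |d| up to sqrt t the integer-order remainders are small enough; beyond that the
  bounds on \<open>g1\<close>, \<open>g2\<close> and the Lipschitz bound on \<open>g\<close>
  suffice, since then |h|^k is at most |h| to the power k + \<delta>, where h = d / sqrt t.\<close>

lemma gauss_smooth_holder:
  fixes f :: "real \<Rightarrow> real" and t \<delta> :: real
  assumes f: "1-lipschitz_on UNIV f" and t: "t > 0" and \<delta>: "0 < \<delta>" "\<delta> \<le> 1"
  defines "g \<equiv> gauss_smooth t f" and "H \<equiv> 3 * smooth_const * t powr (- (1 + \<delta>) / 2)"
  obtains g1 g2 where
    "g1 \<in> borel_measurable borel" "g2 \<in> borel_measurable borel"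
    "\<And>x. \<bar>g1 x\<bar> \<le> 1" "\<And>x. \<bar>g2 x\<bar> \<le> smooth_const / sqrt t"
    "\<And>x d. \<bar>g (x + d) - g x - g1 x * d - g2 x * d\<^sup>2 / 2\<bar> \<le> H * \<bar>d\<bar> powr (2 + \<delta>)"
    "\<And>x d. \<bar>g1 (x + d) - g1 x - g2 x * d\<bar> \<le> H * \<bar>d\<bar> powr (1 + \<delta>)"
    "\<And>x d. \<bar>g2 (x + d) - g2 x\<bar> \<le> H * \<bar>d\<bar> powr \<delta>"
proof -
  let ?c = smooth_const
  obtain g1 g2 where b1: "\<And>x. \<bar>g1 x\<bar> \<le> 1" and b2: "\<And>x. \<bar>g2 x\<bar> \<le> ?c / sqrt t"
    and T0: "\<And>x h. \<bar>h\<bar> \<le> 1 \<Longrightarrow> \<bar>g (x + sqrt t * h) - g x - g1 x * (sqrt t * h) - g2 x * (sqrt t * h)\<^sup>2 / 2\<bar>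
        \<le> ?c * sqrt t * \<bar>h\<bar> ^ 3"
    and T1: "\<And>x h. \<bar>h\<bar> \<le> 1 \<Longrightarrow> \<bar>g1 (x + sqrt t * h) - g1 x - g2 x * (sqrt t * h)\<bar> \<le> ?c * \<bar>h\<bar> ^ 2"
    and T2: "\<And>x h. \<bar>h\<bar> \<le> 1 \<Longrightarrow> \<bar>g2 (x + sqrt t * h) - g2 x\<bar> \<le> ?c / sqrt t * \<bar>h\<bar>"
    unfolding g_def by (rule gauss_smooth_taylor[OF f t]) blast
  have L: "\<bar>g x - g y\<bar> \<le> \<bar>x - y\<bar>" for x y
    using lipschitz_absD[OF gauss_smooth_lipschitz[OF f]] unfolding g_def by simp
  note c2 = smooth_const_ge
  let ?r = "sqrt t"
  have r: "?r > 0" using t by simp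
  have abs_r: "\<bar>?r * h\<bar> = ?r * \<bar>h\<bar>" for h using r by (simp add: abs_mult)
  have pw: "\<bar>h\<bar> ^ Suc k \<le> \<bar>h\<bar> powr (real k + \<delta>)" if "\<bar>h\<bar> \<le> 1" for h :: real and k
  proof (cases "h = 0")
    case False
    then have "\<bar>h\<bar> ^ Suc k = \<bar>h\<bar> powr (real (Suc k))" by (subst powr_realpow) auto
    also have "\<dots> \<le> \<bar>h\<bar> powr (real k + \<delta>)"
      using that False \<delta> by (intro powr_mono') auto
    finally show ?thesis .
  qed simp
  have pw': "\<bar>h\<bar> ^ k \<le> \<bar>h\<bar> powr (real k + \<delta>)" if "1 < \<bar>h\<bar>" for h :: real and k
  proof -
    have "\<bar>h\<bar> ^ k = \<bar>h\<bar> powr (real k)" using that by (subst powr_realpow) auto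
    also have "\<dots> \<le> \<bar>h\<bar> powr (real k + \<delta>)"
      using that \<delta> by (intro powr_mono) auto
    finally show ?thesis .
  qed
  have A0: "\<bar>g (x + ?r * h) - g x - g1 x * (?r * h) - g2 x * (?r * h)\<^sup>2 / 2\<bar>
      \<le> 3 * ?c * ?r * \<bar>h\<bar> powr (2 + \<delta>)" for x h
  proof (cases "\<bar>h\<bar> \<le> 1")
    case True
    have "?c * ?r * \<bar>h\<bar> ^ 3 \<le> ?c * ?r * \<bar>h\<bar> powr (2 + \<delta>)"
      using pw[OF True, of 2] c2 r by (intro mult_left_mono) (auto simp: eval_nat_numeral)
    also have "\<dots> \<le> (3 * ?c) * ?r * \<bar>h\<bar> powr (2 + \<delta>)"
      using c2 r by (intro mult_right_mono) auto
    finally show ?thesis using T0[OF True, of x] by linarith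
  next
    case False
    have h2: "\<bar>h\<bar> \<le> \<bar>h\<bar> ^ 2" using False mult_right_mono[of 1 "\<bar>h\<bar>" "\<bar>h\<bar>"] unfolding power2_eq_square by simp
    have e1: "\<bar>g (x + ?r * h) - g x\<bar> \<le> ?r * \<bar>h\<bar> ^ 2"
      using L[of "x + ?r * h" x] h2 r by (auto simp: abs_r intro: order_trans mult_left_mono)
    have e2: "\<bar>g1 x * (?r * h)\<bar> \<le> ?r * \<bar>h\<bar> ^ 2"
    proof -
      have "\<bar>g1 x\<bar> * (?r * \<bar>h\<bar>) \<le> 1 * (?r * \<bar>h\<bar> ^ 2)"
        using b1 h2 r by (intro mult_mono) auto
      then show ?thesis unfolding abs_mult using r by simp
    qed
    have e3: "\<bar>g2 x * (?r * h)\<^sup>2 / 2\<bar> \<le> ?c * (?r * \<bar>h\<bar> ^ 2)"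
    proof -
      have "\<bar>g2 x\<bar> * (?r * h)\<^sup>2 \<le> ?c / ?r * (?r * h)\<^sup>2" by (intro mult_right_mono b2) auto
      also have "\<dots> = ?c * (?r * \<bar>h\<bar> ^ 2)" using r by (simp add: power2_eq_square)
      finally have *: "\<bar>g2 x * (?r * h)\<^sup>2\<bar> \<le> ?c * (?r * \<bar>h\<bar> ^ 2)" by (simp add: abs_mult)
      then have "\<bar>g2 x * (?r * h)\<^sup>2\<bar> / 2 \<le> ?c * (?r * \<bar>h\<bar> ^ 2)"
        using c2 r by linarith
      then show ?thesis by simp
    qed
    have "\<bar>g (x + ?r * h) - g x - g1 x * (?r * h) - g2 x * (?r * h)\<^sup>2 / 2\<bar>
        \<le> ?r * \<bar>h\<bar> ^ 2 + ?r * \<bar>h\<bar> ^ 2 + ?c * (?r * \<bar>h\<bar> ^ 2)"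
      using e1 e2 e3 by linarith
    also have "\<dots> = (2 + ?c) * ?r * \<bar>h\<bar> ^ 2" by (simp add: algebra_simps)
    also have "\<dots> \<le> (3 * ?c) * ?r * \<bar>h\<bar> powr (2 + \<delta>)"
      using pw'[of h 2] False c2 r by (intro mult_mono) auto
    finally show ?thesis .
  qed
  have A1: "\<bar>g1 (x + ?r * h) - g1 x - g2 x * (?r * h)\<bar> \<le> 3 * ?c * \<bar>h\<bar> powr (1 + \<delta>)" for x h
  proof (cases "\<bar>h\<bar> \<le> 1")
    case True
    have "?c * \<bar>h\<bar> ^ 2 \<le> ?c * \<bar>h\<bar> powr (1 + \<delta>)"
      using pw[OF True, of 1] c2 by (intro mult_left_mono) (auto simp: eval_nat_numeral)
    also have "\<dots> \<le> (3 * ?c) * \<bar>h\<bar> powr (1 + \<delta>)"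
      using c2 by (intro mult_right_mono) auto
    finally show ?thesis using T1[OF True, of x] by linarith
  next
    case False
    have "\<bar>g2 x * (?r * h)\<bar> \<le> ?c / ?r * (?r * \<bar>h\<bar>)"
      unfolding abs_mult[of "g2 x"] abs_r using r by (intro mult_right_mono b2) auto
    also have "\<dots> = ?c * \<bar>h\<bar>" using r by simp
    finally have "\<bar>g1 (x + ?r * h) - g1 x - g2 x * (?r * h)\<bar> \<le> 2 + ?c * \<bar>h\<bar>"
      using b1[of x] b1[of "x + ?r * h"] by linarith
    also have "\<dots> \<le> (3 * ?c) * \<bar>h\<bar> ^ 1"
      using False c2 mult_mono[of 2 "2 * ?c" 1 "\<bar>h\<bar>"] by (simp add: algebra_simps)
    also have "\<dots> \<le> 3 * ?c * \<bar>h\<bar> powr (1 + \<delta>)"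
      using pw'[of h 1] False c2 by (intro mult_left_mono) auto
    finally show ?thesis .
  qed
  have A2: "\<bar>g2 (x + ?r * h) - g2 x\<bar> \<le> 3 * ?c / ?r * \<bar>h\<bar> powr \<delta>" for x h
  proof (cases "\<bar>h\<bar> \<le> 1")
    case True
    have "?c / ?r * \<bar>h\<bar> \<le> ?c / ?r * \<bar>h\<bar> powr \<delta>"
      using pw[OF True, of 0] c2 r by (intro mult_left_mono) auto
    also have "\<dots> \<le> (3 * ?c / ?r) * \<bar>h\<bar> powr \<delta>"
      using c2 r by (intro mult_right_mono divide_right_mono) auto
    finally show ?thesis using T2[OF True, of x] by linarith
  next
    case False
    have "\<bar>g2 (x + ?r * h) - g2 x\<bar> \<le> ?c / ?r + ?c / ?r"
      using b2[of x] b2[of "x + ?r * h"] by linarith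
    also have "\<dots> = 2 * ?c / ?r * 1" by simp
    also have "\<dots> \<le> 3 * ?c / ?r * \<bar>h\<bar> powr \<delta>"
      using pw'[of h 0] False c2 r by (intro mult_mono divide_right_mono) auto
    finally show ?thesis .
  qed
  have H: "H = 3 * ?c * ?r * ?r powr (- (2 + \<delta>))" "H = 3 * ?c * ?r powr (- (1 + \<delta>))"
    "H = 3 * ?c / ?r * ?r powr (- \<delta>)"
  proof -
    have *: "t powr (- (1 + \<delta>) / 2) = ?r powr (- (1 + \<delta>))"
      using t by (simp add: powr_half_sqrt[symmetric] powr_powr)
    show "H = 3 * ?c * ?r powr (- (1 + \<delta>))" unfolding H_def * ..
    have "?r * ?r powr (- (2 + \<delta>)) = ?r powr (1 + (- (2 + \<delta>)))"
      using r by (simp only: powr_add powr_one)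
    then show "H = 3 * ?c * ?r * ?r powr (- (2 + \<delta>))" unfolding H_def * by simp
    have "?r powr (- \<delta>) = ?r * ?r powr (- 1 - \<delta>)"
      using r powr_add[of ?r 1 "- 1 - \<delta>"] by simp
    then show "H = 3 * ?c / ?r * ?r powr (- \<delta>)" unfolding H_def * using r by simp
  qed
  have sc: "\<bar>d / ?r\<bar> powr a = \<bar>d\<bar> powr a * ?r powr (- a)" for d a
    using r by (simp add: abs_divide powr_divide powr_minus_divide)
  have dr: "?r * (d / ?r) = d" for d using r by simp
  have H0: "\<bar>g (x + d) - g x - g1 x * d - g2 x * d\<^sup>2 / 2\<bar> \<le> H * \<bar>d\<bar> powr (2 + \<delta>)" for x d
    using A0[of x "d / ?r"] unfolding dr sc H(1) by (simp add: mult_ac)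
  have H1: "\<bar>g1 (x + d) - g1 x - g2 x * d\<bar> \<le> H * \<bar>d\<bar> powr (1 + \<delta>)" for x d
    using A1[of x "d / ?r"] unfolding dr sc H(2) by (simp add: mult_ac)
  have H2: "\<bar>g2 (x + d) - g2 x\<bar> \<le> H * \<bar>d\<bar> powr \<delta>" for x d
    using A2[of x "d / ?r"] unfolding dr sc H(3) by (simp add: mult_ac)
  \<comment> \<open>\<open>g1\<close> and \<open>g2\<close> are known through their estimates alone;
    vanishing increments make them continuous, hence Borel.\<close>
  have hcont: "continuous_on UNIV u" if hol: "\<And>x d. \<bar>u (x + d) - u x - v x * d\<bar> \<le> K * \<bar>d\<bar> powr a" and a: "a > 0"
    for u v :: "real \<Rightarrow> real" and K a
  proof -
    have "isCont u x" for x
    proof -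
      have "((\<lambda>d. K * \<bar>d\<bar> powr a + \<bar>v x * d\<bar>) \<longlongrightarrow> K * \<bar>0\<bar> powr a + \<bar>v x * 0\<bar>) (at 0)"
        using a by (intro tendsto_intros) auto
      then have "((\<lambda>d. K * \<bar>d\<bar> powr a + \<bar>v x * d\<bar>) \<longlongrightarrow> 0) (at 0)" by simp
      then have "((\<lambda>d. u (x + d) - u x) \<longlongrightarrow> 0) (at 0)"
      proof (rule Lim_null_comparison[rotated], intro always_eventually allI)
        fix d
        show "norm (u (x + d) - u x) \<le> K * \<bar>d\<bar> powr a + \<bar>v x * d\<bar>"
          using hol[of x d] unfolding real_norm_def by linarith
      qed
      then show "isCont u x" by (simp add: isCont_iff LIM_zero_iff)
    qed
    then show ?thesis by (simp add: continuous_on_eq_continuous_at)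
  qed
  have "continuous_on UNIV g1" by (rule hcont[OF H1]) (use \<delta> in auto)
  moreover have "continuous_on UNIV g2"
    by (rule hcont[where v = "\<lambda>_. 0" and K = H and a = \<delta>]) (use \<delta> H2 in auto)
  ultimately have "g1 \<in> borel_measurable borel" "g2 \<in> borel_measurable borel"
    by (auto intro: borel_measurable_continuous_onI)
  then show ?thesis using that[of g1 g2] b1 b2 H0 H1 H2 by blast
qed

section \<open>Scaling and convolution of centred Gaussian laws\<close>

lemma distr_gauss_scale:
  assumes "a \<noteq> 0"
  shows "distr gauss borel (\<lambda>z. a * z) = density lborel (\<lambda>x. ennreal (normal_density 0 \<bar>a\<bar> x))"
proof -
  have "distributed gauss lborel (\<lambda>z. z) (\<lambda>x. ennreal (normal_density 0 1 x))"
    by (auto simp: distributed_def distr_id2)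
  from gauss.normal_density_affine[OF this, of a 0] assms
  have "distributed gauss lborel (\<lambda>z. a * z) (\<lambda>x. ennreal (normal_density 0 \<bar>a\<bar> x))" by simp
  then have "distr gauss lborel (\<lambda>z. a * z) = density lborel (\<lambda>x. ennreal (normal_density 0 \<bar>a\<bar> x))"
    by (simp add: distributed_def)
  moreover have "distr gauss lborel (\<lambda>z. a * z) = distr gauss borel (\<lambda>z. a * z)"
    by (rule distr_cong) auto
  ultimately show ?thesis by simp
qed

lemma distr_gauss_conv:
  assumes "a \<noteq> 0" "b \<noteq> 0"
  shows "distr (gauss \<Otimes>\<^sub>M gauss) borel (\<lambda>(y, z). a * y + b * z)
     = distr gauss borel (\<lambda>z. sqrt (a\<^sup>2 + b\<^sup>2) * z)"
proof -
  let ?A = "distr gauss borel (\<lambda>z. a * z)" and ?B = "distr gauss borel (\<lambda>z. b * z)"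
  interpret A: prob_space ?A by (rule gauss.prob_space_distr) simp
  interpret B: prob_space ?B by (rule gauss.prob_space_distr) simp
  have "?A \<star> ?B = distr (distr (gauss \<Otimes>\<^sub>M gauss) (borel \<Otimes>\<^sub>M borel) (\<lambda>(y, z). (a * y, b * z))) borel (\<lambda>(x, y). x + y)"
    unfolding convolution_def by (subst pair_measure_distr) (auto intro: B.sigma_finite_measure_axioms)
  also have "\<dots> = distr (gauss \<Otimes>\<^sub>M gauss) borel (\<lambda>(y, z). a * y + b * z)"
    by (subst distr_distr) (auto simp: comp_def case_prod_unfold)
  finally have 1: "?A \<star> ?B = distr (gauss \<Otimes>\<^sub>M gauss) borel (\<lambda>(y, z). a * y + b * z)" .
  have "?A \<star> ?B = density lborel (\<lambda>x. ennreal (normal_density 0 (sqrt (\<bar>a\<bar>\<^sup>2 + \<bar>b\<bar>\<^sup>2)) x))"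
    unfolding distr_gauss_scale[OF assms(1)] distr_gauss_scale[OF assms(2)] using assms
    by (subst convolution_density)
       (auto simp: conv_normal_density_zero_mean ennreal_mult''[symmetric]
         intro!: prob_space.finite_measure prob_space_normal_density)
  also have "\<dots> = distr gauss borel (\<lambda>z. sqrt (a\<^sup>2 + b\<^sup>2) * z)"
    using assms by (subst distr_gauss_scale) (auto simp: sum_power2_eq_zero_iff)
  finally show ?thesis using 1 by simp
qed

lemma gauss_conv:
  fixes f :: "real \<Rightarrow> real"
  assumes f: "L-lipschitz_on UNIV f" and ab: "a \<noteq> 0" "b \<noteq> 0"
  shows "integrable (gauss \<Otimes>\<^sub>M gauss) (\<lambda>(y, z). f (a * y + b * z))"
    and "(\<integral>y. (\<integral>z. f (a * y + b * z) \<partial>gauss) \<partial>gauss) = (\<integral>z. f (sqrt (a\<^sup>2 + b\<^sup>2) * z) \<partial>gauss)"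
proof -
  interpret P: pair_prob_space gauss gauss ..
  have [measurable]: "f \<in> borel_measurable borel" by (rule lipschitz_borel[OF f])
  have "integrable gauss (\<lambda>z. f (sqrt (a\<^sup>2 + b\<^sup>2) * z))"
    by (intro gauss.integrable_lipschitz[OF f]) simp
  then have "integrable (distr (gauss \<Otimes>\<^sub>M gauss) borel (\<lambda>(y, z). a * y + b * z)) f"
    unfolding distr_gauss_conv[OF ab] by (subst integrable_distr_eq) auto
  then show I: "integrable (gauss \<Otimes>\<^sub>M gauss) (\<lambda>(y, z). f (a * y + b * z))"
    by (subst (asm) integrable_distr_eq) (auto simp: case_prod_unfold)
  have "(\<integral>y. (\<integral>z. f (a * y + b * z) \<partial>gauss) \<partial>gauss) = (\<integral>p. (\<lambda>(y, z). f (a * y + b * z)) p \<partial>(gauss \<Otimes>\<^sub>M gauss))"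
    using P.integral_fst'[OF I] by (simp add: case_prod_unfold)
  also have "\<dots> = (\<integral>x. f x \<partial>distr (gauss \<Otimes>\<^sub>M gauss) borel (\<lambda>(y, z). a * y + b * z))"
    by (subst integral_distr) (auto simp: case_prod_unfold)
  also have "\<dots> = (\<integral>z. f (sqrt (a\<^sup>2 + b\<^sup>2) * z) \<partial>gauss)"
    unfolding distr_gauss_conv[OF ab] by (subst integral_distr) auto
  finally show "(\<integral>y. (\<integral>z. f (a * y + b * z) \<partial>gauss) \<partial>gauss) = (\<integral>z. f (sqrt (a\<^sup>2 + b\<^sup>2) * z) \<partial>gauss)" .
qed

lemma gauss_smooth_semigroup:
  fixes f :: "real \<Rightarrow> real"
  assumes f: "1-lipschitz_on UNIV f" and st: "s > 0" "t > 0"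
  shows "gauss_smooth (s + t) f x = (\<integral>z. gauss_smooth t f (x + sqrt s * z) \<partial>gauss)"
proof -
  have "1-lipschitz_on UNIV (\<lambda>y. f (x + y))"
  proof (rule lipschitz_absI)
    show "\<bar>f (x + u) - f (x + v)\<bar> \<le> 1 * \<bar>u - v\<bar>" for u v
      using lipschitz_absD[OF f, of "x + u" "x + v"] by simp
  qed simp
  from gauss_conv(2)[OF this, of "sqrt s" "sqrt t"] st
  show ?thesis by (simp add: gauss_smooth_def add.assoc)
qed

section \<open>Covariance inequalities under mixing\<close>

text \<open>The number of levels k / n below x is the ceiling of n * x. This discretised layer cake
  turns covariances of functions into averages of covariances of events.\<close>

lemma abs_ceiling_approx:
  fixes x :: real and n :: nat
  assumes "0 \<le> x" "x \<le> 1" "n > 0"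
  shows "\<bar>(\<Sum>k<n. indicator {u. real k / n < u} x) / n - x\<bar> \<le> 1 / n"
proof -
  have S: "{k. k < n \<and> real k / n < x} = {..<nat \<lceil>n * x\<rceil>}"
  proof -
    have "k < n \<and> real k / n < x \<longleftrightarrow> int k < \<lceil>n * x\<rceil>" for k
    proof -
      have "real k / n < x \<longleftrightarrow> real k < n * x" using assms by (simp add: divide_less_eq mult.commute)
      moreover have "real k < n * x \<Longrightarrow> k < n"
        using assms mult_left_le[of x "real n"] by linarith
      moreover have "real k < n * x \<longleftrightarrow> int k < \<lceil>n * x\<rceil>" by (simp add: less_ceiling_iff)
      ultimately show ?thesis by blast
    qed
    then show ?thesis by (simp add: lessThan_def zless_nat_eq_int_zless)
  qed
  have "(\<Sum>k<n. indicator {u. real k / n < u} x :: real) = real (card {k. k < n \<and> real k / n < x})"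
    by (simp add: indicator_def sum.If_cases lessThan_def Collect_conj_eq[symmetric])
  also have "\<dots> = of_int \<lceil>n * x\<rceil>" unfolding S using assms by simp
  finally have eq: "(\<Sum>k<n. indicator {u. real k / n < u} x :: real) = of_int \<lceil>n * x\<rceil>" .
  have "\<bar>of_int \<lceil>n * x\<rceil> - n * x\<bar> \<le> 1" by linarith
  then have "\<bar>of_int \<lceil>n * x\<rceil> - n * x\<bar> / n \<le> 1 / n" using assms by (simp add: divide_right_mono)
  moreover have "\<bar>of_int \<lceil>n * x\<rceil> - n * x\<bar> / n = \<bar>of_int \<lceil>n * x\<rceil> / n - x\<bar>"
  proof -
    have "(of_int \<lceil>n * x\<rceil> - n * x) / n = of_int \<lceil>n * x\<rceil> / n - x"
      using assms by (simp add: diff_divide_distrib)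
    then show ?thesis using assms abs_divide[of "of_int \<lceil>n * x\<rceil> - n * x" "real n"] by simp
  qed
  ultimately show ?thesis unfolding eq by simp
qed

text \<open>A function that is not integrable has integral zero, so the bound survives in that
  case.\<close>

lemma (in prob_space) abs_expectation_le:
  fixes f :: "'a \<Rightarrow> real"
  assumes "\<And>w. w \<in> space M \<Longrightarrow> \<bar>f w\<bar> \<le> K" and "0 \<le> K"
  shows "\<bar>expectation f\<bar> \<le> K"
proof (cases "integrable M f")
  case True
  have "\<bar>expectation f\<bar> \<le> (\<integral>w. \<bar>f w\<bar> \<partial>M)" by (rule integral_abs_bound)
  also have "\<dots> \<le> (\<integral>w. K \<partial>M)" using True assms by (intro integral_mono) auto
  finally show ?thesis by (simp add: prob_space)
qed (use assms in \<open>simp add: not_integrable_integral_eq\<close>)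

lemma (in prob_space) abs_expectation_diff_le:
  fixes f g :: "'a \<Rightarrow> real"
  assumes "integrable M f" "integrable M g" "\<And>w. w \<in> space M \<Longrightarrow> \<bar>f w - g w\<bar> \<le> K" and "0 \<le> K"
  shows "\<bar>expectation f - expectation g\<bar> \<le> K"
  using abs_expectation_le[of "\<lambda>w. f w - g w" K] assms by simp

lemma (in prob_space) integrable_abs_bounded:
  fixes f :: "'a \<Rightarrow> real"
  assumes "f \<in> borel_measurable M" "\<And>w. w \<in> space M \<Longrightarrow> \<bar>f w\<bar> \<le> K"
  shows "integrable M f"
  by (rule integrable_const_bound[of _ K]) (use assms in auto)

text \<open>\<open>a\<close> is any upper bound of the strong mixing coefficient of the two
  \<sigma>-fields, so that a polynomial rate can be inserted directly.\<close>

locale mixing_pair = prob_space M for M +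
  fixes FA FB :: "'a measure" and a :: real
  assumes subA: "subalgebra M FA" and subB: "subalgebra M FB"
    and mix: "\<And>A B. A \<in> sets FA \<Longrightarrow> B \<in> sets FB \<Longrightarrow> \<bar>prob (A \<inter> B) - prob A * prob B\<bar> \<le> a"
begin

lemma a_nonneg: "0 \<le> a"
  using mix[of "{}" "{}"] by simp

lemma measA: "f \<in> borel_measurable FA \<Longrightarrow> f \<in> borel_measurable M"
  using measurable_from_subalg[OF subA] .

lemma measB: "f \<in> borel_measurable FB \<Longrightarrow> f \<in> borel_measurable M"
  using measurable_from_subalg[OF subB] .

text \<open>Up to 1 / n, each function is the average of the indicators of its n upper level sets.
  The covariance of two such averages is the average of n^2 covariances of events, each at most
  \<open>a\<close>.\<close>

lemma cov_unit:
  fixes f g :: "'a \<Rightarrow> real"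
  assumes f: "f \<in> borel_measurable FA" and g: "g \<in> borel_measurable FB"
    and f01: "\<And>w. w \<in> space M \<Longrightarrow> 0 \<le> f w \<and> f w \<le> 1"
    and g01: "\<And>w. w \<in> space M \<Longrightarrow> 0 \<le> g w \<and> g w \<le> 1"
  shows "\<bar>expectation (\<lambda>w. f w * g w) - expectation f * expectation g\<bar> \<le> a"
proof (rule field_le_epsilon)
  fix e :: real assume "e > 0"
  \<comment> \<open>Two functions are replaced in the mixed moment and two in the product of the
    means, at a cost of 1 / n each.\<close>
  obtain n :: nat where "4 / e < n" using reals_Archimedean2 by blast
  with \<open>e > 0\<close> have "0 < real n" by (intro less_trans[OF _ \<open>4 / e < n\<close>]) simp
  with \<open>4 / e < n\<close> \<open>e > 0\<close> have n: "n > 0" "4 / n < e" by (auto simp: field_simps)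
  note [measurable] = measA[OF f] measB[OF g]
  define A where "A k = {w \<in> space M. real k / n < f w}" for k :: nat
  define B where "B k = {w \<in> space M. real k / n < g w}" for k :: nat
  have A: "A k \<in> sets FA" for k
  proof -
    have "{w \<in> space FA. real k / n < f w} \<in> sets FA" using f by measurable
    then show ?thesis using subA by (simp add: A_def subalgebra_def)
  qed
  have B: "B k \<in> sets FB" for k
  proof -
    have "{w \<in> space FB. real k / n < g w} \<in> sets FB" using g by measurable
    then show ?thesis using subB by (simp add: B_def subalgebra_def)
  qed
  have [measurable]: "A k \<in> events" "B k \<in> events" for k
    unfolding A_def B_def by measurable
  define f' where "f' w = (\<Sum>k<n. indicator (A k) w :: real) / n" for w
  define g' where "g' w = (\<Sum>k<n. indicator (B k) w :: real) / n" for w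
  have [measurable]: "f' \<in> borel_measurable M" "g' \<in> borel_measurable M"
    unfolding f'_def[abs_def] g'_def[abs_def] by measurable
  have ind: "(\<Sum>k<n. indicator (A k) w :: real) \<le> n" "(\<Sum>k<n. indicator (B k) w :: real) \<le> n" for w
    using sum_bounded_above[of "{..<n}" "\<lambda>k. indicator (A k) w :: real" 1]
      sum_bounded_above[of "{..<n}" "\<lambda>k. indicator (B k) w :: real" 1] by (auto simp: indicator_def)
  have f'01: "0 \<le> f' w" "f' w \<le> 1" and g'01: "0 \<le> g' w" "g' w \<le> 1" for w
    using n ind[of w] by (auto simp: f'_def g'_def divide_le_eq intro!: sum_nonneg divide_nonneg_nonneg)
  have ff: "\<bar>f w - f' w\<bar> \<le> 1 / n" if "w \<in> space M" for w
    using abs_ceiling_approx[of "f w" n] f01[OF that] n that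
    by (auto simp: f'_def A_def indicator_def abs_minus_commute)
  have gg: "\<bar>g w - g' w\<bar> \<le> 1 / n" if "w \<in> space M" for w
    using abs_ceiling_approx[of "g w" n] g01[OF that] n that
    by (auto simp: g'_def B_def indicator_def abs_minus_commute)
  have intf: "integrable M f" by (rule integrable_abs_bounded[of _ 1]) (use f01 in auto)
  have intg: "integrable M g" by (rule integrable_abs_bounded[of _ 1]) (use g01 in auto)
  have intf': "integrable M f'" by (rule integrable_abs_bounded[of _ 1]) (use f'01 in auto)
  have intg': "integrable M g'" by (rule integrable_abs_bounded[of _ 1]) (use g'01 in auto)
  have prod_diff: "\<bar>p * q - p' * q'\<bar> \<le> 1 / n + 1 / n"
    if "0 \<le> q" "q \<le> 1" "0 \<le> p'" "p' \<le> 1" "\<bar>p - p'\<bar> \<le> 1 / n" "\<bar>q - q'\<bar> \<le> 1 / n" for p q p' q' :: real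
  proof -
    have "p * q - p' * q' = (p - p') * q + p' * (q - q')" by (simp add: algebra_simps)
    then have "\<bar>p * q - p' * q'\<bar> \<le> \<bar>p - p'\<bar> * q + p' * \<bar>q - q'\<bar>"
      using that abs_triangle_ineq[of "(p - p') * q" "p' * (q - q')"] by (simp add: abs_mult)
    also have "\<dots> \<le> 1 / n * 1 + 1 * (1 / n)"
      using that by (intro add_mono mult_mono) auto
    finally show ?thesis by simp
  qed
  have intfg: "integrable M (\<lambda>w. f w * g w)"
    by (rule integrable_abs_bounded[of _ 1]) (use f01 g01 in \<open>auto simp: abs_mult intro!: mult_le_one\<close>)
  have intfg': "integrable M (\<lambda>w. f' w * g' w)"
    by (rule integrable_abs_bounded[of _ 1]) (use f'01 g'01 in \<open>auto simp: abs_mult intro!: mult_le_one\<close>)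
  have 1: "\<bar>expectation (\<lambda>w. f w * g w) - expectation (\<lambda>w. f' w * g' w)\<bar> \<le> 1 / n + 1 / n"
    by (rule abs_expectation_diff_le[OF intfg intfg'], rule prod_diff)
       (use f'01 g01 ff gg in auto)
  have 2: "\<bar>expectation f * expectation g - expectation f' * expectation g'\<bar> \<le> 1 / n + 1 / n"
  proof (rule prod_diff)
    show "\<bar>expectation f - expectation f'\<bar> \<le> 1 / n"
      by (rule abs_expectation_diff_le[OF intf intf']) (use ff in auto)
    show "\<bar>expectation g - expectation g'\<bar> \<le> 1 / n"
      by (rule abs_expectation_diff_le[OF intg intg']) (use gg in auto)
    show "0 \<le> expectation g" by (rule integral_nonneg_AE) (use g01 in auto)
    show "0 \<le> expectation f'" by (rule integral_nonneg_AE) (use f'01 in auto)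
    show "expectation g \<le> 1" using abs_expectation_le[of g 1] g01 by (auto simp: abs_le_iff)
    show "expectation f' \<le> 1" using abs_expectation_le[of f' 1] f'01 by (auto simp: abs_le_iff)
  qed
  have ind_int: "integrable M (indicator E :: 'a \<Rightarrow> real)" if "E \<in> events" for E
    using that by (intro integrable_real_indicator) (auto simp: emeasure_eq_measure)
  have Ef': "expectation f' = (\<Sum>k<n. prob (A k)) / n" unfolding f'_def by (simp add: Bochner_Integration.integral_sum ind_int)
  have Eg': "expectation g' = (\<Sum>k<n. prob (B k)) / n" unfolding g'_def by (simp add: Bochner_Integration.integral_sum ind_int)
  have "expectation (\<lambda>w. f' w * g' w) = expectation (\<lambda>w. (\<Sum>k<n. \<Sum>l<n. indicator (A k \<inter> B l) w :: real) / n\<^sup>2)"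
    unfolding f'_def g'_def
    by (intro Bochner_Integration.integral_cong) (auto simp: sum_product indicator_inter_arith power2_eq_square)
  also have "\<dots> = (\<Sum>k<n. \<Sum>l<n. prob (A k \<inter> B l)) / n\<^sup>2"
    by (simp add: Bochner_Integration.integral_sum Bochner_Integration.integrable_sum ind_int)
  finally have Efg': "expectation (\<lambda>w. f' w * g' w) = (\<Sum>k<n. \<Sum>l<n. prob (A k \<inter> B l)) / n\<^sup>2" .
  have "expectation (\<lambda>w. f' w * g' w) - expectation f' * expectation g'
      = (\<Sum>k<n. \<Sum>l<n. prob (A k \<inter> B l) - prob (A k) * prob (B l)) / n\<^sup>2"
    unfolding Efg' Ef' Eg' by (simp add: sum_subtractf sum_product diff_divide_distrib power2_eq_square)
  then have "\<bar>expectation (\<lambda>w. f' w * g' w) - expectation f' * expectation g'\<bar>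
      = \<bar>(\<Sum>k<n. \<Sum>l<n. prob (A k \<inter> B l) - prob (A k) * prob (B l))\<bar> / n\<^sup>2"
    by (simp add: abs_divide)
  also have "\<dots> \<le> (\<Sum>k<n. \<Sum>l<n. a) / n\<^sup>2"
    by (intro frac_le order_trans[OF sum_abs] sum_mono mix A B) (use n a_nonneg in \<open>auto intro!: sum_nonneg\<close>)
  also have "\<dots> = a" using n by (simp add: power2_eq_square)
  finally have 3: "\<bar>expectation (\<lambda>w. f' w * g' w) - expectation f' * expectation g'\<bar> \<le> a" .
  have "4 / real n = 1 / n + 1 / n + (1 / n + 1 / n)" by simp
  with 1 2 3 n(2)
  show "\<bar>expectation (\<lambda>w. f w * g w) - expectation f * expectation g\<bar> \<le> a + e" by linarith
qed

text \<open>Affine maps onto [0,1] reduce this to \<open>cov_unit\<close>; they scale the covariance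
  by 1 / (2 * K) and 1 / (2 * L). Vanishing bounds are split off because these maps divide by
  them.\<close>

lemma cov_bounded:
  fixes f g :: "'a \<Rightarrow> real"
  assumes f: "f \<in> borel_measurable FA" and g: "g \<in> borel_measurable FB"
    and fK: "\<And>w. w \<in> space M \<Longrightarrow> \<bar>f w\<bar> \<le> K" and gL: "\<And>w. w \<in> space M \<Longrightarrow> \<bar>g w\<bar> \<le> L"
  shows "\<bar>expectation (\<lambda>w. f w * g w) - expectation f * expectation g\<bar> \<le> 4 * K * L * a"
proof -
  obtain w0 where "w0 \<in> space M" using not_empty by blast
  then have KL: "0 \<le> K" "0 \<le> L" using fK[of w0] gL[of w0] by linarith+
  note [measurable] = measA[OF f] measB[OF g]
  show ?thesis
  proof (cases "K = 0 \<or> L = 0")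
    case True
    then have "expectation (\<lambda>w. f w * g w) = 0" "expectation f * expectation g = 0"
      using fK gL by (auto intro!: integral_eq_zero_AE)
    then show ?thesis using True by auto
  next
    case False
    then have KL: "0 < K" "0 < L" using KL by auto
    define f' where "f' w = (f w + K) / (2 * K)" for w
    define g' where "g' w = (g w + L) / (2 * L)" for w
    have intf: "integrable M f" by (rule integrable_abs_bounded[OF _ fK]) auto
    have intg: "integrable M g" by (rule integrable_abs_bounded[OF _ gL]) auto
    have intfg: "integrable M (\<lambda>w. f w * g w)"
      by (rule integrable_abs_bounded[where K = "K * L"])
         (use fK gL KL in \<open>auto simp: abs_mult intro!: mult_mono\<close>)
    have Ef: "expectation f' = (expectation f + K) / (2 * K)"
      unfolding f'_def using intf by (simp add: prob_space)
    have Eg: "expectation g' = (expectation g + L) / (2 * L)"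
      unfolding g'_def using intg by (simp add: prob_space)
    have "expectation (\<lambda>w. f' w * g' w) = expectation (\<lambda>w. (f w * g w + L * f w + K * g w + K * L) / (4 * K * L))"
      unfolding f'_def g'_def by (intro Bochner_Integration.integral_cong) (auto simp: field_simps)
    also have "\<dots> = (expectation (\<lambda>w. f w * g w) + L * expectation f + K * expectation g + K * L) / (4 * K * L)"
      using intf intg intfg by (simp add: prob_space)
    finally have Efg: "expectation (\<lambda>w. f' w * g' w)
       = (expectation (\<lambda>w. f w * g w) + L * expectation f + K * expectation g + K * L) / (4 * K * L)" .
    have "\<bar>expectation (\<lambda>w. f' w * g' w) - expectation f' * expectation g'\<bar> \<le> a"
    proof (rule cov_unit)
      show "f' \<in> borel_measurable FA" "g' \<in> borel_measurable FB"
        unfolding f'_def[abs_def] g'_def[abs_def] using f g by measurable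
      fix w assume w: "w \<in> space M"
      show "0 \<le> f' w \<and> f' w \<le> 1" using fK[OF w] KL by (auto simp: f'_def field_simps)
      show "0 \<le> g' w \<and> g' w \<le> 1" using gL[OF w] KL by (auto simp: g'_def field_simps)
    qed
    also have "expectation (\<lambda>w. f' w * g' w) - expectation f' * expectation g'
       = (expectation (\<lambda>w. f w * g w) - expectation f * expectation g) / (4 * K * L)"
      unfolding Efg Ef Eg using KL by (simp add: field_simps)
    finally show ?thesis using KL by (simp add: abs_divide abs_mult divide_le_eq mult_ac)
  qed
qed

text \<open>Real and imaginary parts produce four real covariances, each at most 4 *
  \<open>a\<close>.\<close>

lemma cov_iexp:
  fixes f g :: "'a \<Rightarrow> complex"
  assumes f: "f \<in> borel_measurable FA" and g: "g \<in> borel_measurable FB"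
    and f1: "\<And>w. w \<in> space M \<Longrightarrow> norm (f w) \<le> 1" and g1: "\<And>w. w \<in> space M \<Longrightarrow> norm (g w) \<le> 1"
  shows "norm ((CLINT w|M. f w * g w) - (CLINT w|M. f w) * (CLINT w|M. g w)) \<le> 16 * a"
proof -
  have fM: "f \<in> borel_measurable M" using measurable_from_subalg[OF subA f] .
  have gM: "g \<in> borel_measurable M" using measurable_from_subalg[OF subB g] .
  note [measurable] = fM gM
  have rf: "(\<lambda>w. Re (f w)) \<in> borel_measurable FA" "(\<lambda>w. Im (f w)) \<in> borel_measurable FA"
    using f by measurable
  have rg: "(\<lambda>w. Re (g w)) \<in> borel_measurable FB" "(\<lambda>w. Im (g w)) \<in> borel_measurable FB"
    using g by measurable
  have bf: "\<bar>Re (f w)\<bar> \<le> 1" "\<bar>Im (f w)\<bar> \<le> 1" if "w \<in> space M" for w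
    using f1[OF that] abs_Re_le_cmod[of "f w"] abs_Im_le_cmod[of "f w"] by linarith+
  have bg: "\<bar>Re (g w)\<bar> \<le> 1" "\<bar>Im (g w)\<bar> \<le> 1" if "w \<in> space M" for w
    using g1[OF that] abs_Re_le_cmod[of "g w"] abs_Im_le_cmod[of "g w"] by linarith+
  have If: "integrable M f" and Ig: "integrable M g"
    using f1 g1 by (auto intro!: integrable_const_bound[of _ 1])
  have Ifg: "integrable M (\<lambda>w. f w * g w)"
    using f1 g1 by (auto intro!: integrable_const_bound[of _ 1] simp: norm_mult mult_le_one)
  have ints: "integrable M (\<lambda>w. u w * v w)"
    if "u \<in> borel_measurable M" "v \<in> borel_measurable M" "\<And>w. w \<in> space M \<Longrightarrow> \<bar>u w\<bar> \<le> 1"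
       "\<And>w. w \<in> space M \<Longrightarrow> \<bar>v w\<bar> \<le> 1" for u v :: "'a \<Rightarrow> real"
    by (rule integrable_abs_bounded[of _ 1]) (use that in \<open>auto simp: abs_mult intro!: mult_le_one\<close>)
  let ?c = "\<lambda>u v. expectation (\<lambda>w. u w * v w) - expectation u * expectation v"
  let ?Rf = "\<lambda>w. Re (f w)" and ?If = "\<lambda>w. Im (f w)" and ?Rg = "\<lambda>w. Re (g w)" and ?Ig = "\<lambda>w. Im (g w)"
  let ?d = "(CLINT w|M. f w * g w) - (CLINT w|M. f w) * (CLINT w|M. g w)"
  have Re: "Re ?d = ?c ?Rf ?Rg - ?c ?If ?Ig"
  proof -
    have "Re (CLINT w|M. f w * g w) = expectation (\<lambda>w. ?Rf w * ?Rg w - ?If w * ?Ig w)"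
      by (subst integral_Re[OF Ifg, symmetric]) simp
    also have "\<dots> = expectation (\<lambda>w. ?Rf w * ?Rg w) - expectation (\<lambda>w. ?If w * ?Ig w)"
      by (intro Bochner_Integration.integral_diff ints) (use bf bg in auto)
    finally show ?thesis by (simp add: integral_Re[OF If] integral_Im[OF If] integral_Re[OF Ig] integral_Im[OF Ig])
  qed
  have Im: "Im ?d = ?c ?Rf ?Ig + ?c ?If ?Rg"
  proof -
    have "Im (CLINT w|M. f w * g w) = expectation (\<lambda>w. ?Rf w * ?Ig w + ?If w * ?Rg w)"
      by (subst integral_Im[OF Ifg, symmetric]) simp
    also have "\<dots> = expectation (\<lambda>w. ?Rf w * ?Ig w) + expectation (\<lambda>w. ?If w * ?Rg w)"
      by (intro Bochner_Integration.integral_add ints) (use bf bg in auto)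
    finally show ?thesis by (simp add: integral_Re[OF If] integral_Im[OF If] integral_Re[OF Ig] integral_Im[OF Ig])
  qed
  have "norm ?d \<le> \<bar>Re ?d\<bar> + \<bar>Im ?d\<bar>" by (rule cmod_le)
  also have "\<dots> \<le> 16 * a"
    unfolding Re Im
    using cov_bounded[OF rf(1) rg(1) bf(1) bg(1)] cov_bounded[OF rf(1) rg(2) bf(1) bg(2)]
      cov_bounded[OF rf(2) rg(1) bf(2) bg(1)] cov_bounded[OF rf(2) rg(2) bf(2) bg(2)]
    by linarith
  finally show ?thesis .
qed

text \<open>Only the unbounded factor is truncated. The tail costs \<open>T powr (1 - q)\<close>
  times its q-th moment, once in the mixed moment and once in the product of the means.\<close>

lemma cov_truncate:
  fixes f g :: "'a \<Rightarrow> real"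
  assumes f: "f \<in> borel_measurable FA" and g: "g \<in> borel_measurable FB"
    and fK: "\<And>w. w \<in> space M \<Longrightarrow> \<bar>f w\<bar> \<le> K" and q: "1 \<le> q"
    and gq: "integrable M (\<lambda>w. \<bar>g w\<bar> powr q)" and T: "T > 0"
  shows "\<bar>expectation (\<lambda>w. f w * g w) - expectation f * expectation g\<bar>
    \<le> 4 * K * T * a + 2 * K * T powr (1 - q) * expectation (\<lambda>w. \<bar>g w\<bar> powr q)"
proof -
  obtain w0 where "w0 \<in> space M" using not_empty by blast
  then have K: "0 \<le> K" using fK[of w0] by linarith
  note [measurable] = measA[OF f] measB[OF g]
  define h where "h w = (if \<bar>g w\<bar> \<le> T then g w else 0)" for w
  have h: "h \<in> borel_measurable FB" unfolding h_def[abs_def] using g by measurable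
  note [measurable] = measB[OF h]
  have hT: "\<bar>h w\<bar> \<le> T" for w using T by (simp add: h_def)
  have gh: "\<bar>g w - h w\<bar> \<le> T powr (1 - q) * \<bar>g w\<bar> powr q" for w
  proof (cases "\<bar>g w\<bar> \<le> T")
    case False
    then have "\<bar>g w\<bar> powr 1 = \<bar>g w\<bar> powr (1 - q) * \<bar>g w\<bar> powr q"
      using T by (subst powr_add[symmetric]) simp
    also have "\<dots> \<le> T powr (1 - q) * \<bar>g w\<bar> powr q"
      using False T q by (intro mult_right_mono powr_mono2') auto
    finally show ?thesis using False T by (simp add: h_def)
  qed (auto simp: h_def)
  let ?D = "T powr (1 - q) * expectation (\<lambda>w. \<bar>g w\<bar> powr q)"
  have Igh: "integrable M (\<lambda>w. \<bar>g w - h w\<bar>)"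
    by (rule Bochner_Integration.integrable_bound[OF integrable_mult_right[OF gq, of "T powr (1 - q)"]])
       (use gh in auto)
  have Ih: "integrable M h" by (rule integrable_abs_bounded[of _ T]) (use hT in auto)
  have "integrable M (\<lambda>w. g w - h w)" using Igh by (subst (asm) integrable_abs_iff) auto
  then have Ig: "integrable M g" using Bochner_Integration.integrable_add[OF _ Ih] by fastforce
  have bd: "integrable M (\<lambda>w. f w * u w)" if "integrable M u" for u
    by (rule Bochner_Integration.integrable_bound[OF integrable_mult_right[OF integrable_abs[OF that], of K]])
       (use that fK K in \<open>auto simp: abs_mult intro!: mult_right_mono\<close>)
  have E1: "expectation (\<lambda>w. \<bar>g w - h w\<bar>) \<le> ?D"
    using integral_mono[OF Igh integrable_mult_right[OF gq, of "T powr (1 - q)"]] gh by simp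
  have "\<bar>expectation (\<lambda>w. f w * g w) - expectation (\<lambda>w. f w * h w)\<bar> = \<bar>expectation (\<lambda>w. f w * (g w - h w))\<bar>"
    using bd[OF Ig] bd[OF Ih] by (simp add: right_diff_distrib)
  also have "\<dots> \<le> expectation (\<lambda>w. \<bar>f w * (g w - h w)\<bar>)" by (rule integral_abs_bound)
  also have "\<dots> \<le> expectation (\<lambda>w. K * \<bar>g w - h w\<bar>)"
    by (intro integral_mono integrable_abs bd integrable_mult_right Igh)
       (use fK Ig Ih in \<open>auto simp: abs_mult intro!: mult_right_mono\<close>)
  also have "\<dots> \<le> K * ?D" using E1 K by (simp add: mult_left_mono)
  finally have 1: "\<bar>expectation (\<lambda>w. f w * g w) - expectation (\<lambda>w. f w * h w)\<bar> \<le> K * ?D" .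
  have "\<bar>expectation g - expectation h\<bar> \<le> ?D"
    using integral_abs_bound[of M "\<lambda>w. g w - h w"] E1 Ig Ih by simp
  then have "\<bar>expectation f\<bar> * \<bar>expectation g - expectation h\<bar> \<le> K * ?D"
    using abs_expectation_le[OF fK K] K by (intro mult_mono) auto
  then have 2: "\<bar>expectation f * expectation g - expectation f * expectation h\<bar> \<le> K * ?D"
    by (simp add: abs_mult[symmetric] right_diff_distrib)
  have 3: "\<bar>expectation (\<lambda>w. f w * h w) - expectation f * expectation h\<bar> \<le> 4 * K * T * a"
    by (rule cov_bounded[OF f h fK hT])
  show ?thesis using 1 2 3 by (simp add: mult.assoc)
qed

text \<open>Both factors are truncated at the same level. Where the truncation acts, the product is
  at most the square of the larger factor, which costs 2 * B. Truncation spoils the zero mean of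
  \<open>f\<close> by at most \<open>T powr (1 - q) * B\<close>, and multiplied by the bound T on
  the other mean this is the third B.\<close>

lemma cov_truncate2:
  fixes f g :: "'a \<Rightarrow> real"
  assumes f: "f \<in> borel_measurable FA" and g: "g \<in> borel_measurable FB" and q: "2 \<le> q"
    and fq: "integrable M (\<lambda>w. \<bar>f w\<bar> powr q)" "expectation (\<lambda>w. \<bar>f w\<bar> powr q) \<le> B"
    and gq: "integrable M (\<lambda>w. \<bar>g w\<bar> powr q)" "expectation (\<lambda>w. \<bar>g w\<bar> powr q) \<le> B"
    and f0: "integrable M f" "expectation f = 0" and T: "T > 0"
    and fg: "integrable M (\<lambda>w. f w * g w)"
  shows "\<bar>expectation (\<lambda>w. f w * g w)\<bar> \<le> 4 * T\<^sup>2 * a + 3 * B * T powr (2 - q)"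
proof -
  note [measurable] = measA[OF f] measB[OF g]
  define f' where "f' w = (if \<bar>f w\<bar> \<le> T then f w else 0)" for w
  define g' where "g' w = (if \<bar>g w\<bar> \<le> T then g w else 0)" for w
  have f': "f' \<in> borel_measurable FA" unfolding f'_def[abs_def] using f by measurable
  have g': "g' \<in> borel_measurable FB" unfolding g'_def[abs_def] using g by measurable
  note [measurable] = measA[OF f'] measB[OF g']
  have f'T: "\<bar>f' w\<bar> \<le> T" and g'T: "\<bar>g' w\<bar> \<le> T" for w using T by (auto simp: f'_def g'_def)
  have big: "x\<^sup>2 \<le> T powr (2 - q) * x powr q" if "T < x" for x
  proof -
    have "x\<^sup>2 = x powr (2 - q) * x powr q"
      using T that by (subst powr_add[symmetric]) simp
    also have "\<dots> \<le> T powr (2 - q) * x powr q"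
      using that T q by (intro mult_right_mono powr_mono2') auto
    finally show ?thesis .
  qed
  have d1: "\<bar>f w * g w - f' w * g' w\<bar> \<le> T powr (2 - q) * (\<bar>f w\<bar> powr q + \<bar>g w\<bar> powr q)" for w
  proof (cases "\<bar>f w\<bar> \<le> T \<and> \<bar>g w\<bar> \<le> T")
    case False
    then have "f' w * g' w = 0" by (auto simp: f'_def g'_def)
    then have "\<bar>f w * g w - f' w * g' w\<bar> = \<bar>f w\<bar> * \<bar>g w\<bar>"
      by (simp only: diff_zero abs_mult)
    also have "\<dots> \<le> (max \<bar>f w\<bar> \<bar>g w\<bar>)\<^sup>2"
      unfolding power2_eq_square by (intro mult_mono) auto
    also have "\<dots> \<le> T powr (2 - q) * (max \<bar>f w\<bar> \<bar>g w\<bar>) powr q"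
      using False by (intro big) auto
    also have "\<dots> \<le> T powr (2 - q) * (\<bar>f w\<bar> powr q + \<bar>g w\<bar> powr q)"
      by (intro mult_left_mono) (auto simp: max_def)
    finally show ?thesis .
  qed (auto simp: f'_def g'_def)
  have d2: "\<bar>f w - f' w\<bar> * T \<le> T powr (2 - q) * \<bar>f w\<bar> powr q" for w
  proof (cases "\<bar>f w\<bar> \<le> T")
    case False
    then have "\<bar>f w\<bar> * T \<le> \<bar>f w\<bar> * \<bar>f w\<bar>" by (intro mult_left_mono) auto
    with False have "\<bar>f w - f' w\<bar> * T \<le> \<bar>f w\<bar>\<^sup>2"
      by (simp add: f'_def power2_eq_square)
    also have "\<dots> \<le> T powr (2 - q) * \<bar>f w\<bar> powr q" using False by (intro big) auto
    finally show ?thesis .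
  qed (auto simp: f'_def)
  have If': "integrable M f'" by (rule integrable_abs_bounded[of _ T]) (use f'T in auto)
  have Ifg': "integrable M (\<lambda>w. f' w * g' w)"
    by (rule integrable_abs_bounded[of _ "T * T"])
       (use f'T g'T T in \<open>auto simp: abs_mult intro!: mult_mono\<close>)
  have 1: "\<bar>expectation (\<lambda>w. f w * g w) - expectation (\<lambda>w. f' w * g' w)\<bar> \<le> T powr (2 - q) * (2 * B)"
  proof -
    have "\<bar>expectation (\<lambda>w. f w * g w - f' w * g' w)\<bar> \<le> expectation (\<lambda>w. \<bar>f w * g w - f' w * g' w\<bar>)"
      by (rule integral_abs_bound)
    also have "\<dots> \<le> expectation (\<lambda>w. T powr (2 - q) * (\<bar>f w\<bar> powr q + \<bar>g w\<bar> powr q))"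
      using d1 fq gq fg Ifg' by (intro integral_mono integrable_abs) auto
    also have "\<dots> \<le> T powr (2 - q) * (2 * B)"
      using fq gq by (simp add: mult_left_mono)
    finally show ?thesis using fg Ifg' by simp
  qed
  have "\<bar>expectation f'\<bar> * T \<le> expectation (\<lambda>w. \<bar>f w - f' w\<bar>) * T"
  proof -
    have "\<bar>expectation (\<lambda>w. f w - f' w)\<bar> \<le> expectation (\<lambda>w. \<bar>f w - f' w\<bar>)" by (rule integral_abs_bound)
    then show ?thesis using T f0 If' by (simp add: mult_right_mono)
  qed
  also have "\<dots> = expectation (\<lambda>w. \<bar>f w - f' w\<bar> * T)" by simp
  also have "\<dots> \<le> expectation (\<lambda>w. T powr (2 - q) * \<bar>f w\<bar> powr q)"
    using d2 fq f0 If' by (intro integral_mono) auto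
  also have "\<dots> \<le> T powr (2 - q) * B" using fq by (simp add: mult_left_mono)
  finally have "\<bar>expectation f'\<bar> * T \<le> T powr (2 - q) * B" .
  moreover have "\<bar>expectation f'\<bar> * \<bar>expectation g'\<bar> \<le> \<bar>expectation f'\<bar> * T"
    using abs_expectation_le[of g' T] g'T T by (intro mult_left_mono) auto
  ultimately have 2: "\<bar>expectation f' * expectation g'\<bar> \<le> T powr (2 - q) * B"
    by (simp add: abs_mult)
  have 3: "\<bar>expectation (\<lambda>w. f' w * g' w) - expectation f' * expectation g'\<bar> \<le> 4 * T * T * a"
    by (rule cov_bounded[OF f' g' f'T g'T])
  have "4 * T\<^sup>2 * a = 4 * T * T * a" "3 * B * T powr (2 - q) = T powr (2 - q) * (2 * B) + T powr (2 - q) * B"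
    by (auto simp: power2_eq_square)
  with 1 2 3 show ?thesis by linarith
qed

end

section \<open>Partial sums of mixing sequences\<close>

text \<open>Dominates all absolute moments of orders between 0 and 3, so that one constant serves
  every \<delta>.\<close>

definition gauss_const :: real where "gauss_const = (\<integral>z. 1 + \<bar>z\<bar> ^ 3 \<partial>gauss)"

lemma gauss_integrable_abs_powr:
  assumes "0 \<le> q" "q \<le> 3"
  shows "integrable gauss (\<lambda>z. \<bar>z\<bar> powr q)" and "(\<integral>z. \<bar>z\<bar> powr q \<partial>gauss) \<le> gauss_const"
proof -
  have le: "\<bar>z\<bar> powr q \<le> 1 + \<bar>z\<bar> ^ 3" for z :: real
  proof (cases "\<bar>z\<bar> \<le> 1")
    case True
    then have "\<bar>z\<bar> powr q \<le> 1" using assms powr_le1 by auto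
    then show ?thesis using zero_le_power[of "\<bar>z\<bar>" 3] by linarith
  next
    case False
    then have "\<bar>z\<bar> powr q \<le> \<bar>z\<bar> powr 3" using assms by (intro powr_mono) auto
    also have "\<dots> = \<bar>z\<bar> ^ 3" using False by simp
    finally show ?thesis by simp
  qed
  have I: "integrable gauss (\<lambda>z. 1 + \<bar>z\<bar> ^ 3)"
    by (intro Bochner_Integration.integrable_add gauss_integrable_abs_power) auto
  show Iq: "integrable gauss (\<lambda>z. \<bar>z\<bar> powr q)"
    by (rule Bochner_Integration.integrable_bound[OF I]) (use le in auto)
  show "(\<integral>z. \<bar>z\<bar> powr q \<partial>gauss) \<le> gauss_const"
    unfolding gauss_const_def by (rule integral_mono[OF Iq I le])
qed

lemma gauss_const_ge: "gauss_const \<ge> 1"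
proof -
  have "(\<integral>z. 1 \<partial>gauss) \<le> gauss_const"
    unfolding gauss_const_def
    by (intro integral_mono Bochner_Integration.integrable_add gauss_integrable_abs_power) auto
  then show ?thesis by simp
qed

section \<open>Second-order expansion of a single exchange\<close>

lemma gauss_taylor2:
  fixes g g1 g2 :: "real \<Rightarrow> real"
  assumes g: "1-lipschitz_on UNIV g" and s: "0 \<le> s" and H: "0 \<le> H" and q: "2 < q" "q \<le> 3"
    and T: "\<And>x d. \<bar>g (x + d) - g x - g1 x * d - g2 x * d\<^sup>2 / 2\<bar> \<le> H * \<bar>d\<bar> powr q"
  shows "\<bar>(\<integral>z. g (x + s * z) \<partial>gauss) - g x - g2 x * s\<^sup>2 / 2\<bar> \<le> H * gauss_const * s powr q"
proof -
  have 1: "integrable gauss (\<lambda>z. g (x + s * z))"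
    by (rule gauss.integrable_lipschitz[OF g]) simp
  have 2: "integrable gauss (\<lambda>z. g1 x * (s * z))" "integrable gauss (\<lambda>z. g2 x * (s * z)\<^sup>2 / 2)"
    by (auto simp: power_mult_distrib)
  let ?e = "\<lambda>z. g (x + s * z) - g x - g1 x * (s * z) - g2 x * (s * z)\<^sup>2 / 2"
  have Ie: "integrable gauss ?e"
    by (intro Bochner_Integration.integrable_diff 1 2) auto
  have "(\<integral>z. ?e z \<partial>gauss) = (\<integral>z. g (x + s * z) \<partial>gauss) - g x - g2 x * s\<^sup>2 / 2"
    using 1 2 by (simp add: power_mult_distrib)
  moreover have "\<bar>\<integral>z. ?e z \<partial>gauss\<bar> \<le> (\<integral>z. H * s powr q * \<bar>z\<bar> powr q \<partial>gauss)"
  proof (rule order_trans[OF integral_abs_bound integral_mono])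
    show "integrable gauss (\<lambda>z. \<bar>?e z\<bar>)" by (rule integrable_abs[OF Ie])
    show "integrable gauss (\<lambda>z. H * s powr q * \<bar>z\<bar> powr q)"
      using q by (intro integrable_mult_right gauss_integrable_abs_powr) auto
    fix z show "\<bar>?e z\<bar> \<le> H * s powr q * \<bar>z\<bar> powr q"
      using T[of x "s * z"] s by (simp add: abs_mult powr_mult mult.assoc)
  qed
  moreover have "(\<integral>z. H * s powr q * \<bar>z\<bar> powr q \<partial>gauss) \<le> H * s powr q * gauss_const"
    using gauss_integrable_abs_powr(2)[of q] q H by (simp add: mult_left_mono)
  ultimately show ?thesis by (simp add: mult_ac)
qed

text \<open>\<open>P\<close> is the distant past, \<open>U\<close> and \<open>V\<close> are the two
  preceding sub-blocks and \<open>X\<close> is the one exchanged. Five errors arise: the expansion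
  in \<open>X\<close>, the Gaussian expansion, moving \<open>g1\<close> back from
  \<open>P + U + V\<close> to \<open>P + U\<close>, and moving two second-order terms back to
  \<open>P\<close>. With m the largest increment each is at most
  \<open>H * m powr (2 + \<delta>)\<close>, except for the factor \<open>gauss_const\<close> in the
  Gaussian one; hence 4 + \<open>gauss_const\<close>.\<close>

lemma lindeberg_pointwise:
  fixes g g1 g2 :: "real \<Rightarrow> real" and P U V X s \<delta> H :: real
  assumes g: "1-lipschitz_on UNIV g" and s: "0 \<le> s" and H: "0 \<le> H" and \<delta>: "0 < \<delta>" "\<delta> \<le> 1"
    and T0: "\<And>x d. \<bar>g (x + d) - g x - g1 x * d - g2 x * d\<^sup>2 / 2\<bar> \<le> H * \<bar>d\<bar> powr (2 + \<delta>)"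
    and T1: "\<And>x d. \<bar>g1 (x + d) - g1 x - g2 x * d\<bar> \<le> H * \<bar>d\<bar> powr (1 + \<delta>)"
    and T2: "\<And>x d. \<bar>g2 (x + d) - g2 x\<bar> \<le> H * \<bar>d\<bar> powr \<delta>"
  shows "\<bar>g (P + U + V + X) - (\<integral>z. g (P + U + V + s * z) \<partial>gauss)
      - (g1 (P + U) * X + g2 P * (V * X + X\<^sup>2 / 2 - s\<^sup>2 / 2))\<bar>
    \<le> (4 + gauss_const) * H * (\<bar>U\<bar> powr (2 + \<delta>) + \<bar>V\<bar> powr (2 + \<delta>) + \<bar>X\<bar> powr (2 + \<delta>) + s powr (2 + \<delta>))"
proof -
  define m where "m = max (max \<bar>U\<bar> \<bar>V\<bar>) (max \<bar>X\<bar> s)"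
  let ?q = "2 + \<delta>" and ?x = "P + U + V"
  let ?S = "\<bar>U\<bar> powr ?q + \<bar>V\<bar> powr ?q + \<bar>X\<bar> powr ?q + s powr ?q"
  have m: "\<bar>U\<bar> \<le> m" "\<bar>V\<bar> \<le> m" "\<bar>X\<bar> \<le> m" "s \<le> m" "0 \<le> m" using s by (auto simp: m_def)
  have "m = \<bar>U\<bar> \<or> m = \<bar>V\<bar> \<or> m = \<bar>X\<bar> \<or> m = s" by (auto simp: m_def max_def)
  then have mS: "m powr ?q \<le> ?S" using s by (auto simp: add_nonneg_nonneg)
  have mq: "m powr \<delta> * m\<^sup>2 = m powr ?q" "m powr (1 + \<delta>) * m = m powr ?q"
  proof -
    show "m powr \<delta> * m\<^sup>2 = m powr ?q" using m(5)
      by (cases "m = 0") (auto simp: powr_add add.commute[of 2])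
    show "m powr (1 + \<delta>) * m = m powr ?q" using m(5)
      by (cases "m = 0") (auto simp: powr_add power2_eq_square mult_ac)
  qed
  have r0: "\<bar>g (?x + X) - g ?x - g1 ?x * X - g2 ?x * X\<^sup>2 / 2\<bar> \<le> H * m powr ?q"
    using m \<delta> by (intro order_trans[OF T0] mult_left_mono powr_mono2 H) auto
  have r': "\<bar>(\<integral>z. g (?x + s * z) \<partial>gauss) - g ?x - g2 ?x * s\<^sup>2 / 2\<bar> \<le> H * gauss_const * m powr ?q"
    using m s \<delta> H gauss_const_ge
    by (intro order_trans[OF gauss_taylor2[OF g s H _ _ T0]] mult_left_mono powr_mono2) auto
  have r1: "\<bar>(g1 ?x - g1 (P + U) - g2 (P + U) * V) * X\<bar> \<le> H * m powr ?q"
  proof -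
    have "\<bar>g1 ?x - g1 (P + U) - g2 (P + U) * V\<bar> \<le> H * m powr (1 + \<delta>)"
      using m \<delta> by (intro order_trans[OF T1] mult_left_mono powr_mono2 H) auto
    then have "\<bar>g1 ?x - g1 (P + U) - g2 (P + U) * V\<bar> * \<bar>X\<bar> \<le> H * m powr (1 + \<delta>) * m"
      using m H by (intro mult_mono) auto
    then show ?thesis unfolding abs_mult using mq(2) by (simp add: mult.assoc)
  qed
  have r2: "\<bar>(g2 (P + U) - g2 P) * (V * X)\<bar> \<le> H * m powr ?q"
  proof -
    have "\<bar>g2 (P + U) - g2 P\<bar> \<le> H * m powr \<delta>"
      using m \<delta> by (intro order_trans[OF T2] mult_left_mono powr_mono2 H) auto
    moreover have "\<bar>V * X\<bar> \<le> m\<^sup>2" unfolding abs_mult power2_eq_square using m by (intro mult_mono) auto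
    ultimately have "\<bar>g2 (P + U) - g2 P\<bar> * \<bar>V * X\<bar> \<le> H * m powr \<delta> * m\<^sup>2"
      using m H by (intro mult_mono) auto
    then show ?thesis unfolding abs_mult[of "g2 (P + U) - g2 P"] using mq(1) by (simp add: mult.assoc)
  qed
  have r3: "\<bar>(g2 ?x - g2 P) * (X\<^sup>2 / 2 - s\<^sup>2 / 2)\<bar> \<le> H * m powr ?q"
  proof -
    have UV: "\<bar>U + V\<bar> \<le> 2 * m" using m by linarith
    have "\<bar>g2 ?x - g2 P\<bar> \<le> H * \<bar>U + V\<bar> powr \<delta>" using T2[of P "U + V"] by (simp add: add.assoc)
    also have "\<dots> \<le> H * (2 * m) powr \<delta>"
      using UV \<delta> by (intro mult_left_mono powr_mono2 H) auto
    also have "\<dots> = H * (2 powr \<delta> * m powr \<delta>)" using m by (simp add: powr_mult)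
    also have "\<dots> \<le> H * (2 powr 1 * m powr \<delta>)"
      using \<delta> H by (intro mult_left_mono mult_right_mono powr_mono) auto
    finally have a: "\<bar>g2 ?x - g2 P\<bar> \<le> 2 * (H * m powr \<delta>)" by simp
    have "X\<^sup>2 \<le> m\<^sup>2" "s\<^sup>2 \<le> m\<^sup>2" using m s by (auto intro: abs_le_square_iff[THEN iffD1])
    then have b: "\<bar>X\<^sup>2 / 2 - s\<^sup>2 / 2\<bar> \<le> m\<^sup>2 / 2"
      using zero_le_power2[of X] zero_le_power2[of s] by (simp only: abs_le_iff) linarith
    have "\<bar>g2 ?x - g2 P\<bar> * \<bar>X\<^sup>2 / 2 - s\<^sup>2 / 2\<bar> \<le> 2 * (H * m powr \<delta>) * (m\<^sup>2 / 2)"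
      using a b H m by (intro mult_mono) auto
    also have "\<dots> = H * (m powr \<delta> * m\<^sup>2)" by simp
    finally show ?thesis unfolding abs_mult[of "g2 ?x - g2 P"] mq .
  qed
  have dec: "g (?x + X) - (\<integral>z. g (?x + s * z) \<partial>gauss) - (g1 (P + U) * X + g2 P * (V * X + X\<^sup>2 / 2 - s\<^sup>2 / 2))
     = (g (?x + X) - g ?x - g1 ?x * X - g2 ?x * X\<^sup>2 / 2)
      - ((\<integral>z. g (?x + s * z) \<partial>gauss) - g ?x - g2 ?x * s\<^sup>2 / 2)
      + (g1 ?x - g1 (P + U) - g2 (P + U) * V) * X + (g2 (P + U) - g2 P) * (V * X)
      + (g2 ?x - g2 P) * (X\<^sup>2 / 2 - s\<^sup>2 / 2)"
    by (simp add: field_simps)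
  have "\<bar>g (?x + X) - (\<integral>z. g (?x + s * z) \<partial>gauss) - (g1 (P + U) * X + g2 P * (V * X + X\<^sup>2 / 2 - s\<^sup>2 / 2))\<bar>
     \<le> H * m powr ?q + H * gauss_const * m powr ?q + H * m powr ?q + H * m powr ?q + H * m powr ?q"
    unfolding dec using r0 r' r1 r2 r3 by linarith
  also have "\<dots> = (4 + gauss_const) * H * m powr ?q" by (simp add: algebra_simps)
  also have "\<dots> \<le> (4 + gauss_const) * H * ?S"
    using mS H gauss_const_ge by (intro mult_left_mono) auto
  finally show ?thesis .
qed

text \<open>By the largest summand. Convexity would save one power of the cardinality, but
  sub-blocks of slowly growing length can afford it.\<close>

lemma powr_abs_sum_le:
  fixes x :: "'b \<Rightarrow> real"
  assumes "finite I" "0 \<le> q"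
  shows "\<bar>\<Sum>i\<in>I. x i\<bar> powr q \<le> real (card I) powr q * (\<Sum>i\<in>I. \<bar>x i\<bar> powr q)"
proof (cases "I = {}")
  case False
  define m where "m = Max ((\<lambda>i. \<bar>x i\<bar>) ` I)"
  have m: "\<bar>x i\<bar> \<le> m" if "i \<in> I" for i using assms that by (simp add: m_def)
  have "m \<in> (\<lambda>i. \<bar>x i\<bar>) ` I" unfolding m_def using assms False by (intro Max_in) auto
  then obtain j where j: "j \<in> I" "m = \<bar>x j\<bar>" by auto
  have "\<bar>\<Sum>i\<in>I. x i\<bar> \<le> (\<Sum>i\<in>I. \<bar>x i\<bar>)" by (rule sum_abs)
  also have "\<dots> \<le> real (card I) * m" using m by (rule sum_bounded_above)
  finally have "\<bar>\<Sum>i\<in>I. x i\<bar> powr q \<le> (real (card I) * m) powr q"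
    using assms by (intro powr_mono2) auto
  also have "\<dots> = real (card I) powr q * \<bar>x j\<bar> powr q" using j by (simp add: powr_mult)
  also have "\<dots> \<le> real (card I) powr q * (\<Sum>i\<in>I. \<bar>x i\<bar> powr q)"
    using assms j by (intro mult_left_mono member_le_sum) auto
  finally show ?thesis .
qed simp

text \<open>The distances to position i are 1, ..., i on its left and 1, ..., k on its right. The
  case distinction stands for |i - j| in natural numbers.\<close>

lemma sum_window:
  fixes g :: "nat \<Rightarrow> real"
  shows "(\<Sum>j<i + 1 + k. g (if i \<le> j then j - i else i - j)) = g 0 + (\<Sum>d<i. g (Suc d)) + (\<Sum>d<k. g (Suc d))"
proof (induction k)
  case 0
  have "(\<Sum>j<i. g (if i \<le> j then j - i else i - j)) = (\<Sum>j<i. g (Suc (i - Suc j)))"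
    by (intro sum.cong) (auto simp: Suc_diff_Suc)
  also have "\<dots> = (\<Sum>d<i. g (Suc d))" by (rule sum.nat_diff_reindex)
  finally show ?case by simp
qed simp

text \<open>Of stationarity only common covariances at equal lags, zero means and a uniform moment
  bound are kept. The mixing assumption includes m = 0, the trivial past, so that a sum starting at
  the first variable is no special case. The last assumption on \<theta> says that covariances decay
  faster than the inverse square of the lag.\<close>

locale mixing_process = prob_space M for M :: "'a measure" +
  fixes Y :: "nat \<Rightarrow> 'a \<Rightarrow> real" and \<delta> \<theta> C B :: real and \<gamma> :: "nat \<Rightarrow> real"
  assumes Y_meas: "1 \<le> i \<Longrightarrow> Y i \<in> borel_measurable M"
    and Y_mom: "1 \<le> i \<Longrightarrow> integrable M (\<lambda>w. \<bar>Y i w\<bar> powr (2 + \<delta>))"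
    and Y_mom_le: "1 \<le> i \<Longrightarrow> expectation (\<lambda>w. \<bar>Y i w\<bar> powr (2 + \<delta>)) \<le> B"
    and Y_mean: "1 \<le> i \<Longrightarrow> expectation (Y i) = 0"
    and Y_cov: "1 \<le> i \<Longrightarrow> expectation (\<lambda>w. Y i w * Y (i + d) w) = \<gamma> d"
    and mixing: "1 \<le> k \<Longrightarrow> A \<in> sigma_gen M Y {1..m} \<Longrightarrow> D \<in> sigma_gen M Y {k + m..} \<Longrightarrow>
       \<bar>prob (A \<inter> D) - prob A * prob D\<bar> \<le> C * real k powr (- \<theta>)"
    and \<delta>: "0 < \<delta>" "\<delta> \<le> 1" and \<theta>: "2 < \<theta> * \<delta> / (2 + \<delta>)"
begin

text \<open>Truncating at a power of the gap turns the mixing exponent \<open>\<theta>\<close> into the decay rates \<open>\<tau>\<close> for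
  covariances and \<open>\<tau>'\<close> for covariances with a bounded function.\<close>

definition \<tau> :: real where "\<tau> = \<theta> * \<delta> / (2 + \<delta>)"
definition \<tau>' :: real where "\<tau>' = \<theta> * (1 + \<delta>) / (2 + \<delta>)"

definition F :: "nat set \<Rightarrow> 'a measure" where
  "F I = sigma (space M) (\<Union>i\<in>I. {Y i -` S \<inter> space M | S. S \<in> sets borel})"

lemma space_F [simp]: "space (F I) = space M"
  unfolding F_def by (rule space_measure_of) auto

lemma sets_F: "sets (F I) = sigma_gen M Y I"
  unfolding F_def sigma_gen_def by (rule sets_measure_of) auto

lemma F_mono: "I \<subseteq> J \<Longrightarrow> sets (F I) \<subseteq> sets (F J)"
  unfolding sets_F sigma_gen_def by (intro sigma_sets_mono') auto

lemma measurable_F_mono: "I \<subseteq> J \<Longrightarrow> X \<in> measurable (F I) N \<Longrightarrow> X \<in> measurable (F J) N"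
  using F_mono[of I J] by (auto simp: measurable_def)

lemma Y_measurable_F: "i \<in> I \<Longrightarrow> Y i \<in> borel_measurable (F I)"
proof (rule measurableI)
  fix S :: "real set" assume "i \<in> I" "S \<in> sets borel"
  then show "Y i -` S \<inter> space (F I) \<in> sets (F I)"
    unfolding sets_F sigma_gen_def by (auto intro!: sigma_sets.Basic)
qed simp

lemma subalgebra_F: "I \<subseteq> {1..} \<Longrightarrow> subalgebra M (F I)"
  unfolding subalgebra_def sets_F sigma_gen_def
  using Y_meas by (auto intro!: sets.sigma_sets_subset intro: measurable_sets)

lemma measurable_F: "I \<subseteq> {1..} \<Longrightarrow> X \<in> borel_measurable (F I) \<Longrightarrow> X \<in> borel_measurable M"
  using measurable_from_subalg[OF subalgebra_F] by auto

lemma mixing_pair: "1 \<le> k \<Longrightarrow> mixing_pair M (F {1..m}) (F {k + m..}) (C * real k powr (- \<theta>))"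
  by unfold_locales (auto intro!: subalgebra_F mixing simp: sets_F)

lemma C_nonneg: "0 \<le> C"
  using mixing_pair.a_nonneg[OF mixing_pair[of 1 1]] by simp

lemma B_nonneg: "0 \<le> B"
proof -
  have "0 \<le> expectation (\<lambda>w. \<bar>Y 1 w\<bar> powr (2 + \<delta>))" by (rule integral_nonneg_AE) auto
  then show ?thesis using Y_mom_le[OF order_refl] by linarith
qed

lemma \<theta>_pos: "\<theta> > 0"
  using \<theta> \<delta> by (smt (verit) divide_nonpos_pos mult_nonpos_nonneg)

lemma abs_le_powr: "\<bar>x\<bar> \<le> 1 + \<bar>x\<bar> powr (2 + \<delta>)" and square_le_powr: "x\<^sup>2 \<le> 1 + \<bar>x\<bar> powr (2 + \<delta>)" for x :: real
proof -
  have "\<bar>x\<bar> \<le> 1 + \<bar>x\<bar> powr (2 + \<delta>) \<and> x\<^sup>2 \<le> 1 + \<bar>x\<bar> powr (2 + \<delta>)"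
  proof (cases "\<bar>x\<bar> \<le> 1")
    case True
    then have "\<bar>x\<bar> \<le> 1" "x\<^sup>2 \<le> 1" by (auto simp: abs_square_le_1)
    then show ?thesis by (auto simp: add_increasing2)
  next
    case False
    have "\<bar>x\<bar> powr 1 \<le> \<bar>x\<bar> powr (2 + \<delta>)" by (rule powr_mono) (use \<delta> False in auto)
    moreover have "\<bar>x\<bar> powr 2 \<le> \<bar>x\<bar> powr (2 + \<delta>)" by (rule powr_mono) (use \<delta> False in auto)
    moreover have "\<bar>x\<bar> powr 1 = \<bar>x\<bar>" "\<bar>x\<bar> powr 2 = x\<^sup>2" using False by auto
    ultimately show ?thesis by simp
  qed
  then show "\<bar>x\<bar> \<le> 1 + \<bar>x\<bar> powr (2 + \<delta>)" "x\<^sup>2 \<le> 1 + \<bar>x\<bar> powr (2 + \<delta>)" by auto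
qed

lemma integrable_of_powr:
  assumes "X \<in> borel_measurable M" "integrable M (\<lambda>w. \<bar>X w\<bar> powr (2 + \<delta>))"
  shows "integrable M X" "integrable M (\<lambda>w. (X w)\<^sup>2)"
proof -
  have I: "integrable M (\<lambda>w. 1 + \<bar>X w\<bar> powr (2 + \<delta>))" using assms by auto
  show "integrable M X" "integrable M (\<lambda>w. (X w)\<^sup>2)"
    using assms abs_le_powr square_le_powr by (auto intro!: Bochner_Integration.integrable_bound[OF I])
qed

lemma integrable_mult_of_square:
  fixes X X' :: "'a \<Rightarrow> real"
  assumes [measurable]: "X \<in> borel_measurable M" "X' \<in> borel_measurable M"
    and I: "integrable M (\<lambda>w. (X w)\<^sup>2)" "integrable M (\<lambda>w. (X' w)\<^sup>2)"
  shows "integrable M (\<lambda>w. X w * X' w)"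
proof (rule Bochner_Integration.integrable_bound)
  show "integrable M (\<lambda>w. (X w)\<^sup>2 + (X' w)\<^sup>2)" using I by auto
  show "AE w in M. norm (X w * X' w) \<le> norm ((X w)\<^sup>2 + (X' w)\<^sup>2)"
  proof (intro AE_I2)
    fix w
    have "2 * (\<bar>X w\<bar> * \<bar>X' w\<bar>) \<le> (X w)\<^sup>2 + (X' w)\<^sup>2"
      using sum_squares_bound[of "\<bar>X w\<bar>" "\<bar>X' w\<bar>"] by (simp add: mult.assoc)
    moreover have "0 \<le> \<bar>X w\<bar> * \<bar>X' w\<bar>" by simp
    ultimately show "norm (X w * X' w) \<le> norm ((X w)\<^sup>2 + (X' w)\<^sup>2)"
      unfolding real_norm_def abs_mult by linarith
  qed
qed simp

lemma Y_int: "1 \<le> i \<Longrightarrow> integrable M (Y i)" and Y_sq: "1 \<le> i \<Longrightarrow> integrable M (\<lambda>w. (Y i w)\<^sup>2)"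
  using integrable_of_powr[OF Y_meas Y_mom] by auto

lemma Y_prod: "1 \<le> i \<Longrightarrow> 1 \<le> j \<Longrightarrow> integrable M (\<lambda>w. Y i w * Y j w)"
  by (intro integrable_mult_of_square Y_meas Y_sq)

definition cov_const :: real where "cov_const = 4 * C + 3 * B"

lemma cov_const_nonneg: "0 \<le> cov_const"
  using C_nonneg B_nonneg by (simp add: cov_const_def)

text \<open>The truncation level \<open>d powr (\<theta> / (2 + \<delta>))\<close> balances both
  terms of \<open>cov_truncate2\<close>: T^2 times the mixing rate and
  \<open>T powr (- \<delta>)\<close> are then both \<open>d powr (- \<tau>)\<close>.\<close>

lemma \<gamma>_bound:
  assumes d: "1 \<le> d" shows "\<bar>\<gamma> d\<bar> \<le> cov_const * real d powr (- \<tau>)"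
proof -
  interpret mp: mixing_pair M "F {1..1}" "F {d + 1..}" "C * real d powr (- \<theta>)"
    by (rule mixing_pair[OF d])
  let ?T = "real d powr (\<theta> / (2 + \<delta>))"
  have e: "\<theta> / (2 + \<delta>) * 2 + - \<theta> = - \<tau>" "\<theta> / (2 + \<delta>) * (2 - (2 + \<delta>)) = - \<tau>"
    using \<delta> by (auto simp: \<tau>_def field_simps)
  have "?T\<^sup>2 = ?T powr 2" using d by simp
  then have "?T\<^sup>2 = real d powr (\<theta> / (2 + \<delta>) * 2)" by (simp only: powr_powr)
  then have T1: "?T\<^sup>2 * real d powr (- \<theta>) = real d powr (- \<tau>)"
    by (simp only: powr_add[symmetric] e)
  have T2: "?T powr (2 - (2 + \<delta>)) = real d powr (- \<tau>)" by (simp only: powr_powr e)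
  have "\<bar>expectation (\<lambda>w. Y 1 w * Y (1 + d) w)\<bar>
      \<le> 4 * ?T\<^sup>2 * (C * real d powr (- \<theta>)) + 3 * B * ?T powr (2 - (2 + \<delta>))"
    using d \<delta> by (intro mp.cov_truncate2 Y_measurable_F Y_mom Y_mom_le Y_int Y_mean Y_prod) auto
  also have "\<dots> = 4 * C * (?T\<^sup>2 * real d powr (- \<theta>)) + 3 * B * ?T powr (2 - (2 + \<delta>))" by simp
  also have "\<dots> = cov_const * real d powr (- \<tau>)"
    unfolding T1 T2 by (simp add: cov_const_def algebra_simps)
  finally show ?thesis using Y_cov[of 1 d] by simp
qed

section \<open>The long run variance and the tail of its series\<close>

definition \<Gamma> :: "nat \<Rightarrow> real" where "\<Gamma> n = (\<Sum>d<n. \<gamma> (Suc d))"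

definition v :: real where "v = \<gamma> 0 + 2 * (\<Sum>d. \<gamma> (Suc d))"

definition tail_const :: real where "tail_const = cov_const * (\<Sum>d. 1 / (real (Suc d))\<^sup>2)"

lemma summable_inverse_squares_Suc: "summable (\<lambda>d. 1 / (real (Suc d))\<^sup>2)"
  using inverse_squares_sums by (simp add: sums_iff)

lemma \<tau>_gt: "2 < \<tau>"
  using \<theta> by (simp add: \<tau>_def)

text \<open>Two powers of the lag are spent on summability and the remaining \<tau> - 2, which are
  positive, on decay from lag p onwards.\<close>

lemma \<gamma>_bound_tail:
  assumes "1 \<le> p" "p \<le> Suc d"
  shows "\<bar>\<gamma> (Suc d)\<bar> \<le> cov_const * real p powr (2 - \<tau>) * (1 / (real (Suc d))\<^sup>2)"
proof -
  have "real (Suc d) powr (- \<tau>) = real (Suc d) powr (2 - \<tau>) * real (Suc d) powr (- 2)"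
    by (subst powr_add[symmetric]) simp
  also have "\<dots> \<le> real p powr (2 - \<tau>) * real (Suc d) powr (- 2)"
    using assms \<tau>_gt by (intro mult_right_mono powr_mono2') auto
  also have "real (Suc d) powr (- 2) = 1 / (real (Suc d))\<^sup>2"
    by (simp add: powr_minus_divide)
  finally have "cov_const * real (Suc d) powr (- \<tau>) \<le> cov_const * (real p powr (2 - \<tau>) * (1 / (real (Suc d))\<^sup>2))"
    using cov_const_nonneg by (intro mult_left_mono)
  then show ?thesis using \<gamma>_bound[of "Suc d"] by simp
qed

lemma summable_\<gamma>: "summable (\<lambda>d. \<bar>\<gamma> (Suc d)\<bar>)"
proof (rule summable_comparison_test')
  show "summable (\<lambda>d. cov_const * real 1 powr (2 - \<tau>) * (1 / (real (Suc d))\<^sup>2))"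
    by (intro summable_mult summable_inverse_squares_Suc)
  show "norm \<bar>\<gamma> (Suc d)\<bar> \<le> cov_const * real 1 powr (2 - \<tau>) * (1 / (real (Suc d))\<^sup>2)" for d
    using \<gamma>_bound_tail[of 1 d] by simp
qed

lemma \<Gamma>_tail:
  assumes p: "1 \<le> p" "p \<le> n"
  shows "\<bar>\<Gamma> n - (\<Sum>d. \<gamma> (Suc d))\<bar> \<le> tail_const * real p powr (2 - \<tau>)"
proof -
  let ?u = "\<lambda>d. 1 / (real (Suc d))\<^sup>2"
  have sg: "summable (\<lambda>d. \<gamma> (Suc d))" by (rule summable_rabs_cancel[OF summable_\<gamma>])
  have "(\<Sum>d. \<gamma> (Suc d)) = (\<Sum>d. \<gamma> (Suc (d + n))) + \<Gamma> n"
    unfolding \<Gamma>_def by (rule suminf_split_initial_segment[OF sg])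
  then have "\<bar>\<Gamma> n - (\<Sum>d. \<gamma> (Suc d))\<bar> = \<bar>\<Sum>d. \<gamma> (Suc (d + n))\<bar>" by simp
  also have "\<dots> \<le> (\<Sum>d. \<bar>\<gamma> (Suc (d + n))\<bar>)"
    using summable_\<gamma> by (intro summable_rabs) (subst summable_iff_shift[where f = "\<lambda>d. \<bar>\<gamma> (Suc d)\<bar>"])
  also have "\<dots> \<le> (\<Sum>d. cov_const * real p powr (2 - \<tau>) * ?u d)"
  proof (rule suminf_le)
    fix d
    have "\<bar>\<gamma> (Suc (d + n))\<bar> \<le> cov_const * real p powr (2 - \<tau>) * ?u (d + n)"
      using p by (intro \<gamma>_bound_tail) auto
    also have "\<dots> \<le> cov_const * real p powr (2 - \<tau>) * ?u d"
      using cov_const_nonneg by (intro mult_left_mono divide_left_mono power_mono) auto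
    finally show "\<bar>\<gamma> (Suc (d + n))\<bar> \<le> cov_const * real p powr (2 - \<tau>) * ?u d" .
  next
    show "summable (\<lambda>d. \<bar>\<gamma> (Suc (d + n))\<bar>)"
      using summable_\<gamma> by (subst summable_iff_shift[where f = "\<lambda>d. \<bar>\<gamma> (Suc d)\<bar>"])
    show "summable (\<lambda>d. cov_const * real p powr (2 - \<tau>) * ?u d)"
      by (intro summable_mult summable_inverse_squares_Suc)
  qed
  also have "\<dots> = cov_const * real p powr (2 - \<tau>) * (\<Sum>d. ?u d)"
    by (rule suminf_mult[OF summable_inverse_squares_Suc])
  finally show ?thesis by (simp add: tail_const_def mult_ac)
qed

lemma tail_const_nonneg: "0 \<le> tail_const"
  unfolding tail_const_def using cov_const_nonneg
  by (intro mult_nonneg_nonneg suminf_nonneg summable_inverse_squares_Suc) auto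

section \<open>Moments and covariances of partial sums\<close>

definition psum :: "nat \<Rightarrow> nat \<Rightarrow> 'a \<Rightarrow> real" where
  "psum a n w = (\<Sum>i<n. Y (a + 1 + i) w)"

lemma psum_measurable_F: "{a<..a + n} \<subseteq> I \<Longrightarrow> psum a n \<in> borel_measurable (F I)"
  unfolding psum_def[abs_def] by (intro borel_measurable_sum Y_measurable_F) auto

lemma psum_measurable [measurable]: "psum a n \<in> borel_measurable M"
  unfolding psum_def[abs_def] by (intro borel_measurable_sum Y_meas) auto

lemma psum_add: "psum a (m + n) w = psum a m w + psum (a + m) n w"
  unfolding psum_def by (induction n) (auto simp: add_ac)

lemma psum_powr_sum_le: "\<bar>psum a n w\<bar> powr (2 + \<delta>) \<le> real n powr (2 + \<delta>) * (\<Sum>i<n. \<bar>Y (a + 1 + i) w\<bar> powr (2 + \<delta>))"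
  unfolding psum_def using powr_abs_sum_le[of "{..<n}" "2 + \<delta>"] \<delta> by simp

lemma psum_powr_int: "integrable M (\<lambda>w. \<bar>psum a n w\<bar> powr (2 + \<delta>))"
  by (rule Bochner_Integration.integrable_bound[where
        f = "\<lambda>w. real n powr (2 + \<delta>) * (\<Sum>i<n. \<bar>Y (a + 1 + i) w\<bar> powr (2 + \<delta>))"])
     (auto intro!: Y_mom Bochner_Integration.integrable_sum AE_I2
        intro: order_trans[OF psum_powr_sum_le abs_ge_self] order_trans[OF psum_powr_sum_le])

lemma psum_powr_le: "expectation (\<lambda>w. \<bar>psum a n w\<bar> powr (2 + \<delta>)) \<le> real n powr (3 + \<delta>) * B"
proof -
  have "expectation (\<lambda>w. \<bar>psum a n w\<bar> powr (2 + \<delta>))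
     \<le> expectation (\<lambda>w. real n powr (2 + \<delta>) * (\<Sum>i<n. \<bar>Y (a + 1 + i) w\<bar> powr (2 + \<delta>)))"
    by (intro integral_mono psum_powr_int psum_powr_sum_le integrable_mult_right
          Bochner_Integration.integrable_sum Y_mom) auto
  also have "\<dots> = real n powr (2 + \<delta>) * (\<Sum>i<n. expectation (\<lambda>w. \<bar>Y (a + 1 + i) w\<bar> powr (2 + \<delta>)))"
    by (simp add: Bochner_Integration.integral_sum Y_mom del: add_Suc_shift)
  also have "\<dots> \<le> real n powr (2 + \<delta>) * (\<Sum>i<n. B)"
    by (intro mult_left_mono sum_mono Y_mom_le) auto
  also have "\<dots> = real n powr (2 + \<delta>) * real n powr 1 * B" by simp
  also have "\<dots> = real n powr (3 + \<delta>) * B"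
    by (subst powr_add[symmetric]) (simp add: add.commute)
  finally show ?thesis .
qed

lemma psum_int [simp]: "integrable M (psum a n)" and psum_sq: "integrable M (\<lambda>w. (psum a n w)\<^sup>2)"
  using integrable_of_powr[OF _ psum_powr_int] by auto

lemma psum_prod: "integrable M (\<lambda>w. psum a n w * psum a' n' w)"
  by (intro integrable_mult_of_square psum_sq) auto

lemma Y_abs_le: "1 \<le> i \<Longrightarrow> expectation (\<lambda>w. \<bar>Y i w\<bar>) \<le> 1 + B"
proof -
  assume i: "1 \<le> i"
  have "expectation (\<lambda>w. \<bar>Y i w\<bar>) \<le> expectation (\<lambda>w. 1 + \<bar>Y i w\<bar> powr (2 + \<delta>))"
    using i by (intro integral_mono integrable_abs Y_int Bochner_Integration.integrable_add Y_mom abs_le_powr) auto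
  also have "\<dots> \<le> 1 + B" using Y_mom[OF i] Y_mom_le[OF i] by (simp add: prob_space)
  finally show ?thesis .
qed

lemma psum_abs_le: "expectation (\<lambda>w. \<bar>psum a n w\<bar>) \<le> real n * (1 + B)"
proof -
  have "expectation (\<lambda>w. \<bar>psum a n w\<bar>) \<le> expectation (\<lambda>w. \<Sum>i<n. \<bar>Y (a + 1 + i) w\<bar>)"
    unfolding psum_def
    by (intro integral_mono integrable_abs Bochner_Integration.integrable_sum Y_int sum_abs) auto
  also have "\<dots> = (\<Sum>i<n. expectation (\<lambda>w. \<bar>Y (a + 1 + i) w\<bar>))"
    by (intro Bochner_Integration.integral_sum integrable_abs Y_int) auto
  also have "\<dots> \<le> (\<Sum>i<n. 1 + B)" by (intro sum_mono Y_abs_le) auto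
  finally show ?thesis by simp
qed

lemma \<Gamma>_window: "(\<Sum>j<i + 1 + k. \<gamma> (if i \<le> j then j - i else i - j)) = \<gamma> 0 + \<Gamma> i + \<Gamma> k"
  unfolding \<Gamma>_def by (rule sum_window)

lemma \<Gamma>_shift: "(\<Sum>j<n. \<gamma> (Suc m + j)) = \<Gamma> (m + n) - \<Gamma> m"
  by (induction n) (auto simp: \<Gamma>_def)

lemma Y_cov': "1 \<le> i \<Longrightarrow> 1 \<le> j \<Longrightarrow> expectation (\<lambda>w. Y i w * Y j w) = \<gamma> (if i \<le> j then j - i else i - j)"
  using Y_cov[of i "j - i"] Y_cov[of j "i - j"] by (auto simp: mult.commute)

lemma psum_prod_expectation:
  "expectation (\<lambda>w. psum a n w * psum a' n' w) = (\<Sum>i<n. \<Sum>j<n'. expectation (\<lambda>w. Y (a + 1 + i) w * Y (a' + 1 + j) w))"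
  unfolding psum_def sum_product
  by (simp add: Bochner_Integration.integral_sum Bochner_Integration.integrable_sum Y_prod del: add_Suc_shift)

text \<open>Counting, for each index in the last block, the covariances with all indices at distance at
  most \<open>p\<close> gives the full long run variance up to a tail.\<close>

lemma block_variance:
  assumes p: "1 \<le> p"
  shows "\<bar>expectation (\<lambda>w. (psum (a + p) p w)\<^sup>2) + 2 * expectation (\<lambda>w. psum a p w * psum (a + p) p w) - real p * v\<bar>
    \<le> 2 * real p * (tail_const * real p powr (2 - \<tau>))"
proof -
  have 1: "expectation (\<lambda>w. (psum (a + p) p w)\<^sup>2) = (\<Sum>i<p. \<gamma> 0 + \<Gamma> i + \<Gamma> (p - 1 - i))"
  proof -
    have "expectation (\<lambda>w. (psum (a + p) p w)\<^sup>2) = (\<Sum>i<p. \<Sum>j<p. \<gamma> (if i \<le> j then j - i else i - j))"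
      unfolding power2_eq_square psum_prod_expectation
      by (intro sum.cong refl) (subst Y_cov', auto)
    also have "\<dots> = (\<Sum>i<p. \<gamma> 0 + \<Gamma> i + \<Gamma> (p - 1 - i))"
    proof (intro sum.cong refl)
      fix i assume "i \<in> {..<p}"
      then have "i + 1 + (p - 1 - i) = p" by auto
      then show "(\<Sum>j<p. \<gamma> (if i \<le> j then j - i else i - j)) = \<gamma> 0 + \<Gamma> i + \<Gamma> (p - 1 - i)"
        using \<Gamma>_window[of i "p - 1 - i"] by simp
    qed
    finally show ?thesis .
  qed
  have 2: "expectation (\<lambda>w. psum a p w * psum (a + p) p w) = (\<Sum>i<p. \<Sum>j<p. \<gamma> (p + j - i))"
    unfolding psum_prod_expectation by (intro sum.cong refl) (subst Y_cov', auto)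
  \<comment> \<open>The cross covariance is summed in both orders: by rows it cancels the terms
    \<open>\<Gamma> (p - 1 - i)\<close> of the variance, by columns the terms
    \<open>\<Gamma> i\<close>. What stays are values of \<Gamma> at arguments of at least p, which
    are close to the full series.\<close>
  have 3: "(\<Sum>i<p. \<Sum>j<p. \<gamma> (p + j - i)) = (\<Sum>i<p. \<Gamma> (2 * p - 1 - i) - \<Gamma> (p - 1 - i))"
  proof (intro sum.cong refl)
    fix i assume i: "i \<in> {..<p}"
    then have "(\<Sum>j<p. \<gamma> (p + j - i)) = (\<Sum>j<p. \<gamma> (Suc (p - 1 - i) + j))"
      by (intro sum.cong arg_cong[where f = \<gamma>]) auto
    also have "\<dots> = \<Gamma> (p - 1 - i + p) - \<Gamma> (p - 1 - i)" by (rule \<Gamma>_shift)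
    also have "p - 1 - i + p = 2 * p - 1 - i" using i by auto
    finally show "(\<Sum>j<p. \<gamma> (p + j - i)) = \<Gamma> (2 * p - 1 - i) - \<Gamma> (p - 1 - i)" .
  qed
  have 4: "(\<Sum>i<p. \<Sum>j<p. \<gamma> (p + j - i)) = (\<Sum>j<p. \<Gamma> (p + j) - \<Gamma> j)"
  proof (subst sum.swap, intro sum.cong refl)
    fix j assume "j \<in> {..<p}"
    have "(\<Sum>i<p. \<gamma> (p + j - i)) = (\<Sum>i<p. \<gamma> (Suc j + (p - Suc i)))"
      by (intro sum.cong arg_cong[where f = \<gamma>]) auto
    also have "\<dots> = (\<Sum>i<p. \<gamma> (Suc j + i))" by (rule sum.nat_diff_reindex)
    also have "\<dots> = \<Gamma> (p + j) - \<Gamma> j" by (subst \<Gamma>_shift) (simp add: add.commute)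
    finally show "(\<Sum>i<p. \<gamma> (p + j - i)) = \<Gamma> (p + j) - \<Gamma> j" .
  qed
  have "expectation (\<lambda>w. (psum (a + p) p w)\<^sup>2) + 2 * expectation (\<lambda>w. psum a p w * psum (a + p) p w)
     = (\<Sum>i<p. \<gamma> 0 + \<Gamma> i + \<Gamma> (p - 1 - i)) + (\<Sum>i<p. \<Gamma> (2 * p - 1 - i) - \<Gamma> (p - 1 - i)) + (\<Sum>j<p. \<Gamma> (p + j) - \<Gamma> j)"
    using 1 2 3 4 by simp
  also have "\<dots> = (\<Sum>i<p. \<gamma> 0 + \<Gamma> (2 * p - 1 - i) + \<Gamma> (p + i))"
    by (simp add: sum.distrib[symmetric] add.assoc)
  finally have "expectation (\<lambda>w. (psum (a + p) p w)\<^sup>2) + 2 * expectation (\<lambda>w. psum a p w * psum (a + p) p w) - real p * v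
      = (\<Sum>i<p. \<gamma> 0 + \<Gamma> (2 * p - 1 - i) + \<Gamma> (p + i) - v)"
    by (simp add: sum_subtractf)
  moreover have "\<bar>\<Sum>i<p. \<gamma> 0 + \<Gamma> (2 * p - 1 - i) + \<Gamma> (p + i) - v\<bar> \<le> (\<Sum>i<p. 2 * (tail_const * real p powr (2 - \<tau>)))"
  proof (intro order_trans[OF sum_abs] sum_mono)
    fix i assume "i \<in> {..<p}"
    then have "p \<le> 2 * p - 1 - i" "p \<le> p + i" by auto
    then show "\<bar>\<gamma> 0 + \<Gamma> (2 * p - 1 - i) + \<Gamma> (p + i) - v\<bar> \<le> 2 * (tail_const * real p powr (2 - \<tau>))"
      using \<Gamma>_tail[of p "2 * p - 1 - i"] \<Gamma>_tail[of p "p + i"] p unfolding v_def by linarith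
  qed
  ultimately show ?thesis by simp
qed

text \<open>Truncation at \<open>p powr (\<theta> / (2 + \<delta>))\<close> makes both terms of
  \<open>cov_truncate\<close> equal to \<open>p powr (- \<tau>')\<close> up to constants; the
  exponent beats \<tau> because only one factor is unbounded.\<close>

lemma cov_past_Y:
  assumes f: "f \<in> borel_measurable (F {1..m})" and K: "\<And>w. w \<in> space M \<Longrightarrow> \<bar>f w\<bar> \<le> K"
    and p: "1 \<le> p" "m + p \<le> i"
  shows "\<bar>expectation (\<lambda>w. f w * Y i w)\<bar> \<le> K * (4 * C + 2 * B) * real p powr (- \<tau>')"
proof -
  obtain w0 where "w0 \<in> space M" using not_empty by blast
  then have K0: "0 \<le> K" using K[of w0] by linarith
  interpret mp: mixing_pair M "F {1..m}" "F {p + m..}" "C * real p powr (- \<theta>)"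
    by (rule mixing_pair[OF p(1)])
  let ?T = "real p powr (\<theta> / (2 + \<delta>))"
  have e: "\<theta> / (2 + \<delta>) + - \<theta> = - \<tau>'" "\<theta> / (2 + \<delta>) * (1 - (2 + \<delta>)) = - \<tau>'"
    using \<delta> by (auto simp: \<tau>'_def field_simps)
  have T1: "?T * real p powr (- \<theta>) = real p powr (- \<tau>')" by (simp only: powr_add[symmetric] e)
  have T2: "?T powr (1 - (2 + \<delta>)) = real p powr (- \<tau>')" by (simp only: powr_powr e)
  have i: "1 \<le> i" using p by simp
  have "\<bar>expectation (\<lambda>w. f w * Y i w) - expectation f * expectation (Y i)\<bar>
     \<le> 4 * K * ?T * (C * real p powr (- \<theta>)) + 2 * K * ?T powr (1 - (2 + \<delta>)) * expectation (\<lambda>w. \<bar>Y i w\<bar> powr (2 + \<delta>))"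
    using p \<delta> i by (intro mp.cov_truncate f K Y_measurable_F Y_mom) auto
  also have "\<dots> \<le> 4 * K * ?T * (C * real p powr (- \<theta>)) + 2 * K * ?T powr (1 - (2 + \<delta>)) * B"
    using K0 i by (intro add_left_mono mult_left_mono Y_mom_le) auto
  also have "\<dots> = 4 * K * C * (?T * real p powr (- \<theta>)) + 2 * K * ?T powr (1 - (2 + \<delta>)) * B" by simp
  also have "\<dots> = K * (4 * C + 2 * B) * real p powr (- \<tau>')" unfolding T1 T2 by (simp add: algebra_simps)
  finally show ?thesis using Y_mean[OF i] by simp
qed

text \<open>A product has moments of order (2 + \<delta>) / 2 only. The truncation level is
  therefore the square of the one in \<open>cov_past_Y\<close>, and both error terms have the order
  \<open>p powr (- \<tau>)\<close>.\<close>

lemma cov_past_prod: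
  assumes f: "f \<in> borel_measurable (F {1..m})" and K: "\<And>w. w \<in> space M \<Longrightarrow> \<bar>f w\<bar> \<le> K"
    and p: "1 \<le> p" "m + p \<le> i" "m + p \<le> j"
  shows "\<bar>expectation (\<lambda>w. f w * (Y i w * Y j w)) - expectation f * expectation (\<lambda>w. Y i w * Y j w)\<bar>
    \<le> K * (4 * C + 4 * B) * real p powr (- \<tau>)"
proof -
  obtain w0 where "w0 \<in> space M" using not_empty by blast
  then have K0: "0 \<le> K" using K[of w0] by linarith
  interpret mp: mixing_pair M "F {1..m}" "F {p + m..}" "C * real p powr (- \<theta>)"
    by (rule mixing_pair[OF p(1)])
  let ?T = "real p powr (2 * \<theta> / (2 + \<delta>))" and ?q = "(2 + \<delta>) / 2"
  have e: "2 * \<theta> / (2 + \<delta>) + - \<theta> = - \<tau>" "2 * \<theta> / (2 + \<delta>) * (1 - ?q) = - \<tau>"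
    using \<delta> by (auto simp: \<tau>_def field_simps)
  have T1: "?T * real p powr (- \<theta>) = real p powr (- \<tau>)" by (simp only: powr_add[symmetric] e)
  have T2: "?T powr (1 - ?q) = real p powr (- \<tau>)" by (simp only: powr_powr e)
  have i: "1 \<le> i" "1 \<le> j" using p by auto
  note [measurable] = Y_meas[OF i(1)] Y_meas[OF i(2)]
  have le: "\<bar>Y i w * Y j w\<bar> powr ?q \<le> \<bar>Y i w\<bar> powr (2 + \<delta>) + \<bar>Y j w\<bar> powr (2 + \<delta>)" for w
  proof -
    let ?m = "max \<bar>Y i w\<bar> \<bar>Y j w\<bar>"
    have "\<bar>Y i w * Y j w\<bar> \<le> ?m * ?m" unfolding abs_mult by (intro mult_mono) auto
    then have "\<bar>Y i w * Y j w\<bar> powr ?q \<le> (?m * ?m) powr ?q" using \<delta> by (intro powr_mono2) auto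
    also have "\<dots> = ?m powr ?q * ?m powr ?q" by (rule powr_mult)
    also have "\<dots> = ?m powr (2 + \<delta>)" by (subst powr_add[symmetric]) simp
    also have "\<dots> \<le> \<bar>Y i w\<bar> powr (2 + \<delta>) + \<bar>Y j w\<bar> powr (2 + \<delta>)" by (auto simp: max_def)
    finally show ?thesis .
  qed
  have I: "integrable M (\<lambda>w. \<bar>Y i w\<bar> powr (2 + \<delta>) + \<bar>Y j w\<bar> powr (2 + \<delta>))"
    using i by (intro Bochner_Integration.integrable_add Y_mom)
  have Iq: "integrable M (\<lambda>w. \<bar>Y i w * Y j w\<bar> powr ?q)"
    by (rule Bochner_Integration.integrable_bound[OF I]) (use le in auto)
  have "expectation (\<lambda>w. \<bar>Y i w * Y j w\<bar> powr ?q) \<le> expectation (\<lambda>w. \<bar>Y i w\<bar> powr (2 + \<delta>) + \<bar>Y j w\<bar> powr (2 + \<delta>))"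
    by (rule integral_mono[OF Iq I le])
  also have "\<dots> \<le> 2 * B" using Y_mom[OF i(1)] Y_mom[OF i(2)] Y_mom_le[OF i(1)] Y_mom_le[OF i(2)] by simp
  finally have Eq: "expectation (\<lambda>w. \<bar>Y i w * Y j w\<bar> powr ?q) \<le> 2 * B" .
  have m: "(\<lambda>w. Y i w * Y j w) \<in> borel_measurable (F {p + m..})"
    using p by (intro borel_measurable_times Y_measurable_F) auto
  have "\<bar>expectation (\<lambda>w. f w * (Y i w * Y j w)) - expectation f * expectation (\<lambda>w. Y i w * Y j w)\<bar>
     \<le> 4 * K * ?T * (C * real p powr (- \<theta>)) + 2 * K * ?T powr (1 - ?q) * expectation (\<lambda>w. \<bar>Y i w * Y j w\<bar> powr ?q)"
    using p \<delta> by (intro mp.cov_truncate f K m Iq) auto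
  also have "\<dots> \<le> 4 * K * ?T * (C * real p powr (- \<theta>)) + 2 * K * ?T powr (1 - ?q) * (2 * B)"
    using K0 Eq by (intro add_left_mono mult_left_mono) auto
  also have "\<dots> = 4 * K * C * (?T * real p powr (- \<theta>)) + 2 * K * ?T powr (1 - ?q) * (2 * B)" by simp
  also have "\<dots> = K * (4 * C + 4 * B) * real p powr (- \<tau>)" unfolding T1 T2 by (simp add: algebra_simps)
  finally show ?thesis .
qed

end

section \<open>The Lindeberg method for mixing sequences\<close>

context mixing_process
begin

text \<open>The three constants belong to the terms with the first derivative, to the terms with the
  second derivative, and to the Taylor remainder of one exchange.\<close>

definition step_const1 :: real where "step_const1 = 4 * C + 2 * B"
definition step_const2 :: real where "step_const2 = smooth_const * (6 * (C + B) + tail_const)"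
definition step_const3 :: real where
  "step_const3 = (4 + gauss_const) * (3 * smooth_const) * (3 * B + v powr ((2 + \<delta>) / 2))"

lemma abs_diff_chain:
  fixes A D1 D2 R :: real
  shows "\<bar>A - (D1 + D2)\<bar> \<le> R \<Longrightarrow> \<bar>A\<bar> \<le> \<bar>D1\<bar> + \<bar>D2\<bar> + R"
  by linarith

lemma integrable_bounded_mult:
  fixes h k :: "'a \<Rightarrow> real"
  assumes [measurable]: "h \<in> borel_measurable M" and h: "\<And>w. \<bar>h w\<bar> \<le> K" and k: "integrable M k"
  shows "integrable M (\<lambda>w. h w * k w)"
proof (rule Bochner_Integration.integrable_bound)
  show "integrable M (\<lambda>w. K * \<bar>k w\<bar>)" using k by auto
  show "AE w in M. norm (h w * k w) \<le> norm (K * \<bar>k w\<bar>)"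
  proof (intro AE_I2)
    fix w
    have "\<bar>h w\<bar> * \<bar>k w\<bar> \<le> K * \<bar>k w\<bar>" by (intro mult_right_mono h) auto
    also have "\<dots> \<le> \<bar>K\<bar> * \<bar>k w\<bar>" by (intro mult_right_mono) auto
    finally show "norm (h w * k w) \<le> norm (K * \<bar>k w\<bar>)" by (simp add: abs_mult)
  qed
qed (use k in measurable)

lemma cov_past_psum:
  assumes f: "f \<in> borel_measurable (F {1..m})" and K: "\<And>w. \<bar>f w\<bar> \<le> K"
    and p: "1 \<le> p" and i: "m + p \<le> i"
  shows "\<bar>expectation (\<lambda>w. f w * psum i n w)\<bar> \<le> real n * (K * (4 * C + 2 * B) * real p powr (- \<tau>'))"
proof -
  have [measurable]: "f \<in> borel_measurable M" using f by (rule measurable_F[rotated]) auto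
  have I: "integrable M (\<lambda>w. f w * Y (i + 1 + k) w)" for k
    by (intro integrable_bounded_mult[OF _ K] Y_int) auto
  have "expectation (\<lambda>w. f w * psum i n w) = (\<Sum>k<n. expectation (\<lambda>w. f w * Y (i + 1 + k) w))"
    unfolding psum_def sum_distrib_left by (rule Bochner_Integration.integral_sum) (rule I)
  then have "\<bar>expectation (\<lambda>w. f w * psum i n w)\<bar> \<le> (\<Sum>k<n. \<bar>expectation (\<lambda>w. f w * Y (i + 1 + k) w)\<bar>)"
    by simp
  also have "\<dots> \<le> (\<Sum>k<n. K * (4 * C + 2 * B) * real p powr (- \<tau>'))"
    by (intro sum_mono cov_past_Y[OF f K p]) (use i in auto)
  finally show ?thesis by simp
qed

lemma cov_past_psum_prod:
  assumes f: "f \<in> borel_measurable (F {1..m})" and K: "\<And>w. \<bar>f w\<bar> \<le> K"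
    and p: "1 \<le> p" and ij: "m + p \<le> i" "m + p \<le> j"
  shows "\<bar>expectation (\<lambda>w. f w * (psum i n w * psum j n w)) - expectation f * expectation (\<lambda>w. psum i n w * psum j n w)\<bar>
    \<le> real n * real n * (K * (4 * C + 4 * B) * real p powr (- \<tau>))"
proof -
  have [measurable]: "f \<in> borel_measurable M" using f by (rule measurable_F[rotated]) auto
  let ?Y = "\<lambda>k l w. Y (i + 1 + k) w * Y (j + 1 + l) w"
  have I: "integrable M (\<lambda>w. f w * ?Y k l w)" for k l
    by (intro integrable_bounded_mult[OF _ K] Y_prod) auto
  have prod: "f w * (psum i n w * psum j n w) = (\<Sum>k<n. \<Sum>l<n. f w * ?Y k l w)" for w
    unfolding psum_def sum_product by (simp only: sum_distrib_left)
  have "expectation (\<lambda>w. f w * (psum i n w * psum j n w)) = (\<Sum>k<n. expectation (\<lambda>w. \<Sum>l<n. f w * ?Y k l w))"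
    unfolding prod by (rule Bochner_Integration.integral_sum, rule Bochner_Integration.integrable_sum) (rule I)
  also have "\<dots> = (\<Sum>k<n. \<Sum>l<n. expectation (\<lambda>w. f w * ?Y k l w))"
    by (rule sum.cong[OF refl], rule Bochner_Integration.integral_sum) (rule I)
  finally have eq: "expectation (\<lambda>w. f w * (psum i n w * psum j n w)) - expectation f * expectation (\<lambda>w. psum i n w * psum j n w)
    = (\<Sum>k<n. \<Sum>l<n. expectation (\<lambda>w. f w * ?Y k l w) - expectation f * expectation (?Y k l))"
    unfolding psum_prod_expectation by (simp only: sum_distrib_left sum_subtractf)
  have "\<bar>\<Sum>k<n. \<Sum>l<n. expectation (\<lambda>w. f w * ?Y k l w) - expectation f * expectation (?Y k l)\<bar>
     \<le> (\<Sum>k<n. \<Sum>l<n. K * (4 * C + 4 * B) * real p powr (- \<tau>))"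
    by (intro order_trans[OF sum_abs] sum_mono cov_past_prod[OF f K p]) (use ij in auto)
  then show ?thesis unfolding eq by simp
qed

text \<open>The step exchanges the sub-block sum \<open>X\<close> for a Gaussian variable.  The first derivative is taken
  at \<open>P + U\<close> and the second one at \<open>P\<close>, which leaves a gap of length \<open>p\<close> in each covariance with the
  past; the products \<open>V X\<close> then complete the long run variance.\<close>

lemma lindeberg_step:
  assumes f: "1-lipschitz_on UNIV f" and t: "0 < t" and v: "0 < v" and p: "1 \<le> p"
    and P: "P \<in> borel_measurable (F {1..a})" and PI: "integrable M P"
  defines "U \<equiv> psum a p" and "V \<equiv> psum (a + p) p" and "X \<equiv> psum (a + 2 * p) p"
  shows "\<bar>expectation (\<lambda>w. gauss_smooth t f (P w + U w + V w + X w))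
      - expectation (\<lambda>w. gauss_smooth (real p * v + t) f (P w + U w + V w))\<bar>
    \<le> step_const1 * real p powr (1 - \<tau>') + step_const2 * (real p powr (3 - \<tau>) / sqrt t)
      + step_const3 * (real p powr (3 + \<delta>) * t powr (- (1 + \<delta>) / 2))"
proof -
  let ?s = "sqrt (real p * v)" and ?q = "2 + \<delta>"
  let ?g = "gauss_smooth t f" and ?H = "3 * smooth_const * t powr (- (1 + \<delta>) / 2)"
  let ?S = "\<lambda>w. \<bar>U w\<bar> powr ?q + \<bar>V w\<bar> powr ?q + \<bar>X w\<bar> powr ?q + ?s powr ?q"
  obtain g1 g2 where g12 [measurable]: "g1 \<in> borel_measurable borel" "g2 \<in> borel_measurable borel"
    and b1: "\<And>x. \<bar>g1 x\<bar> \<le> 1" and b2: "\<And>x. \<bar>g2 x\<bar> \<le> smooth_const / sqrt t"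
    and T0: "\<And>x d. \<bar>?g (x + d) - ?g x - g1 x * d - g2 x * d\<^sup>2 / 2\<bar> \<le> ?H * \<bar>d\<bar> powr (2 + \<delta>)"
    and T1: "\<And>x d. \<bar>g1 (x + d) - g1 x - g2 x * d\<bar> \<le> ?H * \<bar>d\<bar> powr (1 + \<delta>)"
    and T2: "\<And>x d. \<bar>g2 (x + d) - g2 x\<bar> \<le> ?H * \<bar>d\<bar> powr \<delta>"
    using gauss_smooth_holder[OF f t \<delta>] by blast
  have pv: "0 < real p * v" using p v by simp
  have s2: "?s\<^sup>2 = real p * v" using pv by simp
  have H0: "0 \<le> ?H" using smooth_const_ge by simp
  have K0: "0 \<le> smooth_const / sqrt t" using smooth_const_ge t by simp
  note gl = gauss_smooth_lipschitz[OF f]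
  have [measurable]: "P \<in> borel_measurable M" using P by (rule measurable_F[rotated]) auto
  have [measurable]: "U \<in> borel_measurable M" "V \<in> borel_measurable M" "X \<in> borel_measurable M"
    unfolding U_def V_def X_def by auto
  have IU: "integrable M U" "integrable M V" "integrable M X" unfolding U_def V_def X_def by auto
  have IVX: "integrable M (\<lambda>w. V w * X w)" unfolding V_def X_def by (rule psum_prod)
  have IX2: "integrable M (\<lambda>w. (X w)\<^sup>2)" unfolding X_def by (rule psum_sq)
  let ?D1 = "\<lambda>w. g1 (P w + U w) * X w" and ?W = "\<lambda>w. V w * X w + (X w)\<^sup>2 / 2"
  let ?D2 = "\<lambda>w. g2 (P w) * (V w * X w + (X w)\<^sup>2 / 2 - ?s\<^sup>2 / 2)"
  let ?A = "\<lambda>w. ?g (P w + U w + V w + X w)" and ?A' = "\<lambda>w. gauss_smooth (real p * v + t) f (P w + U w + V w)"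
  have IW: "integrable M ?W" using IVX IX2 by auto
  have ID1: "integrable M ?D1" by (rule integrable_bounded_mult[OF _ b1 IU(3)]) measurable
  have ID2: "integrable M ?D2" by (rule integrable_bounded_mult[OF _ b2]) (use IW in auto)
  have Ig2W: "integrable M (\<lambda>w. g2 (P w) * ?W w)" by (rule integrable_bounded_mult[OF _ b2 IW]) measurable
  have Ig2: "integrable M (\<lambda>w. g2 (P w))" by (rule integrable_abs_bounded[OF _ b2]) measurable
  have IA: "integrable M ?A" by (rule integrable_lipschitz[OF gl]) (use PI IU in auto)
  have IA': "integrable M ?A'" by (rule integrable_lipschitz[OF gl]) (use PI IU in auto)
  have IS: "integrable M ?S" unfolding U_def V_def X_def
    by (intro Bochner_Integration.integrable_add psum_powr_int) auto
  \<comment> \<open>By the semigroup law, raising the smoothing parameter by p * v amounts to adding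
    an independent Gaussian summand of that variance. This makes the two integrands comparable at
    each w.\<close>
  have pw: "\<bar>?A w - ?A' w - (?D1 w + ?D2 w)\<bar> \<le> (4 + gauss_const) * ?H * ?S w" for w
  proof -
    have "?A' w = (\<integral>z. ?g (P w + U w + V w + ?s * z) \<partial>gauss)"
      by (rule gauss_smooth_semigroup[OF f pv t])
    then show ?thesis
      using lindeberg_pointwise[where g = ?g, OF gl _ H0 \<delta> T0 T1 T2, of ?s "P w" "U w" "V w" "X w"] pv by simp
  qed
  have "\<bar>expectation (\<lambda>w. ?A w - ?A' w - (?D1 w + ?D2 w))\<bar> \<le> expectation (\<lambda>w. \<bar>?A w - ?A' w - (?D1 w + ?D2 w)\<bar>)"
    by (rule integral_abs_bound)
  also have "\<dots> \<le> expectation (\<lambda>w. (4 + gauss_const) * ?H * ?S w)"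
    by (intro integral_mono pw integrable_abs integrable_mult_right IS Bochner_Integration.integrable_diff
          Bochner_Integration.integrable_add IA IA' ID1 ID2)
  also have "\<dots> = (4 + gauss_const) * ?H * expectation ?S" by simp
  also have "\<dots> \<le> (4 + gauss_const) * ?H * (real p powr (3 + \<delta>) * (3 * B + v powr ((2 + \<delta>) / 2)))"
  proof (intro mult_left_mono)
    have "expectation ?S = expectation (\<lambda>w. \<bar>U w\<bar> powr ?q) + expectation (\<lambda>w. \<bar>V w\<bar> powr ?q)
        + expectation (\<lambda>w. \<bar>X w\<bar> powr ?q) + ?s powr ?q"
      unfolding U_def V_def X_def
      by (simp add: psum_powr_int Bochner_Integration.integrable_add prob_space)
    also have "\<dots> \<le> 3 * (real p powr (3 + \<delta>) * B) + ?s powr ?q"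
      using psum_powr_le[of a p] psum_powr_le[of "a + p" p] psum_powr_le[of "a + 2 * p" p]
      unfolding U_def V_def X_def by linarith
    finally have S: "expectation ?S \<le> 3 * (real p powr (3 + \<delta>) * B) + ?s powr ?q" .
    have "?s powr ?q \<le> real p powr (3 + \<delta>) * v powr ((2 + \<delta>) / 2)"
    proof -
      have "?s powr ?q = (real p * v) powr ((2 + \<delta>) / 2)"
        using pv by (simp add: powr_half_sqrt[symmetric] powr_powr del: real_sqrt_mult)
      also have "\<dots> = real p powr ((2 + \<delta>) / 2) * v powr ((2 + \<delta>) / 2)"
        by (rule powr_mult)
      also have "\<dots> \<le> real p powr (3 + \<delta>) * v powr ((2 + \<delta>) / 2)"
        using p \<delta> by (intro mult_right_mono powr_mono) auto
      finally show ?thesis .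
    qed
    with S show "expectation ?S \<le> real p powr (3 + \<delta>) * (3 * B + v powr ((2 + \<delta>) / 2))"
      by (simp add: algebra_simps)
  qed (use H0 gauss_const_ge in auto)
  also have "\<dots> = step_const3 * (real p powr (3 + \<delta>) * t powr (- (1 + \<delta>) / 2))"
    by (simp add: step_const3_def mult_ac)
  finally have R: "\<bar>expectation ?A - expectation ?A' - (expectation ?D1 + expectation ?D2)\<bar>
      \<le> step_const3 * (real p powr (3 + \<delta>) * t powr (- (1 + \<delta>) / 2))"
    using IA IA' ID1 ID2 by simp
  have E1: "\<bar>expectation ?D1\<bar> \<le> step_const1 * real p powr (1 - \<tau>')"
  proof -
    have m: "(\<lambda>w. g1 (P w + U w)) \<in> borel_measurable (F {1..a + p})"
    proof -
      have "P \<in> borel_measurable (F {1..a + p})" using P by (rule measurable_F_mono[rotated]) auto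
      moreover have "U \<in> borel_measurable (F {1..a + p})" unfolding U_def by (rule psum_measurable_F) auto
      ultimately show ?thesis by measurable
    qed
    have "\<bar>expectation ?D1\<bar> \<le> real p * (1 * (4 * C + 2 * B) * real p powr (- \<tau>'))"
      unfolding X_def by (rule cov_past_psum[OF m b1 p]) auto
    also have "\<dots> = step_const1 * (real p powr 1 * real p powr (- \<tau>'))" by (simp add: step_const1_def)
    also have "\<dots> = step_const1 * real p powr (1 - \<tau>')" by (simp only: powr_add[symmetric]) simp
    finally show ?thesis .
  qed
  \<comment> \<open>Two covariances with \<open>g2 P\<close>, plus the mean of \<open>g2 P\<close>
    times the variance defect of \<open>block_variance\<close>. The p^2 pairs in each covariance
    cost \<open>p powr (2 - \<tau>)\<close>, which is dominated by the defect of order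
    \<open>p powr (3 - \<tau>)\<close>.\<close>
  have E2: "\<bar>expectation ?D2\<bar> \<le> step_const2 * (real p powr (3 - \<tau>) / sqrt t)"
  proof -
    let ?c = "smooth_const / sqrt t * (4 * C + 4 * B) * real p powr (- \<tau>)"
    have c0: "0 \<le> ?c" using K0 C_nonneg B_nonneg by (intro mult_nonneg_nonneg) auto
    have m: "(\<lambda>w. g2 (P w)) \<in> borel_measurable (F {1..a})" using P by measurable
    let ?e = "expectation (\<lambda>w. g2 (P w))"
    have double: "a + p + p = a + 2 * p" by simp
    have decomp: "A + Q / 2 - e * c / 2 = (A - e * x) + (Q - e * y) / 2 + e * (y + 2 * x - c) / 2"
      for A Q e c x y :: real by (simp add: field_simps)
    have collect: "n * n * (K * (4 * C + 4 * B) * y) + n * n * (K * (4 * C + 4 * B) * y) / 2 + K * (2 * n * (tc * z)) / 2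
       = K * (6 * (C + B) * (n * (n * y)) + tc * (n * z))" for n K y tc z :: real
      by (simp add: field_simps)
    have collect2: "sc / r * (6 * (C + B) * y + tc * y) = sc * (6 * (C + B) + tc) * (y / r)" for sc r y tc :: real
      by (simp add: field_simps)
    have 1: "\<bar>expectation (\<lambda>w. g2 (P w) * (V w * X w)) - ?e * expectation (\<lambda>w. V w * X w)\<bar> \<le> real p * real p * ?c"
      unfolding V_def X_def by (rule cov_past_psum_prod[OF m b2 p]) auto
    have 2: "\<bar>expectation (\<lambda>w. g2 (P w) * (X w)\<^sup>2) - ?e * expectation (\<lambda>w. (X w)\<^sup>2)\<bar> \<le> real p * real p * ?c"
      unfolding X_def power2_eq_square by (rule cov_past_psum_prod[OF m b2 p]) auto
    have eb: "\<bar>?e\<bar> \<le> smooth_const / sqrt t" by (rule abs_expectation_le[OF b2 K0])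
    have 3: "\<bar>expectation (\<lambda>w. (X w)\<^sup>2) + 2 * expectation (\<lambda>w. V w * X w) - real p * v\<bar>
        \<le> 2 * real p * (tail_const * real p powr (2 - \<tau>))"
      using block_variance[OF p, of "a + p"] unfolding V_def X_def unfolding double .
    have "expectation ?D2 = expectation (\<lambda>w. g2 (P w) * (V w * X w) + g2 (P w) * (X w)\<^sup>2 / 2 - g2 (P w) * (real p * v) / 2)"
      unfolding s2 by (intro Bochner_Integration.integral_cong) (auto simp: algebra_simps)
    also have "\<dots> = expectation (\<lambda>w. g2 (P w) * (V w * X w)) + expectation (\<lambda>w. g2 (P w) * (X w)\<^sup>2) / 2 - ?e * (real p * v) / 2"
      using integrable_bounded_mult[OF _ b2 IVX] integrable_bounded_mult[OF _ b2 IX2] Ig2 by simp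
    also have "\<dots> = (expectation (\<lambda>w. g2 (P w) * (V w * X w)) - ?e * expectation (\<lambda>w. V w * X w))
        + (expectation (\<lambda>w. g2 (P w) * (X w)\<^sup>2) - ?e * expectation (\<lambda>w. (X w)\<^sup>2)) / 2
        + ?e * (expectation (\<lambda>w. (X w)\<^sup>2) + 2 * expectation (\<lambda>w. V w * X w) - real p * v) / 2"
      by (rule decomp)
    finally have eq: "expectation ?D2 = (expectation (\<lambda>w. g2 (P w) * (V w * X w)) - ?e * expectation (\<lambda>w. V w * X w))
        + (expectation (\<lambda>w. g2 (P w) * (X w)\<^sup>2) - ?e * expectation (\<lambda>w. (X w)\<^sup>2)) / 2
        + ?e * (expectation (\<lambda>w. (X w)\<^sup>2) + 2 * expectation (\<lambda>w. V w * X w) - real p * v) / 2" .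
    have 4: "\<bar>?e * (expectation (\<lambda>w. (X w)\<^sup>2) + 2 * expectation (\<lambda>w. V w * X w) - real p * v)\<bar>
        \<le> smooth_const / sqrt t * (2 * real p * (tail_const * real p powr (2 - \<tau>)))"
      unfolding abs_mult by (intro mult_mono eb 3 K0) auto
    have tri: "D = x + y / 2 + z / 2 \<Longrightarrow> \<bar>x\<bar> \<le> b \<Longrightarrow> \<bar>y\<bar> \<le> b \<Longrightarrow> \<bar>z\<bar> \<le> c \<Longrightarrow> \<bar>D\<bar> \<le> b + b / 2 + c / 2"
      for D x y z b c :: real by linarith
    have "\<bar>expectation ?D2\<bar> \<le> real p * real p * ?c + real p * real p * ?c / 2
        + smooth_const / sqrt t * (2 * real p * (tail_const * real p powr (2 - \<tau>))) / 2"
      by (rule tri[OF eq 1 2 4])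
    also have "\<dots> = smooth_const / sqrt t * (6 * (C + B) * (real p * (real p * real p powr (- \<tau>))) + tail_const * (real p * real p powr (2 - \<tau>)))"
      by (rule collect)
    also have "\<dots> \<le> smooth_const / sqrt t * (6 * (C + B) * real p powr (3 - \<tau>) + tail_const * real p powr (3 - \<tau>))"
    proof -
      have pp: "real p * real p powr e = real p powr (1 + e)" for e using p by (simp add: powr_add)
      have "real p * (real p * real p powr (- \<tau>)) \<le> real p powr (3 - \<tau>)"
        unfolding pp using p by (intro powr_mono) auto
      moreover have "real p * real p powr (2 - \<tau>) = real p powr (3 - \<tau>)" unfolding pp by simp
      ultimately show ?thesis
        using K0 C_nonneg B_nonneg tail_const_nonneg by (intro mult_left_mono add_mono) auto
    qed
    also have "\<dots> = step_const2 * (real p powr (3 - \<tau>) / sqrt t)"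
      unfolding step_const2_def by (rule collect2)
    finally show ?thesis .
  qed
  show ?thesis using abs_diff_chain[OF R] E1 E2 by linarith
qed

lemma gauss_smooth_0: "gauss_smooth 0 f x = f x"
  by (simp add: gauss_smooth_def)

lemma gauss_smooth_diff:
  assumes f: "1-lipschitz_on UNIV f" and s: "0 < s" and t: "0 \<le> t"
  shows "\<bar>gauss_smooth (s + t) f x - gauss_smooth t f x\<bar> \<le> sqrt s"
proof -
  let ?g = "gauss_smooth t f"
  have g: "1-lipschitz_on UNIV ?g" by (rule gauss_smooth_lipschitz[OF f])
  have eq: "gauss_smooth (s + t) f x = (\<integral>z. ?g (x + sqrt s * z) \<partial>gauss)"
  proof (cases "t = 0")
    case True
    then show ?thesis unfolding True gauss_smooth_0 by (simp add: gauss_smooth_def)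
  next
    case False
    then show ?thesis using gauss_smooth_semigroup[OF f s] t by simp
  qed
  have I: "integrable gauss (\<lambda>z. ?g (x + sqrt s * z))"
    by (rule gauss.integrable_lipschitz[OF g]) simp
  have "gauss_smooth (s + t) f x - ?g x = (\<integral>z. ?g (x + sqrt s * z) - ?g x \<partial>gauss)"
    unfolding eq using I by simp
  then have "\<bar>gauss_smooth (s + t) f x - ?g x\<bar> \<le> (\<integral>z. \<bar>?g (x + sqrt s * z) - ?g x\<bar> \<partial>gauss)"
    using integral_abs_bound[of gauss "\<lambda>z. ?g (x + sqrt s * z) - ?g x"] by simp
  also have "\<dots> \<le> (\<integral>z. sqrt s * \<bar>z\<bar> \<partial>gauss)"
  proof (rule integral_mono)
    show "integrable gauss (\<lambda>z. \<bar>?g (x + sqrt s * z) - ?g x\<bar>)" using I by auto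
    fix z show "\<bar>?g (x + sqrt s * z) - ?g x\<bar> \<le> sqrt s * \<bar>z\<bar>"
      using lipschitz_absD[OF g, of "x + sqrt s * z" x] s by (simp add: abs_mult)
  qed auto
  also have "\<dots> = sqrt s * sqrt (2 / pi)" by (simp add: gauss_integral_abs)
  also have "\<dots> \<le> sqrt s * 1"
    using pi_gt3 s by (intro mult_left_mono) auto
  finally show ?thesis by simp
qed

definition crude_const :: real where "crude_const = 1 + B + sqrt v"

lemma expectation_lipschitz_diff:
  fixes g :: "real \<Rightarrow> real"
  assumes g: "L-lipschitz_on UNIV g" and X: "integrable M X" "integrable M X'"
  shows "\<bar>expectation (\<lambda>w. g (X w)) - expectation (\<lambda>w. g (X' w))\<bar> \<le> L * expectation (\<lambda>w. \<bar>X w - X' w\<bar>)"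
proof -
  note I = integrable_lipschitz[OF g X(1)] integrable_lipschitz[OF g X(2)]
  have "\<bar>expectation (\<lambda>w. g (X w)) - expectation (\<lambda>w. g (X' w))\<bar> = \<bar>expectation (\<lambda>w. g (X w) - g (X' w))\<bar>"
    using I by simp
  also have "\<dots> \<le> expectation (\<lambda>w. \<bar>g (X w) - g (X' w)\<bar>)" by (rule integral_abs_bound)
  also have "\<dots> \<le> expectation (\<lambda>w. L * \<bar>X w - X' w\<bar>)"
    using I X by (intro integral_mono lipschitz_absD[OF g]) auto
  finally show ?thesis by simp
qed

text \<open>For the few exchanges that \<open>lindeberg_step\<close> does not cover: dropping the
  sub-block and dropping its Gaussian substitute each move a Lipschitz function by at most a
  multiple of p.\<close>

lemma crude_step:
  assumes f: "1-lipschitz_on UNIV f" and t: "0 \<le> t" and v: "0 < v" and p: "1 \<le> p" and PI: "integrable M P"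
  shows "\<bar>expectation (\<lambda>w. gauss_smooth t f (P w + psum a p w))
      - expectation (\<lambda>w. gauss_smooth (real p * v + t) f (P w))\<bar> \<le> crude_const * real p"
proof -
  note gl = gauss_smooth_lipschitz[OF f]
  have pv: "0 < real p * v" using p v by simp
  have "\<bar>expectation (\<lambda>w. gauss_smooth t f (P w + psum a p w)) - expectation (\<lambda>w. gauss_smooth t f (P w))\<bar>
     \<le> 1 * expectation (\<lambda>w. \<bar>P w + psum a p w - P w\<bar>)"
    by (rule expectation_lipschitz_diff[OF gl]) (use PI in auto)
  also have "\<dots> \<le> real p * (1 + B)" using psum_abs_le[of a p] by simp
  finally have 1: "\<bar>expectation (\<lambda>w. gauss_smooth t f (P w + psum a p w)) - expectation (\<lambda>w. gauss_smooth t f (P w))\<bar>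
     \<le> real p * (1 + B)" .
  have 2: "\<bar>expectation (\<lambda>w. gauss_smooth (real p * v + t) f (P w)) - expectation (\<lambda>w. gauss_smooth t f (P w))\<bar> \<le> sqrt (real p * v)"
    by (rule abs_expectation_diff_le) (use gauss_smooth_diff[OF f pv t] pv integrable_lipschitz[OF gl PI] in auto)
  have "sqrt (real p) \<le> real p" using p by (intro real_le_lsqrt) (auto simp: power2_eq_square)
  then have "sqrt (real p * v) \<le> real p * sqrt v"
    unfolding real_sqrt_mult using v by (intro mult_right_mono) auto
  with 1 2 show ?thesis unfolding crude_const_def by (simp add: algebra_simps)
qed

end

section \<open>Summation of the exchange errors and the Wasserstein rate\<close>

lemma sum_inverse_sqrt_le: "(\<Sum>j<n. 1 / sqrt (real j)) \<le> 2 * sqrt (real n)"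
proof -
  have "(\<Sum>j<Suc n. 1 / sqrt (real j)) \<le> 2 * sqrt (real n)" for n
  proof (induction n)
    case (Suc n)
    let ?a = "sqrt (real (Suc n))" and ?b = "sqrt (real n)"
    have ab: "?b \<le> ?a" "0 \<le> ?b" "0 < ?a" by auto
    have "1 = ?a * ?a - ?b * ?b" by simp
    also have "\<dots> = (?a - ?b) * (?a + ?b)" by (simp only: algebra_simps)
    also have "\<dots> \<le> (?a - ?b) * (?a + ?a)" using ab by (intro mult_left_mono) auto
    finally have "1 / ?a \<le> 2 * ?a - 2 * ?b" using ab by (simp only: pos_divide_le_eq) (simp only: algebra_simps)
    then show ?case using Suc by (simp only: sum.lessThan_Suc[of _ "Suc n"])
  qed simp
  from order_trans[OF _ this[of n]] show ?thesis by simp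
qed

lemma harm_le_ln: "1 \<le> n \<Longrightarrow> (\<Sum>j<n. 1 / real j) \<le> 1 + ln (real n)"
proof -
  assume n: "1 \<le> n"
  have "(\<Sum>j<n. 1 / real j) \<le> (\<Sum>j<Suc n. 1 / real j)" by (rule sum_mono2) auto
  also have "\<dots> = harm n"
    by (simp only: sum.lessThan_Suc_shift) (simp add: harm_def sum.atLeast1_atMost_eq divide_inverse)
  also have "\<dots> \<le> 1 + ln (real n)"
    using euler_mascheroni_sequence_decreasing[of 1 n] n by (simp add: harm_def)
  finally show ?thesis .
qed

text \<open>Writing the exponent as (1 - \<delta>) / 2 - 1 leaves a harmonic sum. The logarithm is
  the price for a bound that covers \<delta> = 1 as well.\<close>

lemma sum_powr_le:
  assumes \<delta>: "0 \<le> \<delta>" "\<delta> \<le> 1" and n: "1 \<le> n"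
  shows "(\<Sum>j<n. real j powr (- (1 + \<delta>) / 2)) \<le> real n powr ((1 - \<delta>) / 2) * (1 + ln (real n))"
proof -
  have "(\<Sum>j<n. real j powr (- (1 + \<delta>) / 2)) \<le> (\<Sum>j<n. real n powr ((1 - \<delta>) / 2) * (1 / real j))"
  proof (rule sum_mono)
    fix j assume j: "j \<in> {..<n}"
    show "real j powr (- (1 + \<delta>) / 2) \<le> real n powr ((1 - \<delta>) / 2) * (1 / real j)"
    proof (cases "j = 0")
      case False
      have "real j powr (- (1 + \<delta>) / 2) = real j powr ((1 - \<delta>) / 2) * real j powr (- 1)"
        by (subst powr_add[symmetric]) (simp add: field_simps)
      also have "\<dots> \<le> real n powr ((1 - \<delta>) / 2) * real j powr (- 1)"
        using j \<delta> by (intro mult_right_mono powr_mono2) auto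
      finally show ?thesis using False by (simp add: powr_minus_divide)
    qed simp
  qed
  also have "\<dots> = real n powr ((1 - \<delta>) / 2) * (\<Sum>j<n. 1 / real j)" by (simp only: sum_distrib_left)
  also have "\<dots> \<le> real n powr ((1 - \<delta>) / 2) * (1 + ln (real n))"
    using harm_le_ln[OF n] by (intro mult_left_mono) auto
  finally show ?thesis .
qed

context mixing_process
begin

text \<open>Three crude exchanges and the incomplete last sub-block make the factor 4; the final
  sqrt v adjusts the Gaussian variance for the same missing summands.\<close>

definition W_const :: real where
  "W_const = 4 * crude_const + step_const1 + 2 * step_const2 / sqrt v + step_const3 * v powr (- (1 + \<delta>) / 2) + sqrt v"

text \<open>The four terms stem from the crude exchanges and the incomplete sub-block, from the
  first derivative, from the second derivative, and from the Taylor remainders.\<close>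

definition lindeberg_rate :: "nat \<Rightarrow> nat \<Rightarrow> real" where
  "lindeberg_rate p n = real p + real n * real p powr (- \<tau>') + real p powr (2 - \<tau>) * sqrt (real n)
     + real p powr (2 + \<delta>) * real n powr ((1 - \<delta>) / 2) * (1 + ln (real n))"

lemma consts_nonneg:
  assumes "0 < v"
  shows "0 \<le> step_const1" "0 \<le> step_const2" "0 \<le> step_const3" "0 \<le> crude_const"
  using C_nonneg B_nonneg smooth_const_ge gauss_const_ge tail_const_nonneg assms
  unfolding step_const1_def step_const2_def step_const3_def crude_const_def by auto

lemma gauss_scale_diff:
  assumes f: "1-lipschitz_on UNIV f" and st: "0 \<le> s" "s \<le> t"
  shows "\<bar>(\<integral>z. f (sqrt t * z) \<partial>gauss) - (\<integral>z. f (sqrt s * z) \<partial>gauss)\<bar> \<le> sqrt (t - s)"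
proof (cases "s = t")
  case False
  then show ?thesis
    using gauss_smooth_diff[OF f, of "t - s" s 0] st by (simp add: gauss_smooth_def)
qed simp

text \<open>In \<open>h k\<close> the first k of the K sub-blocks are original and the others
  Gaussian, the latter appearing as smoothing by the variance (K - k) * p * v. Thus
  \<open>h 0\<close> is the Gaussian integral, \<open>h K\<close> has no smoothing, and the
  difference telescopes. The n mod p summands left over are dropped on both sides.\<close>

lemma lindeberg_bound:
  assumes f: "1-lipschitz_on UNIV f" and v: "0 < v" and p: "1 \<le> p" "p \<le> n"
  shows "\<bar>expectation (\<lambda>w. f (psum a n w)) - (\<integral>z. f (sqrt (real n * v) * z) \<partial>gauss)\<bar> \<le> W_const * lindeberg_rate p n"
proof -
  define K where "K = n div p"
  have K1: "1 \<le> K" using p by (simp add: K_def div_greater_zero_iff Suc_le_eq)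
  have Kn: "K * p \<le> n" "n - K * p < p"
  proof -
    show "K * p \<le> n" by (simp add: K_def)
    have "n - K * p = n mod p" by (simp add: K_def minus_div_mult_eq_mod)
    then show "n - K * p < p" using p by simp
  qed
  have Kr: "real K \<le> real n / real p"
  proof -
    have "real K * real p \<le> real n" using Kn(1) by (metis of_nat_le_iff of_nat_mult)
    then show ?thesis using p by (simp add: pos_le_divide_eq)
  qed
  define h where "h k = expectation (\<lambda>w. gauss_smooth (real (K - k) * (real p * v)) f (psum a (k * p) w))" for k
  note cn = consts_nonneg[OF v]
  have pv: "0 < real p * v" using p v by simp
  \<comment> \<open>The index j counts the Gaussian sub-blocks still ahead. At j = 0 the two terms
    that depend on the smoothing vanish by the conventions for division and \<open>powr\<close> at
    zero; that exchange is paid for by \<open>?c\<close> below.\<close>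
  let ?E = "\<lambda>j. step_const1 * real p powr (1 - \<tau>') + step_const2 * (real p powr (3 - \<tau>) / sqrt (real j * (real p * v)))
      + step_const3 * (real p powr (3 + \<delta>) * (real j * (real p * v)) powr (- (1 + \<delta>) / 2))"
  have E0: "0 \<le> ?E j" for j using cn by (intro add_nonneg_nonneg mult_nonneg_nonneg divide_nonneg_nonneg) (use v in auto)
  \<comment> \<open>The first two steps have no two sub-blocks before them, and the last one has no smoothing left.\<close>
  let ?c = "\<lambda>k. if k < 2 \<or> k = K - 1 then crude_const * real p else 0"
  have step: "\<bar>h (Suc k) - h k\<bar> \<le> ?c k + ?E (K - Suc k)" if k: "k < K" for k
  proof -
    let ?t = "real (K - Suc k) * (real p * v)"
    have t0: "0 \<le> ?t" using v by simp
    have e: "real (K - k) * (real p * v) = real p * v + ?t"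
    proof -
      have "real (K - k) = 1 + real (K - Suc k)" using k by linarith
      then show ?thesis by (simp only: distrib_right mult_1_left)
    qed
    have hS: "h (Suc k) = expectation (\<lambda>w. gauss_smooth ?t f (psum a (k * p) w + psum (a + k * p) p w))"
      unfolding h_def using psum_add[of a "k * p" p] by (simp add: add.commute)
    have hk: "h k = expectation (\<lambda>w. gauss_smooth (real p * v + ?t) f (psum a (k * p) w))"
      unfolding h_def e ..
    show ?thesis
    proof (cases "k < 2 \<or> k = K - 1")
      case True
      have "\<bar>h (Suc k) - h k\<bar> \<le> crude_const * real p"
        unfolding hS hk by (rule crude_step[OF f t0 v p(1)]) simp
      then show ?thesis using True E0[of "K - Suc k"] by simp
    next
      case False
      then obtain j where j: "k = j + 2" by (metis add.commute le_Suc_ex not_less)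
      have "0 < K - Suc k" using False k by linarith
      then have "0 < real (K - Suc k)" by (simp only: of_nat_0_less_iff)
      then have t: "0 < ?t" using pv by (rule mult_pos_pos)
      let ?P = "psum a (j * p)"
      have P: "?P \<in> borel_measurable (F {1..a + j * p})" by (rule psum_measurable_F) auto
      have e1: "psum a (k * p) w = ?P w + psum (a + j * p) p w + psum (a + j * p + p) p w" for w
      proof -
        have "k * p = j * p + p + p" using j by simp
        then show ?thesis by (simp only: psum_add add.assoc)
      qed
      have e2: "a + k * p = a + j * p + 2 * p" using j by simp
      have "\<bar>h (Suc k) - h k\<bar> \<le> ?E (K - Suc k)"
        unfolding hS hk e1 e2 by (rule lindeberg_step[OF f t v p(1) P]) simp
      then show ?thesis using False by simp
    qed
  qed
  have "h K - h 0 = (\<Sum>k<K. h (Suc k) - h k)" by (rule sum_lessThan_telescope[symmetric])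
  then have "\<bar>h K - h 0\<bar> \<le> (\<Sum>k<K. \<bar>h (Suc k) - h k\<bar>)" by simp
  also have "\<dots> \<le> (\<Sum>k<K. ?c k + ?E (K - Suc k))" by (intro sum_mono step) auto
  also have "\<dots> = (\<Sum>k<K. ?c k) + (\<Sum>k<K. ?E (K - Suc k))" by (rule sum.distrib)
  also have "(\<Sum>k<K. ?E (K - Suc k)) = (\<Sum>j<K. ?E j)" by (rule sum.nat_diff_reindex)
  finally have A: "\<bar>h K - h 0\<bar> \<le> (\<Sum>k<K. ?c k) + (\<Sum>j<K. ?E j)" .
  have c3: "(\<Sum>k<K. ?c k) \<le> 3 * (crude_const * real p)"
  proof -
    have "(\<Sum>k<K. ?c k) = (\<Sum>k\<in>{k. k < K \<and> (k < 2 \<or> k = K - 1)}. crude_const * real p)"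
      by (subst sum.inter_filter[symmetric]) (auto simp: lessThan_def)
    also have "\<dots> = real (card {k. k < K \<and> (k < 2 \<or> k = K - 1)}) * (crude_const * real p)" by simp
    also have "\<dots> \<le> 3 * (crude_const * real p)"
    proof (intro mult_right_mono)
      have "card {k. k < K \<and> (k < 2 \<or> k = K - 1)} \<le> card {0, 1, K - 1}" by (rule card_mono) auto
      also have "\<dots> \<le> 3" by (simp add: card_insert_if)
      finally show "real (card {k. k < K \<and> (k < 2 \<or> k = K - 1)}) \<le> 3" by simp
    qed (use cn in simp)
    finally show ?thesis .
  qed
  have pp: "real p powr x * real p powr y = real p powr (x + y)" for x y by (rule powr_add[symmetric])
  have s1: "(\<Sum>j<K. step_const1 * real p powr (1 - \<tau>')) \<le> step_const1 * (real n * real p powr (- \<tau>'))"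
  proof -
    have "(\<Sum>j<K. step_const1 * real p powr (1 - \<tau>')) = step_const1 * (real K * real p powr (1 - \<tau>'))" by simp
    also have "\<dots> \<le> step_const1 * (real n / real p * real p powr (1 - \<tau>'))"
      using Kr cn by (intro mult_left_mono mult_right_mono) auto
    also have "\<dots> = step_const1 * (real n * real p powr (- \<tau>'))"
    proof -
      have "real p powr (1 - \<tau>') = real p * real p powr (- \<tau>')" using p pp[of 1 "- \<tau>'"] by simp
      then show ?thesis using p by simp
    qed
    finally show ?thesis .
  qed
  have s2: "(\<Sum>j<K. step_const2 * (real p powr (3 - \<tau>) / sqrt (real j * (real p * v))))
      \<le> 2 * step_const2 / sqrt v * (real p powr (2 - \<tau>) * sqrt (real n))"
  proof -
    have "(\<Sum>j<K. step_const2 * (real p powr (3 - \<tau>) / sqrt (real j * (real p * v))))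
       = step_const2 * real p powr (3 - \<tau>) / sqrt (real p * v) * (\<Sum>j<K. 1 / sqrt (real j))"
      unfolding sum_distrib_left by (intro sum.cong refl) (simp add: real_sqrt_mult)
    also have "\<dots> \<le> step_const2 * real p powr (3 - \<tau>) / sqrt (real p * v) * (2 * sqrt (real n / real p))"
    proof (rule mult_left_mono)
      have "2 * sqrt (real K) \<le> 2 * sqrt (real n / real p)" using Kr by (simp only: mult_le_cancel_left_pos real_sqrt_le_iff)
      then show "(\<Sum>j<K. 1 / sqrt (real j)) \<le> 2 * sqrt (real n / real p)"
        using sum_inverse_sqrt_le[of K] by linarith
      show "0 \<le> step_const2 * real p powr (3 - \<tau>) / sqrt (real p * v)" using cn pv by simp
    qed
    also have "\<dots> = 2 * step_const2 / sqrt v * (real p powr (3 - \<tau>) / (sqrt (real p) * sqrt (real p)) * sqrt (real n))"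
      by (simp add: real_sqrt_mult real_sqrt_divide mult_ac del: real_sqrt_mult_self)
    also have "real p powr (3 - \<tau>) / (sqrt (real p) * sqrt (real p)) = real p powr (2 - \<tau>)"
    proof -
      have "real p powr (3 - \<tau>) = real p * real p powr (2 - \<tau>)" using p pp[of 1 "2 - \<tau>"] by simp
      then show ?thesis using p by simp
    qed
    finally show ?thesis .
  qed
  have s3: "(\<Sum>j<K. step_const3 * (real p powr (3 + \<delta>) * (real j * (real p * v)) powr (- (1 + \<delta>) / 2)))
      \<le> step_const3 * v powr (- (1 + \<delta>) / 2) * (real p powr (2 + \<delta>) * real n powr ((1 - \<delta>) / 2) * (1 + ln (real n)))"
  proof -
    let ?e = "- (1 + \<delta>) / 2"
    have "(\<Sum>j<K. step_const3 * (real p powr (3 + \<delta>) * (real j * (real p * v)) powr ?e))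
       = step_const3 * real p powr (3 + \<delta>) * (real p powr ?e * v powr ?e) * (\<Sum>j<K. real j powr ?e)"
      unfolding sum_distrib_left by (intro sum.cong refl) (simp add: powr_mult)
    also have "\<dots> \<le> step_const3 * real p powr (3 + \<delta>) * (real p powr ?e * v powr ?e)
        * ((real n powr ((1 - \<delta>) / 2) / real p powr ((1 - \<delta>) / 2)) * (1 + ln (real n)))"
    proof (rule mult_left_mono)
      have "(\<Sum>j<K. real j powr ?e) \<le> real K powr ((1 - \<delta>) / 2) * (1 + ln (real K))"
        using sum_powr_le[of \<delta> K] \<delta> K1 by simp
      also have "\<dots> \<le> (real n / real p) powr ((1 - \<delta>) / 2) * (1 + ln (real n))"
      proof (intro mult_mono powr_mono2 Kr)
        have "real K \<le> real n" using Kn(1) p K1 by (metis K_def div_le_dividend of_nat_mono)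
        then show "1 + ln (real K) \<le> 1 + ln (real n)" using K1 by simp
      qed (use \<delta> K1 in auto)
      finally show "(\<Sum>j<K. real j powr ?e) \<le> (real n powr ((1 - \<delta>) / 2) / real p powr ((1 - \<delta>) / 2)) * (1 + ln (real n))"
        by (simp add: powr_divide)
      show "0 \<le> step_const3 * real p powr (3 + \<delta>) * (real p powr ?e * v powr ?e)" using cn by simp
    qed
    also have "\<dots> = step_const3 * v powr ?e * ((real p powr (3 + \<delta>) * real p powr ?e * real p powr (- ((1 - \<delta>) / 2)))
        * real n powr ((1 - \<delta>) / 2) * (1 + ln (real n)))"
      by (simp add: powr_minus_divide)
    also have "real p powr (3 + \<delta>) * real p powr ?e * real p powr (- ((1 - \<delta>) / 2)) = real p powr (2 + \<delta>)"
    proof -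
      have "3 + \<delta> + ?e + - ((1 - \<delta>) / 2) = 2 + \<delta>" by (simp add: field_simps)
      then show ?thesis unfolding pp by (simp only:)
    qed
    finally show ?thesis .
  qed
  have sE: "(\<Sum>j<K. ?E j) \<le> step_const1 * (real n * real p powr (- \<tau>'))
     + 2 * step_const2 / sqrt v * (real p powr (2 - \<tau>) * sqrt (real n))
     + step_const3 * v powr (- (1 + \<delta>) / 2) * (real p powr (2 + \<delta>) * real n powr ((1 - \<delta>) / 2) * (1 + ln (real n)))"
    unfolding sum.distrib using s1 s2 s3 by linarith
  have hK: "h K = expectation (\<lambda>w. f (psum a (K * p) w))" by (simp add: h_def gauss_smooth_0)
  have h0: "h 0 = (\<integral>z. f (sqrt (real (K * p) * v) * z) \<partial>gauss)"
    by (simp add: h_def gauss_smooth_def psum_def prob_space mult.assoc)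
  have B1: "\<bar>expectation (\<lambda>w. f (psum a n w)) - h K\<bar> \<le> crude_const * real p"
  proof -
    have "\<bar>expectation (\<lambda>w. f (psum a n w)) - h K\<bar> \<le> 1 * expectation (\<lambda>w. \<bar>psum a n w - psum a (K * p) w\<bar>)"
      unfolding hK by (rule expectation_lipschitz_diff[OF f]) auto
    also have "\<dots> = expectation (\<lambda>w. \<bar>psum (a + K * p) (n - K * p) w\<bar>)"
      using psum_add[of a "K * p" "n - K * p"] Kn(1) by simp
    also have "\<dots> \<le> real (n - K * p) * (1 + B)" by (rule psum_abs_le)
    also have "\<dots> \<le> real p * (1 + B)" using Kn(2) B_nonneg by (intro mult_right_mono) auto
    also have "\<dots> \<le> crude_const * real p" using v by (simp add: crude_const_def algebra_simps)
    finally show ?thesis .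
  qed
  have B2: "\<bar>(\<integral>z. f (sqrt (real n * v) * z) \<partial>gauss) - h 0\<bar> \<le> sqrt v * real p"
  proof -
    have "\<bar>(\<integral>z. f (sqrt (real n * v) * z) \<partial>gauss) - h 0\<bar> \<le> sqrt (real n * v - real (K * p) * v)"
      unfolding h0 by (rule gauss_scale_diff[OF f]) (use Kn(1) v in \<open>auto intro!: mult_right_mono simp flip: of_nat_mult\<close>)
    also have "real n * v - real (K * p) * v = real (n - K * p) * v"
      using Kn(1) by (simp add: of_nat_diff left_diff_distrib)
    also have "sqrt \<dots> \<le> sqrt (real p * v)" using Kn(2) v by (simp add: mult_right_mono)
    also have "\<dots> = sqrt v * sqrt (real p)" by (simp add: real_sqrt_mult)
    also have "\<dots> \<le> sqrt v * real p"
      using p v by (intro mult_left_mono real_le_lsqrt) (auto simp: power2_eq_square)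
    finally show ?thesis .
  qed
  let ?x1 = "real p" and ?x2 = "real n * real p powr (- \<tau>')" and ?x3 = "real p powr (2 - \<tau>) * sqrt (real n)"
    and ?x4 = "real p powr (2 + \<delta>) * real n powr ((1 - \<delta>) / 2) * (1 + ln (real n))"
  have ln0: "0 \<le> ln (real n)" using p by simp
  have x0: "0 \<le> ?x1" "0 \<le> ?x2" "0 \<le> ?x3" "0 \<le> ?x4" using ln0 by auto
  let ?k1 = "4 * crude_const + sqrt v" and ?k2 = step_const1 and ?k3 = "2 * step_const2 / sqrt v"
    and ?k4 = "step_const3 * v powr (- (1 + \<delta>) / 2)"
  have k0: "0 \<le> ?k1" "0 \<le> ?k2" "0 \<le> ?k3" "0 \<le> ?k4" using cn v by auto
  have "\<bar>expectation (\<lambda>w. f (psum a n w)) - (\<integral>z. f (sqrt (real n * v) * z) \<partial>gauss)\<bar>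
     \<le> \<bar>expectation (\<lambda>w. f (psum a n w)) - h K\<bar> + \<bar>h K - h 0\<bar> + \<bar>(\<integral>z. f (sqrt (real n * v) * z) \<partial>gauss) - h 0\<bar>"
    by linarith
  also have "\<dots> \<le> crude_const * real p + (3 * (crude_const * real p) + (?k2 * ?x2 + ?k3 * ?x3 + ?k4 * ?x4)) + sqrt v * real p"
    by (intro add_mono B1 B2 order_trans[OF A] c3 sE)
  also have "\<dots> = ?k1 * ?x1 + ?k2 * ?x2 + ?k3 * ?x3 + ?k4 * ?x4" by (simp add: distrib_right)
  also have "\<dots> \<le> W_const * ?x1 + W_const * ?x2 + W_const * ?x3 + W_const * ?x4"
    unfolding W_const_def using k0 x0 by (intro add_mono mult_right_mono) auto
  also have "\<dots> = W_const * lindeberg_rate p n"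
    unfolding lindeberg_rate_def by (simp only: distrib_left)
  finally show ?thesis .
qed

text \<open>The exponent balances the terms of \<open>lindeberg_rate\<close> well enough for the rate that the theorem needs.\<close>

definition sub_len :: "real \<Rightarrow> nat \<Rightarrow> nat" where
  "sub_len \<rho> n = nat \<lfloor>real n powr (\<delta> / (3 * (\<rho> + 1)))\<rfloor>"

definition w1_err :: "real \<Rightarrow> nat \<Rightarrow> real" where
  "w1_err \<rho> n = W_const / sqrt v * (lindeberg_rate (sub_len \<rho> n) n / sqrt (real n))"

lemma sub_len_bounds:
  assumes \<rho>: "1 < \<rho>" and n: "1 \<le> n"
  defines "x \<equiv> \<delta> / (3 * (\<rho> + 1))"
  shows "1 \<le> sub_len \<rho> n" "sub_len \<rho> n \<le> n" "real (sub_len \<rho> n) \<le> real n powr x"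
    "real n powr x / 2 \<le> real (sub_len \<rho> n)"
proof -
  have x: "0 < x" "x \<le> 1" using \<rho> \<delta> by (auto simp: x_def divide_le_eq)
  have n1: "1 \<le> real n powr x" using n x by (intro ge_one_powr_ge_zero) auto
  have nn: "real n powr x \<le> real n" using powr_mono[of x 1 "real n"] x n by simp
  have eq: "real (sub_len \<rho> n) = of_int \<lfloor>real n powr x\<rfloor>"
    using n1 by (simp add: sub_len_def x_def)
  show "1 \<le> sub_len \<rho> n"
    unfolding sub_len_def x_def[symmetric] using n1 by (simp add: le_nat_iff)
  show le: "real (sub_len \<rho> n) \<le> real n powr x" unfolding eq by simp
  show "sub_len \<rho> n \<le> n" using le nn by linarith
  have "1 \<le> real (sub_len \<rho> n)" using \<open>1 \<le> sub_len \<rho> n\<close> by simp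
  moreover have "real n powr x < real (sub_len \<rho> n) + 1" unfolding eq by linarith
  ultimately show "real n powr x / 2 \<le> real (sub_len \<rho> n)" by linarith
qed

text \<open>The function \<open>r * f (x / r)\<close> is again 1-Lipschitz, so normalising the sum
  divides the error by r.\<close>

lemma w1_bound:
  assumes f: "1-lipschitz_on UNIV f" and v: "0 < v" and \<rho>: "1 < \<rho>" and n: "1 \<le> n"
  shows "\<bar>expectation (\<lambda>w. f (psum a n w / sqrt (real n * v))) - (\<integral>z. f z \<partial>gauss)\<bar> \<le> w1_err \<rho> n"
proof -
  define r where "r = sqrt (real n * v)"
  have r: "0 < r" using v n by (simp add: r_def)
  define f' where "f' x = r * f (x / r)" for x
  have f': "1-lipschitz_on UNIV f'"
  proof (rule lipschitz_absI)
    fix x y :: real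
    have "\<bar>f' x - f' y\<bar> = r * \<bar>f (x / r) - f (y / r)\<bar>"
      using r by (simp add: f'_def abs_mult flip: right_diff_distrib)
    also have "\<dots> \<le> r * (1 * \<bar>x / r - y / r\<bar>)" using r by (intro mult_left_mono lipschitz_absD[OF f]) auto
    also have "\<dots> = 1 * \<bar>x - y\<bar>" using r by (simp flip: diff_divide_distrib)
    finally show "\<bar>f' x - f' y\<bar> \<le> 1 * \<bar>x - y\<bar>" .
  qed simp
  let ?p = "sub_len \<rho> n"
  have "\<bar>expectation (\<lambda>w. f' (psum a n w)) - (\<integral>z. f' (r * z) \<partial>gauss)\<bar> \<le> W_const * lindeberg_rate ?p n"
    unfolding r_def by (rule lindeberg_bound[OF f' v]) (use sub_len_bounds[OF \<rho> n] in auto)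
  moreover have "expectation (\<lambda>w. f' (psum a n w)) - (\<integral>z. f' (r * z) \<partial>gauss)
     = r * (expectation (\<lambda>w. f (psum a n w / r)) - (\<integral>z. f z \<partial>gauss))"
    using r by (simp add: f'_def right_diff_distrib)
  ultimately have "r * \<bar>expectation (\<lambda>w. f (psum a n w / r)) - (\<integral>z. f z \<partial>gauss)\<bar> \<le> W_const * lindeberg_rate ?p n"
    using r by (simp add: abs_mult)
  then have "\<bar>expectation (\<lambda>w. f (psum a n w / r)) - (\<integral>z. f z \<partial>gauss)\<bar> \<le> W_const * lindeberg_rate ?p n / r"
    using r by (simp add: pos_le_divide_eq mult.commute)
  also have "\<dots> = w1_err \<rho> n" by (simp add: w1_err_def r_def real_sqrt_mult)
  finally show ?thesis unfolding r_def .
qed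

text \<open>With sub-blocks of length about n to the power x = \<delta> / (3 * (\<rho> + 1)), the
  four terms of the rate, divided by sqrt n, have the exponents x - 1/2, 1/2 - x * \<tau>', x * (2 -
  \<tau>) and at most 3 * x - \<delta> / 2 (here \<delta> \<le> 1 bounds 2 + \<delta> by 3). The
  choice of x makes the last one equal to the exponent claimed (\<open>I4\<close>);
  \<open>I1\<close> to \<open>I3\<close> show that the other three do not exceed it.\<close>

lemma w1_err_le:
  assumes \<rho>: "1 < \<rho>" and \<theta>_eq: "\<theta> = \<rho> * (2 + \<delta>) * (1 + \<delta>) / \<delta>\<^sup>2" and n: "1 \<le> n" and v: "0 < v"
  shows "w1_err \<rho> n \<le> W_const / sqrt v * (2 + 2 powr \<tau>' + 2 powr (\<tau> - 2))
     * (real n powr (- (\<delta> * ((\<rho> - 1) / (\<rho> + 1))) / 2) * (1 + ln (real n)))"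
proof -
  let ?x = "\<delta> / (3 * (\<rho> + 1))" and ?e = "\<delta> * ((\<rho> - 1) / (\<rho> + 1)) / 2" and ?p = "real (sub_len \<rho> n)" and ?n = "real n"
  note p = sub_len_bounds[OF \<rho> n]
  have p1: "1 \<le> ?p" using p(1) by simp
  have n1: "1 \<le> ?n" using n by simp
  have x: "0 < ?x" using \<rho> \<delta> by simp
  have "\<theta> * \<delta> / (2 + \<delta>) = \<rho> * (1 + \<delta>) / \<delta>" "\<theta> * (1 + \<delta>) / (2 + \<delta>) = \<rho> * (1 + \<delta>)\<^sup>2 / \<delta>\<^sup>2"
    using \<delta> unfolding \<theta>_eq by (simp_all add: divide_simps power2_eq_square)
  then have \<tau>: "\<tau> = \<rho> * (1 + \<delta>) / \<delta>" and \<tau>': "\<tau>' = \<rho> * (1 + \<delta>)\<^sup>2 / \<delta>\<^sup>2"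
    unfolding \<tau>_def \<tau>'_def by auto
  have \<delta>\<delta>: "\<delta> * \<delta> \<le> \<delta>" using \<delta> by (simp add: mult_left_le)
  have \<tau>'0: "0 \<le> \<tau>'" using \<rho> unfolding \<tau>' by simp
  have u: "\<rho> + 1 \<noteq> 0" using \<rho> by simp
  have x6: "?x = 2 * \<delta> / (6 * (\<rho> + 1))" using u by (simp add: divide_simps)
  have e6: "?e = 3 * \<delta> * (\<rho> - 1) / (6 * (\<rho> + 1))" using u by (simp add: divide_simps)
  have I1: "?x - 1 / 2 \<le> - ?e"
  proof -
    have "\<delta> * (3 * \<rho> - 1) \<le> 1 * (3 * \<rho> - 1)" using \<delta> \<rho> by (intro mult_right_mono) auto
    also have "\<dots> \<le> 1 / 2 * (6 * (\<rho> + 1))" by simp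
    finally have "\<delta> * (3 * \<rho> - 1) \<le> 1 / 2 * (6 * (\<rho> + 1))" .
    then have "\<delta> * (3 * \<rho> - 1) / (6 * (\<rho> + 1)) \<le> 1 / 2" using \<rho> by (subst pos_divide_le_eq) auto
    moreover have "?x + ?e = \<delta> * (3 * \<rho> - 1) / (6 * (\<rho> + 1))"
      unfolding x6 e6 add_divide_distrib[symmetric] by (simp add: algebra_simps)
    ultimately show ?thesis by linarith
  qed
  have I2: "1 / 2 - ?x * \<tau>' \<le> - ?e"
  proof -
    have "\<delta> * \<delta> * \<rho> \<le> \<delta> * \<rho>" using \<delta>\<delta> \<rho> by (intro mult_right_mono) auto
    moreover have "4 * \<delta> \<le> 1 + 4 * (\<delta> * \<delta>)"
      using zero_le_square[of "2 * \<delta> - 1"] by (simp add: algebra_simps)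
    moreover have "2 * \<rho> * (1 + \<delta>)\<^sup>2 - (3 * \<delta> * (\<rho> + 1) + 3 * (\<delta> * \<delta>) * (\<rho> - 1))
        = 2 * \<rho> + \<delta> * \<rho> - \<delta> * \<delta> * \<rho> - 3 * \<delta> + 3 * (\<delta> * \<delta>)"
      by (simp add: power2_eq_square algebra_simps)
    ultimately have key: "3 * \<delta> * (\<rho> + 1) + 3 * (\<delta> * \<delta>) * (\<rho> - 1) \<le> 2 * \<rho> * (1 + \<delta>)\<^sup>2"
      using \<rho> by linarith
    have d: "0 < 6 * \<delta> * (\<rho> + 1)" using \<rho> \<delta> by simp
    have "1 / 2 + ?e = (3 * \<delta> * (\<rho> + 1) + 3 * (\<delta> * \<delta>) * (\<rho> - 1)) / (6 * \<delta> * (\<rho> + 1))"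
      unfolding e6 using u \<delta> by (simp add: divide_simps) (simp add: algebra_simps)
    also have "\<dots> \<le> 2 * \<rho> * (1 + \<delta>)\<^sup>2 / (6 * \<delta> * (\<rho> + 1))" using key d by (intro divide_right_mono) auto
    also have "\<dots> = ?x * \<tau>'" unfolding \<tau>' using u \<delta> by (simp add: divide_simps power2_eq_square)
    finally show ?thesis by linarith
  qed
  have I3: "?x * (2 - \<tau>) \<le> - ?e"
  proof -
    have "\<rho> * \<delta> \<le> \<rho> * 1" using \<rho> \<delta> by (intro mult_left_mono) auto
    moreover have "2 * (\<rho> * (1 + \<delta>) - 2 * \<delta>) - 3 * \<delta> * (\<rho> - 1) = 2 * \<rho> - \<rho> * \<delta> - \<delta>"
      by (simp add: algebra_simps)
    ultimately have key: "3 * \<delta> * (\<rho> - 1) \<le> 2 * (\<rho> * (1 + \<delta>) - 2 * \<delta>)"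
      using \<rho> \<delta> by linarith
    have "?e = 3 * \<delta> * (\<rho> - 1) / (6 * (\<rho> + 1))" by (rule e6)
    also have "\<dots> \<le> 2 * (\<rho> * (1 + \<delta>) - 2 * \<delta>) / (6 * (\<rho> + 1))" using key \<rho> by (intro divide_right_mono) auto
    also have "\<dots> = - (?x * (2 - \<tau>))" unfolding \<tau> using u \<delta> by (simp add: divide_simps) (simp add: algebra_simps)
    finally show ?thesis by linarith
  qed
  have I4: "?x * 3 - \<delta> / 2 = - ?e" using u by (simp add: divide_simps) (simp add: algebra_simps)
  have L: "0 \<le> ln ?n" using n1 by simp
  let ?r = "?n powr (- ?e)"
  have npow: "?n powr a \<le> ?r" if "a \<le> - ?e" for a using that n1 by (intro powr_mono) auto
  have sq: "sqrt ?n = ?n powr (1 / 2)" using n1 by (simp add: powr_half_sqrt)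
  have t1: "?p / sqrt ?n \<le> 1 * ?r"
  proof -
    have "?p / sqrt ?n \<le> ?n powr ?x / ?n powr (1 / 2)" unfolding sq using p(3) by (intro divide_right_mono) auto
    also have "\<dots> = ?n powr (?x - 1 / 2)" using n1 by (simp add: powr_diff)
    also have "\<dots> \<le> ?r" by (rule npow[OF I1])
    finally show ?thesis by simp
  qed
  have half: "(?n powr ?x / 2) powr (- a) = 2 powr a * ?n powr (- ?x * a)" for a
    by (simp add: powr_divide powr_powr powr_minus_divide)
  have t2: "?n * ?p powr (- \<tau>') / sqrt ?n \<le> 2 powr \<tau>' * ?r"
  proof -
    have "?p powr (- \<tau>') \<le> (?n powr ?x / 2) powr (- \<tau>')"
      using p(4) n1 \<tau>'0 by (intro powr_mono2') auto
    then have "?n * ?p powr (- \<tau>') / sqrt ?n \<le> ?n * (2 powr \<tau>' * ?n powr (- ?x * \<tau>')) / sqrt ?n"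
      unfolding half using n1 by (intro divide_right_mono mult_left_mono) auto
    also have "\<dots> = 2 powr \<tau>' * (?n powr (1 / 2) * ?n powr (- ?x * \<tau>'))"
      using n1 by (simp add: real_div_sqrt powr_half_sqrt field_simps)
    also have "\<dots> = 2 powr \<tau>' * ?n powr (1 / 2 + - ?x * \<tau>')" by (simp only: powr_add)
    also have "\<dots> \<le> 2 powr \<tau>' * ?r" using I2 by (intro mult_left_mono npow) auto
    finally show ?thesis .
  qed
  have t3: "?p powr (2 - \<tau>) * sqrt ?n / sqrt ?n \<le> 2 powr (\<tau> - 2) * ?r"
  proof -
    have "?p powr (2 - \<tau>) \<le> (?n powr ?x / 2) powr (2 - \<tau>)"
      using p(4) n1 \<tau>_gt by (intro powr_mono2') auto
    also have "\<dots> = 2 powr (\<tau> - 2) * ?n powr (?x * (2 - \<tau>))"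
    proof -
      have e1: "- (\<tau> - 2) = 2 - \<tau>" by simp
      have e2: "- ?x * (\<tau> - 2) = ?x * (2 - \<tau>)" by (simp only: minus_mult_commute e1)
      show ?thesis using half[of "\<tau> - 2"] unfolding e1 e2 .
    qed
    also have "\<dots> \<le> 2 powr (\<tau> - 2) * ?r" by (intro mult_left_mono npow I3) auto
    finally show ?thesis using n1 by simp
  qed
  have t4: "?p powr (2 + \<delta>) * ?n powr ((1 - \<delta>) / 2) * (1 + ln ?n) / sqrt ?n \<le> ?r * (1 + ln ?n)"
  proof -
    have "?p powr (2 + \<delta>) \<le> ?p powr 3" using p1 \<delta> by (intro powr_mono) auto
    also have "\<dots> \<le> (?n powr ?x) powr 3" using p(3) by (intro powr_mono2) auto
    also have "\<dots> = ?n powr (?x * 3)" by (rule powr_powr)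
    finally have "?p powr (2 + \<delta>) * (?n powr ((1 - \<delta>) / 2) / ?n powr (1 / 2)) \<le> ?n powr (?x * 3) * (?n powr ((1 - \<delta>) / 2) / ?n powr (1 / 2))"
      by (intro mult_right_mono) auto
    also have "\<dots> = ?n powr (?x * 3 + ((1 - \<delta>) / 2 - 1 / 2))"
      by (simp only: powr_add powr_diff)
    also have "?x * 3 + ((1 - \<delta>) / 2 - 1 / 2) = - ?e"
      using I4 by (simp add: diff_divide_distrib)
    finally have "?p powr (2 + \<delta>) * (?n powr ((1 - \<delta>) / 2) / ?n powr (1 / 2)) * (1 + ln ?n) \<le> ?r * (1 + ln ?n)"
      using L by (intro mult_right_mono) auto
    then show ?thesis unfolding sq by simp
  qed
  have r0: "0 \<le> ?r" by simp
  have mono: "c * ?r \<le> c * (?r * (1 + ln ?n))" if "0 \<le> c" for c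
    using that L r0 by (intro mult_left_mono) (auto simp: distrib_left)
  have "lindeberg_rate (sub_len \<rho> n) n / sqrt ?n = ?p / sqrt ?n + ?n * ?p powr (- \<tau>') / sqrt ?n
     + ?p powr (2 - \<tau>) * sqrt ?n / sqrt ?n + ?p powr (2 + \<delta>) * ?n powr ((1 - \<delta>) / 2) * (1 + ln ?n) / sqrt ?n"
    unfolding lindeberg_rate_def by (simp only: add_divide_distrib)
  also have "\<dots> \<le> 1 * (?r * (1 + ln ?n)) + 2 powr \<tau>' * (?r * (1 + ln ?n)) + 2 powr (\<tau> - 2) * (?r * (1 + ln ?n)) + ?r * (1 + ln ?n)"
    by (intro add_mono order_trans[OF t1 mono] order_trans[OF t2 mono] order_trans[OF t3 mono] t4) auto
  also have "\<dots> = (2 + 2 powr \<tau>' + 2 powr (\<tau> - 2)) * (?r * (1 + ln ?n))" by (simp only: distrib_right)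
  finally have "lindeberg_rate (sub_len \<rho> n) n / sqrt ?n \<le> (2 + 2 powr \<tau>' + 2 powr (\<tau> - 2)) * (?r * (1 + ln ?n))" .
  moreover have "0 \<le> W_const / sqrt v" using consts_nonneg[OF v] v by (simp add: W_const_def)
  ultimately have "w1_err \<rho> n \<le> W_const / sqrt v * ((2 + 2 powr \<tau>' + 2 powr (\<tau> - 2)) * (?r * (1 + ln ?n)))"
    unfolding w1_err_def by (rule mult_left_mono)
  also have "- ?e = - (\<delta> * ((\<rho> - 1) / (\<rho> + 1))) / 2" by simp
  finally show ?thesis by (simp only: mult.assoc)
qed

lemma w1_err_nonneg:
  assumes "0 < v" "1 < \<rho>" "1 \<le> n"
  shows "0 \<le> w1_err \<rho> n"
  using w1_bound[OF _ assms, of "\<lambda>_. 0" 0] by (simp add: lipschitz_on_def)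

text \<open>The strict inequality leaves a negative power of n, half of which absorbs the
  logarithm.\<close>

lemma w1_err_tendsto:
  assumes \<rho>: "1 < \<rho>" and \<theta>_eq: "\<theta> = \<rho> * (2 + \<delta>) * (1 + \<delta>) / \<delta>\<^sup>2" and v: "0 < v"
    and \<beta>: "\<beta> < \<delta> * ((\<rho> - 1) / (\<rho> + 1))"
  shows "(\<lambda>n. real n powr (\<beta> / 2) * w1_err \<rho> n) \<longlonglongrightarrow> 0"
proof -
  let ?e = "\<delta> * ((\<rho> - 1) / (\<rho> + 1))" and ?K = "W_const / sqrt v * (2 + 2 powr \<tau>' + 2 powr (\<tau> - 2))"
  define c where "c = (?e - \<beta>) / 2"
  have c: "0 < c" using \<beta> by (simp add: c_def)
  have K0: "0 \<le> ?K" using consts_nonneg[OF v] v by (auto simp: W_const_def intro!: mult_nonneg_nonneg)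
  have up: "real n powr (\<beta> / 2) * w1_err \<rho> n \<le> ?K * (1 + 2 / c) * real n powr (- (c / 2))" if n: "1 \<le> n" for n
  proof -
    have n1: "1 \<le> real n" using n by simp
    have "ln (real n) \<le> real n powr (c / 2) / (c / 2)" using n1 c by (intro ln_powr_bound) auto
    moreover have "1 \<le> real n powr (c / 2)" using n1 c by (intro ge_one_powr_ge_zero) auto
    ultimately have l: "1 + ln (real n) \<le> (1 + 2 / c) * real n powr (c / 2)" by (simp add: algebra_simps)
    have "real n powr (\<beta> / 2) * w1_err \<rho> n \<le> real n powr (\<beta> / 2) * (?K * (real n powr (- ?e / 2) * (1 + ln (real n))))"
      by (intro mult_left_mono w1_err_le[OF \<rho> \<theta>_eq n v]) auto
    also have "\<dots> \<le> real n powr (\<beta> / 2) * (?K * (real n powr (- ?e / 2) * ((1 + 2 / c) * real n powr (c / 2))))"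
      by (intro mult_left_mono l K0) auto
    also have "\<dots> = ?K * (1 + 2 / c) * (real n powr (\<beta> / 2) * real n powr (- ?e / 2) * real n powr (c / 2))"
      by (simp only: mult_ac)
    also have "real n powr (\<beta> / 2) * real n powr (- ?e / 2) * real n powr (c / 2) = real n powr (- (c / 2))"
    proof -
      have "\<beta> / 2 + - E / 2 + (E - \<beta>) / 2 / 2 = - ((E - \<beta>) / 2 / 2)" for E by (simp add: field_simps)
      then have "\<beta> / 2 + - ?e / 2 + c / 2 = - (c / 2)" unfolding c_def .
      then show ?thesis by (simp only: powr_add[symmetric])
    qed
    finally show ?thesis .
  qed
  have lim: "(\<lambda>n. ?K * (1 + 2 / c) * real n powr (- (c / 2))) \<longlonglongrightarrow> 0"
    using c by (intro tendsto_mult_right_zero tendsto_neg_powr filterlim_real_sequentially) auto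
  show ?thesis
  proof (rule tendsto_sandwich[OF _ _ tendsto_const lim])
    show "\<forall>\<^sub>F n in sequentially. 0 \<le> real n powr (\<beta> / 2) * w1_err \<rho> n"
      using w1_err_nonneg[OF v \<rho>] by (intro eventually_sequentiallyI[of 1]) auto
    show "\<forall>\<^sub>F n in sequentially. real n powr (\<beta> / 2) * w1_err \<rho> n \<le> ?K * (1 + 2 / c) * real n powr (- (c / 2))"
      using up by (intro eventually_sequentiallyI[of 1]) auto
  qed
qed

end

section \<open>Riemann sums of piecewise Lipschitz functions\<close>

text \<open>Off the jump set the value at x depends only on which jump points lie to the left of x,
  and there are finitely many such sets. At the jump points themselves the values are arbitrary but
  finite in number.\<close>

lemma piecewise_constant01_finite_range:
  assumes "piecewise_constant01 p"
  shows "finite (p ` {0..1})"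
proof -
  obtain D where D: "finite D"
    and const: "\<And>x y. x \<in> {0..1} \<Longrightarrow> y \<in> {0..1} \<Longrightarrow> x \<le> y \<Longrightarrow> {x..y} \<inter> D = {} \<Longrightarrow> p x = p y"
    using assms unfolding piecewise_constant01_def by blast
  define c where "c S = p (SOME x. x \<in> {0..1} \<and> x \<notin> D \<and> {d \<in> D. d < x} = S)" for S
  have eq: "p x = c {d \<in> D. d < x}" if x: "x \<in> {0..1}" "x \<notin> D" for x
  proof -
    let ?y = "SOME y. y \<in> {0..1} \<and> y \<notin> D \<and> {d \<in> D. d < y} = {d \<in> D. d < x}"
    have y: "?y \<in> {0..1} \<and> ?y \<notin> D \<and> {d \<in> D. d < ?y} = {d \<in> D. d < x}"
      by (rule someI[of _ x]) (use x in auto)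
    have "p u = p w" if uw: "u \<in> {0..1}" "w \<in> {0..1}" "u \<notin> D" "w \<notin> D" "{d \<in> D. d < u} = {d \<in> D. d < w}" "u \<le> w" for u w
    proof (rule const)
      show "{u..w} \<inter> D = {}"
      proof (rule ccontr)
        assume "{u..w} \<inter> D \<noteq> {}"
        then obtain d where d: "d \<in> D" "u \<le> d" "d \<le> w" by auto
        from d uw(4) have "d < w" by (cases "d = w") auto
        then have "d \<in> {d \<in> D. d < u}" unfolding uw(5) using d(1) by simp
        with d show False by simp
      qed
    qed (use uw in auto)
    note const' = this
    have "p x = p ?y"
    proof (cases "x \<le> ?y")
      case True
      show ?thesis by (rule const') (use x y True in auto)
    next
      case False
      show ?thesis by (rule const'[symmetric]) (use x y False in auto)
    qed
    then show ?thesis unfolding c_def .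
  qed
  have "p ` {0..1} \<subseteq> p ` D \<union> c ` Pow D"
  proof (rule image_subsetI)
    fix x :: real assume x: "x \<in> {0..1}"
    show "p x \<in> p ` D \<union> c ` Pow D"
    proof (cases "x \<in> D")
      case False
      then show ?thesis using eq[OF x] by auto
    qed auto
  qed
  then show ?thesis using D by (auto intro: finite_subset)
qed

lemma piecewise_lipschitz01_bounded:
  assumes "piecewise_lipschitz01 \<sigma>"
  obtains S where "\<And>x. x \<in> {0..1} \<Longrightarrow> \<bar>\<sigma> x\<bar> \<le> S"
proof -
  obtain g p L where g: "L-lipschitz_on {0..1} g" and p: "piecewise_constant01 p"
    and eq: "\<And>x. x \<in> {0..1} \<Longrightarrow> \<sigma> x = g x + p x"
    using assms unfolding piecewise_lipschitz01_def by blast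
  have "compact (g ` {0..1})"
    by (intro compact_continuous_image lipschitz_on_continuous_on[OF g]) auto
  then have "bounded (g ` {0..1})" by (rule compact_imp_bounded)
  then obtain A where "\<forall>y\<in>g ` {0..1}. norm y \<le> A" unfolding bounded_iff by blast
  then have A: "\<And>x. x \<in> {0..1} \<Longrightarrow> \<bar>g x\<bar> \<le> A" by simp
  have "bounded (p ` {0..1})" by (intro finite_imp_bounded piecewise_constant01_finite_range p)
  then obtain B where "\<forall>y\<in>p ` {0..1}. norm y \<le> B" unfolding bounded_iff by blast
  then have B: "\<And>x. x \<in> {0..1} \<Longrightarrow> \<bar>p x\<bar> \<le> B" by simp
  show ?thesis
  proof (rule that[of "A + B"])
    fix x :: real assume x: "x \<in> {0..1}"
    show "\<bar>\<sigma> x\<bar> \<le> A + B" using A[OF x] B[OF x] unfolding eq[OF x] by linarith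
  qed
qed

text \<open>The extension by a constant is continuous except at the jump points and at 0 and 1, and
  countably many exceptional points do not affect measurability.\<close>

lemma piecewise_lipschitz01_borel:
  assumes "piecewise_lipschitz01 \<sigma>"
  shows "(\<lambda>x. if x \<in> {0..1} then \<sigma> x else c) \<in> borel_measurable borel"
proof -
  obtain g p L where g: "L-lipschitz_on {0..1} g" and p: "piecewise_constant01 p"
    and eq: "\<And>x. x \<in> {0..1} \<Longrightarrow> \<sigma> x = g x + p x"
    using assms unfolding piecewise_lipschitz01_def by blast
  obtain D where D: "finite D"
    and const: "\<And>x y. x \<in> {0..1} \<Longrightarrow> y \<in> {0..1} \<Longrightarrow> x \<le> y \<Longrightarrow> {x..y} \<inter> D = {} \<Longrightarrow> p x = p y"
    using p unfolding piecewise_constant01_def by blast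
  let ?f = "\<lambda>x. if x \<in> {0..1} then \<sigma> x else c" and ?X = "D \<union> {0, 1}"
  have "isCont ?f x" if x: "x \<in> - ?X" for x
  proof -
    have "open (- ?X)" using D by (intro open_Compl finite_imp_closed) auto
    then obtain e where e: "0 < e" "ball x e \<subseteq> - ?X" using x by (meson open_contains_ball)
    show ?thesis
    proof (cases "x \<in> {0..1}")
      case True
      then have x01: "0 < x" "x < 1" using x by auto
      have "open ({0<..<1} \<inter> ball x e)" by auto
      moreover have "x \<in> {0<..<1} \<inter> ball x e" using x01 e by auto
      moreover have "?f y = g y + p x" if y: "y \<in> {0<..<1} \<inter> ball x e" for y
      proof -
        have "{min x y..max x y} \<subseteq> ball x e"
          using y e by (auto simp: dist_real_def min_def max_def split: if_splits)
        then have "{min x y..max x y} \<inter> D = {}" using e(2) by auto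
        then have "p (min x y) = p (max x y)" using x01 y by (intro const) auto
        then have "p x = p y" by (auto simp: min_def max_def split: if_splits)
        then show ?thesis using y eq[of y] by auto
      qed
      ultimately have ev: "\<forall>\<^sub>F y in nhds x. ?f y = g y + p x"
        unfolding eventually_nhds by blast
      have "continuous_on {0<..<1} g"
        by (rule continuous_on_subset[OF lipschitz_on_continuous_on[OF g]]) auto
      then have "isCont g x" using x01 by (simp add: continuous_on_eq_continuous_at)
      then have "isCont (\<lambda>y. g y + p x) x" by simp
      then show ?thesis using isCont_cong[OF ev] by simp
    next
      case False
      have "open (- {0..1::real})" by (intro open_Compl closed_atLeastAtMost)
      then have ev: "\<forall>\<^sub>F y in nhds x. ?f y = c" unfolding eventually_nhds using False by (intro exI[of _ "- {0..1}"]) auto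
      show ?thesis using isCont_cong[OF ev] by simp
    qed
  qed
  then have "continuous_on (- ?X) ?f" by (intro continuous_at_imp_continuous_on) auto
  then show ?thesis
    by (intro borel_measurable_continuous_countable_exceptions[of ?X]) (use D in \<open>auto intro: countable_finite\<close>)
qed

text \<open>Each jump point lies in one block only, so the oscillations over the blocks of an equidistant
  partition have a sum that is bounded independently of the number of blocks.\<close>

lemma piecewise_lipschitz01_oscillation:
  assumes "piecewise_lipschitz01 \<sigma>"
  obtains K where "0 \<le> K"
    "\<And>b. 1 \<le> b \<Longrightarrow> \<exists>d. (\<forall>j. 0 \<le> d j) \<and> (\<Sum>j<b. d j) \<le> K \<and>
       (\<forall>j<b. \<forall>x. real j / real b < x \<and> x \<le> real (Suc j) / real b \<longrightarrow> \<bar>\<sigma> x - \<sigma> (real (Suc j) / real b)\<bar> \<le> d j)"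
proof -
  obtain g p L where g: "L-lipschitz_on {0..1} g" and p: "piecewise_constant01 p"
    and eq: "\<And>x. x \<in> {0..1} \<Longrightarrow> \<sigma> x = g x + p x"
    using assms unfolding piecewise_lipschitz01_def by blast
  obtain D where D: "finite D"
    and const: "\<And>x y. x \<in> {0..1} \<Longrightarrow> y \<in> {0..1} \<Longrightarrow> x \<le> y \<Longrightarrow> {x..y} \<inter> D = {} \<Longrightarrow> p x = p y"
    using p unfolding piecewise_constant01_def by blast
  obtain S where S: "\<And>x. x \<in> {0..1} \<Longrightarrow> \<bar>\<sigma> x\<bar> \<le> S" using piecewise_lipschitz01_bounded[OF assms] by blast
  have S0: "0 \<le> S" using S[of 0] by simp
  have L0: "0 \<le> L" using g by (rule lipschitz_on_nonneg)
  show ?thesis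
  proof (rule that[of "L + 2 * S * real (card D)"])
    show "0 \<le> L + 2 * S * real (card D)" using S0 L0 by simp
    fix b :: nat assume b: "1 \<le> b"
    \<comment> \<open>Open on the left, closed on the right: with n = b * l these intervals contain
      exactly the points i / n of block j, which runs from j * l + 1 to (j + 1) * l.\<close>
    define I where "I j = {real j / real b <.. real (Suc j) / real b}" for j
    define d where "d j = L / real b + (if I j \<inter> D = {} then 0 else 2 * S)" for j
    have in01: "x \<in> {0..1}" if "x \<in> I j" "j < b" for x j
    proof -
      have "real (Suc j) / real b \<le> 1" using that b by simp
      moreover have "0 \<le> real j / real b" by simp
      moreover have "real j / real b < x" "x \<le> real (Suc j) / real b" using that(1) by (auto simp only: I_def greaterThanAtMost_iff)
      ultimately show ?thesis unfolding atLeastAtMost_iff by linarith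
    qed
    have d0: "0 \<le> d j" for j using S0 L0 by (simp add: d_def)
    have bd: "\<bar>\<sigma> x - \<sigma> (real (Suc j) / real b)\<bar> \<le> d j" if j: "j < b" and x: "x \<in> I j" for j x
    proof -
      let ?y = "real (Suc j) / real b"
      have yI: "?y \<in> I j" using b by (auto simp: I_def divide_strict_right_mono)
      note x01 = in01[OF x j] and y01 = in01[OF yI j]
      have xy: "x \<le> ?y" using x by (simp add: I_def)
      show ?thesis
      proof (cases "I j \<inter> D = {}")
        case True
        have "{x..?y} \<subseteq> I j" using x by (auto simp: I_def)
        then have "p x = p ?y" using True by (intro const x01 y01 xy) auto
        then have "\<bar>\<sigma> x - \<sigma> ?y\<bar> = \<bar>g x - g ?y\<bar>" unfolding eq[OF x01] eq[OF y01] by simp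
        also have "\<dots> \<le> L * \<bar>x - ?y\<bar>" using lipschitz_onD[OF g x01 y01] by (simp add: dist_real_def)
        also have "\<dots> \<le> L * (1 / real b)"
        proof (intro mult_left_mono L0)
          have "?y - real j / real b = 1 / real b" by (simp add: diff_divide_distrib[symmetric])
          then show "\<bar>x - ?y\<bar> \<le> 1 / real b" using x by (auto simp: I_def)
        qed
        finally show ?thesis using True by (simp add: d_def)
      next
        case False
        have "\<bar>\<sigma> x - \<sigma> ?y\<bar> \<le> 2 * S" using S[OF x01] S[OF y01] by linarith
        then show ?thesis using False L0 by (simp add: d_def add_increasing)
      qed
    qed
    let ?J = "{j. j < b \<and> I j \<inter> D \<noteq> {}}"
    have sum_d: "(\<Sum>j<b. d j) = L + (\<Sum>j<b. if I j \<inter> D = {} then 0 else 2 * S)"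
      using b by (simp add: d_def sum.distrib)
    have "(\<Sum>j<b. if I j \<inter> D = {} then 0 else 2 * S) = (\<Sum>j\<in>?J. 2 * S)"
      by (intro sum.mono_neutral_cong_right) auto
    also have "\<dots> = 2 * S * real (card ?J)" by simp
    also have "\<dots> \<le> 2 * S * real (card D)"
    proof -
      \<comment> \<open>One jump point chosen from every block that contains any; disjointness of
        the blocks makes the choice injective, which bounds the number of such blocks by the number
        of jump points.\<close>
      define h where "h j = (SOME x. x \<in> I j \<inter> D)" for j
      have h: "h j \<in> I j \<inter> D" if "j \<in> ?J" for j
        unfolding h_def using that someI_ex[of "\<lambda>x. x \<in> I j \<inter> D"] by blast
      have "inj_on h ?J"
      proof (rule inj_onI)
        fix i j assume ij: "i \<in> ?J" "j \<in> ?J" "h i = h j"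
        have disj: "False" if "i' < j'" "z \<in> I i'" "z \<in> I j'" for i' j' z
        proof -
          have "real (Suc i') / real b \<le> real j' / real b" using that by (intro divide_right_mono) auto
          then show False using that by (auto simp: I_def)
        qed
        have "h i \<in> I i" "h i \<in> I j" using h[OF ij(1)] h[OF ij(2)] ij(3) by auto
        then show "i = j" using disj[of i j "h i"] disj[of j i "h i"] by (cases i j rule: linorder_cases) auto
      qed
      then have "card ?J \<le> card D" using h D by (intro card_inj_on_le) auto
      then show ?thesis using S0 by (intro mult_left_mono) auto
    qed
    finally have "(\<Sum>j<b. d j) \<le> L + 2 * S * real (card D)" using sum_d by simp
    then show "\<exists>d. (\<forall>j. 0 \<le> d j) \<and> (\<Sum>j<b. d j) \<le> L + 2 * S * real (card D) \<and>
       (\<forall>j<b. \<forall>x. real j / real b < x \<and> x \<le> real (Suc j) / real b \<longrightarrow> \<bar>\<sigma> x - \<sigma> (real (Suc j) / real b)\<bar> \<le> d j)"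
      using d0 bd unfolding I_def greaterThanAtMost_iff by blast
  qed
qed

lemma indicator_blocks:
  assumes "1 \<le> b"
  shows "(\<Sum>j<m. indicator {real j / real b <.. real (Suc j) / real b} x :: real) = indicator {0 <.. real m / real b} x"
proof (induction m)
  case (Suc m)
  have aux: "indicator {0 <.. u} x + indicator {u <.. w} x = (indicator {0 <.. w} x :: real)" if "0 \<le> u" "u \<le> w" for u w
    using that by (auto simp: indicator_def)
  have "indicator {0 <.. real m / real b} x + indicator {real m / real b <.. real (Suc m) / real b} x
      = (indicator {0 <.. real (Suc m) / real b} x :: real)"
    by (rule aux) (auto simp: divide_right_mono)
  then show ?case unfolding sum.lessThan_Suc Suc .
qed simp

lemma riemann_sum_le:
  fixes H :: "real \<Rightarrow> real"
  assumes b: "1 \<le> b" and [measurable]: "H \<in> borel_measurable borel"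
    and S: "\<And>x. \<bar>H x\<bar> \<le> S"
    and osc: "\<And>j x. j < b \<Longrightarrow> real j / real b < x \<Longrightarrow> x \<le> real (Suc j) / real b \<Longrightarrow> \<bar>H x - c j\<bar> \<le> d j"
  shows "\<bar>(\<Sum>j<b. c j) / real b - (LBINT x:{0..1}. H x)\<bar> \<le> (\<Sum>j<b. d j) / real b"
proof -
  let ?I = "\<lambda>j. {real j / real b <.. real (Suc j) / real b}"
  have Imeas: "measure lborel (?I j) = 1 / real b" for j
    by (subst measure_lborel_Ioc) (auto simp: divide_right_mono diff_divide_distrib[symmetric])
  have Ifin: "emeasure lborel (?I j) < \<infinity>" for j
    by (subst emeasure_lborel_Ioc) (auto simp: divide_right_mono)
  have int: "set_integrable lborel A H" if "A \<in> sets lborel" "emeasure lborel A < \<infinity>" for A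
    unfolding set_integrable_def using that S
    by (intro integrableI_bounded_set[where A = A and B = S]) (auto simp: indicator_def)
  have intI: "set_integrable lborel (?I j) H" for j by (rule int) (use Ifin in auto)
  have "(LBINT x:{0..1}. H x) = (LBINT x:{0<..1}. H x)"
    unfolding set_lebesgue_integral_def
  proof (rule integral_cong_AE)
    have "AE x in lborel. x \<noteq> (0::real)" by (rule AE_lborel_singleton)
    then show "AE x in lborel. indicat_real {0..1} x *\<^sub>R H x = indicat_real {0<..1} x *\<^sub>R H x"
      by eventually_elim (auto simp: indicator_def)
  qed auto
  also have "\<dots> = (\<integral>x. (\<Sum>j<b. indicator (?I j) x * H x) \<partial>lborel)"
  proof -
    have "(\<Sum>j<b. indicator (?I j) x) = (indicator {0<..1} x :: real)" for x
      using indicator_blocks[OF b, where m = b and x = x] b by simp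
    then show ?thesis
      unfolding set_lebesgue_integral_def by (simp only: sum_distrib_right[symmetric] real_scaleR_def)
  qed
  also have "\<dots> = (\<Sum>j<b. LBINT x:?I j. H x)"
    unfolding set_lebesgue_integral_def using intI
    by (subst Bochner_Integration.integral_sum) (auto simp: set_integrable_def)
  finally have eq: "(LBINT x:{0..1}. H x) = (\<Sum>j<b. LBINT x:?I j. H x)" .
  have cint: "set_integrable lborel (?I j) (\<lambda>_. k)" for j and k :: real
    unfolding set_integrable_def using Ifin[of j] by auto
  have const: "(LBINT x:?I j. k) = k / real b" for j and k :: real
    using Imeas[of j] by (simp add: set_lebesgue_integral_def measure_def)
  have blk: "\<bar>c j / real b - (LBINT x:?I j. H x)\<bar> \<le> d j / real b" if j: "j < b" for j
  proof -
    have "(LBINT x:?I j. c j - d j) \<le> (LBINT x:?I j. H x)"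
    proof (rule set_integral_mono[OF cint intI])
      fix x assume "x \<in> ?I j"
      then show "c j - d j \<le> H x" using osc[OF j, of x] by (auto simp: abs_le_iff)
    qed
    moreover have "(LBINT x:?I j. H x) \<le> (LBINT x:?I j. c j + d j)"
    proof (rule set_integral_mono[OF intI cint])
      fix x assume "x \<in> ?I j"
      then show "H x \<le> c j + d j" using osc[OF j, of x] by (auto simp: abs_le_iff)
    qed
    ultimately show ?thesis unfolding const by (simp add: diff_divide_distrib add_divide_distrib abs_le_iff)
  qed
  have "(\<Sum>j<b. c j) / real b - (LBINT x:{0..1}. H x) = (\<Sum>j<b. c j / real b - (LBINT x:?I j. H x))"
    unfolding eq by (simp only: sum_divide_distrib sum_subtractf)
  then have "\<bar>(\<Sum>j<b. c j) / real b - (LBINT x:{0..1}. H x)\<bar> \<le> (\<Sum>j<b. \<bar>c j / real b - (LBINT x:?I j. H x)\<bar>)"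
    by simp
  also have "\<dots> \<le> (\<Sum>j<b. d j / real b)" by (intro sum_mono blk) auto
  finally show ?thesis by (simp only: sum_divide_distrib)
qed

section \<open>The kernel of Gini's mean difference\<close>

definition layer :: "real \<Rightarrow> real \<Rightarrow> real" where "layer x u = (if x \<le> u then 1 else 0)"

lemma layer_measurable [measurable (raw)]:
  "f \<in> borel_measurable M \<Longrightarrow> g \<in> borel_measurable M \<Longrightarrow> (\<lambda>w. layer (f w) (g w)) \<in> borel_measurable M"
  unfolding layer_def by measurable

lemma layer_01: "0 \<le> layer x u" "layer x u \<le> 1" "\<bar>layer x u\<bar> \<le> 1"
  by (auto simp: layer_def)

text \<open>The integrand is 1 exactly if the level u separates x from y, and these levels form an
  interval of length |x - y|.\<close>

lemma layer_abs_diff_nn: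
  "(\<integral>\<^sup>+u. ennreal (layer x u + layer y u - 2 * (layer x u * layer y u)) \<partial>lborel) = ennreal \<bar>x - y\<bar>"
proof -
  have "(\<integral>\<^sup>+u. ennreal (layer x u + layer y u - 2 * (layer x u * layer y u)) \<partial>lborel)
     = (\<integral>\<^sup>+u. indicator {min x y ..< max x y} u \<partial>lborel)"
    by (intro nn_integral_cong) (auto simp: layer_def indicator_def min_def max_def)
  also have "\<dots> = ennreal (max x y - min x y)" by simp
  finally show ?thesis by (simp add: max_def min_def abs_if)
qed

lemma (in prob_space) layer_abs_diff:
  assumes X: "integrable M X" and Y: "integrable M Y"
  shows "has_bochner_integral lborel
    (\<lambda>u. expectation (\<lambda>w. layer (X w) u) + expectation (\<lambda>w. layer (Y w) u) - 2 * expectation (\<lambda>w. layer (X w) u * layer (Y w) u))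
    (expectation (\<lambda>w. \<bar>X w - Y w\<bar>))"
proof -
  interpret P: pair_sigma_finite M lborel ..
  have [measurable]: "X \<in> borel_measurable M" "Y \<in> borel_measurable M" using X Y by auto
  let ?k = "\<lambda>u w. layer (X w) u + layer (Y w) u - 2 * (layer (X w) u * layer (Y w) u)"
  have k01: "0 \<le> ?k u w" "?k u w \<le> 1" for u w by (auto simp: layer_def)
  have I: "integrable M (\<lambda>w. layer (X w) u)" "integrable M (\<lambda>w. layer (Y w) u)" "integrable M (\<lambda>w. layer (X w) u * layer (Y w) u)" for u
    by (auto intro!: integrable_abs_bounded[of _ 1] simp: layer_def)
  have eq: "expectation (\<lambda>w. layer (X w) u) + expectation (\<lambda>w. layer (Y w) u) - 2 * expectation (\<lambda>w. layer (X w) u * layer (Y w) u)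
     = expectation (?k u)" for u
    using I[of u] by simp
  have Ik: "integrable M (?k u)" for u using I[of u] by simp
  have "(\<integral>\<^sup>+u. ennreal (expectation (?k u)) \<partial>lborel) = (\<integral>\<^sup>+u. (\<integral>\<^sup>+w. ennreal (?k u w) \<partial>M) \<partial>lborel)"
    by (intro nn_integral_cong nn_integral_eq_integral[symmetric] Ik AE_I2 k01)
  also have "\<dots> = (\<integral>\<^sup>+w. (\<integral>\<^sup>+u. ennreal (?k u w) \<partial>lborel) \<partial>M)"
    by (rule P.Fubini') measurable
  also have "\<dots> = (\<integral>\<^sup>+w. ennreal \<bar>X w - Y w\<bar> \<partial>M)" by (simp add: layer_abs_diff_nn)
  also have "\<dots> = ennreal (expectation (\<lambda>w. \<bar>X w - Y w\<bar>))"
    using X Y by (intro nn_integral_eq_integral) auto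
  finally have nn: "(\<integral>\<^sup>+u. ennreal (expectation (?k u)) \<partial>lborel) = ennreal (expectation (\<lambda>w. \<bar>X w - Y w\<bar>))" .
  show ?thesis unfolding eq
  proof (rule has_bochner_integral_nn_integral[OF _ _ _ nn])
    show "(\<lambda>u. expectation (?k u)) \<in> borel_measurable lborel"
      by (rule borel_measurable_lebesgue_integral) measurable
    show "AE u in lborel. 0 \<le> expectation (?k u)"
      by (intro AE_I2 integral_nonneg_AE) (rule k01(1))
  qed auto
qed

text \<open>\<open>layer_abs_diff\<close> on the product space, where the joint term factorises.
  Subtracting the two identities expresses the effect of dependence on the mean of |X - Y| as an
  integral of covariances of level events.\<close>

lemma layer_abs_diff_prod:
  assumes "prob_space M1" "prob_space M2" and X: "integrable M1 X" and Y: "integrable M2 Y"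
  shows "has_bochner_integral lborel
    (\<lambda>u. (\<integral>w. layer (X w) u \<partial>M1) + (\<integral>w. layer (Y w) u \<partial>M2) - 2 * ((\<integral>w. layer (X w) u \<partial>M1) * (\<integral>w. layer (Y w) u \<partial>M2)))
    (\<integral>w. (\<integral>w'. \<bar>X w - Y w'\<bar> \<partial>M2) \<partial>M1)"
proof -
  interpret M1: prob_space M1 by fact
  interpret M2: prob_space M2 by fact
  interpret P: pair_prob_space M1 M2 ..
  have [measurable]: "X \<in> borel_measurable M1" "Y \<in> borel_measurable M2" using X Y by auto
  have I1: "integrable (M1 \<Otimes>\<^sub>M M2) (\<lambda>p. X (fst p))"
    using X by (intro P.Fubini_integrable) (auto simp: M2.prob_space)
  have I2: "integrable (M1 \<Otimes>\<^sub>M M2) (\<lambda>p. Y (snd p))"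
    using Y by (intro P.Fubini_integrable) (auto simp: M1.prob_space)
  have bd: "integrable (M1 \<Otimes>\<^sub>M M2) (\<lambda>p. f (fst p) * g (snd p))"
    if [measurable]: "f \<in> borel_measurable M1" "g \<in> borel_measurable M2" and b: "\<And>x. \<bar>f x\<bar> \<le> 1" "\<And>x. \<bar>g x\<bar> \<le> 1"
    for f :: "'a \<Rightarrow> real" and g :: "'b \<Rightarrow> real"
    by (rule P.integrable_abs_bounded[of _ 1]) (use b in \<open>auto simp: abs_mult intro!: mult_le_one\<close>)
  have fub: "P.expectation (\<lambda>p. f (fst p) * g (snd p)) = (\<integral>x. f x \<partial>M1) * (\<integral>y. g y \<partial>M2)"
    if "f \<in> borel_measurable M1" "g \<in> borel_measurable M2" and b: "\<And>x. \<bar>f x\<bar> \<le> 1" "\<And>x. \<bar>g x\<bar> \<le> 1"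
    for f :: "'a \<Rightarrow> real" and g :: "'b \<Rightarrow> real"
    using P.integral_fst'[OF bd[OF that]] by simp
  have m: "(\<lambda>w. layer (X w) u) \<in> borel_measurable M1" "(\<lambda>w. layer (Y w) u) \<in> borel_measurable M2"
    "(\<lambda>w. 1::real) \<in> borel_measurable M1" "(\<lambda>w. 1::real) \<in> borel_measurable M2" for u by measurable
  have e1: "P.expectation (\<lambda>p. layer (X (fst p)) u) = (\<integral>w. layer (X w) u \<partial>M1)" for u
    using fub[OF m(1,4)] by (simp add: layer_01 M2.prob_space)
  have e2: "P.expectation (\<lambda>p. layer (Y (snd p)) u) = (\<integral>w. layer (Y w) u \<partial>M2)" for u
    using fub[OF m(3,2)] by (simp add: layer_01 M1.prob_space)
  have e3: "P.expectation (\<lambda>p. layer (X (fst p)) u * layer (Y (snd p)) u) = (\<integral>w. layer (X w) u \<partial>M1) * (\<integral>w. layer (Y w) u \<partial>M2)" for u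
    by (rule fub[OF m(1,2)]) (auto simp: layer_01)
  have e4: "P.expectation (\<lambda>p. \<bar>X (fst p) - Y (snd p)\<bar>) = (\<integral>w. (\<integral>w'. \<bar>X w - Y w'\<bar> \<partial>M2) \<partial>M1)"
    using P.integral_fst'[of "\<lambda>p. \<bar>X (fst p) - Y (snd p)\<bar>"] I1 I2 by simp
  show ?thesis using P.layer_abs_diff[OF I1 I2] unfolding e1 e2 e3 e4 .
qed

section \<open>Projections of the kernel onto Gaussian variables\<close>

definition gcdf :: "real \<Rightarrow> real \<Rightarrow> real" where "gcdf c u = (\<integral>z. layer (c * z) u \<partial>gauss)"

text \<open>The version \<open>h x y z\<close> of the conditional expectation in \<psi>^2 is
  \<open>gdist (\<sigma> x * z) (\<sigma> y)\<close>.\<close>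

definition gdist :: "real \<Rightarrow> real \<Rightarrow> real" where "gdist u c = (\<integral>z. \<bar>u - c * z\<bar> \<partial>gauss)"

definition gdist2 :: "real \<Rightarrow> real \<Rightarrow> real" where "gdist2 c d = (\<integral>z. gdist (c * z) d \<partial>gauss)"

lemma gauss_integral_abs_le_1: "(\<integral>z. \<bar>z\<bar> \<partial>gauss) \<le> 1"
  unfolding gauss_integral_abs using pi_gt3 by simp

lemma gdist_diff: "\<bar>gdist u c - gdist u' c'\<bar> \<le> \<bar>u - u'\<bar> + \<bar>c - c'\<bar>"
proof -
  have "\<bar>gdist u c - gdist u' c'\<bar> \<le> (\<integral>z. \<bar>\<bar>u - c * z\<bar> - \<bar>u' - c' * z\<bar>\<bar> \<partial>gauss)"
    unfolding gdist_def
    using integral_abs_bound[of gauss "\<lambda>z. \<bar>u - c * z\<bar> - \<bar>u' - c' * z\<bar>"] by simp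
  also have "\<dots> \<le> (\<integral>z. \<bar>u - u'\<bar> + \<bar>c - c'\<bar> * \<bar>z\<bar> \<partial>gauss)"
  proof (rule integral_mono)
    fix z :: real
    have "\<bar>\<bar>u - c * z\<bar> - \<bar>u' - c' * z\<bar>\<bar> \<le> \<bar>(u - c * z) - (u' - c' * z)\<bar>" by (rule abs_triangle_ineq3)
    also have "(u - c * z) - (u' - c' * z) = (u - u') - (c - c') * z" by (simp add: algebra_simps)
    finally show "\<bar>\<bar>u - c * z\<bar> - \<bar>u' - c' * z\<bar>\<bar> \<le> \<bar>u - u'\<bar> + \<bar>c - c'\<bar> * \<bar>z\<bar>"
      using abs_triangle_ineq4[of "u - u'" "(c - c') * z"] by (simp add: abs_mult)
  qed auto
  also have "\<dots> = \<bar>u - u'\<bar> + \<bar>c - c'\<bar> * (\<integral>z. \<bar>z\<bar> \<partial>gauss)" by simp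
  also have "\<dots> \<le> \<bar>u - u'\<bar> + \<bar>c - c'\<bar> * 1"
    by (intro add_left_mono mult_left_mono gauss_integral_abs_le_1) auto
  finally show ?thesis by simp
qed

lemma gdist_lipschitz: "1-lipschitz_on UNIV (\<lambda>u. gdist u c)"
  by (rule lipschitz_absI) (use gdist_diff[of _ c _ c] in auto)

lemma gdist_nonneg: "0 \<le> gdist u c"
  unfolding gdist_def by (intro integral_nonneg_AE) auto

lemma gdist_le: "gdist u c \<le> \<bar>u\<bar> + \<bar>c\<bar>"
proof -
  have "gdist 0 0 = 0" by (simp add: gdist_def)
  then show ?thesis using gdist_diff[of u c 0 0] gdist_nonneg[of u c] by simp
qed

text \<open>Jensen's inequality. The growth it provides later rules out a degenerate limit.\<close>

lemma gdist_ge: "\<bar>u\<bar> \<le> gdist u c"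
proof -
  have "\<bar>\<integral>z. u - c * z \<partial>gauss\<bar> \<le> gdist u c" unfolding gdist_def by (rule integral_abs_bound)
  then show ?thesis by simp
qed

lemma gdist2_eq: "c \<noteq> 0 \<Longrightarrow> d \<noteq> 0 \<Longrightarrow> gdist2 c d = sqrt (c\<^sup>2 + d\<^sup>2) * sqrt (2 / pi)"
proof -
  assume cd: "c \<noteq> 0" "d \<noteq> 0"
  have L: "1-lipschitz_on UNIV (\<lambda>x::real. \<bar>x\<bar>)" by (rule lipschitz_absI) auto
  have "gdist2 c d = (\<integral>y. (\<integral>z. \<bar>c * y + (- d) * z\<bar> \<partial>gauss) \<partial>gauss)"
    by (simp add: gdist2_def gdist_def)
  also have "\<dots> = (\<integral>z. \<bar>sqrt (c\<^sup>2 + (- d)\<^sup>2) * z\<bar> \<partial>gauss)" using cd by (intro gauss_conv(2)[OF L]) auto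
  also have "\<dots> = sqrt (c\<^sup>2 + d\<^sup>2) * sqrt (2 / pi)" by (simp add: abs_mult gauss_integral_abs)
  finally show ?thesis .
qed

definition gini_kernel :: "real \<Rightarrow> real \<Rightarrow> real \<Rightarrow> real \<Rightarrow> real" where
  "gini_kernel x y c d = \<bar>x - y\<bar> - gdist x d - gdist y c + gdist2 c d"

text \<open>The completely degenerate part of the kernel \<open>|x - y|\<close>.  That it factorises under an integral over
  the levels \<open>u\<close> makes its sum over all pairs a negative integral of a square.\<close>

lemma gini_kernel_layer:
  "has_bochner_integral lborel (\<lambda>u. - 2 * ((layer x u - gcdf c u) * (layer y u - gcdf d u))) (gini_kernel x y c d)"
proof -
  have p: "gauss.expectation (\<lambda>_. k) = k" for k :: real by simp
  have 1: "has_bochner_integral lborel (\<lambda>u. layer x u + layer y u - 2 * (layer x u * layer y u)) \<bar>x - y\<bar>"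
    using gauss.layer_abs_diff[of "\<lambda>_. x" "\<lambda>_. y"] by (simp only: p) simp
  have 2: "has_bochner_integral lborel (\<lambda>u. layer a u + gcdf e u - 2 * (layer a u * gcdf e u)) (gdist a e)" for a e
    using layer_abs_diff_prod[OF gauss.prob_space_axioms gauss.prob_space_axioms, of "\<lambda>_. a" "\<lambda>z. e * z"]
    by (simp add: gcdf_def gdist_def)
  have 3: "has_bochner_integral lborel (\<lambda>u. gcdf c u + gcdf d u - 2 * (gcdf c u * gcdf d u)) (gdist2 c d)"
    using layer_abs_diff_prod[OF gauss.prob_space_axioms gauss.prob_space_axioms, of "\<lambda>z. c * z" "\<lambda>z. d * z"]
    by (simp add: gcdf_def gdist_def gdist2_def)
  have "has_bochner_integral lborel (\<lambda>u. layer x u + layer y u - 2 * (layer x u * layer y u)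
      - (layer x u + gcdf d u - 2 * (layer x u * gcdf d u)) - (layer y u + gcdf c u - 2 * (layer y u * gcdf c u))
      + (gcdf c u + gcdf d u - 2 * (gcdf c u * gcdf d u))) (gini_kernel x y c d)"
    unfolding gini_kernel_def by (intro has_bochner_integral_add has_bochner_integral_diff 1 2 3)
  then show ?thesis by (rule has_bochner_integral_cong[THEN iffD1, rotated 3]) (auto simp: algebra_simps)
qed

text \<open>The sum over j of the centred level indicators is squared. The diagonal terms belong to
  this square, although they do not vanish as those of |x - y| do; being few, they can be
  afforded.\<close>

lemma gini_kernel_sum_nonpos: "(\<Sum>j\<in>J. \<Sum>k\<in>J. gini_kernel (x j) (x k) (c j) (c k)) \<le> 0"
proof -
  let ?e = "\<lambda>j u. layer (x j) u - gcdf (c j) u"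
  have "has_bochner_integral lborel (\<lambda>u. \<Sum>j\<in>J. \<Sum>k\<in>J. - 2 * (?e j u * ?e k u)) (\<Sum>j\<in>J. \<Sum>k\<in>J. gini_kernel (x j) (x k) (c j) (c k))"
    by (intro has_bochner_integral_sum gini_kernel_layer)
  then have "(\<Sum>j\<in>J. \<Sum>k\<in>J. gini_kernel (x j) (x k) (c j) (c k)) = (\<integral>u. (\<Sum>j\<in>J. \<Sum>k\<in>J. - 2 * (?e j u * ?e k u)) \<partial>lborel)"
    by (simp add: has_bochner_integral_iff)
  also have "\<dots> = (\<integral>u. - 2 * (\<Sum>j\<in>J. ?e j u)\<^sup>2 \<partial>lborel)"
    unfolding power2_eq_square sum_product by (simp only: sum_distrib_left)
  also have "\<dots> \<le> 0"
  proof -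
    have "0 \<le> (\<integral>u. (\<Sum>j\<in>J. ?e j u)\<^sup>2 \<partial>lborel)" by (rule integral_nonneg_AE) auto
    then show ?thesis by simp
  qed
  finally show ?thesis .
qed

lemma abs_diff_swap:
  fixes X :: "'a \<Rightarrow> real" and Y :: "'b \<Rightarrow> real"
  assumes "prob_space M1" "prob_space M2" and X: "integrable M1 X" and Y: "integrable M2 Y"
  shows "(\<integral>w. (\<integral>w'. \<bar>X w - Y w'\<bar> \<partial>M2) \<partial>M1) = (\<integral>w'. (\<integral>w. \<bar>Y w' - X w\<bar> \<partial>M1) \<partial>M2)"
  using layer_abs_diff_prod[OF assms] layer_abs_diff_prod[OF assms(2,1) Y X]
  by (simp add: has_bochner_integral_iff add.commute mult.commute)

section \<open>Decoupling the kernel under mixing\<close>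

definition clamp_abs :: "real \<Rightarrow> real \<Rightarrow> real" where "clamp_abs T x = max (- T) (min T x)"

lemma clamp_abs_le: "0 < T \<Longrightarrow> \<bar>clamp_abs T x\<bar> \<le> T"
  by (auto simp: clamp_abs_def)

lemma clamp_abs_diff: "0 < T \<Longrightarrow> \<bar>x - clamp_abs T x\<bar> \<le> x\<^sup>2 / T"
proof -
  assume T: "0 < T"
  show ?thesis
  proof (cases "\<bar>x\<bar> \<le> T")
    case True
    then have "clamp_abs T x = x" by (auto simp: clamp_abs_def)
    then show ?thesis using T by simp
  next
    case False
    then have "\<bar>x - clamp_abs T x\<bar> \<le> \<bar>x\<bar>" using T by (auto simp: clamp_abs_def)
    also have "\<dots> \<le> x\<^sup>2 / T"
    proof -
      have "\<bar>x\<bar> * T \<le> \<bar>x\<bar> * \<bar>x\<bar>" using False by (intro mult_left_mono) auto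
      then show ?thesis using T by (simp add: pos_le_divide_eq power2_eq_square)
    qed
    finally show ?thesis .
  qed
qed

lemma clamp_abs_measurable [measurable]: "clamp_abs T \<in> borel_measurable borel"
  unfolding clamp_abs_def[abs_def] by measurable

context mixing_pair
begin

text \<open>Clamping to [-T, T] confines the levels with a nonzero covariance to an interval of
  length 2 * T, where each contributes at most 2 * \<open>a\<close>; this gives 4 * T *
  \<open>a\<close>. Clamping costs s / T per variable, by second moments alone, both for the joint
  law and for the product law.\<close>

lemma abs_diff_decouple:
  assumes X: "X \<in> borel_measurable FA" and Y: "Y \<in> borel_measurable FB"
    and X2: "integrable M (\<lambda>w. (X w)\<^sup>2)" "expectation (\<lambda>w. (X w)\<^sup>2) \<le> s"
    and Y2: "integrable M (\<lambda>w. (Y w)\<^sup>2)" "expectation (\<lambda>w. (Y w)\<^sup>2) \<le> s"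
    and I: "integrable M X" "integrable M Y" and T: "0 < T"
  shows "\<bar>expectation (\<lambda>w. \<bar>X w - Y w\<bar>) - expectation (\<lambda>w. expectation (\<lambda>w'. \<bar>X w - Y w'\<bar>))\<bar> \<le> 4 * s / T + 4 * T * a"
proof -
  note [measurable] = measA[OF X] measB[OF Y]
  let ?X = "\<lambda>w. clamp_abs T (X w)" and ?Y = "\<lambda>w. clamp_abs T (Y w)"
  have Xb: "?X \<in> borel_measurable FA" using X by measurable
  have Yb: "?Y \<in> borel_measurable FB" using Y by measurable
  note [measurable] = measA[OF Xb] measB[OF Yb]
  have IX: "integrable M ?X" by (rule integrable_abs_bounded[of _ T]) (use clamp_abs_le[OF T] in auto)
  have IY: "integrable M ?Y" by (rule integrable_abs_bounded[of _ T]) (use clamp_abs_le[OF T] in auto)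
  have dX: "expectation (\<lambda>w. \<bar>X w - ?X w\<bar>) \<le> s / T"
  proof -
    have "expectation (\<lambda>w. \<bar>X w - ?X w\<bar>) \<le> expectation (\<lambda>w. (X w)\<^sup>2 / T)"
      using I IX X2 clamp_abs_diff[OF T] by (intro integral_mono) auto
    also have "\<dots> \<le> s / T" using X2 T by (simp add: divide_right_mono)
    finally show ?thesis .
  qed
  have dY: "expectation (\<lambda>w. \<bar>Y w - ?Y w\<bar>) \<le> s / T"
  proof -
    have "expectation (\<lambda>w. \<bar>Y w - ?Y w\<bar>) \<le> expectation (\<lambda>w. (Y w)\<^sup>2 / T)"
      using I IY Y2 clamp_abs_diff[OF T] by (intro integral_mono) auto
    also have "\<dots> \<le> s / T" using Y2 T by (simp add: divide_right_mono)
    finally show ?thesis .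
  qed
  have tri: "\<bar>\<bar>x - y\<bar> - \<bar>x' - y'\<bar>\<bar> \<le> \<bar>x - x'\<bar> + \<bar>y - y'\<bar>" for x y x' y' :: real by linarith
  have 1: "\<bar>expectation (\<lambda>w. \<bar>X w - Y w\<bar>) - expectation (\<lambda>w. \<bar>?X w - ?Y w\<bar>)\<bar> \<le> 2 * s / T"
  proof -
    have "\<bar>expectation (\<lambda>w. \<bar>X w - Y w\<bar> - \<bar>?X w - ?Y w\<bar>)\<bar> \<le> expectation (\<lambda>w. \<bar>\<bar>X w - Y w\<bar> - \<bar>?X w - ?Y w\<bar>\<bar>)"
      by (rule integral_abs_bound)
    also have "\<dots> \<le> expectation (\<lambda>w. \<bar>X w - ?X w\<bar> + \<bar>Y w - ?Y w\<bar>)"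
      using I IX IY by (intro integral_mono tri) auto
    also have "\<dots> \<le> s / T + s / T" using dX dY I IX IY by simp
    finally show ?thesis using I IX IY by simp
  qed
  have L: "1-lipschitz_on UNIV (\<lambda>x. expectation (\<lambda>w'. \<bar>x - U w'\<bar>))" if U: "integrable M U" for U :: "'a \<Rightarrow> real"
  proof (rule lipschitz_absI)
    fix x y
    have "\<bar>expectation (\<lambda>w'. \<bar>x - U w'\<bar>) - expectation (\<lambda>w'. \<bar>y - U w'\<bar>)\<bar> \<le> \<bar>x - y\<bar>"
      by (rule abs_expectation_diff_le) (use U in auto)
    then show "\<bar>expectation (\<lambda>w'. \<bar>x - U w'\<bar>) - expectation (\<lambda>w'. \<bar>y - U w'\<bar>)\<bar> \<le> 1 * \<bar>x - y\<bar>" by simp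
  qed simp
  have EL: "integrable M (\<lambda>w. expectation (\<lambda>w'. \<bar>V w - U w'\<bar>))" if "integrable M U" "integrable M V" for U V :: "'a \<Rightarrow> real"
    by (rule integrable_lipschitz[OF L[OF that(1)] that(2)])
  have 2: "\<bar>expectation (\<lambda>w. expectation (\<lambda>w'. \<bar>X w - Y w'\<bar>)) - expectation (\<lambda>w. expectation (\<lambda>w'. \<bar>?X w - ?Y w'\<bar>))\<bar> \<le> 2 * s / T"
  proof -
    have in_le: "\<bar>expectation (\<lambda>w'. \<bar>X w - Y w'\<bar>) - expectation (\<lambda>w'. \<bar>?X w - ?Y w'\<bar>)\<bar> \<le> \<bar>X w - ?X w\<bar> + s / T" for w
    proof -
      have "\<bar>expectation (\<lambda>w'. \<bar>X w - Y w'\<bar> - \<bar>?X w - ?Y w'\<bar>)\<bar> \<le> expectation (\<lambda>w'. \<bar>\<bar>X w - Y w'\<bar> - \<bar>?X w - ?Y w'\<bar>\<bar>)"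
        by (rule integral_abs_bound)
      also have "\<dots> \<le> expectation (\<lambda>w'. \<bar>X w - ?X w\<bar> + \<bar>Y w' - ?Y w'\<bar>)"
        using I IX IY by (intro integral_mono tri) auto
      also have "\<dots> \<le> \<bar>X w - ?X w\<bar> + s / T" using dY I IY by (simp add: prob_space)
      finally show ?thesis using I IX IY by simp
    qed
    have "\<bar>expectation (\<lambda>w. expectation (\<lambda>w'. \<bar>X w - Y w'\<bar>)) - expectation (\<lambda>w. expectation (\<lambda>w'. \<bar>?X w - ?Y w'\<bar>))\<bar>
      \<le> expectation (\<lambda>w. \<bar>expectation (\<lambda>w'. \<bar>X w - Y w'\<bar>) - expectation (\<lambda>w'. \<bar>?X w - ?Y w'\<bar>)\<bar>)"
      using integral_abs_bound[of M "\<lambda>w. expectation (\<lambda>w'. \<bar>X w - Y w'\<bar>) - expectation (\<lambda>w'. \<bar>?X w - ?Y w'\<bar>)"]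
        EL[OF I(2) I(1)] EL[OF IY IX] by simp
    also have "\<dots> \<le> expectation (\<lambda>w. \<bar>X w - ?X w\<bar> + s / T)"
      using EL[OF I(2) I(1)] EL[OF IY IX] I IX by (intro integral_mono in_le) auto
    also have "\<dots> \<le> s / T + s / T" using dX I IX by (simp add: prob_space)
    finally show ?thesis by simp
  qed
  let ?c = "\<lambda>u. expectation (\<lambda>w. layer (?X w) u * layer (?Y w) u) - expectation (\<lambda>w. layer (?X w) u) * expectation (\<lambda>w. layer (?Y w) u)"
  have hb: "has_bochner_integral lborel (\<lambda>u. - 2 * ?c u)
      (expectation (\<lambda>w. \<bar>?X w - ?Y w\<bar>) - expectation (\<lambda>w. expectation (\<lambda>w'. \<bar>?X w - ?Y w'\<bar>)))"
    using has_bochner_integral_diff[OF layer_abs_diff[OF IX IY] layer_abs_diff_prod[OF prob_space_axioms prob_space_axioms IX IY]]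
    by (rule has_bochner_integral_cong[THEN iffD1, rotated 3]) (auto simp: algebra_simps)
  have c_le: "\<bar>- 2 * ?c u\<bar> \<le> 2 * a * indicator {- T..T} u" for u
  proof (cases "\<bar>u\<bar> \<le> T")
    case True
    have "\<bar>?c u\<bar> \<le> a"
      by (rule cov_unit) (use Xb Yb in \<open>auto simp: layer_01\<close>)
    then show ?thesis using True by (simp add: indicator_def abs_le_iff)
  next
    case False
    then consider "u < - T" | "T < u" by linarith
    then have "?c u = 0"
    proof cases
      case 1
      have "\<not> clamp_abs T x \<le> u" for x using clamp_abs_le[OF T, of x] 1 by linarith
      then show ?thesis by (simp add: layer_def)
    next
      case 2
      have "clamp_abs T x \<le> u" for x using clamp_abs_le[OF T, of x] 2 by linarith
      then show ?thesis by (simp add: layer_def prob_space)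
    qed
    then show ?thesis using a_nonneg by simp
  qed
  have 3: "\<bar>expectation (\<lambda>w. \<bar>?X w - ?Y w\<bar>) - expectation (\<lambda>w. expectation (\<lambda>w'. \<bar>?X w - ?Y w'\<bar>))\<bar> \<le> 4 * T * a"
  proof -
    have "\<bar>\<integral>u. - 2 * ?c u \<partial>lborel\<bar> \<le> (\<integral>u. \<bar>- 2 * ?c u\<bar> \<partial>lborel)" by (rule integral_abs_bound)
    also have "\<dots> \<le> (\<integral>u. 2 * a * indicator {- T..T} u \<partial>lborel)"
    proof (rule integral_mono)
      show "integrable lborel (\<lambda>u. \<bar>- 2 * ?c u\<bar>)" using hb by (intro integrable_abs) (simp only: has_bochner_integral_iff)
      show "integrable lborel (\<lambda>u. 2 * a * indicator {- T..T} u)"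
        by (intro integrable_mult_right integrable_real_indicator) (auto simp: emeasure_lborel_Icc_eq)
    qed (rule c_le)
    also have "\<dots> = 4 * T * a" using T by (simp add: measure_def)
    finally show ?thesis using hb by (simp only: has_bochner_integral_iff)
  qed
  have "4 * s / T = 2 * s / T + 2 * s / T" by simp
  with 1 2 3 show ?thesis by linarith
qed

text \<open>After decoupling, the mean of |X - Y| is that of h(X) with h(x) the mean of |x - Y|,
  while the mean of \<open>gdist (Y w) c\<close> is the Gaussian integral of h. The Wasserstein
  bound for X is used twice, on h and on the first projection, which pairs all four terms of the
  kernel.\<close>

lemma gini_kernel_decouple:
  assumes X: "X \<in> borel_measurable FA" and Y: "Y \<in> borel_measurable FB"
    and X2: "integrable M (\<lambda>w. (X w)\<^sup>2)" "expectation (\<lambda>w. (X w)\<^sup>2) \<le> s"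
    and Y2: "integrable M (\<lambda>w. (Y w)\<^sup>2)" "expectation (\<lambda>w. (Y w)\<^sup>2) \<le> s"
    and I: "integrable M X" "integrable M Y" and T: "0 < T"
    and W: "\<And>f. 1-lipschitz_on UNIV f \<Longrightarrow> \<bar>expectation (\<lambda>w. f (X w)) - (\<integral>z. f (c * z) \<partial>gauss)\<bar> \<le> \<epsilon>"
  shows "\<bar>expectation (\<lambda>w. gini_kernel (X w) (Y w) c d)\<bar> \<le> 4 * s / T + 4 * T * a + 2 * \<epsilon>"
proof -
  let ?h = "\<lambda>x. expectation (\<lambda>w'. \<bar>x - Y w'\<bar>)"
  have L: "1-lipschitz_on UNIV ?h"
  proof (rule lipschitz_absI)
    fix x y
    have "\<bar>?h x - ?h y\<bar> \<le> \<bar>x - y\<bar>" by (rule abs_expectation_diff_le) (use I in auto)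
    then show "\<bar>?h x - ?h y\<bar> \<le> 1 * \<bar>x - y\<bar>" by simp
  qed simp
  have Ig: "integrable M (\<lambda>w. gdist (X w) d)" "integrable M (\<lambda>w. gdist (Y w) c)"
    by (auto intro!: integrable_lipschitz[OF gdist_lipschitz] I)
  have "expectation (\<lambda>w. gini_kernel (X w) (Y w) c d)
     = expectation (\<lambda>w. \<bar>X w - Y w\<bar>) - expectation (\<lambda>w. gdist (X w) d) - expectation (\<lambda>w. gdist (Y w) c) + gdist2 c d"
    unfolding gini_kernel_def using I Ig by (simp add: prob_space)
  moreover have "(\<integral>z. ?h (c * z) \<partial>gauss) = expectation (\<lambda>w. gdist (Y w) c)"
    unfolding gdist_def using I
    by (intro abs_diff_swap[OF gauss.prob_space_axioms prob_space_axioms]) auto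
  moreover have "\<bar>expectation (\<lambda>w. ?h (X w)) - (\<integral>z. ?h (c * z) \<partial>gauss)\<bar> \<le> \<epsilon>" by (rule W[OF L])
  moreover have "\<bar>expectation (\<lambda>w. gdist (X w) d) - gdist2 c d\<bar> \<le> \<epsilon>"
    unfolding gdist2_def by (rule W[OF gdist_lipschitz])
  moreover note abs_diff_decouple[OF X Y X2 Y2 I T]
  ultimately show ?thesis by linarith
qed

end

lemma gini_kernel_commute: "gini_kernel x y c d = gini_kernel y x d c"
proof -
  have "gdist2 c d = gdist2 d c"
    unfolding gdist2_def gdist_def
    using abs_diff_swap[OF gauss.prob_space_axioms gauss.prob_space_axioms, of "\<lambda>z. c * z" "\<lambda>z. d * z"] by simp
  then show ?thesis by (simp add: gini_kernel_def abs_minus_commute)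
qed

lemma gdist2_le: "gdist2 c d \<le> \<bar>c\<bar> + \<bar>d\<bar>" and gdist2_nonneg: "0 \<le> gdist2 c d"
proof -
  have I: "integrable gauss (\<lambda>z. gdist (c * z) d)" by (rule gauss.integrable_lipschitz[OF gdist_lipschitz]) simp
  have "gdist2 c d \<le> (\<integral>z. \<bar>c\<bar> * \<bar>z\<bar> + \<bar>d\<bar> \<partial>gauss)"
    unfolding gdist2_def
  proof (rule integral_mono[OF I])
    fix z show "gdist (c * z) d \<le> \<bar>c\<bar> * \<bar>z\<bar> + \<bar>d\<bar>" using gdist_le[of "c * z" d] by (simp add: abs_mult)
  qed auto
  also have "\<dots> = \<bar>c\<bar> * (\<integral>z. \<bar>z\<bar> \<partial>gauss) + \<bar>d\<bar>" by simp
  also have "\<dots> \<le> \<bar>c\<bar> * 1 + \<bar>d\<bar>" by (intro add_right_mono mult_left_mono gauss_integral_abs_le_1) auto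
  finally show "gdist2 c d \<le> \<bar>c\<bar> + \<bar>d\<bar>" by simp
  show "0 \<le> gdist2 c d" unfolding gdist2_def by (intro integral_nonneg_AE AE_I2 gdist_nonneg)
qed

lemma gini_kernel_abs_le: "\<bar>gini_kernel x y c d\<bar> \<le> 2 * (\<bar>x\<bar> + \<bar>y\<bar> + \<bar>c\<bar> + \<bar>d\<bar>)"
  using gdist_le[of x d] gdist_le[of y c] gdist_nonneg[of x d] gdist_nonneg[of y c] gdist2_le[of c d] gdist2_nonneg[of c d]
    abs_triangle_ineq4[of x y] abs_ge_zero[of "x - y"] abs_ge_zero[of x] abs_ge_zero[of y] abs_ge_zero[of c] abs_ge_zero[of d]
  unfolding gini_kernel_def distrib_left by (intro abs_leI) linarith+

section \<open>The degenerate part\<close>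

lemma (in prob_space) expectation_abs_le_sqrt:
  fixes X :: "'a \<Rightarrow> real"
  assumes "integrable M X" "integrable M (\<lambda>w. (X w)\<^sup>2)" "expectation (\<lambda>w. (X w)\<^sup>2) \<le> s"
  shows "expectation (\<lambda>w. \<bar>X w\<bar>) \<le> sqrt s"
proof -
  have "0 \<le> variance (\<lambda>w. \<bar>X w\<bar>)" by (rule variance_positive)
  also have "\<dots> = expectation (\<lambda>w. (X w)\<^sup>2) - (expectation (\<lambda>w. \<bar>X w\<bar>))\<^sup>2"
    using assms by (subst variance_eq) auto
  finally have "(expectation (\<lambda>w. \<bar>X w\<bar>))\<^sup>2 \<le> s" using assms(3) by linarith
  then show ?thesis by (rule real_le_rsqrt)
qed

context mixing_process
begin

text \<open>The absolutely convergent variant of \<open>v\<close>. It also bounds variances of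
  weighted sums, where cancellation between covariances cannot be relied on.\<close>

definition vabs :: real where "vabs = \<bar>\<gamma> 0\<bar> + 2 * (\<Sum>d. \<bar>\<gamma> (Suc d)\<bar>)"

lemma vabs_nonneg: "0 \<le> vabs"
  unfolding vabs_def by (intro add_nonneg_nonneg mult_nonneg_nonneg suminf_nonneg summable_\<gamma>) auto

lemma weighted_sum_integrable:
  "integrable M (\<lambda>w. \<Sum>i<n. c i * Y (a + 1 + i) w)" "integrable M (\<lambda>w. (\<Sum>i<n. c i * Y (a + 1 + i) w)\<^sup>2)"
proof -
  show "integrable M (\<lambda>w. \<Sum>i<n. c i * Y (a + 1 + i) w)"
    by (intro Bochner_Integration.integrable_sum integrable_mult_right Y_int) auto
  have "integrable M (\<lambda>w. \<Sum>i<n. \<Sum>j<n. c i * c j * (Y (a + 1 + i) w * Y (a + 1 + j) w))"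
    by (intro Bochner_Integration.integrable_sum integrable_mult_right Y_prod) auto
  also have "(\<lambda>w. \<Sum>i<n. \<Sum>j<n. c i * c j * (Y (a + 1 + i) w * Y (a + 1 + j) w)) = (\<lambda>w. (\<Sum>i<n. c i * Y (a + 1 + i) w)\<^sup>2)"
    unfolding power2_eq_square sum_product by (simp add: mult_ac)
  finally show "integrable M (\<lambda>w. (\<Sum>i<n. c i * Y (a + 1 + i) w)\<^sup>2)" .
qed

text \<open>Every row of the covariance matrix has absolute sum at most \<open>vabs\<close>. The
  weights that matter later are the deviations of \<sigma> from its value at the end of a
  block.\<close>

lemma weighted_sum_square:
  assumes c: "\<And>i. i < n \<Longrightarrow> \<bar>c i\<bar> \<le> e"
  shows "expectation (\<lambda>w. (\<Sum>i<n. c i * Y (a + 1 + i) w)\<^sup>2) \<le> e\<^sup>2 * (real n * vabs)"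
proof -
  let ?\<gamma> = "\<lambda>i j. \<gamma> (if i \<le> j then j - i else i - j)"
  have I: "integrable M (\<lambda>w. c i * c j * (Y (a + 1 + i) w * Y (a + 1 + j) w))" for i j
    by (intro integrable_mult_right Y_prod) auto
  have row: "(\<Sum>j<n. \<bar>?\<gamma> i j\<bar>) \<le> vabs" if i: "i < n" for i
  proof -
    have "i + 1 + (n - 1 - i) = n" using i by simp
    then have "(\<Sum>j<n. \<bar>?\<gamma> i j\<bar>) = \<bar>\<gamma> 0\<bar> + (\<Sum>d<i. \<bar>\<gamma> (Suc d)\<bar>) + (\<Sum>d<n - 1 - i. \<bar>\<gamma> (Suc d)\<bar>)"
      using sum_window[of "\<lambda>d. \<bar>\<gamma> d\<bar>" i "n - 1 - i"] by simp
    moreover have s: "(\<Sum>d<k. \<bar>\<gamma> (Suc d)\<bar>) \<le> (\<Sum>d. \<bar>\<gamma> (Suc d)\<bar>)" for k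
      by (intro sum_le_suminf summable_\<gamma>) auto
    ultimately show ?thesis unfolding vabs_def using s[of i] s[of "n - 1 - i"] by linarith
  qed
  have "expectation (\<lambda>w. (\<Sum>i<n. c i * Y (a + 1 + i) w)\<^sup>2)
      = expectation (\<lambda>w. \<Sum>i<n. \<Sum>j<n. c i * c j * (Y (a + 1 + i) w * Y (a + 1 + j) w))"
    unfolding power2_eq_square sum_product by (simp add: mult_ac)
  also have "\<dots> = (\<Sum>i<n. \<Sum>j<n. c i * c j * expectation (\<lambda>w. Y (a + 1 + i) w * Y (a + 1 + j) w))"
    by (simp add: Bochner_Integration.integral_sum Bochner_Integration.integrable_sum I Y_prod del: add_Suc_shift)
  also have "\<dots> = (\<Sum>i<n. \<Sum>j<n. c i * c j * ?\<gamma> i j)"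
    by (intro sum.cong refl) (subst Y_cov', auto)
  also have "\<dots> \<le> (\<Sum>i<n. \<Sum>j<n. e\<^sup>2 * \<bar>?\<gamma> i j\<bar>)"
  proof (intro sum_mono)
    fix i j assume ij: "i \<in> {..<n}" "j \<in> {..<n}"
    have "\<bar>c i\<bar> * \<bar>c j\<bar> \<le> e * e" using c[of i] c[of j] ij by (intro mult_mono) auto
    then have "\<bar>c i * c j\<bar> * \<bar>?\<gamma> i j\<bar> \<le> e\<^sup>2 * \<bar>?\<gamma> i j\<bar>"
      by (intro mult_right_mono) (auto simp: abs_mult power2_eq_square)
    then show "c i * c j * ?\<gamma> i j \<le> e\<^sup>2 * \<bar>?\<gamma> i j\<bar>"
      using abs_ge_self[of "c i * c j * ?\<gamma> i j"] unfolding abs_mult[of "c i * c j"] by (rule order_trans[rotated])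
  qed
  also have "\<dots> = e\<^sup>2 * (\<Sum>i<n. \<Sum>j<n. \<bar>?\<gamma> i j\<bar>)" by (simp only: sum_distrib_left)
  also have "\<dots> \<le> e\<^sup>2 * (\<Sum>i<n. vabs)" by (intro mult_left_mono sum_mono row) auto
  finally show ?thesis by simp
qed

lemma weighted_sum_abs:
  assumes c: "\<And>i. i < n \<Longrightarrow> \<bar>c i\<bar> \<le> e" and e: "0 \<le> e"
  shows "expectation (\<lambda>w. \<bar>\<Sum>i<n. c i * Y (a + 1 + i) w\<bar>) \<le> e * sqrt (real n * vabs)"
  using expectation_abs_le_sqrt[OF weighted_sum_integrable weighted_sum_square[OF c]] e by (simp add: real_sqrt_mult)

lemma psum_square: "expectation (\<lambda>w. (psum a n w)\<^sup>2) \<le> real n * vabs"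
  using weighted_sum_square[of n "\<lambda>_. 1" 1 a] by (simp add: psum_def)

lemma psum_abs_sqrt: "expectation (\<lambda>w. \<bar>psum a n w\<bar>) \<le> sqrt (real n * vabs)"
  using weighted_sum_abs[of n "\<lambda>_. 1" 1 a] by (simp add: psum_def)

text \<open>Blocks are counted from 0: block j covers the indices j * l + 1 to (j + 1) * l and
  belongs to the local mean with index j + 1.\<close>

definition bsum :: "nat \<Rightarrow> nat \<Rightarrow> 'a \<Rightarrow> real" where
  "bsum l j w = psum (j * l) l w / sqrt (real l * v)"

lemma bsum_measurable [measurable]: "bsum l j \<in> borel_measurable M"
  unfolding bsum_def[abs_def] by measurable

lemma bsum_int [simp]: "integrable M (bsum l j)"
  unfolding bsum_def[abs_def] by simp

lemma bsum_sq: "integrable M (\<lambda>w. (bsum l j w)\<^sup>2)"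
  unfolding bsum_def power_divide using psum_sq by simp

lemma bsum_square:
  assumes "0 < v" "1 \<le> l"
  shows "expectation (\<lambda>w. (bsum l j w)\<^sup>2) \<le> vabs / v"
proof -
  have lv: "0 < real l * v" using assms by simp
  have "expectation (\<lambda>w. (bsum l j w)\<^sup>2) = expectation (\<lambda>w. (psum (j * l) l w)\<^sup>2) / (real l * v)"
    unfolding bsum_def power_divide using lv by simp
  also have "\<dots> \<le> real l * vabs / (real l * v)" using lv by (intro divide_right_mono psum_square) auto
  also have "\<dots> = vabs / v" using assms by simp
  finally show ?thesis .
qed

lemma bsum_abs:
  assumes "0 < v" "1 \<le> l"
  shows "expectation (\<lambda>w. \<bar>bsum l j w\<bar>) \<le> sqrt (vabs / v)"
  by (rule expectation_abs_le_sqrt[OF bsum_int bsum_sq bsum_square[OF assms]])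

lemma bsum_w1:
  assumes f: "L-lipschitz_on UNIV f" and v: "0 < v" and \<rho>: "1 < \<rho>" and n: "1 \<le> l"
  shows "\<bar>expectation (\<lambda>w. f (bsum l j w)) - (\<integral>z. f z \<partial>gauss)\<bar> \<le> L * w1_err \<rho> l"
proof -
  have L: "0 \<le> L" using f by (rule lipschitz_on_nonneg)
  show ?thesis
  proof (cases "L = 0")
    case True
    then have f0: "f x = f 0" for x using lipschitz_absD[OF f, of x 0] by simp
    have "expectation (\<lambda>w. f (bsum l j w)) = expectation (\<lambda>w. f 0)" "(\<integral>z. f z \<partial>gauss) = (\<integral>z. f 0 \<partial>gauss)"
      by (rule Bochner_Integration.integral_cong[OF refl f0])+
    then have "expectation (\<lambda>w. f (bsum l j w)) = f 0" "(\<integral>z. f z \<partial>gauss) = f 0"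
      by (auto simp: prob_space)
    then show ?thesis using True by simp
  next
    case False
    then have L0: "0 < L" using L by simp
    have "1-lipschitz_on UNIV (\<lambda>x. f x / L)"
    proof (rule lipschitz_absI)
      fix x y
      have "\<bar>f x / L - f y / L\<bar> = \<bar>f x - f y\<bar> / L" using L0 by (simp add: abs_divide flip: diff_divide_distrib)
      also have "\<dots> \<le> L * \<bar>x - y\<bar> / L" using L0 by (intro divide_right_mono lipschitz_absD[OF f]) auto
      finally show "\<bar>f x / L - f y / L\<bar> \<le> 1 * \<bar>x - y\<bar>" using L0 by simp
    qed simp
    from w1_bound[OF this v \<rho> n, of "j * l"]
    have "\<bar>(expectation (\<lambda>w. f (bsum l j w)) - (\<integral>z. f z \<partial>gauss)) / L\<bar> \<le> w1_err \<rho> l"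
      unfolding bsum_def by (simp add: diff_divide_distrib)
    then show ?thesis using L0 by (simp add: abs_divide pos_divide_le_eq mult.commute)
  qed
qed

lemma bsum_measurable_F: "{j * l<..j * l + l} \<subseteq> I \<Longrightarrow> bsum l j \<in> borel_measurable (F I)"
proof -
  assume "{j * l<..j * l + l} \<subseteq> I"
  then have "psum (j * l) l \<in> borel_measurable (F I)" by (rule psum_measurable_F)
  then show ?thesis unfolding bsum_def[abs_def] by measurable
qed

lemma lipschitz_scale_arg:
  fixes f :: "real \<Rightarrow> real"
  assumes "L-lipschitz_on UNIV f"
  shows "(L * \<bar>c\<bar>)-lipschitz_on UNIV (\<lambda>x. f (c * x))"
proof (rule lipschitz_absI)
  fix x y
  have "\<bar>f (c * x) - f (c * y)\<bar> \<le> L * \<bar>c * x - c * y\<bar>" by (rule lipschitz_absD[OF assms])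
  then show "\<bar>f (c * x) - f (c * y)\<bar> \<le> L * \<bar>c\<bar> * \<bar>x - y\<bar>" by (simp add: abs_mult mult.assoc flip: right_diff_distrib)
qed (use lipschitz_on_nonneg[OF assms] in auto)

text \<open>At least one whole block lies in between and serves as a gap of length l. Clamping at T
  = l turns both decoupling errors into multiples of 1 / l, because \<theta> is at least 2.\<close>

lemma gini_kernel_far:
  assumes v: "0 < v" and \<rho>: "1 < \<rho>" and l: "1 \<le> l" and jk: "j + 2 \<le> k"
    and c: "0 \<le> c" "c \<le> S" and d: "0 \<le> d" "d \<le> S"
  shows "\<bar>expectation (\<lambda>w. gini_kernel (c * bsum l j w) (d * bsum l k w) c d)\<bar>
    \<le> (4 * (S\<^sup>2 * (vabs / v)) + 4 * C) / real l + 2 * (S * w1_err \<rho> l)"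
proof -
  interpret mp: mixing_pair M "F {1..(j + 1) * l}" "F {l + (j + 1) * l..}" "C * real l powr (- \<theta>)"
    by (rule mixing_pair[OF l])
  have S0: "0 \<le> S" using c by simp
  have kl: "l + (j + 1) * l \<le> k * l"
  proof -
    have "(j + 2) * l \<le> k * l" using jk by (rule mult_right_mono) simp
    then show ?thesis by simp
  qed
  have X: "(\<lambda>w. c * bsum l j w) \<in> borel_measurable (F {1..(j + 1) * l})"
  proof -
    have "bsum l j \<in> borel_measurable (F {1..(j + 1) * l})" by (rule bsum_measurable_F) auto
    then show ?thesis by measurable
  qed
  have Y: "(\<lambda>w. d * bsum l k w) \<in> borel_measurable (F {l + (j + 1) * l..})"
  proof -
    have "bsum l k \<in> borel_measurable (F {l + (j + 1) * l..})" by (rule bsum_measurable_F) (use kl in auto)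
    then show ?thesis by measurable
  qed
  have sq: "expectation (\<lambda>w. (e * bsum l i w)\<^sup>2) \<le> S\<^sup>2 * (vabs / v)" if e: "0 \<le> e" "e \<le> S" for e i
  proof -
    have "expectation (\<lambda>w. (e * bsum l i w)\<^sup>2) = e\<^sup>2 * expectation (\<lambda>w. (bsum l i w)\<^sup>2)"
      by (simp add: power_mult_distrib)
    also have "\<dots> \<le> S\<^sup>2 * (vabs / v)"
    proof (intro mult_mono bsum_square[OF v l])
      show "e\<^sup>2 \<le> S\<^sup>2" using e by (intro power_mono) auto
      show "0 \<le> expectation (\<lambda>w. (bsum l i w)\<^sup>2)" by (intro integral_nonneg_AE) auto
    qed auto
    finally show ?thesis .
  qed
  have isq: "integrable M (\<lambda>w. (e * bsum l i w)\<^sup>2)" for e i using bsum_sq by (simp add: power_mult_distrib)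
  have W: "\<bar>expectation (\<lambda>w. f (c * bsum l j w)) - (\<integral>z. f (c * z) \<partial>gauss)\<bar> \<le> S * w1_err \<rho> l"
    if f: "1-lipschitz_on UNIV f" for f
  proof -
    have "\<bar>expectation (\<lambda>w. f (c * bsum l j w)) - (\<integral>z. f (c * z) \<partial>gauss)\<bar> \<le> (1 * \<bar>c\<bar>) * w1_err \<rho> l"
      by (rule bsum_w1[OF lipschitz_scale_arg[OF f] v \<rho> l])
    also have "\<dots> \<le> S * w1_err \<rho> l" using c w1_err_nonneg[OF v \<rho> l] by (intro mult_right_mono) auto
    finally show ?thesis .
  qed
  have l0: "0 < real l" using l by simp
  have 1: "\<bar>expectation (\<lambda>w. gini_kernel (c * bsum l j w) (d * bsum l k w) c d)\<bar>
      \<le> 4 * (S\<^sup>2 * (vabs / v)) / real l + 4 * real l * (C * real l powr (- \<theta>)) + 2 * (S * w1_err \<rho> l)"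
    using c d by (intro mp.gini_kernel_decouple[OF X Y isq _ isq _ _ _ l0 W] sq) auto
  have 2: "4 * real l * (C * real l powr (- \<theta>)) \<le> 4 * C / real l"
  proof -
    have \<theta>2: "2 \<le> \<theta>"
    proof -
      have "\<theta> * \<delta> / (2 + \<delta>) \<le> \<theta> * 1"
      proof -
        have "\<theta> * (\<delta> / (2 + \<delta>)) \<le> \<theta> * 1" using \<delta> \<theta>_pos by (intro mult_left_mono) (auto simp: divide_le_eq)
        then show ?thesis by simp
      qed
      then show ?thesis using \<theta> by simp
    qed
    have "real l * real l powr (- \<theta>) = real l powr (1 - \<theta>)" using l0 powr_add[of "real l" 1 "- \<theta>"] by simp
    also have "\<dots> \<le> real l powr (- 1)" using \<theta>2 l by (intro powr_mono) auto
    also have "\<dots> = 1 / real l" using l0 by (simp add: powr_minus_divide)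
    finally have "4 * C * (real l * real l powr (- \<theta>)) \<le> 4 * C * (1 / real l)"
      using C_nonneg by (intro mult_left_mono) auto
    then show ?thesis by (simp add: mult_ac)
  qed
  show ?thesis using 1 2 unfolding add_divide_distrib by linarith
qed

text \<open>At most 3 * b pairs of blocks are equal or adjacent, among b^2, so a bounded mean is
  good enough for them.\<close>

lemma gini_kernel_near:
  assumes v: "0 < v" and l: "1 \<le> l" and c: "0 \<le> c" "c \<le> S" and d: "0 \<le> d" "d \<le> S"
  shows "integrable M (\<lambda>w. gini_kernel (c * bsum l j w) (d * bsum l k w) c d)"
    and "\<bar>expectation (\<lambda>w. gini_kernel (c * bsum l j w) (d * bsum l k w) c d)\<bar> \<le> 4 * S * (sqrt (vabs / v) + 1)"
proof -
  have S0: "0 \<le> S" using c by simp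
  show I: "integrable M (\<lambda>w. gini_kernel (c * bsum l j w) (d * bsum l k w) c d)"
    unfolding gini_kernel_def
    by (intro Bochner_Integration.integrable_add Bochner_Integration.integrable_diff integrable_abs
          integrable_lipschitz[OF gdist_lipschitz] integrable_mult_right bsum_int) auto
  have "\<bar>expectation (\<lambda>w. gini_kernel (c * bsum l j w) (d * bsum l k w) c d)\<bar>
     \<le> expectation (\<lambda>w. \<bar>gini_kernel (c * bsum l j w) (d * bsum l k w) c d\<bar>)" by (rule integral_abs_bound)
  also have "\<dots> \<le> expectation (\<lambda>w. 2 * (S * \<bar>bsum l j w\<bar> + S * \<bar>bsum l k w\<bar> + S + S))"
  proof (rule integral_mono)
    fix w
    have "\<bar>c * bsum l j w\<bar> \<le> S * \<bar>bsum l j w\<bar>" "\<bar>d * bsum l k w\<bar> \<le> S * \<bar>bsum l k w\<bar>"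
      using c d by (auto simp: abs_mult intro!: mult_right_mono)
    then show "\<bar>gini_kernel (c * bsum l j w) (d * bsum l k w) c d\<bar> \<le> 2 * (S * \<bar>bsum l j w\<bar> + S * \<bar>bsum l k w\<bar> + S + S)"
      using c d by (intro order_trans[OF gini_kernel_abs_le] mult_left_mono add_mono) auto
  qed (use I in auto)
  also have "\<dots> = 2 * (S * expectation (\<lambda>w. \<bar>bsum l j w\<bar>) + S * expectation (\<lambda>w. \<bar>bsum l k w\<bar>) + S + S)"
    by (simp add: prob_space)
  also have "\<dots> \<le> 2 * (S * sqrt (vabs / v) + S * sqrt (vabs / v) + S + S)"
    using bsum_abs[OF v l] S0 by (intro mult_left_mono add_mono) auto
  also have "\<dots> = 4 * S * (sqrt (vabs / v) + 1)" by (simp only: distrib_left)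
  finally show "\<bar>expectation (\<lambda>w. gini_kernel (c * bsum l j w) (d * bsum l k w) c d)\<bar> \<le> 4 * S * (sqrt (vabs / v) + 1)" .
qed

text \<open>Since the double sum never changes sign, the modulus can be moved outside the
  expectation, which then splits into pairs. After multiplication by sqrt b / b^2 the near pairs are
  of order 1 / sqrt b.\<close>

lemma degenerate_part:
  assumes v: "0 < v" and \<rho>: "1 < \<rho>" and l: "1 \<le> l" and c: "\<And>j. j < b \<Longrightarrow> 0 \<le> c j \<and> c j \<le> S" and S: "0 \<le> S"
  shows "expectation (\<lambda>w. \<bar>\<Sum>j<b. \<Sum>k<b. gini_kernel (c j * bsum l j w) (c k * bsum l k w) (c j) (c k)\<bar>)
    \<le> 3 * real b * (4 * S * (sqrt (vabs / v) + 1))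
      + (real b)\<^sup>2 * ((4 * (S\<^sup>2 * (vabs / v)) + 4 * C) / real l + 2 * (S * w1_err \<rho> l))"
proof -
  let ?g = "\<lambda>j k w. gini_kernel (c j * bsum l j w) (c k * bsum l k w) (c j) (c k)"
  let ?N = "4 * S * (sqrt (vabs / v) + 1)" and ?R = "(4 * (S\<^sup>2 * (vabs / v)) + 4 * C) / real l + 2 * (S * w1_err \<rho> l)"
  have N0: "0 \<le> ?N" using S vabs_nonneg v by (intro mult_nonneg_nonneg add_nonneg_nonneg) auto
  have R0: "0 \<le> ?R" using S vabs_nonneg v C_nonneg w1_err_nonneg[OF v \<rho> l] by (auto intro!: add_nonneg_nonneg divide_nonneg_nonneg)
  have I: "integrable M (?g j k)" if "j < b" "k < b" for j k
    using gini_kernel_near(1)[OF v l, of "c j" S "c k"] c that by simp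
  have one: "\<bar>expectation (?g j k)\<bar> \<le> (if j + 2 \<le> k \<or> k + 2 \<le> j then 0 else ?N) + ?R" if jk: "j < b" "k < b" for j k
  proof -
    consider "j + 2 \<le> k" | "k + 2 \<le> j" | "\<not> (j + 2 \<le> k \<or> k + 2 \<le> j)" by blast
    then show ?thesis
    proof cases
      case 1
      then show ?thesis using gini_kernel_far[OF v \<rho> l 1, of "c j" S "c k"] c jk by simp
    next
      case 2
      have "?g j k w = ?g k j w" for w by (rule gini_kernel_commute)
      then show ?thesis using gini_kernel_far[OF v \<rho> l 2, of "c k" S "c j"] c jk 2 by simp
    next
      case 3
      have "\<bar>expectation (?g j k)\<bar> \<le> ?N" using gini_kernel_near(2)[OF v l, of "c j" S "c k"] c jk by simp
      then show ?thesis using 3 R0 by simp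
    qed
  qed
  have "expectation (\<lambda>w. \<bar>\<Sum>j<b. \<Sum>k<b. ?g j k w\<bar>) = expectation (\<lambda>w. - (\<Sum>j<b. \<Sum>k<b. ?g j k w))"
    by (intro Bochner_Integration.integral_cong refl abs_of_nonpos gini_kernel_sum_nonpos)
  also have "\<dots> = - (\<Sum>j<b. \<Sum>k<b. expectation (?g j k))"
  proof -
    have "expectation (\<lambda>w. \<Sum>j<b. \<Sum>k<b. ?g j k w) = (\<Sum>j<b. expectation (\<lambda>w. \<Sum>k<b. ?g j k w))"
      by (rule Bochner_Integration.integral_sum, rule Bochner_Integration.integrable_sum) (auto intro: I)
    also have "\<dots> = (\<Sum>j<b. \<Sum>k<b. expectation (?g j k))"
      by (intro sum.cong refl Bochner_Integration.integral_sum) (auto intro: I)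
    finally show ?thesis by simp
  qed
  also have "\<dots> \<le> (\<Sum>j<b. \<Sum>k<b. \<bar>expectation (?g j k)\<bar>)"
    using sum_mono[of "{..<b}" "\<lambda>j. - (\<Sum>k<b. expectation (?g j k))" "\<lambda>j. \<Sum>k<b. \<bar>expectation (?g j k)\<bar>"]
    by (simp add: sum_negf[symmetric] sum_mono abs_ge_minus_self)
  also have "\<dots> \<le> (\<Sum>j<b. \<Sum>k<b. (if j + 2 \<le> k \<or> k + 2 \<le> j then 0 else ?N) + ?R)"
    by (intro sum_mono one) auto
  also have "\<dots> = (\<Sum>j<b. \<Sum>k<b. if j + 2 \<le> k \<or> k + 2 \<le> j then 0 else ?N) + real b * (real b * ?R)"
    by (simp add: sum.distrib)
  also have "\<dots> \<le> (\<Sum>j<b. 3 * ?N) + real b * (real b * ?R)"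
  proof (intro add_right_mono sum_mono)
    fix j assume "j \<in> {..<b}"
    have "(\<Sum>k<b. if j + 2 \<le> k \<or> k + 2 \<le> j then 0 else ?N) = (\<Sum>k\<in>{k. k < b \<and> \<not> (j + 2 \<le> k \<or> k + 2 \<le> j)}. ?N)"
      by (intro sum.mono_neutral_cong_right) auto
    also have "\<dots> = real (card {k. k < b \<and> \<not> (j + 2 \<le> k \<or> k + 2 \<le> j)}) * ?N" by simp
    also have "\<dots> \<le> 3 * ?N"
    proof (intro mult_right_mono N0)
      \<comment> \<open>For j = 0 truncated subtraction merges j - 1 with j, which only makes the
        covering set smaller.\<close>
      have "card {k. k < b \<and> \<not> (j + 2 \<le> k \<or> k + 2 \<le> j)} \<le> card {j - 1, j, j + 1}" by (rule card_mono) auto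
      also have "\<dots> \<le> 3" by (simp add: card_insert_if)
      finally show "real (card {k. k < b \<and> \<not> (j + 2 \<le> k \<or> k + 2 \<le> j)}) \<le> 3" by simp
    qed
    finally show "(\<Sum>k<b. if j + 2 \<le> k \<or> k + 2 \<le> j then 0 else ?N) \<le> 3 * ?N" .
  qed
  also have "\<dots> = 3 * real b * ?N + (real b)\<^sup>2 * ?R" by (simp add: power2_eq_square)
  finally show ?thesis .
qed

end

section \<open>Characteristic functions of block functionals\<close>

lemma norm_iexp_diff: "norm (iexp x - iexp y) \<le> \<bar>x - y\<bar>"
proof -
  have "iexp x - iexp y = iexp y * (iexp (x - y) - 1)"
    by (simp add: right_diff_distrib exp_add[symmetric] algebra_simps)
  then have "norm (iexp x - iexp y) = norm (iexp (x - y) - 1)" by (simp add: norm_mult)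
  also have "\<dots> \<le> \<bar>x - y\<bar>" using iexp_approx1[of "x - y" 0] by simp
  finally show ?thesis .
qed

lemma iexp_cos_sin: "Re (iexp x) = cos x" "Im (iexp x) = sin x"
  by (simp_all flip: cis_conv_exp)

lemma cos_sin_lipschitz:
  fixes h :: "real \<Rightarrow> real"
  assumes "L-lipschitz_on UNIV h"
  shows "L-lipschitz_on UNIV (\<lambda>x. cos (h x))" "L-lipschitz_on UNIV (\<lambda>x. sin (h x))"
proof -
  have L: "0 \<le> L" using assms by (rule lipschitz_on_nonneg)
  have *: "\<bar>cos a - cos b\<bar> \<le> \<bar>a - b\<bar>" "\<bar>sin a - sin b\<bar> \<le> \<bar>a - b\<bar>" for a b :: real
    using order_trans[OF abs_Re_le_cmod[of "iexp a - iexp b"] norm_iexp_diff]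
      order_trans[OF abs_Im_le_cmod[of "iexp a - iexp b"] norm_iexp_diff]
    unfolding minus_complex.simps iexp_cos_sin by auto
  show "L-lipschitz_on UNIV (\<lambda>x. cos (h x))" "L-lipschitz_on UNIV (\<lambda>x. sin (h x))"
    by (rule lipschitz_absI[OF order_trans[OF *(1) lipschitz_absD[OF assms]] L],
        rule lipschitz_absI[OF order_trans[OF *(2) lipschitz_absD[OF assms]] L])
qed

definition gauss_moment :: "nat \<Rightarrow> real" where "gauss_moment k = (\<integral>z. (\<bar>z\<bar> + 1) ^ k \<partial>gauss)"

lemma gauss_integrable_abs1_power: "integrable gauss (\<lambda>z. (\<bar>z\<bar> + 1) ^ k)"
  unfolding binomial_ring
  by (intro Bochner_Integration.integrable_sum integrable_mult_left integrable_mult_right gauss_integrable_abs_power)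

lemma exp_minus_approx: "0 \<le> x \<Longrightarrow> \<bar>1 - x - exp (- x)\<bar> \<le> x\<^sup>2" for x :: real
proof -
  assume x: "0 \<le> x"
  have 1: "1 - x \<le> exp (- x)" using exp_ge_add_one_self[of "- x"] by simp
  have "1 \<le> (1 - x + x\<^sup>2) * (1 + x)"
  proof -
    have "(1 - x + x\<^sup>2) * (1 + x) = 1 + x ^ 3" by (simp add: algebra_simps power2_eq_square power3_eq_cube)
    then show ?thesis using x by simp
  qed
  also have "\<dots> \<le> (1 - x + x\<^sup>2) * exp x"
  proof (rule mult_left_mono)
    have "(1 - x + x\<^sup>2) = (1 / 2 - x)\<^sup>2 + 3 / 4" by (simp add: power2_eq_square algebra_simps)
    then show "0 \<le> 1 - x + x\<^sup>2" by simp
  qed (rule exp_ge_add_one_self)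
  finally have "exp (- x) \<le> 1 - x + x\<^sup>2"
    by (simp add: exp_minus field_simps)
  with 1 show ?thesis by simp
qed

text \<open>The second-order expansion of the exponential leaves a third moment of h; replacing 1 -
  v / 2 by exp (- v / 2), with v the second moment of h, costs at most (v / 2)^2. In the application
  e is of order 1 / sqrt b, so that b such errors still vanish.\<close>

lemma gauss_char_approx:
  fixes h :: "real \<Rightarrow> real"
  assumes [measurable]: "h \<in> borel_measurable borel" and h: "\<And>z. \<bar>h z\<bar> \<le> e * (\<bar>z\<bar> + 1)" and e: "0 \<le> e"
    and h0: "(\<integral>z. h z \<partial>gauss) = 0"
  shows "norm ((CLINT z|gauss. iexp (h z)) - exp (- (\<integral>z. (h z)\<^sup>2 \<partial>gauss) / 2))
    \<le> e ^ 3 * gauss_moment 3 + e ^ 4 * (gauss_moment 2)\<^sup>2"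
proof -
  have I1: "integrable gauss h"
    by (rule Bochner_Integration.integrable_bound[OF integrable_mult_right[OF gauss_integrable_abs1_power[of 1], of e]])
       (use h e in \<open>auto intro: order_trans[OF h]\<close>)
  have h2: "(h z)\<^sup>2 \<le> e\<^sup>2 * (\<bar>z\<bar> + 1)\<^sup>2" for z
    using power_mono[OF h[of z], of 2] by (simp add: power_mult_distrib)
  have I2: "integrable gauss (\<lambda>z. (h z)\<^sup>2)"
    by (rule Bochner_Integration.integrable_bound[OF integrable_mult_right[OF gauss_integrable_abs1_power[of 2], of "e\<^sup>2"]])
       (use h2 in auto)
  have h3: "\<bar>h z\<bar> ^ 3 \<le> e ^ 3 * (\<bar>z\<bar> + 1) ^ 3" for z
    using power_mono[OF h[of z], of 3] by (simp add: power_mult_distrib)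
  have I3: "integrable gauss (\<lambda>z. \<bar>h z\<bar> ^ 3)"
    by (rule Bochner_Integration.integrable_bound[OF integrable_mult_right[OF gauss_integrable_abs1_power[of 3], of "e ^ 3"]])
       (use h3 e in auto)
  let ?v = "\<integral>z. (h z)\<^sup>2 \<partial>gauss"
  have v0: "0 \<le> ?v" by (intro integral_nonneg_AE) auto
  have vle: "?v \<le> e\<^sup>2 * gauss_moment 2"
    unfolding gauss_moment_def using integral_mono[OF I2 integrable_mult_right[OF gauss_integrable_abs1_power[of 2], of "e\<^sup>2"] h2] by simp
  have IE: "complex_integrable gauss (\<lambda>z. iexp (h z))"
    by (intro gauss.integrable_const_bound[of _ 1]) auto
  let ?p = "\<lambda>z. (1 + \<i> * of_real (h z) - of_real ((h z)\<^sup>2 / 2) :: complex)"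
  have Ip: "complex_integrable gauss ?p"
    by (intro Bochner_Integration.integrable_add Bochner_Integration.integrable_diff integrable_mult_right integrable_of_real)
       (use I1 I2 in auto)
  have Ep: "(CLINT z|gauss. ?p z) = of_real (1 - ?v / 2)"
  proof -
    have "(CLINT z|gauss. ?p z) = (CLINT z|gauss. 1) + (CLINT z|gauss. \<i> * of_real (h z)) - (CLINT z|gauss. of_real ((h z)\<^sup>2 / 2))"
      using I1 I2 by (subst Bochner_Integration.integral_diff Bochner_Integration.integral_add; (intro Bochner_Integration.integrable_add integrable_mult_right integrable_of_real)?; simp)+
    also have "\<dots> = of_real (1 - ?v / 2)"
      using h0 by (simp only: integral_mult_right_zero integral_complex_of_real) simp
    finally show ?thesis .
  qed
  have "norm (iexp (h z) - ?p z) \<le> \<bar>h z\<bar> ^ 3" for z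
  proof -
    have "(\<Sum>k\<le>2. (\<i> * of_real (h z)) ^ k / fact k) = ?p z"
      by (simp add: numeral_2_eq_2 atMost_Suc power_mult_distrib)
    then have "norm (iexp (h z) - ?p z) \<le> \<bar>h z\<bar> ^ 3 / 6"
      using iexp_approx1[of "h z" 2] by (simp add: fact_numeral eval_nat_numeral)
    also have "\<dots> \<le> \<bar>h z\<bar> ^ 3" by simp
    finally show ?thesis .
  qed
  then have d: "norm (iexp (h z) - ?p z) \<le> e ^ 3 * (\<bar>z\<bar> + 1) ^ 3" for z using h3 order_trans by blast
  have "norm ((CLINT z|gauss. iexp (h z)) - (CLINT z|gauss. ?p z)) = norm (CLINT z|gauss. iexp (h z) - ?p z)"
    by (subst Bochner_Integration.integral_diff[OF IE Ip]) (rule refl)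
  also have "\<dots> \<le> (\<integral>z. norm (iexp (h z) - ?p z) \<partial>gauss)" by (rule integral_norm_bound)
  also have "\<dots> \<le> (\<integral>z. e ^ 3 * (\<bar>z\<bar> + 1) ^ 3 \<partial>gauss)"
    by (intro integral_mono d integrable_norm[OF Bochner_Integration.integrable_diff[OF IE Ip]] integrable_mult_right gauss_integrable_abs1_power)
  also have "\<dots> = e ^ 3 * gauss_moment 3" by (simp add: gauss_moment_def)
  finally have 1: "norm ((CLINT z|gauss. iexp (h z)) - of_real (1 - ?v / 2)) \<le> e ^ 3 * gauss_moment 3" unfolding Ep .
  have "norm (of_real (1 - ?v / 2) - of_real (exp (- ?v / 2)) :: complex) = \<bar>1 - ?v / 2 - exp (- (?v / 2))\<bar>"
    by (simp flip: of_real_diff)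
  also have "\<dots> \<le> (?v / 2)\<^sup>2" using v0 by (intro exp_minus_approx) auto
  also have "\<dots> \<le> (e\<^sup>2 * gauss_moment 2)\<^sup>2" using v0 vle by (intro power_mono) linarith+
  also have "\<dots> = e ^ 4 * (gauss_moment 2)\<^sup>2" by (simp add: power_mult_distrib)
  finally have 2: "norm (of_real (1 - ?v / 2) - of_real (exp (- ?v / 2)) :: complex) \<le> e ^ 4 * (gauss_moment 2)\<^sup>2" .
  show ?thesis using norm_triangle_mono[OF 1 2] by simp
qed

lemma norm_prod_diff_le:
  fixes f g :: "nat \<Rightarrow> complex"
  assumes "\<And>j. j < b \<Longrightarrow> norm (f j) \<le> 1" "\<And>j. j < b \<Longrightarrow> norm (g j) \<le> 1" "\<And>j. j < b \<Longrightarrow> norm (f j - g j) \<le> e"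
  shows "norm ((\<Prod>j<b. f j) - (\<Prod>j<b. g j)) \<le> real b * e"
proof -
  have "norm ((\<Prod>j<b. f j) - (\<Prod>j<b. g j)) \<le> (\<Sum>j<b. norm (f j - g j))"
    using assms by (intro norm_prod_diff) auto
  also have "\<dots> \<le> (\<Sum>j<b. e)" using assms by (intro sum_mono) auto
  finally show ?thesis by simp
qed

lemma norm_integral_iexp_le_1: "prob_space M \<Longrightarrow> norm (CLINT w|M. iexp (h w)) \<le> 1"
proof -
  assume "prob_space M"
  then interpret prob_space M .
  have "norm (CLINT w|M. iexp (h w)) \<le> (\<integral>w. norm (iexp (h w)) \<partial>M)" by (rule integral_norm_bound)
  then show ?thesis by (simp add: prob_space)
qed

lemma gauss_char_prod_approx:
  fixes h :: "nat \<Rightarrow> real \<Rightarrow> real"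
  assumes "\<And>j. j < b \<Longrightarrow> h j \<in> borel_measurable borel" and "\<And>j z. j < b \<Longrightarrow> \<bar>h j z\<bar> \<le> e * (\<bar>z\<bar> + 1)" and e: "0 \<le> e"
    and "\<And>j. j < b \<Longrightarrow> (\<integral>z. h j z \<partial>gauss) = 0"
  shows "norm ((\<Prod>j<b. CLINT z|gauss. iexp (h j z)) - exp (- (\<Sum>j<b. \<integral>z. (h j z)\<^sup>2 \<partial>gauss) / 2))
    \<le> real b * (e ^ 3 * gauss_moment 3 + e ^ 4 * (gauss_moment 2)\<^sup>2)"
proof -
  let ?v = "\<lambda>j. \<integral>z. (h j z)\<^sup>2 \<partial>gauss"
  have v0: "0 \<le> ?v j" for j by (intro integral_nonneg_AE) auto
  have "norm ((\<Prod>j<b. CLINT z|gauss. iexp (h j z)) - (\<Prod>j<b. of_real (exp (- ?v j / 2)) :: complex))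
    \<le> real b * (e ^ 3 * gauss_moment 3 + e ^ 4 * (gauss_moment 2)\<^sup>2)"
  proof (rule norm_prod_diff_le)
    fix j assume j: "j < b"
    show "norm (CLINT z|gauss. iexp (h j z)) \<le> 1"
      by (rule norm_integral_iexp_le_1[OF gauss.prob_space_axioms])
    show "norm (of_real (exp (- ?v j / 2)) :: complex) \<le> 1" using v0[of j] by simp
    show "norm ((CLINT z|gauss. iexp (h j z)) - of_real (exp (- ?v j / 2))) \<le> e ^ 3 * gauss_moment 3 + e ^ 4 * (gauss_moment 2)\<^sup>2"
      using assms j by (intro gauss_char_approx) auto
  qed
  moreover have "(\<Prod>j<b. of_real (exp (- ?v j / 2)) :: complex) = of_real (exp (- (\<Sum>j<b. ?v j) / 2))"
    by (simp add: exp_sum[symmetric] sum_divide_distrib sum_negf flip: of_real_prod)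
  ultimately show ?thesis by (simp only:)
qed

context mixing_process
begin

text \<open>Dropping the last \<open>m\<close> summands of each block leaves gaps across which mixing decouples the blocks.\<close>

definition tsum :: "nat \<Rightarrow> nat \<Rightarrow> nat \<Rightarrow> 'a \<Rightarrow> real" where
  "tsum l m j w = psum (j * l) (l - m) w / sqrt (real l * v)"

lemma tsum_measurable_F: "m \<le> l \<Longrightarrow> {j * l<..j * l + (l - m)} \<subseteq> I \<Longrightarrow> tsum l m j \<in> borel_measurable (F I)"
proof -
  assume "{j * l<..j * l + (l - m)} \<subseteq> I"
  then have "psum (j * l) (l - m) \<in> borel_measurable (F I)" by (rule psum_measurable_F)
  then show ?thesis unfolding tsum_def[abs_def] by measurable
qed

lemma tsum_measurable [measurable]: "tsum l m j \<in> borel_measurable M"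
  unfolding tsum_def[abs_def] by measurable

lemma tsum_diff:
  assumes "0 < v" "m \<le> l"
  shows "expectation (\<lambda>w. \<bar>bsum l j w - tsum l m j w\<bar>) \<le> sqrt (real m * vabs) / sqrt (real l * v)"
proof -
  have "psum (j * l) l w = psum (j * l) (l - m) w + psum (j * l + (l - m)) m w" for w
    using psum_add[of "j * l" "l - m" m w] assms by simp
  then have "\<bar>bsum l j w - tsum l m j w\<bar> = \<bar>psum (j * l + (l - m)) m w\<bar> / \<bar>sqrt (real l * v)\<bar>" for w
    unfolding bsum_def tsum_def by (simp flip: diff_divide_distrib add: abs_divide)
  then have "expectation (\<lambda>w. \<bar>bsum l j w - tsum l m j w\<bar>) = expectation (\<lambda>w. \<bar>psum (j * l + (l - m)) m w\<bar>) / \<bar>sqrt (real l * v)\<bar>"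
    by simp
  also have "\<dots> \<le> sqrt (real m * vabs) / \<bar>sqrt (real l * v)\<bar>" by (intro divide_right_mono psum_abs_sqrt) auto
  finally show ?thesis using assms by simp
qed

text \<open>Induction on the number of blocks peels off the last one. The shortened preceding block
  ends m indices before it starts, so \<open>cov_iexp\<close> applies across a gap of length
  m.\<close>

lemma char_blocks_factor:
  fixes h :: "nat \<Rightarrow> real \<Rightarrow> real"
  assumes h: "\<And>j. j < b \<Longrightarrow> h j \<in> borel_measurable borel" and m: "1 \<le> m" "m \<le> l"
  shows "norm ((CLINT w|M. iexp (\<Sum>j<b. h j (tsum l m j w))) - (\<Prod>j<b. CLINT w|M. iexp (h j (tsum l m j w))))
    \<le> real b * (16 * (C * real m powr (- \<theta>)))"
  using h
proof (induction b)
  case 0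
  then show ?case by (simp add: prob_space)
next
  case (Suc b)
  let ?f = "\<lambda>w. iexp (\<Sum>j<b. h j (tsum l m j w))" and ?g = "\<lambda>w. iexp (h b (tsum l m b w))"
  let ?a = "16 * (C * real m powr (- \<theta>))"
  have a0: "0 \<le> ?a" using C_nonneg by simp
  have IH: "norm ((CLINT w|M. ?f w) - (\<Prod>j<b. CLINT w|M. iexp (h j (tsum l m j w)))) \<le> real b * ?a"
    using Suc by simp
  have cov: "norm ((CLINT w|M. ?f w * ?g w) - (CLINT w|M. ?f w) * (CLINT w|M. ?g w)) \<le> ?a"
  proof (cases b)
    case 0
    then show ?thesis using a0 by (simp add: prob_space)
  next
    case (Suc b')
    interpret mp: mixing_pair M "F {1..b' * l + (l - m)}" "F {m + (b' * l + (l - m))..}" "C * real m powr (- \<theta>)"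
      by (rule mixing_pair[OF m(1)])
    have e: "m + (b' * l + (l - m)) = b * l" using Suc m by simp
    show ?thesis
    proof (rule mp.cov_iexp)
      have "(\<lambda>w. h j (tsum l m j w)) \<in> borel_measurable (F {1..b' * l + (l - m)})" if j: "j < b" for j
      proof -
        have jl: "j * l \<le> b' * l" using j Suc by simp
        have "{j * l<..j * l + (l - m)} \<subseteq> {1..b' * l + (l - m)}"
        proof (rule subsetI)
          fix x assume "x \<in> {j * l<..j * l + (l - m)}"
          then have "j * l < x" "x \<le> j * l + (l - m)" by (auto simp only: greaterThanAtMost_iff)
          then show "x \<in> {1..b' * l + (l - m)}" using jl unfolding atLeastAtMost_iff by linarith
        qed
        then have "tsum l m j \<in> borel_measurable (F {1..b' * l + (l - m)})"
          by (rule tsum_measurable_F[OF m(2)])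
        then show ?thesis using Suc.prems[of j] j by (auto intro: measurable_compose)
      qed
      then show "?f \<in> borel_measurable (F {1..b' * l + (l - m)})" by measurable
      have "tsum l m b \<in> borel_measurable (F {m + (b' * l + (l - m))..})"
        unfolding e by (intro tsum_measurable_F m) auto
      then have "(\<lambda>w. h b (tsum l m b w)) \<in> borel_measurable (F {m + (b' * l + (l - m))..})"
        using Suc.prems[of b] by (auto intro: measurable_compose)
      then show "?g \<in> borel_measurable (F {m + (b' * l + (l - m))..})" by measurable
    qed auto
  qed
  have split: "iexp (\<Sum>j<Suc b. h j (tsum l m j w)) = ?f w * ?g w" for w
    by (simp add: exp_add distrib_left)
  let ?P = "\<Prod>j<b. CLINT w|M. iexp (h j (tsum l m j w))" and ?G = "CLINT w|M. ?g w"
  have G1: "norm ?G \<le> 1" by (rule norm_integral_iexp_le_1[OF prob_space_axioms])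
  have "norm ((CLINT w|M. ?f w) * ?G - ?P * ?G) \<le> real b * ?a * 1"
    unfolding left_diff_distrib[symmetric] norm_mult using a0 by (intro mult_mono IH G1) auto
  then have "norm ((CLINT w|M. ?f w * ?g w) - ?P * ?G) \<le> ?a + real b * ?a"
    using norm_triangle_mono[OF cov] by fastforce
  then show ?case unfolding split prod.lessThan_Suc by (simp add: distrib_right)
qed

text \<open>Cosine and sine of a Lipschitz function are Lipschitz with the same constant, so the
  Wasserstein bound applies to real and imaginary part; hence the factor 2.\<close>

lemma char_block_gauss:
  fixes h :: "real \<Rightarrow> real"
  assumes h: "L-lipschitz_on UNIV h" and v: "0 < v" and \<rho>: "1 < \<rho>" and m: "m \<le> l" "1 \<le> l"
  shows "norm ((CLINT w|M. iexp (h (tsum l m j w))) - (CLINT z|gauss. iexp (h z)))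
    \<le> 2 * L * (w1_err \<rho> l + sqrt (real m * vabs) / sqrt (real l * v))"
proof -
  have L: "0 \<le> L" using h by (rule lipschitz_on_nonneg)
  note [measurable] = lipschitz_borel[OF h]
  let ?W = "w1_err \<rho> l + sqrt (real m * vabs) / sqrt (real l * v)"
  have It: "integrable M (tsum l m j)" unfolding tsum_def[abs_def] by simp
  have real_part: "\<bar>expectation (\<lambda>w. k (tsum l m j w)) - (\<integral>z. k z \<partial>gauss)\<bar> \<le> L * ?W" if k: "L-lipschitz_on UNIV k" for k
  proof -
    have "\<bar>expectation (\<lambda>w. k (tsum l m j w)) - expectation (\<lambda>w. k (bsum l j w))\<bar> \<le> L * expectation (\<lambda>w. \<bar>tsum l m j w - bsum l j w\<bar>)"
      by (rule expectation_lipschitz_diff[OF k It bsum_int])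
    also have "\<dots> \<le> L * (sqrt (real m * vabs) / sqrt (real l * v))"
      using tsum_diff[OF v m(1), of j] L by (intro mult_left_mono) (auto simp: abs_minus_commute)
    finally have "\<bar>expectation (\<lambda>w. k (tsum l m j w)) - expectation (\<lambda>w. k (bsum l j w))\<bar> \<le> L * (sqrt (real m * vabs) / sqrt (real l * v))" .
    with bsum_w1[OF k v \<rho> m(2), of j] show ?thesis unfolding distrib_left by linarith
  qed
  have IM: "complex_integrable M (\<lambda>w. iexp (h (tsum l m j w)))" by (intro integrable_const_bound[of _ 1]) auto
  have IG: "complex_integrable gauss (\<lambda>z. iexp (h z))" by (intro gauss.integrable_const_bound[of _ 1]) auto
  let ?d = "(CLINT w|M. iexp (h (tsum l m j w))) - (CLINT z|gauss. iexp (h z))"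
  have "Re ?d = expectation (\<lambda>w. cos (h (tsum l m j w))) - (\<integral>z. cos (h z) \<partial>gauss)"
    unfolding minus_complex.simps integral_Re[OF IM, symmetric] integral_Re[OF IG, symmetric] iexp_cos_sin ..
  moreover have "Im ?d = expectation (\<lambda>w. sin (h (tsum l m j w))) - (\<integral>z. sin (h z) \<partial>gauss)"
    unfolding minus_complex.simps integral_Im[OF IM, symmetric] integral_Im[OF IG, symmetric] iexp_cos_sin ..
  ultimately show ?thesis
    using cmod_le[of ?d] real_part[OF cos_sin_lipschitz(1)[OF h]] real_part[OF cos_sin_lipschitz(2)[OF h]] by simp
qed

text \<open>Shorten the blocks, factorise, compare each factor with the Gaussian one. The shortening
  is paid for once in the first step and twice in the third, which makes the factor 3.\<close>

lemma char_blocks_gauss: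
  fixes h :: "nat \<Rightarrow> real \<Rightarrow> real"
  assumes h: "\<And>j. j < b \<Longrightarrow> L-lipschitz_on UNIV (h j)" and L: "0 \<le> L" and v: "0 < v" and \<rho>: "1 < \<rho>"
    and m: "1 \<le> m" "m \<le> l"
  shows "norm ((CLINT w|M. iexp (\<Sum>j<b. h j (bsum l j w))) - (\<Prod>j<b. CLINT z|gauss. iexp (h j z)))
    \<le> real b * (3 * L * (sqrt (real m * vabs) / sqrt (real l * v)) + 16 * (C * real m powr (- \<theta>)) + 2 * L * w1_err \<rho> l)"
proof -
  let ?s = "sqrt (real m * vabs) / sqrt (real l * v)"
  have l: "1 \<le> l" using m by simp
  have hm [measurable]: "h j \<in> borel_measurable borel" if "j < b" for j using lipschitz_borel[OF h[OF that]] .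
  have It: "integrable M (tsum l m j)" for j unfolding tsum_def[abs_def] by simp
  let ?B = "\<lambda>w. \<Sum>j<b. h j (bsum l j w)" and ?T = "\<lambda>w. \<Sum>j<b. h j (tsum l m j w)"
  have mB: "?B \<in> borel_measurable M" and mT: "?T \<in> borel_measurable M"
    by (auto intro!: borel_measurable_sum intro: measurable_compose[OF _ hm])
  have IB: "complex_integrable M (\<lambda>w. iexp (?B w))" by (intro integrable_const_bound[of _ 1]) (use mB in auto)
  have IT: "complex_integrable M (\<lambda>w. iexp (?T w))" by (intro integrable_const_bound[of _ 1]) (use mT in auto)
  have "norm ((CLINT w|M. iexp (?B w)) - (CLINT w|M. iexp (?T w))) = norm (CLINT w|M. iexp (?B w) - iexp (?T w))"
    using IB IT by simp
  also have "\<dots> \<le> expectation (\<lambda>w. norm (iexp (?B w) - iexp (?T w)))" by (rule integral_norm_bound)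
  also have "\<dots> \<le> expectation (\<lambda>w. \<Sum>j<b. L * \<bar>bsum l j w - tsum l m j w\<bar>)"
  proof (rule integral_mono)
    show "integrable M (\<lambda>w. norm (iexp (?B w) - iexp (?T w)))" using IB IT by auto
    show "integrable M (\<lambda>w. \<Sum>j<b. L * \<bar>bsum l j w - tsum l m j w\<bar>)" using It by auto
    fix w
    have "norm (iexp (?B w) - iexp (?T w)) \<le> \<bar>?B w - ?T w\<bar>" by (rule norm_iexp_diff)
    also have "\<dots> \<le> (\<Sum>j<b. \<bar>h j (bsum l j w) - h j (tsum l m j w)\<bar>)"
      unfolding sum_subtractf[symmetric] by (rule sum_abs)
    also have "\<dots> \<le> (\<Sum>j<b. L * \<bar>bsum l j w - tsum l m j w\<bar>)" by (intro sum_mono lipschitz_absD h) auto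
    finally show "norm (iexp (?B w) - iexp (?T w)) \<le> (\<Sum>j<b. L * \<bar>bsum l j w - tsum l m j w\<bar>)" .
  qed
  also have "\<dots> = (\<Sum>j<b. L * expectation (\<lambda>w. \<bar>bsum l j w - tsum l m j w\<bar>))"
    using It by (subst Bochner_Integration.integral_sum) auto
  also have "\<dots> \<le> (\<Sum>j<b. L * ?s)" by (intro sum_mono mult_left_mono tsum_diff v m L)
  also have "\<dots> = real b * (L * ?s)" by simp
  finally have 1: "norm ((CLINT w|M. iexp (?B w)) - (CLINT w|M. iexp (?T w))) \<le> real b * (L * ?s)" .
  have 2: "norm ((CLINT w|M. iexp (?T w)) - (\<Prod>j<b. CLINT w|M. iexp (h j (tsum l m j w)))) \<le> real b * (16 * (C * real m powr (- \<theta>)))"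
    by (rule char_blocks_factor[OF hm m]) auto
  have 3: "norm ((\<Prod>j<b. CLINT w|M. iexp (h j (tsum l m j w))) - (\<Prod>j<b. CLINT z|gauss. iexp (h j z)))
      \<le> real b * (2 * L * (w1_err \<rho> l + ?s))"
    by (rule norm_prod_diff_le)
       (use norm_integral_iexp_le_1[OF prob_space_axioms] norm_integral_iexp_le_1[OF gauss.prob_space_axioms] char_block_gauss[OF h v \<rho> m(2) l] in auto)
  have "norm ((CLINT w|M. iexp (?B w)) - (\<Prod>j<b. CLINT z|gauss. iexp (h j z)))
      \<le> real b * (L * ?s) + real b * (16 * (C * real m powr (- \<theta>))) + real b * (2 * L * (w1_err \<rho> l + ?s))"
    using norm_triangle_mono[OF norm_triangle_mono[OF 1 2] 3] by simp
  also have "\<dots> = real b * (3 * L * ?s + 16 * (C * real m powr (- \<theta>)) + 2 * L * w1_err \<rho> l)"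
    by (simp only: distrib_left) (simp add: algebra_simps)
  finally show ?thesis .
qed

end

section \<open>The asymptotic variance\<close>

definition centred :: "(real \<Rightarrow> real) \<Rightarrow> real \<Rightarrow> real \<Rightarrow> real" where
  "centred q c z = q (c * z) - (\<integral>z'. q (c * z') \<partial>gauss)"

definition gauss_var :: "(real \<Rightarrow> real) \<Rightarrow> real \<Rightarrow> real" where
  "gauss_var q c = (\<integral>z. (centred q c z)\<^sup>2 \<partial>gauss)"

lemma gauss_int_lipschitz:
  fixes q :: "real \<Rightarrow> real"
  shows "1-lipschitz_on UNIV q \<Longrightarrow> integrable gauss (\<lambda>z. q (c * z))"
  by (rule gauss.integrable_lipschitz[where L = 1]) auto

lemma centred_measurable: "1-lipschitz_on UNIV q \<Longrightarrow> centred q c \<in> borel_measurable borel"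
  unfolding centred_def[abs_def] using lipschitz_borel by measurable

lemma centred_integral: "1-lipschitz_on UNIV q \<Longrightarrow> (\<integral>z. centred q c z \<partial>gauss) = 0"
  unfolding centred_def using gauss_int_lipschitz[of q c] by simp

lemma centred_lipschitz:
  assumes "1-lipschitz_on UNIV q"
  shows "\<bar>c\<bar>-lipschitz_on UNIV (centred q c)"
proof (rule lipschitz_absI)
  fix x y
  show "\<bar>centred q c x - centred q c y\<bar> \<le> \<bar>c\<bar> * \<bar>x - y\<bar>"
    using lipschitz_absD[OF assms, of "c * x" "c * y"] by (simp add: centred_def abs_mult flip: right_diff_distrib)
qed simp

lemma gauss_integral_diff_le:
  fixes f g :: "real \<Rightarrow> real"
  assumes "integrable gauss f" "integrable gauss g" "integrable gauss h" "\<And>z. \<bar>f z - g z\<bar> \<le> h z"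
  shows "\<bar>(\<integral>z. f z \<partial>gauss) - (\<integral>z. g z \<partial>gauss)\<bar> \<le> (\<integral>z. h z \<partial>gauss)"
proof -
  have "\<bar>\<integral>z. f z - g z \<partial>gauss\<bar> \<le> (\<integral>z. \<bar>f z - g z\<bar> \<partial>gauss)" by (rule integral_abs_bound)
  also have "\<dots> \<le> (\<integral>z. h z \<partial>gauss)" using assms by (intro integral_mono) auto
  finally show ?thesis using assms by simp
qed

text \<open>The summand 1 next to |z| accounts for the change of the mean. Taking one scale to be 0
  turns this into the growth bound \<open>centred_bound\<close>.\<close>

lemma centred_diff_scale:
  assumes q: "1-lipschitz_on UNIV q"
  shows "\<bar>centred q c z - centred q c' z\<bar> \<le> \<bar>c - c'\<bar> * (\<bar>z\<bar> + 1)"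
proof -
  have p: "\<bar>q (c * z) - q (c' * z)\<bar> \<le> \<bar>c - c'\<bar> * \<bar>z\<bar>" for z
    using lipschitz_absD[OF q, of "c * z" "c' * z"] by (simp add: abs_mult flip: left_diff_distrib)
  have "\<bar>(\<integral>z. q (c * z) \<partial>gauss) - (\<integral>z. q (c' * z) \<partial>gauss)\<bar> \<le> (\<integral>z. \<bar>c - c'\<bar> * \<bar>z\<bar> \<partial>gauss)"
    by (intro gauss_integral_diff_le gauss_int_lipschitz q p) auto
  also have "\<dots> \<le> \<bar>c - c'\<bar> * 1" using mult_left_mono[OF gauss_integral_abs_le_1, of "\<bar>c - c'\<bar>"] by simp
  finally have "\<bar>(\<integral>z. q (c * z) \<partial>gauss) - (\<integral>z. q (c' * z) \<partial>gauss)\<bar> \<le> \<bar>c - c'\<bar>" by simp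
  moreover have "\<bar>x - y - (x' - y')\<bar> \<le> \<bar>x - x'\<bar> + \<bar>y - y'\<bar>" for x y x' y' :: real by linarith
  ultimately show ?thesis using p[of z] unfolding centred_def distrib_left mult_1_right
    by (meson add_mono order_trans)
qed

lemma centred_bound:
  assumes "1-lipschitz_on UNIV q"
  shows "\<bar>centred q c z\<bar> \<le> \<bar>c\<bar> * (\<bar>z\<bar> + 1)"
  using centred_diff_scale[OF assms, of c z 0] by (simp add: centred_def)

lemma square_diff_le:
  fixes x y :: real
  assumes "\<bar>x - y\<bar> \<le> d" "\<bar>x\<bar> \<le> e" "\<bar>y\<bar> \<le> e"
  shows "\<bar>x\<^sup>2 - y\<^sup>2\<bar> \<le> d * (2 * e)"
proof -
  have "x\<^sup>2 - y\<^sup>2 = (x - y) * (x + y)" by (simp add: power2_eq_square algebra_simps)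
  then have "\<bar>x\<^sup>2 - y\<^sup>2\<bar> = \<bar>x - y\<bar> * \<bar>x + y\<bar>" by (simp add: abs_mult)
  also have "\<dots> \<le> d * (2 * e)" using assms by (intro mult_mono) linarith+
  finally show ?thesis .
qed

lemma centred_sq_int:
  assumes q: "1-lipschitz_on UNIV q"
  shows "integrable gauss (\<lambda>z. (centred q c z)\<^sup>2)"
proof (rule Bochner_Integration.integrable_bound)
  show "integrable gauss (\<lambda>z. \<bar>c\<bar>\<^sup>2 * (\<bar>z\<bar> + 1) ^ 2)"
    by (intro integrable_mult_right gauss_integrable_abs1_power)
  show "(\<lambda>z. (centred q c z)\<^sup>2) \<in> borel_measurable gauss" using centred_measurable[OF q] by measurable
  show "AE z in gauss. norm ((centred q c z)\<^sup>2) \<le> norm (\<bar>c\<bar>\<^sup>2 * (\<bar>z\<bar> + 1) ^ 2)"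
  proof (intro AE_I2)
    fix z
    have "\<bar>centred q c z\<bar> ^ 2 \<le> (\<bar>c\<bar> * (\<bar>z\<bar> + 1)) ^ 2" by (intro power_mono centred_bound q) auto
    then show "norm ((centred q c z)\<^sup>2) \<le> norm (\<bar>c\<bar>\<^sup>2 * (\<bar>z\<bar> + 1) ^ 2)" by (simp add: power_mult_distrib)
  qed
qed

lemma gauss_var_nonneg: "0 \<le> gauss_var q c"
  unfolding gauss_var_def by (intro integral_nonneg_AE) auto

lemma gauss_var_lipschitz:
  assumes q: "1-lipschitz_on UNIV q" and c: "\<bar>c\<bar> \<le> S" "\<bar>c'\<bar> \<le> S"
  shows "\<bar>gauss_var q c - gauss_var q c'\<bar> \<le> 2 * S * gauss_moment 2 * \<bar>c - c'\<bar>"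
proof -
  have "\<bar>gauss_var q c - gauss_var q c'\<bar> \<le> (\<integral>z. 2 * S * \<bar>c - c'\<bar> * (\<bar>z\<bar> + 1) ^ 2 \<partial>gauss)"
    unfolding gauss_var_def
  proof (intro gauss_integral_diff_le centred_sq_int q integrable_mult_right gauss_integrable_abs1_power)
    fix z
    have b: "\<bar>centred q e z\<bar> \<le> S * (\<bar>z\<bar> + 1)" if "\<bar>e\<bar> \<le> S" for e
      using that by (intro order_trans[OF centred_bound[OF q]] mult_right_mono) auto
    have "\<bar>(centred q c z)\<^sup>2 - (centred q c' z)\<^sup>2\<bar> \<le> \<bar>c - c'\<bar> * (\<bar>z\<bar> + 1) * (2 * (S * (\<bar>z\<bar> + 1)))"
      using c by (intro square_diff_le centred_diff_scale q b)
    also have "\<dots> = 2 * S * \<bar>c - c'\<bar> * (\<bar>z\<bar> + 1) ^ 2" by (simp only: power2_eq_square mult_ac)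
    finally show "\<bar>(centred q c z)\<^sup>2 - (centred q c' z)\<^sup>2\<bar> \<le> 2 * S * \<bar>c - c'\<bar> * (\<bar>z\<bar> + 1) ^ 2" .
  qed
  also have "\<dots> = 2 * S * gauss_moment 2 * \<bar>c - c'\<bar>" by (simp add: gauss_moment_def)
  finally show ?thesis .
qed

lemma gauss_var_diff:
  assumes q: "1-lipschitz_on UNIV q" "1-lipschitz_on UNIV q'" and c: "\<bar>c\<bar> \<le> S"
    and e: "\<And>x. \<bar>q x - q' x\<bar> \<le> e" and S: "0 \<le> S"
  shows "\<bar>gauss_var q c - gauss_var q' c\<bar> \<le> 4 * S * gauss_moment 2 * e"
proof -
  have e0: "0 \<le> e" using e[of 0] by linarith
  have "\<bar>gauss_var q c - gauss_var q' c\<bar> \<le> (\<integral>z. 4 * S * e * (\<bar>z\<bar> + 1) ^ 2 \<partial>gauss)"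
    unfolding gauss_var_def
  proof (intro gauss_integral_diff_le centred_sq_int q integrable_mult_right gauss_integrable_abs1_power)
    fix z
    have b: "\<bar>centred r c z\<bar> \<le> S * (\<bar>z\<bar> + 1)" if "1-lipschitz_on UNIV r" for r
      using c by (intro order_trans[OF centred_bound[OF that]] mult_right_mono) auto
    have "\<bar>(\<integral>z. q (c * z) \<partial>gauss) - (\<integral>z. q' (c * z) \<partial>gauss)\<bar> \<le> (\<integral>z. e \<partial>gauss)"
      by (rule gauss_integral_diff_le[OF gauss_int_lipschitz[OF q(1)] gauss_int_lipschitz[OF q(2)] _ e]) simp
    then have "\<bar>centred q c z - centred q' c z\<bar> \<le> 2 * e"
      using e[of "c * z"] unfolding centred_def by simp
    then have "\<bar>(centred q c z)\<^sup>2 - (centred q' c z)\<^sup>2\<bar> \<le> 2 * e * (2 * (S * (\<bar>z\<bar> + 1)))"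
      using q by (intro square_diff_le b)
    also have "\<dots> = 4 * S * e * (\<bar>z\<bar> + 1)" by simp
    also have "\<dots> \<le> 4 * S * e * (\<bar>z\<bar> + 1) ^ 2"
      using e0 S by (intro mult_left_mono) (auto simp: power2_eq_square algebra_simps)
    finally show "\<bar>(centred q c z)\<^sup>2 - (centred q' c z)\<^sup>2\<bar> \<le> 4 * S * e * (\<bar>z\<bar> + 1) ^ 2" .
  qed
  also have "\<dots> = 4 * S * gauss_moment 2 * e" by (simp add: gauss_moment_def)
  finally show ?thesis .
qed

text \<open>With variance zero, q (c * z) would equal its mean for almost all z. But q u \<ge> |u|
  forces a larger value on a whole interval to the right of mean / c, which is not a null
  set.\<close>

lemma gauss_var_pos:
  assumes q: "1-lipschitz_on UNIV q" and ge: "\<And>u. \<bar>u\<bar> \<le> q u" and c: "0 < c"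
  shows "0 < gauss_var q c"
proof (rule ccontr)
  assume "\<not> 0 < gauss_var q c"
  then have "gauss_var q c = 0" using gauss_var_nonneg[of q c] by linarith
  then have "AE z in gauss. (centred q c z)\<^sup>2 = 0"
    unfolding gauss_var_def using integral_nonneg_eq_0_iff_AE[OF centred_sq_int[OF q, of c]] by simp
  then have "AE z in lborel. 0 < ennreal (std_normal_density z) \<longrightarrow> (centred q c z)\<^sup>2 = 0"
    by (subst (asm) AE_density) auto
  then have ae: "AE z in lborel. centred q c z = 0"
    by eventually_elim (auto simp: normal_density_pos)
  let ?m = "\<integral>z'. q (c * z') \<partial>gauss"
  let ?I = "{?m / c<..<?m / c + 1}"
  have imp: "z \<notin> ?I" if "centred q c z = 0" for z
  proof
    assume "z \<in> ?I"
    then have "?m < c * z" using c by (auto simp: divide_less_eq mult.commute)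
    moreover have "c * z \<le> ?m" using that ge[of "c * z"] by (simp add: centred_def)
    ultimately show False by simp
  qed
  have "AE z in lborel. z \<notin> ?I" by (rule eventually_mono[OF ae imp])
  then have "emeasure lborel ?I = 0" by (subst (asm) AE_iff_measurable[of ?I]) auto
  moreover have "emeasure lborel ?I = 1" by (subst emeasure_lborel_Ioo) auto
  ultimately show False by simp
qed

section \<open>Integrals over [0,1] as expectations under the uniform law\<close>

abbreviation unif01 :: "real measure" where "unif01 \<equiv> restrict_space lborel {0..1}"

lemma prob_space_unif01: "prob_space unif01"
  by (rule prob_spaceI) (simp add: space_restrict_space emeasure_restrict_space)

interpretation unif01: prob_space unif01 by (rule prob_space_unif01)

lemma unif01_prob [simp]: "measure unif01 {0..1} = 1"
  using unif01.prob_space by (simp add: space_restrict_space)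

lemma LBINT_unif01: "(LBINT y:{0..1}. f y) = (\<integral>y. f y \<partial>unif01)" for f :: "real \<Rightarrow> real"
  unfolding set_lebesgue_integral_def by (subst integral_restrict_space) auto

lemma gdist_measurable: "(\<lambda>p. gdist (fst p) (snd p)) \<in> borel_measurable borel"
proof (intro borel_measurable_continuous_onI lipschitz_on_continuous_on lipschitz_onI)
  fix p q :: "real \<times> real"
  have "dist (gdist (fst p) (snd p)) (gdist (fst q) (snd q)) \<le> dist (fst p) (fst q) + dist (snd p) (snd q)"
    using gdist_diff by (simp add: dist_real_def)
  also have "\<dots> \<le> 2 * dist p q" using dist_fst_le[of p q] dist_snd_le[of p q] by linarith
  finally show "dist (gdist (fst p) (snd p)) (gdist (fst q) (snd q)) \<le> 2 * dist p q" .
qed simp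

lemma gdist_measurable2 [measurable (raw)]:
  "f \<in> borel_measurable M \<Longrightarrow> g \<in> borel_measurable M \<Longrightarrow> (\<lambda>w. gdist (f w) (g w)) \<in> borel_measurable M"
  using measurable_compose[OF measurable_Pair gdist_measurable[folded borel_prod]] by (simp add: borel_prod)

text \<open>\<open>s\<close> stands for an extension of \<sigma> to the whole line. Positivity and
  boundedness everywhere spare side conditions on the argument.\<close>

locale scale_function =
  fixes s :: "real \<Rightarrow> real" and S :: real
  assumes s_meas [measurable]: "s \<in> borel_measurable borel" and s_pos: "\<And>x. 0 < s x" and s_le: "\<And>x. s x \<le> S"
begin

lemma s_unif [measurable]: "s \<in> borel_measurable unif01"
  by (rule measurable_restrict_space1) simp

lemma S_pos: "0 < S" using s_pos[of 0] s_le[of 0] by simp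

lemma gdist_s_bound: "\<bar>gdist u (s y)\<bar> \<le> \<bar>u\<bar> + S"
  using gdist_le[of u "s y"] gdist_nonneg[of u "s y"] s_pos[of y] s_le[of y] by simp

lemma gdist_s_int: "integrable unif01 (\<lambda>y. gdist u (s y))"
  by (rule unif01.integrable_abs_bounded[of _ "\<bar>u\<bar> + S"]) (use gdist_s_bound in auto)

text \<open>The limiting first-order projection of the kernel, averaged over the scale of the second
  argument; its centred variance is the inner expectation of \<psi>^2.\<close>

definition qlim :: "real \<Rightarrow> real" where "qlim u = (\<integral>y. gdist u (s y) \<partial>unif01)"

lemma qlim_lipschitz: "1-lipschitz_on UNIV qlim"
proof (rule lipschitz_absI)
  fix x y
  have "\<bar>qlim x - qlim y\<bar> \<le> \<bar>x - y\<bar>"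
    unfolding qlim_def
    by (intro unif01.abs_expectation_diff_le gdist_s_int) (use gdist_diff[of x "s w" y "s w" for w] in auto)
  then show "\<bar>qlim x - qlim y\<bar> \<le> 1 * \<bar>x - y\<bar>" by simp
qed simp

lemma qlim_ge: "\<bar>u\<bar> \<le> qlim u"
proof -
  have "(\<integral>y. \<bar>u\<bar> \<partial>unif01) \<le> qlim u" unfolding qlim_def
    by (intro integral_mono gdist_s_int gdist_ge) auto
  then show ?thesis by simp
qed

lemma qlim_fubini: "(\<integral>z. qlim (c * z) \<partial>gauss) = (\<integral>y. gdist2 c (s y) \<partial>unif01)"
proof -
  interpret P: pair_prob_space gauss unif01 ..
  have I: "integrable (gauss \<Otimes>\<^sub>M unif01) (\<lambda>(z, y). gdist (c * z) (s y))"
  proof (rule P.Fubini_integrable)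
    show "(\<lambda>(z, y). gdist (c * z) (s y)) \<in> borel_measurable (gauss \<Otimes>\<^sub>M unif01)" by measurable
    have "(\<lambda>z. \<integral>y. norm (case (z, y) of (z, y) \<Rightarrow> gdist (c * z) (s y)) \<partial>unif01) = (\<lambda>z. qlim (c * z))"
      by (simp add: qlim_def gdist_nonneg)
    then show "integrable gauss (\<lambda>z. \<integral>y. norm (case (z, y) of (z, y) \<Rightarrow> gdist (c * z) (s y)) \<partial>unif01)"
      using gauss_int_lipschitz[OF qlim_lipschitz] by simp
  qed (use gdist_s_int in auto)
  show ?thesis unfolding qlim_def gdist2_def using P.Fubini_integral[OF I] by simp
qed

end

section \<open>Conditional expectation given Z and the form of the limiting variance\<close>

locale gauss_pair = prob_space N for N :: "'b measure" +
  fixes Z Z' :: "'b \<Rightarrow> real"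
  assumes Z: "distributed N lborel Z (\<lambda>x. ennreal (std_normal_density x))"
    and Z': "distributed N lborel Z' (\<lambda>x. ennreal (std_normal_density x))"
    and indep: "indep_var borel Z borel Z'"
begin

lemma Z_measurable [measurable]: "Z \<in> borel_measurable N" "Z' \<in> borel_measurable N"
  using Z Z' by (auto simp: distributed_def)

lemma distr_Z: "distr N borel Z = gauss" "distr N borel Z' = gauss"
proof -
  have "distr N borel Z = distr N lborel Z" "distr N borel Z' = distr N lborel Z'"
    by (auto intro: distr_cong)
  then show "distr N borel Z = gauss" "distr N borel Z' = gauss" using Z Z' by (auto simp: distributed_def)
qed

lemma distr_pair_Z: "distr N (borel \<Otimes>\<^sub>M borel) (\<lambda>v. (Z v, Z' v)) = gauss \<Otimes>\<^sub>M gauss"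
  using indep unfolding indep_var_distribution_eq distr_Z by simp

lemma integral_Z: "f \<in> borel_measurable borel \<Longrightarrow> (\<integral>v. f (Z v) \<partial>N) = (\<integral>z. f z \<partial>gauss)" for f :: "real \<Rightarrow> real"
  unfolding distr_Z(1)[symmetric] by (subst integral_distr) auto

lemma integrable_Z: "f \<in> borel_measurable borel \<Longrightarrow> integrable N (\<lambda>v. f (Z v)) \<longleftrightarrow> integrable gauss f" for f :: "real \<Rightarrow> real"
  unfolding distr_Z(1)[symmetric] by (subst integrable_distr_eq) auto

lemma integrable_Z': "f \<in> borel_measurable borel \<Longrightarrow> integrable N (\<lambda>v. f (Z' v)) \<longleftrightarrow> integrable gauss f" for f :: "real \<Rightarrow> real"
  unfolding distr_Z(2)[symmetric] by (subst integrable_distr_eq) auto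

lemma Z_integrable [simp]: "integrable N Z" "integrable N Z'"
  using integrable_Z[of "\<lambda>z. z"] integrable_Z'[of "\<lambda>z. z"] by auto

lemma integral_Z_pair:
  assumes [measurable]: "B \<in> sets borel"
  shows "(\<integral>v. indicator B (Z v) * \<bar>c * Z v - d * Z' v\<bar> \<partial>N) = (\<integral>z. indicator B z * gdist (c * z) d \<partial>gauss)"
proof -
  interpret P: pair_prob_space gauss gauss ..
  let ?f = "\<lambda>p. indicator B (fst p) * \<bar>c * fst p - d * snd p\<bar> :: real"
  have "integrable N (\<lambda>v. indicator B (Z v) * \<bar>c * Z v - d * Z' v\<bar>)"
    by (rule Bochner_Integration.integrable_bound[of _ "\<lambda>v. \<bar>c * Z v - d * Z' v\<bar>"]) (auto simp: indicator_def)
  then have "integrable (distr N (borel \<Otimes>\<^sub>M borel) (\<lambda>v. (Z v, Z' v))) ?f"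
    by (subst integrable_distr_eq) auto
  then have I: "integrable (gauss \<Otimes>\<^sub>M gauss) ?f" unfolding distr_pair_Z .
  have "(\<integral>v. indicator B (Z v) * \<bar>c * Z v - d * Z' v\<bar> \<partial>N) = (\<integral>p. ?f p \<partial>distr N (borel \<Otimes>\<^sub>M borel) (\<lambda>v. (Z v, Z' v)))"
    by (subst integral_distr) auto
  also have "\<dots> = (\<integral>z. (\<integral>z'. ?f (z, z') \<partial>gauss) \<partial>gauss)" unfolding distr_pair_Z by (rule P.integral_fst'[OF I, symmetric])
  also have "\<dots> = (\<integral>z. indicator B z * gdist (c * z) d \<partial>gauss)" by (simp add: gdist_def)
  finally show ?thesis .
qed

lemma expectation_Z_pair: "(\<integral>v. \<bar>c * Z v - d * Z' v\<bar> \<partial>N) = gdist2 c d"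
  using integral_Z_pair[of UNIV c d] by (simp add: gdist2_def)

abbreviation "sigmaZ \<equiv> vimage_algebra (space N) Z borel"

lemma subalgebra_sigmaZ: "subalgebra N sigmaZ"
  unfolding subalgebra_def by (auto simp: sets_vimage_algebra2 intro: measurable_sets)

text \<open>Independence permits integrating Z' out with Z frozen. Every event of
  \<open>sigmaZ\<close> is a preimage under Z, so \<open>integral_Z_pair\<close> is the
  characterising property of the conditional expectation.\<close>

lemma cond_exp_Z:
  "AE w in N. real_cond_exp N sigmaZ (\<lambda>v. \<bar>c * Z v - d * Z' v\<bar>) w = gdist (c * Z w) d"
proof -
  interpret F: finite_measure_subalgebra N sigmaZ
    by unfold_locales (rule subalgebra_sigmaZ)
  show ?thesis
  proof (rule F.real_cond_exp_charact)
    fix A assume "A \<in> sets sigmaZ"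
    then obtain B where B: "B \<in> sets borel" "A = Z -` B \<inter> space N" by (auto simp: sets_vimage_algebra2)
    note [measurable] = B(1)
    have ind: "indicator A w = (indicator B (Z w) :: real)" if "w \<in> space N" for w using that B by (auto simp: indicator_def)
    have "(\<integral>w\<in>A. \<bar>c * Z w - d * Z' w\<bar> \<partial>N) = (\<integral>w. indicator B (Z w) * \<bar>c * Z w - d * Z' w\<bar> \<partial>N)"
      unfolding set_lebesgue_integral_def by (intro Bochner_Integration.integral_cong) (auto simp: ind)
    also have "\<dots> = (\<integral>z. indicator B z * gdist (c * z) d \<partial>gauss)" by (rule integral_Z_pair[OF B(1)])
    also have "\<dots> = (\<integral>w. indicator B (Z w) * gdist (c * Z w) d \<partial>N)" by (rule integral_Z[symmetric]) measurable
    also have "\<dots> = (\<integral>w\<in>A. gdist (c * Z w) d \<partial>N)"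
      unfolding set_lebesgue_integral_def by (intro Bochner_Integration.integral_cong) (auto simp: ind)
    finally show "(\<integral>w\<in>A. \<bar>c * Z w - d * Z' w\<bar> \<partial>N) = (\<integral>w\<in>A. gdist (c * Z w) d \<partial>N)" .
  next
    show "integrable N (\<lambda>w. gdist (c * Z w) d)"
      by (rule integrable_lipschitz[OF gdist_lipschitz]) simp
    have "Z \<in> borel_measurable sigmaZ" by (rule measurable_vimage_algebra1) simp
    then show "(\<lambda>w. gdist (c * Z w) d) \<in> borel_measurable sigmaZ" by measurable
  qed simp
qed

text \<open>For fixed x the inner integral over y becomes \<open>qlim (s x * Z)\<close>, and by
  \<open>qlim_fubini\<close> the subtracted part is its Gaussian mean; the expectation of the square
  is thus a variance under the law of Z.\<close>

lemma psi_sq_eq: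
  assumes G: "cond_exp_version N Z Z' \<sigma> G" and s: "scale_function s S" and eq: "\<And>x. x \<in> {0..1} \<Longrightarrow> s x = \<sigma> x"
  shows "psi_sq N Z Z' \<sigma> G = 4 * (\<integral>x. gauss_var (scale_function.qlim s) (s x) \<partial>unif01)"
proof -
  interpret scale_function s S by fact
  have inner: "(\<integral>w. \<bar>LBINT y:{0..1}. (G x y w - (\<integral>v. \<bar>\<sigma> x * Z v - \<sigma> y * Z' v\<bar> \<partial>N))\<bar>\<^sup>2 \<partial>N) = gauss_var qlim (s x)"
    if x: "x \<in> {0..1}" for x
  proof -
    interpret P: pair_sigma_finite unif01 N ..
    have sp: "space unif01 = {0..1}" by (simp add: space_restrict_space)
    let ?g = "\<lambda>y w. gdist (s x * Z w) (s y)"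
    have Gm: "(\<lambda>(y, w). G x y w) \<in> borel_measurable (unif01 \<Otimes>\<^sub>M N)"
    proof -
      have "(\<lambda>p. (fst p, snd p)) \<in> measurable (unif01 \<Otimes>\<^sub>M N) (restrict_space borel {0..1} \<Otimes>\<^sub>M sigmaZ)"
      proof (rule measurable_Pair)
        have "sets unif01 = sets (restrict_space borel {0..1})" by (simp add: sets_restrict_space)
        then show "fst \<in> measurable (unif01 \<Otimes>\<^sub>M N) (restrict_space borel {0..1})"
          using measurable_fst[of unif01 N] measurable_cong_sets[OF refl] by blast
        show "snd \<in> measurable (unif01 \<Otimes>\<^sub>M N) sigmaZ"
          by (rule measurable_vimage_algebra2) (auto simp: space_pair_measure)
      qed
      moreover have "(\<lambda>(y, w). G x y w) \<in> borel_measurable (restrict_space borel {0..1} \<Otimes>\<^sub>M sigmaZ)"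
        using G x unfolding cond_exp_version_def by blast
      ultimately have "(\<lambda>p. (\<lambda>(y, w). G x y w) (fst p, snd p)) \<in> borel_measurable (unif01 \<Otimes>\<^sub>M N)"
        by (rule measurable_compose)
      then show ?thesis by (simp add: case_prod_unfold)
    qed
    have gm: "(\<lambda>p. ?g (fst p) (snd p)) \<in> borel_measurable (unif01 \<Otimes>\<^sub>M N)" by measurable
    have Gm': "(\<lambda>p. G x (fst p) (snd p)) \<in> borel_measurable (unif01 \<Otimes>\<^sub>M N)"
      using Gm by (simp add: case_prod_unfold)
    have "AE w in N. G x y w = ?g y w" if y: "y \<in> {0..1}" for y
    proof -
      have "AE w in N. G x y w = real_cond_exp N sigmaZ (\<lambda>v. \<bar>\<sigma> x * Z v - \<sigma> y * Z' v\<bar>) w"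
        using G x y unfolding cond_exp_version_def by blast
      moreover have "AE w in N. real_cond_exp N sigmaZ (\<lambda>v. \<bar>\<sigma> x * Z v - \<sigma> y * Z' v\<bar>) w = gdist (\<sigma> x * Z w) (\<sigma> y)"
        by (rule cond_exp_Z)
      ultimately show ?thesis by eventually_elim (simp add: eq[OF x] eq[OF y])
    qed
    then have "AE y in unif01. AE w in N. G x y w = ?g y w" by (rule AE_I2) (simp only: sp)
    \<comment> \<open>The exceptional null set of w depends on y. Joint measurability allows
      exchanging the two quantifiers, so that for almost every w the integrands agree for almost
      every y.\<close>
    then have ae: "AE w in N. AE y in unif01. G x y w = ?g y w"
      by (subst (asm) P.AE_commute) (intro borel_measurable_eq Gm' gm)
    have gd2: "gdist2 (s x) (s y) = sqrt ((s x)\<^sup>2 + (s y)\<^sup>2) * sqrt (2 / pi)" for y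
      using s_pos[of x] s_pos[of y] by (intro gdist2_eq) auto
    have gd2m [measurable]: "(\<lambda>y. gdist2 (s x) (s y)) \<in> borel_measurable unif01" unfolding gd2 by measurable
    have gd2b: "\<bar>gdist2 (s x) (s y)\<bar> \<le> S + S" for y
      using gdist2_le[of "s x" "s y"] gdist2_nonneg[of "s x" "s y"] s_pos[of x] s_pos[of y] s_le[of x] s_le[of y] by simp
    have gd2i: "integrable unif01 (\<lambda>y. gdist2 (s x) (s y))"
      by (rule unif01.integrable_abs_bounded[OF gd2m gd2b])
    let ?E = "\<lambda>y. \<integral>v. \<bar>\<sigma> x * Z v - \<sigma> y * Z' v\<bar> \<partial>N"
    have E: "?E y = gdist2 (s x) (s y)" if "y \<in> {0..1}" for y
      using expectation_Z_pair[of "\<sigma> x" "\<sigma> y"] eq[OF x] eq[OF that] by simp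
    have L: "(LBINT y:{0..1}. (G x y w - ?E y)) = (\<integral>y. G x y w - gdist2 (s x) (s y) \<partial>unif01)" for w
      unfolding LBINT_unif01 by (intro Bochner_Integration.integral_cong refl) (simp add: sp E)
    have Lm: "(\<lambda>w. \<integral>y. G x y w - gdist2 (s x) (s y) \<partial>unif01) \<in> borel_measurable N"
    proof (rule unif01.borel_measurable_lebesgue_integral)
      have "(\<lambda>q. G x (snd q) (fst q)) \<in> borel_measurable (N \<Otimes>\<^sub>M unif01)"
        using measurable_pair_swap[OF Gm] by (simp add: case_prod_unfold)
      then show "(\<lambda>(w, y). G x y w - gdist2 (s x) (s y)) \<in> borel_measurable (N \<Otimes>\<^sub>M unif01)"
        unfolding case_prod_unfold by measurable
    qed
    note q = qlim_lipschitz
    have "AE w in N. (\<integral>y. G x y w - gdist2 (s x) (s y) \<partial>unif01) = centred qlim (s x) (Z w)"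
      using ae AE_space
    proof eventually_elim
      fix w assume w: "AE y in unif01. G x y w = ?g y w" "w \<in> space N"
      have "(\<lambda>y. G x y w) \<in> borel_measurable unif01"
        using measurable_compose[OF measurable_Pair2'[OF w(2)] Gm] by simp
      then have "(\<integral>y. G x y w - gdist2 (s x) (s y) \<partial>unif01) = (\<integral>y. ?g y w - gdist2 (s x) (s y) \<partial>unif01)"
        using w(1) by (intro integral_cong_AE) auto
      also have "\<dots> = qlim (s x * Z w) - (\<integral>y. gdist2 (s x) (s y) \<partial>unif01)"
        unfolding qlim_def by (rule Bochner_Integration.integral_diff[OF gdist_s_int gd2i])
      finally show "(\<integral>y. G x y w - gdist2 (s x) (s y) \<partial>unif01) = centred qlim (s x) (Z w)"
        unfolding centred_def qlim_fubini .
    qed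
    then have "(\<integral>w. \<bar>\<integral>y. G x y w - gdist2 (s x) (s y) \<partial>unif01\<bar>\<^sup>2 \<partial>N) = (\<integral>w. (centred qlim (s x) (Z w))\<^sup>2 \<partial>N)"
      using Lm measurable_compose[OF Z_measurable(1) centred_measurable[OF q]] by (intro integral_cong_AE) auto
    also have "\<dots> = gauss_var qlim (s x)"
      unfolding gauss_var_def using centred_measurable[OF q] by (intro integral_Z) measurable
    finally show ?thesis unfolding L .
  qed
  have sp: "space unif01 = {0..1}" by (simp add: space_restrict_space)
  show ?thesis
    unfolding psi_sq_def LBINT_unif01[of "\<lambda>x. (\<integral>w. \<bar>LBINT y:{0..1}. (G x y w - (\<integral>v. \<bar>\<sigma> x * Z v - \<sigma> y * Z' v\<bar> \<partial>N))\<bar>\<^sup>2 \<partial>N)"]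
    by (intro arg_cong[where f = "\<lambda>r. 4 * r"] Bochner_Integration.integral_cong refl) (simp only: sp inner)
qed

end

context scale_function
begin

text \<open>The variance is Lipschitz in the scale on bounded sets only, so the scale is clamped to
  [-S, S], which does not change it on the range of s.\<close>

lemma gauss_var_measurable: "(\<lambda>x. gauss_var qlim (s x)) \<in> borel_measurable borel"
proof -
  let ?f = "\<lambda>c. gauss_var qlim (max (- S) (min S c))"
  have "(2 * S * gauss_moment 2)-lipschitz_on UNIV ?f"
  proof (rule lipschitz_absI)
    fix c c' :: real
    let ?k = "\<lambda>c. max (- S) (min S c)"
    have "\<bar>?f c - ?f c'\<bar> \<le> 2 * S * gauss_moment 2 * \<bar>?k c - ?k c'\<bar>"
      using S_pos by (intro gauss_var_lipschitz qlim_lipschitz) auto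
    also have "\<dots> \<le> 2 * S * gauss_moment 2 * \<bar>c - c'\<bar>"
    proof (rule mult_left_mono)
      show "\<bar>?k c - ?k c'\<bar> \<le> \<bar>c - c'\<bar>" by (auto simp: max_def min_def)
      have "0 \<le> gauss_moment 2" unfolding gauss_moment_def by (intro integral_nonneg_AE) auto
      then show "0 \<le> 2 * S * gauss_moment 2" using S_pos by simp
    qed
    finally show "\<bar>?f c - ?f c'\<bar> \<le> 2 * S * gauss_moment 2 * \<bar>c - c'\<bar>" .
  next
    have "0 \<le> gauss_moment 2" unfolding gauss_moment_def by (intro integral_nonneg_AE) auto
    then show "0 \<le> 2 * S * gauss_moment 2" using S_pos by simp
  qed
  then have "?f \<in> borel_measurable borel" by (rule lipschitz_borel)
  then have "(\<lambda>x. ?f (s x)) \<in> borel_measurable borel" by measurable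
  moreover have "?f (s x) = gauss_var qlim (s x)" for x using s_pos[of x] s_le[of x] S_pos by (simp add: max_def min_def)
  ultimately show ?thesis by simp
qed

definition psi2 :: real where "psi2 = 4 * (\<integral>x. gauss_var qlim (s x) \<partial>unif01)"

lemma gauss_var_s_bound: "\<bar>gauss_var qlim (s x)\<bar> \<le> 2 * S * gauss_moment 2 * S"
proof -
  have "\<bar>gauss_var qlim (s x) - gauss_var qlim 0\<bar> \<le> 2 * S * gauss_moment 2 * \<bar>s x - 0\<bar>"
    using s_pos[of x] s_le[of x] S_pos by (intro gauss_var_lipschitz qlim_lipschitz) auto
  moreover have "gauss_var qlim 0 = 0" by (simp add: gauss_var_def centred_def)
  moreover have "2 * S * gauss_moment 2 * \<bar>s x - 0\<bar> \<le> 2 * S * gauss_moment 2 * S"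
  proof (rule mult_left_mono)
    have "0 \<le> gauss_moment 2" unfolding gauss_moment_def by (intro integral_nonneg_AE) auto
    then show "0 \<le> 2 * S * gauss_moment 2" using S_pos by simp
  qed (use s_pos[of x] s_le[of x] in auto)
  ultimately show ?thesis by simp
qed

lemma gauss_var_s_int: "integrable unif01 (\<lambda>x. gauss_var qlim (s x))"
proof (rule unif01.integrable_abs_bounded[OF _ gauss_var_s_bound])
  show "(\<lambda>x. gauss_var qlim (s x)) \<in> borel_measurable unif01"
    using gauss_var_measurable by (intro measurable_restrict_space1) simp
qed

text \<open>The limit law is given by a density, which requires a genuinely positive standard
  deviation.\<close>

lemma psi2_pos: "0 < psi2"
proof (rule ccontr)
  assume "\<not> 0 < psi2"
  moreover have "0 \<le> (\<integral>x. gauss_var qlim (s x) \<partial>unif01)" by (intro integral_nonneg_AE AE_I2 gauss_var_nonneg)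
  ultimately have "(\<integral>x. gauss_var qlim (s x) \<partial>unif01) = 0" unfolding psi2_def by linarith
  then have "AE x in unif01. gauss_var qlim (s x) = 0"
    using integral_nonneg_eq_0_iff_AE[OF gauss_var_s_int] gauss_var_nonneg by simp
  moreover have "gauss_var qlim (s x) \<noteq> 0" for x
    using gauss_var_pos[OF qlim_lipschitz qlim_ge s_pos[of x]] by simp
  ultimately have "AE x in unif01. False" by simp
  then show False using unif01.AE_False by simp
qed

end

section \<open>Local means and the Hoeffding decomposition\<close>

lemma sum_block_shift:
  fixes f :: "nat \<Rightarrow> real"
  shows "(\<Sum>i = j * l + 1..Suc j * l. f i) = (\<Sum>i<l. f (j * l + 1 + i))"
proof -
  have "{j * l + 1..Suc j * l} = (\<lambda>i. j * l + 1 + i) ` {..<l}"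
  proof (intro equalityI subsetI)
    fix x assume x: "x \<in> {j * l + 1..Suc j * l}"
    then have "x = j * l + 1 + (x - (j * l + 1))" "x - (j * l + 1) < l" by auto
    then show "x \<in> (\<lambda>i. j * l + 1 + i) ` {..<l}" by blast
  qed auto
  then show ?thesis by (simp add: sum.reindex inj_on_def)
qed

text \<open>The diagonal terms are zero and may be added; the shift counts blocks from 0.\<close>

lemma U_stat_eq:
  "U_stat X l b w = (\<Sum>j<b. \<Sum>k<b. \<bar>local_mean X l (Suc j) w - local_mean X l (Suc k) w\<bar>) / (real b * (real b - 1))"
proof -
  let ?f = "\<lambda>(j, k). \<bar>local_mean X l j w - local_mean X l k w\<bar>"
  have "(\<Sum>(j, k)\<in>{(j, k). j \<in> {1..b} \<and> k \<in> {1..b} \<and> j \<noteq> k}. \<bar>local_mean X l j w - local_mean X l k w\<bar>)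
      = sum ?f ({1..b} \<times> {1..b})"
    by (rule sum.mono_neutral_left) auto
  also have "\<dots> = (\<Sum>j\<in>{1..b}. \<Sum>k\<in>{1..b}. \<bar>local_mean X l j w - local_mean X l k w\<bar>)"
    by (simp add: sum.cartesian_product)
  also have "\<dots> = (\<Sum>j<b. \<Sum>k<b. \<bar>local_mean X l (Suc j) w - local_mean X l (Suc k) w\<bar>)"
    unfolding One_nat_def sum.atLeast1_atMost_eq ..
  finally show ?thesis unfolding U_stat_def by simp
qed

lemma sum_abs_diff_le:
  fixes x y :: "nat \<Rightarrow> real"
  shows "\<bar>(\<Sum>j<b. \<Sum>k<b. \<bar>x j - x k\<bar>) - (\<Sum>j<b. \<Sum>k<b. \<bar>y j - y k\<bar>)\<bar> \<le> 2 * real b * (\<Sum>j<b. \<bar>x j - y j\<bar>)"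
proof -
  have tri: "\<bar>\<bar>p - q\<bar> - \<bar>p' - q'\<bar>\<bar> \<le> \<bar>p - p'\<bar> + \<bar>q - q'\<bar>" for p q p' q' :: real by linarith
  have "(\<Sum>j<b. \<Sum>k<b. \<bar>x j - x k\<bar>) - (\<Sum>j<b. \<Sum>k<b. \<bar>y j - y k\<bar>) = (\<Sum>j<b. \<Sum>k<b. \<bar>x j - x k\<bar> - \<bar>y j - y k\<bar>)"
    by (simp only: sum_subtractf)
  then have "\<bar>(\<Sum>j<b. \<Sum>k<b. \<bar>x j - x k\<bar>) - (\<Sum>j<b. \<Sum>k<b. \<bar>y j - y k\<bar>)\<bar> \<le> (\<Sum>j<b. \<Sum>k<b. \<bar>\<bar>x j - x k\<bar> - \<bar>y j - y k\<bar>\<bar>)"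
    by (simp only:) (intro order_trans[OF sum_abs] sum_mono order_trans[OF sum_abs] order_refl)
  also have "\<dots> \<le> (\<Sum>j<b. \<Sum>k<b. \<bar>x j - y j\<bar> + \<bar>x k - y k\<bar>)" by (intro sum_mono tri)
  also have "\<dots> = 2 * real b * (\<Sum>j<b. \<bar>x j - y j\<bar>)" by (simp add: sum.distrib sum_distrib_left mult.assoc)
  finally show ?thesis .
qed

text \<open>If \<mu> x differed from m, right continuity would keep \<mu> away from m on an interval
  to the right of x. No such interval exists inside [0,1] at x = 1.\<close>

lemma cadlag01_ae_const:
  assumes "cadlag01 \<mu>" and ae: "AE x in lborel. x \<in> {0..1} \<longrightarrow> \<mu> x = m" and x: "0 \<le> x" "x < 1"
  shows "\<mu> x = m"
proof (rule ccontr)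
  assume ne: "\<mu> x \<noteq> m"
  have "(\<mu> \<longlongrightarrow> \<mu> x) (at_right x)" using assms unfolding cadlag01_def by auto
  then have "\<forall>\<^sub>F y in at_right x. \<mu> y \<noteq> m" using ne by (rule tendsto_imp_eventually_ne)
  then obtain c where c: "x < c" "\<And>y. x < y \<Longrightarrow> y < c \<Longrightarrow> \<mu> y \<noteq> m"
    unfolding eventually_at_right_field by blast
  define d where "d = min c 1"
  have d: "x < d" using c x by (simp add: d_def)
  have "AE y in lborel. y \<notin> {x<..<d}"
    by (rule eventually_mono[OF ae]) (use c x in \<open>auto simp: d_def\<close>)
  then have "emeasure lborel {x<..<d} = 0" by (subst (asm) AE_iff_measurable[of "{x<..<d}"]) auto
  moreover have "emeasure lborel {x<..<d} = d - x" using d by simp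
  ultimately show False using d by simp
qed

text \<open>\<open>m\<close> is the constant value of \<mu>, available on [0,1) only, and
  \<open>K\<close> bounds the sum of the oscillations of s over the blocks for every number b of
  blocks.\<close>

locale gini_clt = mixing_process M Y \<delta> \<theta> C B \<gamma> + scale_function s S
  for M :: "'a measure" and Y \<delta> \<theta> C B \<gamma> s S +
  fixes \<mu> \<sigma> :: "real \<Rightarrow> real" and m \<rho> K :: real
  assumes v: "0 < v" and \<rho>: "1 < \<rho>"
    and \<sigma>: "\<And>x. x \<in> {0..1} \<Longrightarrow> s x = \<sigma> x" and \<mu>: "\<And>x. 0 \<le> x \<Longrightarrow> x < 1 \<Longrightarrow> \<mu> x = m"
    and K: "0 \<le> K" and osc: "1 \<le> b \<Longrightarrow> \<exists>d. (\<forall>j. 0 \<le> d j) \<and> (\<Sum>j<b. d j) \<le> K \<and>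
       (\<forall>j<b. \<forall>x. real j / real b < x \<and> x \<le> real (Suc j) / real b \<longrightarrow> \<bar>s x - s (real (Suc j) / real b)\<bar> \<le> d j)"
begin

definition grid :: "nat \<Rightarrow> nat \<Rightarrow> real" where "grid b j = s (real (Suc j) / real b)"

lemma grid: "0 < grid b j" "grid b j \<le> S" "\<bar>grid b j\<bar> \<le> S"
  using s_pos[of "real (Suc j) / real b"] s_le[of "real (Suc j) / real b"] by (auto simp: grid_def)

definition obs :: "nat \<Rightarrow> nat \<Rightarrow> nat \<Rightarrow> 'a \<Rightarrow> real" where
  "obs l b j w = sqrt (real l) / sqrt v * (local_mean (observation \<mu> \<sigma> Y (b * l)) l (Suc j) w - m)"

definition stat :: "nat \<Rightarrow> nat \<Rightarrow> 'a \<Rightarrow> real" where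
  "stat l b w = sqrt (real b) * (sqrt (real l) / sqrt v * U_stat (observation \<mu> \<sigma> Y (b * l)) l b w
     - (\<integral>x. (\<integral>y. gdist2 (s x) (s y) \<partial>unif01) \<partial>unif01))"

definition qemp :: "nat \<Rightarrow> real \<Rightarrow> real" where "qemp b u = (\<Sum>k<b. gdist u (grid b k)) / real b"

text \<open>The first-order projection of the statistic. It uses the finite average
  \<open>qemp\<close> instead of \<open>qlim\<close>, because the decomposition for finite b is then
  an exact identity.\<close>

definition linear_part :: "nat \<Rightarrow> nat \<Rightarrow> 'a \<Rightarrow> real" where
  "linear_part l b w = 2 / sqrt (real b) * (\<Sum>j<b. centred (qemp b) (grid b j) (bsum l j w))"

text \<open>The second summand pays for the observation with index n, where \<mu> is evaluated at
  1.\<close>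

definition obs_const :: real where
  "obs_const = K * sqrt (vabs / v) + \<bar>\<mu> 1 - m\<bar> / sqrt v"

lemma observation_measurable: "1 \<le> i \<Longrightarrow> observation \<mu> \<sigma> Y n i \<in> borel_measurable M"
  unfolding observation_def[abs_def] using Y_meas by measurable

lemma local_mean_measurable [measurable]: "local_mean (observation \<mu> \<sigma> Y n) l j \<in> borel_measurable M"
  unfolding local_mean_def[abs_def]
  by (intro borel_measurable_divide borel_measurable_sum observation_measurable borel_measurable_const) auto

text \<open>The difference is a sum of the variables of the block with weights \<sigma>(i / n) minus
  \<sigma> at the end of the block, all of modulus at most d, plus a deterministic part from \<mu>
  that can be nonzero in the last block only.\<close>

lemma obs_diff:
  assumes l: "1 \<le> l" and j: "j < b" and d: "0 \<le> d"
    and dj: "\<And>x. real j / real b < x \<Longrightarrow> x \<le> real (Suc j) / real b \<Longrightarrow> \<bar>s x - s (real (Suc j) / real b)\<bar> \<le> d"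
  shows "integrable M (obs l b j)"
    and "expectation (\<lambda>w. \<bar>obs l b j w - grid b j * bsum l j w\<bar>)
      \<le> d * sqrt (vabs / v) + (if Suc j = b then \<bar>\<mu> 1 - m\<bar> / sqrt v else 0)"
proof -
  define t where "t i = real (j * l + 1 + i) / real (b * l)" for i
  have bl: "0 < real (b * l)" using l j by simp
  have t: "real j / real b < t i" "t i \<le> real (Suc j) / real b" if "i < l" for i
  proof -
    have e: "real j / real b = real (j * l) / real (b * l)" "real (Suc j) / real b = real (Suc j * l) / real (b * l)"
      using l j by (simp_all add: field_simps)
    show "real j / real b < t i" unfolding t_def e by (intro divide_strict_right_mono bl) simp
    have "j * l + 1 + i \<le> Suc j * l" using that by simp
    then have "real (j * l + 1 + i) \<le> real (Suc j * l)" by (simp only: of_nat_le_iff)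
    then show "t i \<le> real (Suc j) / real b" unfolding t_def e using bl by (intro divide_right_mono) auto
  qed
  have le1: "real (Suc j) / real b \<le> 1" using j by simp
  have t01: "t i \<in> {0..1}" if "i < l" for i
  proof -
    have "0 \<le> real j / real b" by simp
    then show ?thesis using t[OF that] le1 unfolding atLeastAtMost_iff by linarith
  qed
  let ?r = "sqrt (real l * v)"
  have r: "0 < ?r" using l v by simp
  have rr: "sqrt (real l) / sqrt v / real l = 1 / ?r"
  proof -
    have "real l = sqrt (real l) * sqrt (real l)" by simp
    then have "sqrt (real l) / sqrt v / real l = sqrt (real l) / sqrt v / (sqrt (real l) * sqrt (real l))" by simp
    also have "\<dots> = 1 / (sqrt (real l) * sqrt v)" using l by (simp del: real_sqrt_mult_self)
    finally show ?thesis by (simp add: real_sqrt_mult)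
  qed
  let ?m = "\<Sum>i<l. \<mu> (t i) - m" and ?Y = "\<lambda>c w. \<Sum>i<l. c i * Y (j * l + 1 + i) w"
  have obs_eq: "obs l b j w = (?m + ?Y (\<lambda>i. \<sigma> (t i)) w) / ?r" for w
  proof -
    have "local_mean (observation \<mu> \<sigma> Y (b * l)) l (Suc j) w
        = (\<Sum>i<l. \<mu> (t i) + \<sigma> (t i) * Y (j * l + 1 + i) w) / real l"
      unfolding local_mean_def observation_def t_def
      using sum_block_shift[of "\<lambda>i. \<mu> (real i / real (b * l)) + \<sigma> (real i / real (b * l)) * Y i w" j l] by simp
    moreover have "(\<Sum>i<l. \<mu> (t i) + \<sigma> (t i) * Y (j * l + 1 + i) w) = (?m + ?Y (\<lambda>i. \<sigma> (t i)) w) + real l * m"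
      by (simp add: sum.distrib sum_subtractf)
    ultimately have "local_mean (observation \<mu> \<sigma> Y (b * l)) l (Suc j) w - m = (?m + ?Y (\<lambda>i. \<sigma> (t i)) w) / real l"
      using l by (simp add: add_divide_distrib)
    then have "obs l b j w = sqrt (real l) / sqrt v / real l * (?m + ?Y (\<lambda>i. \<sigma> (t i)) w)"
      unfolding obs_def by simp
    then show ?thesis unfolding rr by simp
  qed
  have IY: "integrable M (?Y c)" for c by (rule weighted_sum_integrable)
  show I: "integrable M (obs l b j)" unfolding obs_eq[abs_def] using IY by simp
  have grid_eq: "grid b j * bsum l j w = ?Y (\<lambda>_. grid b j) w / ?r" for w
    unfolding bsum_def psum_def by (simp add: sum_distrib_left)
  have diff: "obs l b j w - grid b j * bsum l j w = (?m + ?Y (\<lambda>i. \<sigma> (t i) - grid b j) w) / ?r" for w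
    unfolding obs_eq grid_eq diff_divide_distrib[symmetric]
    by (simp add: sum_subtractf left_diff_distrib)
  have c: "\<bar>\<sigma> (t i) - grid b j\<bar> \<le> d" if "i < l" for i
    using dj[OF t[OF that]] \<sigma>[OF t01[OF that]] unfolding grid_def by simp
  have EY: "expectation (\<lambda>w. \<bar>?Y (\<lambda>i. \<sigma> (t i) - grid b j) w\<bar>) \<le> d * sqrt (real l * vabs)"
    by (rule weighted_sum_abs[OF c d])
  have mu_le: "\<bar>?m\<bar> \<le> (if Suc j = b then \<bar>\<mu> 1 - m\<bar> else 0)"
  proof (cases "Suc j = b")
    case True
    \<comment> \<open>Every point of the last block except the final one lies strictly below 1, so a
      single summand of the deterministic part survives.\<close>
    have lt: "t i < 1" if "i < l - 1" for i
    proof -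
      have "j * l + 1 + i < Suc j * l" using that by simp
      then have "real (j * l + 1 + i) < real (b * l)" using True by (simp only: of_nat_less_iff)
      then show ?thesis unfolding t_def using bl by (simp only: divide_less_eq_1_pos)
    qed
    obtain l' where l': "l = Suc l'" using l by (cases l) auto
    have "?m = (\<Sum>i<l'. \<mu> (t i) - m) + (\<mu> (t l') - m)" unfolding l' by simp
    also have "(\<Sum>i<l'. \<mu> (t i) - m) = 0"
      using lt t01 l' by (intro sum.neutral ballI) (auto intro!: \<mu>)
    also have "t l' = 1"
    proof -
      have "j * l + 1 + l' = b * l" using True l' by auto
      then show ?thesis unfolding t_def using l j by simp
    qed
    finally show ?thesis using True by simp
  next
    case False
    then have "real (Suc j) / real b < 1" using j by simp
    then have "\<mu> (t i) = m" if "i < l" for i using t[OF that] t01[OF that] by (intro \<mu>) auto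
    then show ?thesis using False by simp
  qed
  have "expectation (\<lambda>w. \<bar>obs l b j w - grid b j * bsum l j w\<bar>)
      = expectation (\<lambda>w. \<bar>?m + ?Y (\<lambda>i. \<sigma> (t i) - grid b j) w\<bar>) / ?r"
    unfolding diff abs_divide using r by simp
  also have "\<dots> \<le> (d * sqrt (real l * vabs) + \<bar>?m\<bar>) / ?r"
  proof (rule divide_right_mono)
    have "expectation (\<lambda>w. \<bar>?m + ?Y (\<lambda>i. \<sigma> (t i) - grid b j) w\<bar>) \<le> expectation (\<lambda>w. \<bar>?m\<bar> + \<bar>?Y (\<lambda>i. \<sigma> (t i) - grid b j) w\<bar>)"
      using IY by (intro integral_mono abs_triangle_ineq) auto
    also have "\<dots> = \<bar>?m\<bar> + expectation (\<lambda>w. \<bar>?Y (\<lambda>i. \<sigma> (t i) - grid b j) w\<bar>)"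
      using IY by (simp add: prob_space)
    finally show "expectation (\<lambda>w. \<bar>?m + ?Y (\<lambda>i. \<sigma> (t i) - grid b j) w\<bar>) \<le> d * sqrt (real l * vabs) + \<bar>?m\<bar>"
      using EY by simp
  qed (use r in simp)
  also have "\<dots> = d * sqrt (vabs / v) + \<bar>?m\<bar> / ?r"
    using l by (simp add: add_divide_distrib real_sqrt_mult real_sqrt_divide)
  also have "\<bar>?m\<bar> / ?r \<le> (if Suc j = b then \<bar>\<mu> 1 - m\<bar> / sqrt v else 0)"
  proof -
    have "\<bar>?m\<bar> / ?r \<le> (if Suc j = b then \<bar>\<mu> 1 - m\<bar> else 0) / ?r" using mu_le r by (intro divide_right_mono) auto
    also have "\<dots> \<le> (if Suc j = b then \<bar>\<mu> 1 - m\<bar> else 0) / sqrt v"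
      using l v by (intro divide_left_mono) (auto simp: mult_le_cancel_right1)
    finally show ?thesis by (auto split: if_splits)
  qed
  finally show "expectation (\<lambda>w. \<bar>obs l b j w - grid b j * bsum l j w\<bar>)
      \<le> d * sqrt (vabs / v) + (if Suc j = b then \<bar>\<mu> 1 - m\<bar> / sqrt v else 0)" by simp
qed

lemma obs_sum_diff:
  assumes l: "1 \<le> l" and b: "1 \<le> b"
  shows "\<And>j. j < b \<Longrightarrow> integrable M (obs l b j)"
    and "(\<Sum>j<b. expectation (\<lambda>w. \<bar>obs l b j w - grid b j * bsum l j w\<bar>)) \<le> obs_const"
proof -
  obtain d where d0: "\<And>j. 0 \<le> d j" and dK: "(\<Sum>j<b. d j) \<le> K"
    and d: "\<And>j x. j < b \<Longrightarrow> real j / real b < x \<Longrightarrow> x \<le> real (Suc j) / real b \<Longrightarrow> \<bar>s x - s (real (Suc j) / real b)\<bar> \<le> d j"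
    using osc[OF b] by blast
  note od = obs_diff[OF l _ d0 d]
  show "integrable M (obs l b j)" if "j < b" for j by (rule od(1)[OF that that])
  have "(\<Sum>j<b. expectation (\<lambda>w. \<bar>obs l b j w - grid b j * bsum l j w\<bar>))
     \<le> (\<Sum>j<b. d j * sqrt (vabs / v) + (if Suc j = b then \<bar>\<mu> 1 - m\<bar> / sqrt v else 0))"
    by (intro sum_mono od(2)) auto
  also have "\<dots> = (\<Sum>j<b. d j) * sqrt (vabs / v) + (\<Sum>j<b. if Suc j = b then \<bar>\<mu> 1 - m\<bar> / sqrt v else 0)"
    by (simp add: sum.distrib sum_distrib_right)
  also have "(\<Sum>j<b. if Suc j = b then \<bar>\<mu> 1 - m\<bar> / sqrt v else 0) = \<bar>\<mu> 1 - m\<bar> / sqrt v"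
  proof -
    obtain b' where "b = Suc b'" using b by (cases b) auto
    then show ?thesis by simp
  qed
  also have "(\<Sum>j<b. d j) * sqrt (vabs / v) + \<bar>\<mu> 1 - m\<bar> / sqrt v \<le> obs_const"
    unfolding obs_const_def using dK vabs_nonneg v by (intro add_right_mono mult_right_mono) auto
  finally show "(\<Sum>j<b. expectation (\<lambda>w. \<bar>obs l b j w - grid b j * bsum l j w\<bar>)) \<le> obs_const" .
qed

lemma qemp_lipschitz: "1-lipschitz_on UNIV (qemp b)"
proof (rule lipschitz_absI)
  fix x y
  have "qemp b x - qemp b y = (\<Sum>k<b. gdist x (grid b k) - gdist y (grid b k)) / real b"
    unfolding qemp_def by (simp add: sum_subtractf diff_divide_distrib)
  then have "\<bar>qemp b x - qemp b y\<bar> = \<bar>\<Sum>k<b. gdist x (grid b k) - gdist y (grid b k)\<bar> / real b" by simp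
  also have "\<dots> \<le> (\<Sum>k<b. \<bar>x - y\<bar>) / real b"
    using gdist_diff[of x "grid b k" y "grid b k" for k]
    by (intro divide_right_mono order_trans[OF sum_abs] sum_mono) auto
  also have "\<dots> \<le> 1 * \<bar>x - y\<bar>" by simp
  finally show "\<bar>qemp b x - qemp b y\<bar> \<le> 1 * \<bar>x - y\<bar>" .
qed simp

text \<open>The oscillation of f (s x) over block j is at most L times that of s, and the sum over j
  is at most L * K whatever b is.\<close>

lemma riemann_grid:
  fixes f :: "real \<Rightarrow> real"
  assumes b: "1 \<le> b" and m: "(\<lambda>x. f (s x)) \<in> borel_measurable borel" and bd: "\<And>x. \<bar>f (s x)\<bar> \<le> T"
    and L: "\<And>x y. \<bar>f (s x) - f (s y)\<bar> \<le> L * \<bar>s x - s y\<bar>" "0 \<le> L"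
  shows "\<bar>(\<Sum>j<b. f (grid b j)) / real b - (\<integral>x. f (s x) \<partial>unif01)\<bar> \<le> L * K / real b"
proof -
  obtain d where dK: "(\<Sum>j<b. d j) \<le> K"
    and d: "\<And>j x. j < b \<Longrightarrow> real j / real b < x \<Longrightarrow> x \<le> real (Suc j) / real b \<Longrightarrow> \<bar>s x - s (real (Suc j) / real b)\<bar> \<le> d j"
    using osc[OF b] by blast
  have "\<bar>(\<Sum>j<b. f (grid b j)) / real b - (LBINT x:{0..1}. f (s x))\<bar> \<le> (\<Sum>j<b. L * d j) / real b"
  proof (rule riemann_sum_le[OF b m bd])
    fix j x assume jx: "j < b" "real j / real b < x" "x \<le> real (Suc j) / real b"
    have "\<bar>f (s x) - f (grid b j)\<bar> \<le> L * \<bar>s x - grid b j\<bar>" unfolding grid_def by (rule L)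
    also have "\<dots> \<le> L * d j" using d[OF jx] L(2) unfolding grid_def by (intro mult_left_mono)
    finally show "\<bar>f (s x) - f (grid b j)\<bar> \<le> L * d j" .
  qed
  also have "\<dots> \<le> L * K / real b"
    unfolding sum_distrib_left[symmetric] using dK L(2) by (intro divide_right_mono mult_left_mono) auto
  finally show ?thesis unfolding LBINT_unif01 .
qed

lemma qemp_qlim: "1 \<le> b \<Longrightarrow> \<bar>qemp b u - qlim u\<bar> \<le> K / real b"
  using riemann_grid[of b "gdist u" "\<bar>u\<bar> + S" 1] gdist_s_bound gdist_diff[of u _ u]
  unfolding qemp_def qlim_def by simp

lemma qlim_scale_diff: "\<bar>(\<integral>z. qlim (c * z) \<partial>gauss) - (\<integral>z. qlim (c' * z) \<partial>gauss)\<bar> \<le> \<bar>c - c'\<bar>"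
proof -
  have "\<bar>(\<integral>z. qlim (c * z) \<partial>gauss) - (\<integral>z. qlim (c' * z) \<partial>gauss)\<bar> \<le> (\<integral>z. \<bar>c - c'\<bar> * \<bar>z\<bar> \<partial>gauss)"
  proof (intro gauss_integral_diff_le gauss_int_lipschitz qlim_lipschitz)
    show "\<bar>qlim (c * z) - qlim (c' * z)\<bar> \<le> \<bar>c - c'\<bar> * \<bar>z\<bar>" for z
      using lipschitz_absD[OF qlim_lipschitz, of "c * z" "c' * z"] by (simp add: abs_mult flip: left_diff_distrib)
  qed auto
  also have "\<dots> \<le> \<bar>c - c'\<bar> * 1" using mult_left_mono[OF gauss_integral_abs_le_1, of "\<bar>c - c'\<bar>"] by simp
  finally show ?thesis by simp
qed

definition centre :: real where "centre = (\<integral>x. (\<integral>y. gdist2 (s x) (s y) \<partial>unif01) \<partial>unif01)"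

lemma qemp_gauss: "(\<integral>z. qemp b (c * z) \<partial>gauss) = (\<Sum>k<b. gdist2 c (grid b k)) / real b"
  unfolding qemp_def gdist2_def
  using gauss_int_lipschitz[OF gdist_lipschitz] by simp

text \<open>The double sum is compared with the double integral one variable at a time, each at a
  cost of K / b.\<close>

lemma centre_riemann:
  assumes b: "1 \<le> b"
  shows "\<bar>(\<Sum>j<b. \<Sum>k<b. gdist2 (grid b j) (grid b k)) / (real b)\<^sup>2 - centre\<bar> \<le> 2 * K / real b"
proof -
  let ?Q = "\<lambda>c. \<integral>z. qlim (c * z) \<partial>gauss" and ?q = "\<lambda>c. \<integral>z. qemp b (c * z) \<partial>gauss"
  have QL: "1-lipschitz_on UNIV ?Q" by (rule lipschitz_absI) (use qlim_scale_diff in auto)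
  have b1: "\<bar>?Q (s x)\<bar> \<le> \<bar>?Q 0\<bar> + S" for x
    using qlim_scale_diff[of "s x" 0] s_pos[of x] s_le[of x] by simp
  have 1: "\<bar>(\<Sum>j<b. ?Q (grid b j)) / real b - centre\<bar> \<le> K / real b"
    using riemann_grid[of b ?Q "\<bar>?Q 0\<bar> + S" 1, OF b measurable_compose[OF s_meas lipschitz_borel[OF QL]] b1] qlim_scale_diff
    unfolding centre_def qlim_fubini by simp
  have "\<bar>?q c - ?Q c\<bar> \<le> (\<integral>z. K / real b \<partial>gauss)" for c
    by (rule gauss_integral_diff_le[OF gauss_int_lipschitz[OF qemp_lipschitz] gauss_int_lipschitz[OF qlim_lipschitz]
          gauss.integrable_const qemp_qlim[OF b]])
  then have q: "\<bar>?q c - ?Q c\<bar> \<le> K / real b" for c by simp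
  have "(\<Sum>j<b. ?q (grid b j)) / real b - (\<Sum>j<b. ?Q (grid b j)) / real b = (\<Sum>j<b. ?q (grid b j) - ?Q (grid b j)) / real b"
    by (simp add: sum_subtractf diff_divide_distrib)
  then have "\<bar>(\<Sum>j<b. ?q (grid b j)) / real b - (\<Sum>j<b. ?Q (grid b j)) / real b\<bar>
      = \<bar>\<Sum>j<b. ?q (grid b j) - ?Q (grid b j)\<bar> / real b" by simp
  also have "\<dots> \<le> (\<Sum>j<b. K / real b) / real b"
    by (intro divide_right_mono order_trans[OF sum_abs] sum_mono q) simp
  also have "\<dots> = K / real b" using b by simp
  finally have 2: "\<bar>(\<Sum>j<b. ?q (grid b j)) / real b - (\<Sum>j<b. ?Q (grid b j)) / real b\<bar> \<le> K / real b" .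
  have 3: "(\<Sum>j<b. ?q (grid b j)) / real b = (\<Sum>j<b. \<Sum>k<b. gdist2 (grid b j) (grid b k)) / (real b)\<^sup>2"
    unfolding qemp_gauss by (simp add: sum_divide_distrib power2_eq_square)
  have tri: "\<bar>x - z\<bar> \<le> 2 * k / n" if "\<bar>x - y\<bar> \<le> k / n" "\<bar>y - z\<bar> \<le> k / n" for x y z k n :: real
    using that by (auto simp: abs_le_iff)
  show ?thesis using tri[OF 2 1] unfolding 3 .
qed

text \<open>Replacing \<open>qemp\<close> by \<open>qlim\<close> costs 4 units \<open>?g\<close>,
  the Riemann sum over the scales 2 more, and the factor 4 of \<open>psi2\<close> makes 24.\<close>

lemma psi2_riemann:
  assumes b: "1 \<le> b"
  shows "\<bar>4 * ((\<Sum>j<b. gauss_var (qemp b) (grid b j)) / real b) - psi2\<bar> \<le> 24 * S * gauss_moment 2 * K / real b"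
proof -
  let ?g = "S * gauss_moment 2 * K / real b"
  have SK: "0 \<le> S * gauss_moment 2"
  proof -
    have "0 \<le> 2 * S * gauss_moment 2 * \<bar>1 * S - 0\<bar>"
      using order_trans[OF abs_ge_zero gauss_var_lipschitz[OF qlim_lipschitz, of S S 0]] S_pos by simp
    then show ?thesis using S_pos by (simp add: zero_le_mult_iff)
  qed
  have 1: "\<bar>(\<Sum>j<b. gauss_var qlim (grid b j)) / real b - (\<integral>x. gauss_var qlim (s x) \<partial>unif01)\<bar> \<le> (2 * S * gauss_moment 2) * K / real b"
  proof (rule riemann_grid[OF b gauss_var_measurable gauss_var_s_bound])
    show "\<bar>gauss_var qlim (s x) - gauss_var qlim (s y)\<bar> \<le> 2 * S * gauss_moment 2 * \<bar>s x - s y\<bar>" for x y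
      using s_pos[of x] s_pos[of y] s_le[of x] s_le[of y] by (intro gauss_var_lipschitz qlim_lipschitz) auto
  qed (use SK in simp)
  have q: "\<bar>gauss_var (qemp b) (grid b j) - gauss_var qlim (grid b j)\<bar> \<le> 4 * S * gauss_moment 2 * (K / real b)" for j
    using S_pos by (intro gauss_var_diff qemp_lipschitz qlim_lipschitz qemp_qlim b grid) auto
  have "(\<Sum>j<b. gauss_var (qemp b) (grid b j)) / real b - (\<Sum>j<b. gauss_var qlim (grid b j)) / real b
      = (\<Sum>j<b. gauss_var (qemp b) (grid b j) - gauss_var qlim (grid b j)) / real b"
    by (simp add: sum_subtractf diff_divide_distrib)
  then have "\<bar>(\<Sum>j<b. gauss_var (qemp b) (grid b j)) / real b - (\<Sum>j<b. gauss_var qlim (grid b j)) / real b\<bar>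
      = \<bar>\<Sum>j<b. gauss_var (qemp b) (grid b j) - gauss_var qlim (grid b j)\<bar> / real b" by simp
  also have "\<dots> \<le> (\<Sum>j<b. 4 * S * gauss_moment 2 * (K / real b)) / real b"
    by (intro divide_right_mono order_trans[OF sum_abs] sum_mono q) simp
  also have "\<dots> = 4 * S * gauss_moment 2 * (K / real b)" using b by simp
  finally have 2: "\<bar>(\<Sum>j<b. gauss_var (qemp b) (grid b j)) / real b - (\<Sum>j<b. gauss_var qlim (grid b j)) / real b\<bar>
    \<le> 4 * S * gauss_moment 2 * (K / real b)" .
  have tri: "\<bar>4 * x - 4 * z\<bar> \<le> 24 * S * gauss_moment 2 * K / real b"
    if "\<bar>x - y\<bar> \<le> 4 * S * gauss_moment 2 * (K / real b)" "\<bar>y - z\<bar> \<le> (2 * S * gauss_moment 2) * K / real b" for x y z :: real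
  proof -
    have "4 * S * gauss_moment 2 * (K / real b) = 4 * ?g" "(2 * S * gauss_moment 2) * K / real b = 2 * ?g"
      "24 * S * gauss_moment 2 * K / real b = 24 * ?g" by simp_all
    then show ?thesis using that by linarith
  qed
  show ?thesis unfolding psi2_def by (rule tri[OF 2 1])
qed

text \<open>An algebraic identity in the values y, with no probability involved. The two projections
  give the same double sum after exchanging j and k, hence the factor 2.\<close>

lemma hoeffding_decomposition:
  assumes b: "1 \<le> b"
  shows "(\<Sum>j<b. \<Sum>k<b. \<bar>grid b j * y j - grid b k * y k\<bar>)
    = (\<Sum>j<b. \<Sum>k<b. gdist2 (grid b j) (grid b k)) + 2 * real b * (\<Sum>j<b. centred (qemp b) (grid b j) (y j))
      + (\<Sum>j<b. \<Sum>k<b. gini_kernel (grid b j * y j) (grid b k * y k) (grid b j) (grid b k))"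
proof -
  let ?D = "\<Sum>j<b. \<Sum>k<b. gdist2 (grid b j) (grid b k)"
  have 1: "real b * (\<Sum>j<b. centred (qemp b) (grid b j) (y j)) = (\<Sum>j<b. \<Sum>k<b. gdist (grid b j * y j) (grid b k)) - ?D"
  proof -
    have "(\<Sum>j<b. centred (qemp b) (grid b j) (y j)) = ((\<Sum>j<b. \<Sum>k<b. gdist (grid b j * y j) (grid b k)) - ?D) / real b"
      unfolding centred_def qemp_gauss unfolding qemp_def by (simp add: sum_subtractf diff_divide_distrib sum_divide_distrib)
    then show ?thesis using b by simp
  qed
  have 2: "(\<Sum>j<b. \<Sum>k<b. gdist (grid b k * y k) (grid b j)) = (\<Sum>j<b. \<Sum>k<b. gdist (grid b j * y j) (grid b k))"
    by (rule sum.swap)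
  show ?thesis unfolding gini_kernel_def using 1 2 by (simp add: sum.distrib sum_subtractf)
qed

lemma stat_eq:
  assumes b: "2 \<le> b" and l: "1 \<le> l"
  shows "stat l b w = sqrt (real b) * ((\<Sum>j<b. \<Sum>k<b. \<bar>obs l b j w - obs l b k w\<bar>) / (real b * (real b - 1)) - centre)"
proof -
  let ?c = "sqrt (real l) / sqrt v"
  have c: "0 \<le> ?c" using v by simp
  have "\<bar>obs l b j w - obs l b k w\<bar> = ?c * \<bar>local_mean (observation \<mu> \<sigma> Y (b * l)) l (Suc j) w - local_mean (observation \<mu> \<sigma> Y (b * l)) l (Suc k) w\<bar>" for j k
  proof -
    have e: "c * (x - m) - c * (y - m) = c * (x - y)" for c x y :: real by (simp add: algebra_simps)
    show ?thesis unfolding obs_def e abs_mult abs_of_nonneg[OF c] ..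
  qed
  then show ?thesis unfolding stat_def U_stat_eq centre_def by (simp only: sum_distrib_left[symmetric] times_divide_eq_right)
qed

text \<open>In order: replacing the observations by block sums, passing from b * (b - 1) to b^2, the
  Riemann error of the centring, and the near pairs of the degenerate part.\<close>

definition rem_const :: real where
  "rem_const = 4 * obs_const + 4 * (S * sqrt (vabs / v)) + 2 * K + 12 * (S * (sqrt (vabs / v) + 1))"

text \<open>The decomposition is natural with the divisor b^2, the statistic has b * (b - 1).
  Splitting 1 / (b * (b - 1)) into 1 / b^2 and 1 / (b^2 * (b - 1)) leaves a term of order G /
  b^3.\<close>

lemma stat_linear_part_pointwise:
  fixes b G L R D n Ob x c :: real
  assumes b: "2 \<le> b" and d: "\<bar>Ob - G\<bar> \<le> 2 * b * x" and G: "G = D + 2 * b * L + R" "0 \<le> G" and D: "\<bar>D / b\<^sup>2 - c\<bar> \<le> 2 * k / b"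
    and x: "0 \<le> x"
  shows "\<bar>Ob / (b * (b - 1)) - c - 2 * L / b\<bar> \<le> 4 * x / b + 2 * G / b ^ 3 + \<bar>R\<bar> / b\<^sup>2 + 2 * k / b"
proof -
  have b1: "0 < b - 1" "0 < b" "1 / (b - 1) \<le> 2 / b" using b by (auto simp: field_simps)
  have "Ob / (b * (b - 1)) - c - 2 * L / b = (Ob - G) / (b * (b - 1)) + G / (b\<^sup>2 * (b - 1)) + R / b\<^sup>2 + (D / b\<^sup>2 - c)"
  proof -
    have "G / (b * (b - 1)) = G / (b\<^sup>2 * (b - 1)) + G / b\<^sup>2" using b1 by (simp add: field_simps power2_eq_square)
    moreover have "G / b\<^sup>2 = D / b\<^sup>2 + 2 * L / b + R / b\<^sup>2" unfolding G using b1 by (simp add: field_simps power2_eq_square)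
    ultimately show ?thesis by (simp add: diff_divide_distrib)
  qed
  moreover have "\<bar>(Ob - G) / (b * (b - 1))\<bar> \<le> 4 * x / b"
  proof -
    have "\<bar>(Ob - G) / (b * (b - 1))\<bar> = \<bar>Ob - G\<bar> / b * (1 / (b - 1))" using b1 by simp
    also have "\<dots> \<le> 2 * b * x / b * (2 / b)" using b1 d x by (intro mult_mono divide_right_mono) auto
    finally show ?thesis using b1 by simp
  qed
  moreover have "\<bar>G / (b\<^sup>2 * (b - 1))\<bar> \<le> 2 * G / b ^ 3"
  proof -
    have "\<bar>G / (b\<^sup>2 * (b - 1))\<bar> = G / b\<^sup>2 * (1 / (b - 1))" using b1 G(2) by simp
    also have "\<dots> \<le> G / b\<^sup>2 * (2 / b)" using b1 G(2) by (intro mult_left_mono) auto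
    finally show ?thesis by (simp add: power3_eq_cube power2_eq_square mult.commute)
  qed
  moreover have "\<bar>R / b\<^sup>2\<bar> = \<bar>R\<bar> / b\<^sup>2" by simp
  ultimately show ?thesis using D by linarith
qed

lemma linear_part_int: "integrable M (linear_part l b)"
proof -
  have "integrable M (\<lambda>w. centred (qemp b) (grid b j) (bsum l j w))" for j
    by (rule integrable_lipschitz[OF centred_lipschitz[OF qemp_lipschitz]]) auto
  then show ?thesis unfolding linear_part_def[abs_def] by simp
qed

lemma stat_linear_part:
  assumes b: "2 \<le> b" and l: "1 \<le> l"
  shows "integrable M (stat l b)"
    and "expectation (\<lambda>w. \<bar>stat l b w - linear_part l b w\<bar>)
      \<le> sqrt (real b) * (rem_const / real b + (4 * (S\<^sup>2 * (vabs / v)) + 4 * C) / real l + 2 * (S * w1_err \<rho> l))"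
proof -
  have b1: "1 \<le> b" and b0: "0 < real b" using b by auto
  let ?y = "\<lambda>j w. grid b j * bsum l j w"
  let ?X = "\<lambda>w. \<Sum>j<b. \<bar>obs l b j w - ?y j w\<bar>"
  let ?G = "\<lambda>w. \<Sum>j<b. \<Sum>k<b. \<bar>?y j w - ?y k w\<bar>"
  let ?R = "\<lambda>w. \<Sum>j<b. \<Sum>k<b. gini_kernel (?y j w) (?y k w) (grid b j) (grid b k)"
  note oI = obs_sum_diff(1)[OF l b1]
  have XI: "integrable M ?X" using oI by (intro Bochner_Integration.integrable_sum integrable_abs Bochner_Integration.integrable_diff) auto
  have GI: "integrable M ?G" by (intro Bochner_Integration.integrable_sum integrable_abs Bochner_Integration.integrable_diff) auto
  have RI: "integrable M ?R"
    using gini_kernel_near(1)[OF v l, of "grid b j" S "grid b k" j k for j k] grid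
    by (intro Bochner_Integration.integrable_sum) (auto simp: less_imp_le)
  show SI: "integrable M (stat l b)"
    unfolding stat_eq[OF b l, abs_def] using oI
    by (intro integrable_mult_right Bochner_Integration.integrable_diff integrable_divide Bochner_Integration.integrable_sum integrable_abs) auto
  have pw: "\<bar>stat l b w - linear_part l b w\<bar> \<le> sqrt (real b) * (4 * ?X w / real b + 2 * ?G w / real b ^ 3 + \<bar>?R w\<bar> / (real b)\<^sup>2 + 2 * K / real b)" for w
  proof -
    let ?O = "\<Sum>j<b. \<Sum>k<b. \<bar>obs l b j w - obs l b k w\<bar>" and ?L = "\<Sum>j<b. centred (qemp b) (grid b j) (bsum l j w)"
    have "stat l b w - linear_part l b w = sqrt (real b) * (?O / (real b * (real b - 1)) - centre - 2 * ?L / real b)"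
    proof -
      have "2 / sqrt (real b) = sqrt (real b) * (2 / real b)" using b0 by (simp add: field_simps)
      then show ?thesis unfolding stat_eq[OF b l] linear_part_def by (simp add: algebra_simps)
    qed
    then have "\<bar>stat l b w - linear_part l b w\<bar> = sqrt (real b) * \<bar>?O / (real b * (real b - 1)) - centre - 2 * ?L / real b\<bar>"
      by (simp add: abs_mult)
    also have "\<dots> \<le> sqrt (real b) * (4 * ?X w / real b + 2 * ?G w / real b ^ 3 + \<bar>?R w\<bar> / (real b)\<^sup>2 + 2 * K / real b)"
      using b by (intro mult_left_mono stat_linear_part_pointwise[OF _ sum_abs_diff_le hoeffding_decomposition[OF b1] _ centre_riemann[OF b1]] sum_nonneg) auto
    finally show ?thesis .
  qed
  have EX: "expectation ?X \<le> obs_const"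
    using obs_sum_diff(2)[OF l b1] oI by (subst Bochner_Integration.integral_sum) auto
  have EG: "expectation ?G \<le> (real b)\<^sup>2 * (2 * (S * sqrt (vabs / v)))"
  proof -
    have one: "expectation (\<lambda>w. \<bar>?y j w\<bar>) \<le> S * sqrt (vabs / v)" for j
    proof -
      have "expectation (\<lambda>w. \<bar>?y j w\<bar>) = \<bar>grid b j\<bar> * expectation (\<lambda>w. \<bar>bsum l j w\<bar>)" by (simp add: abs_mult)
      also have "\<dots> \<le> S * sqrt (vabs / v)" using S_pos by (intro mult_mono grid bsum_abs v l) auto
      finally show ?thesis .
    qed
    have "expectation (\<lambda>w. \<bar>?y j w - ?y k w\<bar>) \<le> 2 * (S * sqrt (vabs / v))" for j k
    proof -
      have "expectation (\<lambda>w. \<bar>?y j w - ?y k w\<bar>) \<le> expectation (\<lambda>w. \<bar>?y j w\<bar> + \<bar>?y k w\<bar>)"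
        by (intro integral_mono abs_triangle_ineq4) auto
      also have "\<dots> = expectation (\<lambda>w. \<bar>?y j w\<bar>) + expectation (\<lambda>w. \<bar>?y k w\<bar>)" by simp
      finally show ?thesis using one[of j] one[of k] by linarith
    qed
    then have "(\<Sum>j<b. \<Sum>k<b. expectation (\<lambda>w. \<bar>?y j w - ?y k w\<bar>)) \<le> (\<Sum>j<b. \<Sum>k<b. 2 * (S * sqrt (vabs / v)))"
      by (intro sum_mono)
    then show ?thesis by (simp add: power2_eq_square mult.assoc)
  qed
  have ER: "expectation (\<lambda>w. \<bar>?R w\<bar>) \<le> 3 * real b * (4 * S * (sqrt (vabs / v) + 1))
        + (real b)\<^sup>2 * ((4 * (S\<^sup>2 * (vabs / v)) + 4 * C) / real l + 2 * (S * w1_err \<rho> l))"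
    using S_pos by (intro degenerate_part v \<rho> l) (auto simp: grid less_imp_le)
  have fin: "4 * x / n + 2 * g / n ^ 3 + r / n\<^sup>2 + 2 * K / n \<le> rem_const / n + A / real l + B'"
    if x: "x \<le> obs_const" and g: "g \<le> n\<^sup>2 * (2 * (S * sqrt (vabs / v)))" and n: "0 < n"
      and r: "r \<le> 3 * n * (4 * S * (sqrt (vabs / v) + 1)) + n\<^sup>2 * (A / real l + B')" for x g r n A B' :: real
  proof -
    have "2 * g / n ^ 3 \<le> 2 * (n\<^sup>2 * (2 * (S * sqrt (vabs / v)))) / n ^ 3" using n by (intro divide_right_mono mult_left_mono g) auto
    also have "\<dots> = 4 * (S * sqrt (vabs / v)) / n" using n by (simp add: field_simps power2_eq_square power3_eq_cube)
    finally have g': "2 * g / n ^ 3 \<le> 4 * (S * sqrt (vabs / v)) / n" .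
    have "r / n\<^sup>2 \<le> (3 * n * (4 * S * (sqrt (vabs / v) + 1)) + n\<^sup>2 * (A / real l + B')) / n\<^sup>2" using r n by (intro divide_right_mono) auto
    also have "\<dots> = 12 * (S * (sqrt (vabs / v) + 1)) / n + (A / real l + B')"
    proof -
      have "3 * n * (4 * S * x) / n\<^sup>2 = 12 * (S * x) / n" "n\<^sup>2 * x / n\<^sup>2 = x" for x :: real
        using n by (simp_all add: power2_eq_square)
      then show ?thesis by (simp only: add_divide_distrib)
    qed
    finally have r': "r / n\<^sup>2 \<le> 12 * (S * (sqrt (vabs / v) + 1)) / n + (A / real l + B')" .
    have "4 * x / n \<le> 4 * obs_const / n" using x n by (intro divide_right_mono) auto
    then show ?thesis using g' r' unfolding rem_const_def add_divide_distrib by linarith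
  qed
  have "expectation (\<lambda>w. \<bar>stat l b w - linear_part l b w\<bar>)
      \<le> expectation (\<lambda>w. sqrt (real b) * (4 * ?X w / real b + 2 * ?G w / real b ^ 3 + \<bar>?R w\<bar> / (real b)\<^sup>2 + 2 * K / real b))"
    using pw
  proof (rule integral_mono[rotated 2])
    show "integrable M (\<lambda>w. \<bar>stat l b w - linear_part l b w\<bar>)" using SI linear_part_int by auto
    show "integrable M (\<lambda>w. sqrt (real b) * (4 * ?X w / real b + 2 * ?G w / real b ^ 3 + \<bar>?R w\<bar> / (real b)\<^sup>2 + 2 * K / real b))"
      using integrable_mult_right[OF XI, of 4] integrable_mult_right[OF GI, of 2] integrable_abs[OF RI]
      by (intro integrable_mult_right Bochner_Integration.integrable_add integrable_divide integrable_const) auto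
  qed
  also have "\<dots> = sqrt (real b) * (4 * expectation ?X / real b + 2 * expectation ?G / real b ^ 3
      + expectation (\<lambda>w. \<bar>?R w\<bar>) / (real b)\<^sup>2 + 2 * K / real b)"
  proof -
    have lin: "expectation (\<lambda>w. a * (4 * x w / n + 2 * g w / n3 + r w / n2 + k)) = a * (4 * expectation x / n + 2 * expectation g / n3 + expectation r / n2 + k)"
      if "integrable M x" "integrable M g" "integrable M r" for a n n2 n3 k :: real and x g r :: "'a \<Rightarrow> real"
      using that by (simp add: prob_space)
    show ?thesis by (rule lin[OF XI GI integrable_abs[OF RI]])
  qed
  also have "\<dots> \<le> sqrt (real b) * (rem_const / real b + (4 * (S\<^sup>2 * (vabs / v)) + 4 * C) / real l + 2 * (S * w1_err \<rho> l))"
    by (intro mult_left_mono fin EX EG b0 ER) simp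
  finally show "expectation (\<lambda>w. \<bar>stat l b w - linear_part l b w\<bar>)
      \<le> sqrt (real b) * (rem_const / real b + (4 * (S\<^sup>2 * (vabs / v)) + 4 * C) / real l + 2 * (S * w1_err \<rho> l))" .
qed

end

section \<open>The central limit theorem\<close>

lemma exp_neg_diff_le:
  fixes x y :: real
  assumes "0 \<le> x" "0 \<le> y"
  shows "\<bar>exp (- x) - exp (- y)\<bar> \<le> \<bar>x - y\<bar>"
proof -
  have *: "exp (- x) - exp (- y) \<le> y - x" "exp (- y) \<le> exp (- x)" if "0 \<le> x" "x \<le> y" for x y :: real
  proof -
    have 1: "1 - exp (x - y) \<le> y - x" using exp_ge_add_one_self[of "x - y"] by linarith
    have "exp (- y) = exp (- x) * exp (x - y)" by (subst mult_exp_exp) simp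
    then have "exp (- x) - exp (- y) = exp (- x) * (1 - exp (x - y))" by (simp only: right_diff_distrib mult_1_right)
    also have "\<dots> \<le> 1 * (1 - exp (x - y))" by (rule mult_right_mono) (use that in simp_all)
    also have "\<dots> \<le> y - x" using 1 by (simp only: mult_1_left)
    finally show "exp (- x) - exp (- y) \<le> y - x" .
    show "exp (- y) \<le> exp (- x)" using that by simp
  qed
  have tri: "\<bar>p - q\<bar> \<le> \<bar>x - y\<bar>" if "p - q \<le> y - x" "q \<le> p" for p q x y :: real using that by linarith
  consider "x \<le> y" | "y \<le> x" by linarith
  then show ?thesis
  proof cases
    case 1 show ?thesis by (rule tri; rule *) (use assms 1 in auto)
  next
    case 2
    have "\<bar>exp (- y) - exp (- x)\<bar> \<le> \<bar>y - x\<bar>" by (rule tri; rule *) (use assms 2 in auto)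
    then show ?thesis by (simp only: abs_minus_commute)
  qed
qed

context gini_clt
begin

lemma stat_measurable [measurable]: "stat l b \<in> borel_measurable M"
  unfolding stat_def[abs_def] U_stat_eq by measurable

text \<open>The functions \<open>h j\<close> of the block sums have Lipschitz constants of order 1 /
  sqrt b. The three lines of the bound are the passage to Gaussian factors, the expansion of these
  factors, and the Riemann error of the variance.\<close>

lemma char_linear_part:
  assumes b: "1 \<le> b" and n: "1 \<le> n" "n \<le> l"
  shows "norm ((CLINT w|M. iexp (t * linear_part l b w)) - of_real (exp (- (t\<^sup>2 * psi2 / 2))))
    \<le> real b * (3 * (2 * \<bar>t\<bar> * S / sqrt (real b)) * (sqrt (real n * vabs) / sqrt (real l * v)) + 16 * (C * real n powr (- \<theta>))
          + 2 * (2 * \<bar>t\<bar> * S / sqrt (real b)) * w1_err \<rho> l)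
      + real b * ((2 * \<bar>t\<bar> * S / sqrt (real b)) ^ 3 * gauss_moment 3 + (2 * \<bar>t\<bar> * S / sqrt (real b)) ^ 4 * (gauss_moment 2)\<^sup>2)
      + t\<^sup>2 / 2 * (24 * S * gauss_moment 2 * K / real b)"
proof -
  let ?L = "2 * \<bar>t\<bar> * S / sqrt (real b)"
  let ?k = "2 * t / sqrt (real b)"
  define h where "h j z = ?k * centred (qemp b) (grid b j) z" for j z
  have k: "\<bar>?k\<bar> = 2 * \<bar>t\<bar> / sqrt (real b)" by (simp add: abs_mult)
  have b0: "0 < real b" using b by simp
  have L0: "0 \<le> ?L" using S_pos by (intro divide_nonneg_nonneg mult_nonneg_nonneg) auto
  have kc: "\<bar>?k\<bar> * (\<bar>grid b j\<bar> * x) \<le> ?L * x" if "0 \<le> x" for j x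
  proof -
    have "\<bar>?k\<bar> * (\<bar>grid b j\<bar> * x) \<le> \<bar>?k\<bar> * (S * x)" using that grid[of b j] by (intro mult_left_mono mult_right_mono) auto
    then show ?thesis unfolding k by simp
  qed
  have hL: "?L-lipschitz_on UNIV (h j)" for j
  proof (rule lipschitz_absI[OF _ L0])
    fix x y
    have "\<bar>h j x - h j y\<bar> = \<bar>?k\<bar> * \<bar>centred (qemp b) (grid b j) x - centred (qemp b) (grid b j) y\<bar>"
      unfolding h_def right_diff_distrib[symmetric] abs_mult ..
    also have "\<dots> \<le> \<bar>?k\<bar> * (\<bar>grid b j\<bar> * \<bar>x - y\<bar>)"
      by (intro mult_left_mono lipschitz_absD[OF centred_lipschitz[OF qemp_lipschitz]]) simp
    also have "\<dots> \<le> ?L * \<bar>x - y\<bar>" by (rule kc) simp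
    finally show "\<bar>h j x - h j y\<bar> \<le> ?L * \<bar>x - y\<bar>" .
  qed
  have hb: "\<bar>h j z\<bar> \<le> ?L * (\<bar>z\<bar> + 1)" for j z
  proof -
    have "\<bar>h j z\<bar> \<le> \<bar>?k\<bar> * (\<bar>grid b j\<bar> * (\<bar>z\<bar> + 1))"
      unfolding h_def abs_mult by (intro mult_left_mono centred_bound qemp_lipschitz) simp
    also have "\<dots> \<le> ?L * (\<bar>z\<bar> + 1)" by (rule kc) simp
    finally show ?thesis .
  qed
  have h0: "(\<integral>z. h j z \<partial>gauss) = 0" for j unfolding h_def using centred_integral[OF qemp_lipschitz] by simp
  have lin: "(\<Sum>j<b. h j (bsum l j w)) = t * linear_part l b w" for w
    unfolding h_def linear_part_def sum_distrib_left[symmetric] by simp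
  let ?V = "\<Sum>j<b. \<integral>z. (h j z)\<^sup>2 \<partial>gauss"
  have V: "?V = t\<^sup>2 * (4 * ((\<Sum>j<b. gauss_var (qemp b) (grid b j)) / real b))"
  proof -
    have "?k\<^sup>2 = t\<^sup>2 * 4 / real b" using b0 by (simp add: power_divide power_mult_distrib)
    then have "(\<integral>z. (h j z)\<^sup>2 \<partial>gauss) = t\<^sup>2 * 4 / real b * gauss_var (qemp b) (grid b j)" for j
      unfolding h_def power_mult_distrib gauss_var_def by simp
    then show ?thesis by (simp add: sum_distrib_left sum_divide_distrib mult.assoc)
  qed
  have 1: "norm ((CLINT w|M. iexp (t * linear_part l b w)) - (\<Prod>j<b. CLINT z|gauss. iexp (h j z)))
    \<le> real b * (3 * ?L * (sqrt (real n * vabs) / sqrt (real l * v)) + 16 * (C * real n powr (- \<theta>)) + 2 * ?L * w1_err \<rho> l)"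
    using char_blocks_gauss[where h = h and b = b, OF hL L0 v \<rho> n] unfolding lin .
  have 2: "norm ((\<Prod>j<b. CLINT z|gauss. iexp (h j z)) - of_real (exp (- ?V / 2)))
    \<le> real b * (?L ^ 3 * gauss_moment 3 + ?L ^ 4 * (gauss_moment 2)\<^sup>2)"
    using gauss_char_prod_approx[where h = h and b = b, OF lipschitz_borel[OF hL] hb L0 h0] by (simp add: exp_of_real)
  have V0: "0 \<le> ?V" by (intro sum_nonneg integral_nonneg_AE) auto
  have 3: "norm (of_real (exp (- ?V / 2)) - of_real (exp (- (t\<^sup>2 * psi2 / 2))) :: complex) \<le> t\<^sup>2 / 2 * (24 * S * gauss_moment 2 * K / real b)"
  proof -
    have "norm (of_real (exp (- ?V / 2)) - of_real (exp (- (t\<^sup>2 * psi2 / 2))) :: complex) = \<bar>exp (- (?V / 2)) - exp (- (t\<^sup>2 * psi2 / 2))\<bar>"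
      unfolding of_real_diff[symmetric] norm_of_real by simp
    also have "\<dots> \<le> \<bar>?V / 2 - t\<^sup>2 * psi2 / 2\<bar>" using V0 psi2_pos by (intro exp_neg_diff_le) auto
    also have "\<dots> = t\<^sup>2 / 2 * \<bar>4 * ((\<Sum>j<b. gauss_var (qemp b) (grid b j)) / real b) - psi2\<bar>"
    proof -
      have "\<bar>t\<^sup>2 * x / 2 - t\<^sup>2 * y / 2\<bar> = t\<^sup>2 / 2 * \<bar>x - y\<bar>" for x y :: real
        by (simp add: abs_mult flip: diff_divide_distrib right_diff_distrib)
      then show ?thesis unfolding V .
    qed
    also have "\<dots> \<le> t\<^sup>2 / 2 * (24 * S * gauss_moment 2 * K / real b)" by (intro mult_left_mono psi2_riemann b) simp
    finally show ?thesis .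
  qed
  have tri: "norm (p - q) \<le> A + B + D" if "norm (p - x) \<le> A" "norm (x - y) \<le> B" "norm (y - q) \<le> D" for p q x y :: complex and A B D
    using norm_triangle_ineq[of "p - x" "x - y"] norm_triangle_ineq[of "p - y" "y - q"] that by simp
  show ?thesis by (rule tri[OF 1 2 3])
qed

lemma char_stat_linear_part:
  assumes b: "2 \<le> b" and l: "1 \<le> l"
  shows "norm (char (distr M borel (stat l b)) t - (CLINT w|M. iexp (t * linear_part l b w)))
    \<le> \<bar>t\<bar> * (sqrt (real b) * (rem_const / real b + (4 * (S\<^sup>2 * (vabs / v)) + 4 * C) / real l + 2 * (S * w1_err \<rho> l)))"
proof -
  note st = stat_linear_part[OF b l]
  have LM [measurable]: "linear_part l b \<in> borel_measurable M" using linear_part_int by auto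
  have I: "integrable M (\<lambda>w. iexp (t * f w))" if [measurable]: "f \<in> borel_measurable M" for f :: "'a \<Rightarrow> real"
    by (rule integrable_const_bound[of _ 1]) auto
  have "char (distr M borel (stat l b)) t = (CLINT w|M. iexp (t * stat l b w))"
    unfolding char_def by (subst integral_distr) auto
  then have "norm (char (distr M borel (stat l b)) t - (CLINT w|M. iexp (t * linear_part l b w)))
     = norm (CLINT w|M. iexp (t * stat l b w) - iexp (t * linear_part l b w))"
    using I[OF stat_measurable] I[OF LM] by simp
  also have "\<dots> \<le> expectation (\<lambda>w. norm (iexp (t * stat l b w) - iexp (t * linear_part l b w)))"
    by (rule integral_norm_bound)
  also have "\<dots> \<le> expectation (\<lambda>w. \<bar>t\<bar> * \<bar>stat l b w - linear_part l b w\<bar>)"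
  proof (rule integral_mono)
    show "integrable M (\<lambda>w. norm (iexp (t * stat l b w) - iexp (t * linear_part l b w)))"
      using I[OF stat_measurable] I[OF LM] by (intro integrable_norm Bochner_Integration.integrable_diff)
    show "integrable M (\<lambda>w. \<bar>t\<bar> * \<bar>stat l b w - linear_part l b w\<bar>)"
      using st(1) linear_part_int by (intro integrable_mult_right integrable_abs Bochner_Integration.integrable_diff)
    show "norm (iexp (t * stat l b w) - iexp (t * linear_part l b w)) \<le> \<bar>t\<bar> * \<bar>stat l b w - linear_part l b w\<bar>" for w
      using norm_iexp_diff[of "t * stat l b w" "t * linear_part l b w"] by (simp add: abs_mult flip: right_diff_distrib)
  qed
  also have "\<dots> = \<bar>t\<bar> * expectation (\<lambda>w. \<bar>stat l b w - linear_part l b w\<bar>)" by simp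
  also have "\<dots> \<le> \<bar>t\<bar> * (sqrt (real b) * (rem_const / real b + (4 * (S\<^sup>2 * (vabs / v)) + 4 * C) / real l + 2 * (S * w1_err \<rho> l)))"
    by (intro mult_left_mono st(2)) simp
  finally show ?thesis .
qed

text \<open>Levy's continuity theorem. \<open>n k\<close> is the length of the gaps cut out of the
  blocks: \<open>gap\<close> makes what is cut out negligible, \<open>mix\<close> makes the
  remaining pieces asymptotically independent.\<close>

theorem stat_clt:
  fixes l b n :: "nat \<Rightarrow> nat"
  assumes b: "filterlim (\<lambda>k. real (b k)) at_top sequentially"
    and n: "\<forall>\<^sub>F k in sequentially. 1 \<le> n k \<and> n k \<le> l k"
    and w: "(\<lambda>k. sqrt (real (b k)) * w1_err \<rho> (l k)) \<longlonglongrightarrow> 0"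
    and l: "(\<lambda>k. sqrt (real (b k)) / real (l k)) \<longlonglongrightarrow> 0"
    and gap: "(\<lambda>k. sqrt (real (b k)) * sqrt (real (n k)) / sqrt (real (l k))) \<longlonglongrightarrow> 0"
    and mix: "(\<lambda>k. real (b k) * real (n k) powr (- \<theta>)) \<longlonglongrightarrow> 0"
  shows "weak_conv_m (\<lambda>k. distr M borel (stat (l k) (b k))) (density lborel (\<lambda>x. ennreal (normal_density 0 (sqrt psi2) x)))"
proof (rule levy_continuity)
  let ?c = "sqrt psi2"
  have c: "0 < ?c" using psi2_pos by simp
  have lim: "density lborel (\<lambda>x. ennreal (normal_density 0 ?c x)) = distr gauss borel (\<lambda>z. ?c * z)"
    using distr_gauss_scale[of ?c] c by simp
  show "real_distribution (distr M borel (stat (l k) (b k)))" for k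
    by (rule real_distribution_distr) simp
  show "real_distribution (density lborel (\<lambda>x. ennreal (normal_density 0 ?c x)))"
    unfolding lim by (rule gauss.real_distribution_distr) simp
  fix t
  have char_lim: "char (density lborel (\<lambda>x. ennreal (normal_density 0 ?c x))) t = of_real (exp (- (t\<^sup>2 * psi2 / 2)))"
  proof -
    have "char (distr gauss borel (\<lambda>z. ?c * z)) t = char gauss (t * ?c)"
      unfolding char_def by (subst integral_distr) (auto simp: ac_simps)
    also have "\<dots> = of_real (exp (- (t * ?c)\<^sup>2 / 2))" unfolding char_std_normal_distribution ..
    also have "\<dots> = of_real (exp (- (t\<^sup>2 * psi2 / 2)))" using psi2_pos by (simp add: power_mult_distrib)
    finally show ?thesis unfolding lim .
  qed
  have isq: "(\<lambda>k. 1 / sqrt (real (b k))) \<longlonglongrightarrow> 0"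
    by (rule real_tendsto_divide_at_top[OF tendsto_const]) (rule filterlim_compose[OF sqrt_at_top b])
  have ib: "(\<lambda>k. 1 / real (b k)) \<longlonglongrightarrow> 0" by (rule real_tendsto_divide_at_top[OF tendsto_const b])
  let ?u = "2 * \<bar>t\<bar> * S"
  \<comment> \<open>The error bounds regrouped so that each summand is a constant times one of the
    assumed null sequences, using b = sqrt b * sqrt b.\<close>
  define E where "E k =
      \<bar>t\<bar> * (rem_const * (1 / sqrt (real (b k))) + (4 * (S\<^sup>2 * (vabs / v)) + 4 * C) * (sqrt (real (b k)) / real (l k))
        + 2 * S * (sqrt (real (b k)) * w1_err \<rho> (l k)))
      + (3 * ?u * sqrt (vabs / v) * (sqrt (real (b k)) * sqrt (real (n k)) / sqrt (real (l k)))
         + 16 * C * (real (b k) * real (n k) powr (- \<theta>)) + 2 * ?u * (sqrt (real (b k)) * w1_err \<rho> (l k)))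
      + (?u ^ 3 * gauss_moment 3 * (1 / sqrt (real (b k))) + ?u ^ 4 * (gauss_moment 2)\<^sup>2 * (1 / real (b k)))
      + t\<^sup>2 / 2 * (24 * S * gauss_moment 2 * K) * (1 / real (b k))" for k
  have E0: "E \<longlonglongrightarrow> 0"
    unfolding E_def[abs_def] by (intro tendsto_add_zero tendsto_mult_right_zero isq ib w l gap mix)
  have bd: "\<forall>\<^sub>F k in sequentially. norm (char (distr M borel (stat (l k) (b k))) t - of_real (exp (- (t\<^sup>2 * psi2 / 2)))) \<le> E k"
  proof -
    have "\<forall>\<^sub>F k in sequentially. 2 \<le> real (b k)" using b unfolding filterlim_at_top by blast
    with n show ?thesis
    proof eventually_elim
      case (elim k)
      then have bk: "2 \<le> b k" "1 \<le> b k" "0 < real (b k)" and lk: "1 \<le> l k" by auto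
      let ?b = "real (b k)" and ?s = "sqrt (real (b k))"
      have s: "0 < ?s" "?b = ?s * ?s" using bk by auto
      have tri: "norm (p - q) \<le> A + B" if "norm (p - x) \<le> A" "norm (x - q) \<le> B" for p q x :: complex and A B
        using norm_triangle_ineq[of "p - x" "x - q"] that by simp
      have eq: "A1 + (A2 + A3 + A4) = E k"
        if "A1 = \<bar>t\<bar> * (?s * (rem_const / ?b + (4 * (S\<^sup>2 * (vabs / v)) + 4 * C) / real (l k) + 2 * (S * w1_err \<rho> (l k))))"
          and "A2 = ?b * (3 * (?u / ?s) * (sqrt (real (n k) * vabs) / sqrt (real (l k) * v)) + 16 * (C * real (n k) powr (- \<theta>)) + 2 * (?u / ?s) * w1_err \<rho> (l k))"
          and "A3 = ?b * ((?u / ?s) ^ 3 * gauss_moment 3 + (?u / ?s) ^ 4 * (gauss_moment 2)\<^sup>2)"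
          and "A4 = t\<^sup>2 / 2 * (24 * S * gauss_moment 2 * K / ?b)" for A1 A2 A3 A4
      proof -
        have "A1 = \<bar>t\<bar> * (rem_const * (1 / ?s) + (4 * (S\<^sup>2 * (vabs / v)) + 4 * C) * (?s / real (l k)) + 2 * S * (?s * w1_err \<rho> (l k)))"
        proof -
          have e: "s' * (r / b' + a / l' + 2 * (c * w')) = r * (1 / s') + a * (s' / l') + 2 * c * (s' * w')" if "0 < s'" "b' = s' * s'" for s' b' r a l' c w' :: real
            using that by (simp add: distrib_left)
          show ?thesis unfolding that(1) e[OF s] ..
        qed
        moreover have "A2 = 3 * ?u * sqrt (vabs / v) * (?s * sqrt (real (n k)) / sqrt (real (l k)))
         + 16 * C * (?b * real (n k) powr (- \<theta>)) + 2 * ?u * (?s * w1_err \<rho> (l k))"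
        proof -
          have e: "b' * (3 * (u / s') * (n' * a / (l' * c)) + 16 * (C * p) + 2 * (u / s') * w')
            = 3 * u * (a / c) * (s' * n' / l') + 16 * C * (b' * p) + 2 * u * (s' * w')" if "0 < s'" "b' = s' * s'" for s' b' u n' a l' c p w' :: real
            using that by (simp add: distrib_left ac_simps)
          show ?thesis unfolding that(2) real_sqrt_mult real_sqrt_divide by (rule e[OF s])
        qed
        moreover have "A3 = ?u ^ 3 * gauss_moment 3 * (1 / ?s) + ?u ^ 4 * (gauss_moment 2)\<^sup>2 * (1 / ?b)"
        proof -
          have e: "b' * ((u / s') ^ 3 * p + (u / s') ^ 4 * q) = u ^ 3 * p * (1 / s') + u ^ 4 * q * (1 / b')" if "0 < s'" "b' = s' * s'" for s' b' u p q :: real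
            using that by (simp add: distrib_left power_divide power3_eq_cube power4_eq_xxxx)
          show ?thesis unfolding that(3) by (rule e[OF s])
        qed
        moreover have "A4 = t\<^sup>2 / 2 * (24 * S * gauss_moment 2 * K) * (1 / ?b)" unfolding that(4) by simp
        ultimately show ?thesis unfolding E_def by (simp only: add.assoc)
      qed
      show ?case
        by (rule order_trans[OF tri[OF char_stat_linear_part[OF bk(1) lk] char_linear_part] eq[THEN eq_refl]])
           (use elim bk in auto)
    qed
  qed
  have "(\<lambda>k. char (distr M borel (stat (l k) (b k))) t - of_real (exp (- (t\<^sup>2 * psi2 / 2)))) \<longlonglongrightarrow> 0"
    by (rule Lim_null_comparison[OF bd E0])
  then show "(\<lambda>k. char (distr M borel (stat (l k) (b k))) t) \<longlonglongrightarrow> char (density lborel (\<lambda>x. ennreal (normal_density 0 ?c x))) t"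
    unfolding char_lim by (rule LIM_zero_cancel)
qed

end

section \<open>From the exponent s to powers of the block length\<close>

lemma powr_at_top:
  fixes p :: real
  assumes p: "0 < p"
  shows "filterlim (\<lambda>x. x powr p) at_top at_top"
  unfolding filterlim_at_top_ge[where c = 1]
proof (intro allI impI)
  fix z :: real assume z: "1 \<le> z"
  show "\<forall>\<^sub>F x in at_top. z \<le> x powr p"
  proof (rule eventually_mono[OF eventually_ge_at_top])
    fix x assume "z powr (1 / p) \<le> x"
    then have "(z powr (1 / p)) powr p \<le> x powr p" using p by (intro powr_mono2) auto
    then show "z \<le> x powr p" using p z by (simp add: powr_powr)
  qed
qed

text \<open>As l is n to the power s and b is n to the power 1 - s, b is l to the power \<beta>. The
  two entries of the maximum are the two conditions on \<beta>, solved for s.\<close>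

lemma block_exponent:
  fixes s :: real
  assumes s: "1 / 2 < s" "s < 1" and "1 < \<rho>" "0 < \<delta>"
    and max: "s > max (1 / (1 + \<delta> * ((\<rho> - 1) / (\<rho> + 1))))
                 ((1 + \<delta>\<^sup>2 / (\<rho> * (2 + \<delta>) * (1 + \<delta>))) / (2 + \<delta>\<^sup>2 / (\<rho> * (2 + \<delta>) * (1 + \<delta>))))"
    and \<beta>: "\<beta> = (1 - s) / s"
  shows "0 < \<beta>" and "\<beta> < \<delta> * ((\<rho> - 1) / (\<rho> + 1))"
    and "\<beta> + \<beta> / (\<rho> * (2 + \<delta>) * (1 + \<delta>) / \<delta>\<^sup>2) < 1"
proof -
  have s0: "0 < s" using s by simp
  define e where "e = \<delta> * ((\<rho> - 1) / (\<rho> + 1))"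
  \<comment> \<open>The reciprocal of the mixing exponent \<theta>.\<close>
  define q where "q = \<delta>\<^sup>2 / (\<rho> * (2 + \<delta>) * (1 + \<delta>))"
  have e: "0 < e" using assms unfolding e_def by simp
  have q: "0 < q" using assms unfolding q_def by simp
  show "0 < \<beta>" unfolding \<beta> using s by simp
  have "1 / (1 + e) < s" using max unfolding e_def by simp
  then have "1 < s * (1 + e)" using e by (simp add: field_simps)
  then show "\<beta> < \<delta> * ((\<rho> - 1) / (\<rho> + 1))"
    unfolding e_def[symmetric] \<beta> using s0 by (simp add: field_simps)
  have "(1 + q) / (2 + q) < s" using max unfolding q_def by simp
  then have "1 + q < s * (2 + q)" using q by (simp add: field_simps)
  then have "(1 - s) * (1 + q) / s < 1" using s0 by (simp add: field_simps)
  moreover have "\<beta> + \<beta> * q = (1 - s) * (1 + q) / s" unfolding \<beta> by (simp add: distrib_left add_divide_distrib)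
  ultimately have "\<beta> + \<beta> * q < 1" by simp
  then show "\<beta> + \<beta> / (\<rho> * (2 + \<delta>) * (1 + \<delta>) / \<delta>\<^sup>2) < 1" unfolding q_def by simp
qed

context gini_clt
begin

theorem stat_clt_powr:
  fixes l b :: "nat \<Rightarrow> nat"
  assumes \<theta>_eq: "\<theta> = \<rho> * (2 + \<delta>) * (1 + \<delta>) / \<delta>\<^sup>2"
    and \<beta>: "0 < \<beta>" "\<beta> < \<delta> * ((\<rho> - 1) / (\<rho> + 1))" "\<beta> + \<beta> / \<theta> < 1"
    and l: "filterlim l at_top sequentially"
    and b: "\<And>k. 1 \<le> l k \<Longrightarrow> real (b k) = real (l k) powr \<beta>"
  shows "weak_conv_m (\<lambda>k. distr M borel (stat (l k) (b k))) (density lborel (\<lambda>x. ennreal (normal_density 0 (sqrt psi2) x)))"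
proof -
  have \<theta>0: "0 < \<theta>" unfolding \<theta>_eq using \<rho> \<delta> by simp
  have "\<beta> / \<theta> > 0" using \<beta> \<theta>0 by simp
  then have \<beta>1: "\<beta> < 1" using \<beta>(3) by linarith
  \<comment> \<open>The gaps have length about l to the power x. Factorisation needs \<beta> < x *
    \<theta>, negligible gaps need \<beta> + x < 1; x is the midpoint of the interval from \<beta> /
    \<theta> to 1 - \<beta>, which is nonempty by the third condition on \<beta>.\<close>
  define x where "x = (\<beta> / \<theta> + 1 - \<beta>) / 2"
  have x: "0 < x" "x < 1 - \<beta>" "\<beta> / \<theta> < x" "x < 1"
  proof -
    have "0 < (r + 1 - \<beta>) / 2 \<and> (r + 1 - \<beta>) / 2 < 1 - \<beta> \<and> r < (r + 1 - \<beta>) / 2 \<and> (r + 1 - \<beta>) / 2 < 1"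
      if "0 < r" "\<beta> + r < 1" for r using that \<beta>(1) by auto
    then show "0 < x" "x < 1 - \<beta>" "\<beta> / \<theta> < x" "x < 1" using \<beta>(3) \<open>\<beta> / \<theta> > 0\<close> unfolding x_def by blast+
  qed
  define n where "n k = nat \<lceil>real (l k) powr x\<rceil>" for k
  have rl: "filterlim (\<lambda>k. real (l k)) at_top sequentially"
    by (rule filterlim_compose[OF filterlim_real_sequentially l])
  have ev: "\<forall>\<^sub>F k in sequentially. 1 \<le> l k" using l unfolding filterlim_at_top by blast
  have sb: "sqrt (real (b k)) = real (l k) powr (\<beta> / 2)" if "1 \<le> l k" for k
    using b[OF that] that by (simp add: powr_half_sqrt_powr)
  have neg: "(\<lambda>k. c * real (l k) powr a) \<longlonglongrightarrow> 0" if "a < 0" for a c :: real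
    by (rule tendsto_mult_right_zero[OF tendsto_neg_powr[OF that rl]])
  have nk: "1 \<le> n k" "n k \<le> l k" "real (l k) powr x \<le> real (n k)" "real (n k) \<le> 2 * real (l k) powr x" if k: "1 \<le> l k" for k
  proof -
    have 1: "1 \<le> real (l k) powr x" using k x by (intro ge_one_powr_ge_zero) auto
    have 2: "real (l k) powr x \<le> real (l k)" using powr_mono[of x 1 "real (l k)"] k x by simp
    show lo: "real (l k) powr x \<le> real (n k)" unfolding n_def by (rule real_nat_ceiling_ge)
    show "1 \<le> n k" using lo 1 by linarith
    show "n k \<le> l k" unfolding n_def using 2 by simp
    have "real (n k) \<le> real (l k) powr x + 1" unfolding n_def using 1 by linarith
    then show "real (n k) \<le> 2 * real (l k) powr x" using 1 by linarith
  qed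
  show ?thesis
  proof (rule stat_clt[where n = n])
    have "filterlim (\<lambda>k. real (l k) powr \<beta>) at_top sequentially"
      by (rule filterlim_compose[OF powr_at_top[OF \<beta>(1)] rl])
    then show "filterlim (\<lambda>k. real (b k)) at_top sequentially"
      by (rule filterlim_cong[THEN iffD1, rotated 3]) (auto intro: eventually_mono[OF ev] simp: b)
    show "\<forall>\<^sub>F k in sequentially. 1 \<le> n k \<and> n k \<le> l k" by (rule eventually_mono[OF ev]) (use nk in auto)
    have "(\<lambda>k. real (l k) powr (\<beta> / 2) * w1_err \<rho> (l k)) \<longlonglongrightarrow> 0"
      by (rule filterlim_compose[OF w1_err_tendsto[OF \<rho> \<theta>_eq v \<beta>(2)] l])
    then show "(\<lambda>k. sqrt (real (b k)) * w1_err \<rho> (l k)) \<longlonglongrightarrow> 0"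
      by (rule Lim_transform_eventually) (rule eventually_mono[OF ev], simp add: sb)
    show "(\<lambda>k. sqrt (real (b k)) / real (l k)) \<longlonglongrightarrow> 0"
    proof (rule Lim_transform_eventually[OF neg[of "\<beta> / 2 - 1" 1]])
      show "\<forall>\<^sub>F k in sequentially. 1 * real (l k) powr (\<beta> / 2 - 1) = sqrt (real (b k)) / real (l k)"
        by (rule eventually_mono[OF ev]) (simp add: sb powr_diff)
    qed (use \<beta>1 in simp)
    show "(\<lambda>k. sqrt (real (b k)) * sqrt (real (n k)) / sqrt (real (l k))) \<longlonglongrightarrow> 0"
    proof (rule Lim_null_comparison[OF _ neg[of "(\<beta> + x - 1) / 2" "sqrt 2"]])
      show "\<forall>\<^sub>F k in sequentially. norm (sqrt (real (b k)) * sqrt (real (n k)) / sqrt (real (l k)))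
          \<le> sqrt 2 * real (l k) powr ((\<beta> + x - 1) / 2)"
      proof (rule eventually_mono[OF ev])
        fix k assume k: "1 \<le> l k"
        have l0: "0 < real (l k)" using k by simp
        have "sqrt (real (b k)) * sqrt (real (n k)) / sqrt (real (l k)) = sqrt (real (b k) * real (n k) / real (l k))"
          by (simp add: real_sqrt_mult real_sqrt_divide)
        also have "\<dots> \<le> sqrt (real (l k) powr \<beta> * (2 * real (l k) powr x) / real (l k))"
          unfolding b[OF k] by (intro real_sqrt_le_mono divide_right_mono mult_left_mono nk(4) k) auto
        also have "real (l k) powr \<beta> * (2 * real (l k) powr x) / real (l k) = 2 * real (l k) powr (\<beta> + x - 1)"
          using l0 by (simp add: powr_add powr_diff)
        also have "sqrt (2 * real (l k) powr (\<beta> + x - 1)) = sqrt 2 * real (l k) powr ((\<beta> + x - 1) / 2)"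
          using l0 by (simp add: real_sqrt_mult powr_half_sqrt_powr)
        finally show "norm (sqrt (real (b k)) * sqrt (real (n k)) / sqrt (real (l k))) \<le> sqrt 2 * real (l k) powr ((\<beta> + x - 1) / 2)"
          by simp
      qed
    qed (use x in simp)
    show "(\<lambda>k. real (b k) * real (n k) powr (- \<theta>)) \<longlonglongrightarrow> 0"
    proof (rule Lim_null_comparison[OF _ neg[of "\<beta> - x * \<theta>" 1]])
      show "\<forall>\<^sub>F k in sequentially. norm (real (b k) * real (n k) powr (- \<theta>)) \<le> 1 * real (l k) powr (\<beta> - x * \<theta>)"
      proof (rule eventually_mono[OF ev])
        fix k assume k: "1 \<le> l k"
        have l0: "0 < real (l k)" using k by simp
        have "real (n k) powr (- \<theta>) \<le> (real (l k) powr x) powr (- \<theta>)"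
          using nk[OF k] l0 \<theta>0 by (intro powr_mono2') auto
        then have "real (b k) * real (n k) powr (- \<theta>) \<le> real (l k) powr \<beta> * real (l k) powr (- (x * \<theta>))"
          unfolding b[OF k] by (intro mult_left_mono) (auto simp: powr_powr)
        then show "norm (real (b k) * real (n k) powr (- \<theta>)) \<le> 1 * real (l k) powr (\<beta> - x * \<theta>)"
          by (simp add: powr_add[symmetric])
      qed
    qed (use x \<theta>0 in \<open>simp add: field_simps\<close>)
  qed
qed

end

section \<open>From stationarity and mixing coefficients to the abstract assumptions\<close>

lemma stationary_distr:
  assumes st: "strictly_stationary M Y" and J: "finite J" "J \<subseteq> {1..}" and f: "f \<in> measurable (Pi\<^sub>M J (\<lambda>_. borel)) N"
  shows "distr M N (\<lambda>w. f (\<lambda>j\<in>J. Y (j + k) w)) = distr M N (\<lambda>w. f (\<lambda>j\<in>J. Y j w))"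
proof -
  have m: "(\<lambda>w. \<lambda>j\<in>J. Y (j + k) w) \<in> measurable M (Pi\<^sub>M J (\<lambda>_. borel))" for k
  proof (rule measurable_restrict)
    fix j assume "j \<in> J"
    then have "1 \<le> j + k" using J by auto
    then show "Y (j + k) \<in> borel_measurable M" using st unfolding strictly_stationary_def by blast
  qed
  have "distr M (Pi\<^sub>M J (\<lambda>_. borel)) (\<lambda>w. \<lambda>j\<in>J. Y (j + k) w) = distr M (Pi\<^sub>M J (\<lambda>_. borel)) (\<lambda>w. \<lambda>j\<in>J. Y j w)"
    using st J unfolding strictly_stationary_def by blast
  from arg_cong[OF this, of "\<lambda>D. distr D N f"] show ?thesis
    using distr_distr[OF f m[of k]] distr_distr[OF f m[of 0]] by (simp add: comp_def)
qed

lemma stationary_pair_distr: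
  assumes st: "strictly_stationary M Y" and i: "1 \<le> i"
  shows "distr M (borel \<Otimes>\<^sub>M borel) (\<lambda>w. (Y i w, Y (i + d) w)) = distr M (borel \<Otimes>\<^sub>M borel) (\<lambda>w. (Y 1 w, Y (1 + d) w))"
proof -
  have "(\<lambda>f. (f 1, f (1 + d))) \<in> measurable (Pi\<^sub>M {1, 1 + d} (\<lambda>_. borel)) (borel \<Otimes>\<^sub>M borel)"
    by (intro measurable_Pair measurable_component_singleton) auto
  from stationary_distr[OF st _ _ this, of "i - 1"] show ?thesis
    using i by (simp add: add.commute add.left_commute)
qed

text \<open>Statements about a single variable are obtained with a function that ignores its second
  argument and lag 0.\<close>

lemma stationary_expectation_pair:
  fixes f :: "real \<Rightarrow> real \<Rightarrow> real"
  assumes st: "strictly_stationary M Y" and i: "1 \<le> i" and f: "(\<lambda>(x, y). f x y) \<in> borel_measurable (borel \<Otimes>\<^sub>M borel)"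
  shows "(\<integral>w. f (Y i w) (Y (i + d) w) \<partial>M) = (\<integral>w. f (Y 1 w) (Y (1 + d) w) \<partial>M)"
    and "integrable M (\<lambda>w. f (Y i w) (Y (i + d) w)) \<longleftrightarrow> integrable M (\<lambda>w. f (Y 1 w) (Y (1 + d) w))"
proof -
  have m: "(\<lambda>w. (Y i w, Y (i + d) w)) \<in> measurable M (borel \<Otimes>\<^sub>M borel)" if "1 \<le> i" for i
    using st that unfolding strictly_stationary_def by (intro measurable_Pair) auto
  note e = stationary_pair_distr[OF st i, of d]
  show "(\<integral>w. f (Y i w) (Y (i + d) w) \<partial>M) = (\<integral>w. f (Y 1 w) (Y (1 + d) w) \<partial>M)"
    using integral_distr[OF m[OF i] f] integral_distr[OF m[of 1] f] unfolding e by simp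
  show "integrable M (\<lambda>w. f (Y i w) (Y (i + d) w)) \<longleftrightarrow> integrable M (\<lambda>w. f (Y 1 w) (Y (1 + d) w))"
    using integrable_distr_eq[OF m[OF i] f] integrable_distr_eq[OF m[of 1] f] unfolding e by simp
qed

text \<open>Real suprema dominate their elements only for bounded sets; here everything is at most
  1. The restriction on m matches the range of the outer supremum.\<close>

lemma (in prob_space) alpha_mix_bound:
  assumes m: "1 \<le> m" and A: "A \<in> sigma_gen M Y {1..m}" and D: "D \<in> sigma_gen M Y {k + m..}"
  shows "\<bar>prob (A \<inter> D) - prob A * prob D\<bar> \<le> alpha_mix M Y k"
proof -
  have 1: "\<bar>prob A * prob B - prob (A \<inter> B)\<bar> \<le> 1" for A B
  proof -
    have "0 \<le> prob A * prob B" "prob A * prob B \<le> 1" by (auto intro: mult_le_one)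
    then show ?thesis using measure_nonneg[of M "A \<inter> B"] prob_le_1[of "A \<inter> B"] by linarith
  qed
  have up: "\<bar>prob A * prob B - prob (A \<inter> B)\<bar> \<le> alpha_dep M \<A> \<B>" if "A \<in> \<A>" "B \<in> \<B>" for A B \<A> \<B>
    unfolding alpha_dep_def
  proof (rule cSup_upper)
    show "bdd_above {\<bar>prob A * prob B - prob (A \<inter> B)\<bar> |A B. A \<in> \<A> \<and> B \<in> \<B>}"
      by (rule bdd_aboveI[of _ 1]) (use 1 in blast)
  qed (use that in blast)
  have le1: "alpha_dep M \<A> \<B> \<le> 1" if "A \<in> \<A>" "B \<in> \<B>" for A B \<A> \<B>
    unfolding alpha_dep_def by (rule cSup_least) (use that 1 in blast)+
  have ne: "{} \<in> sigma_gen M Y I" for I unfolding sigma_gen_def by (rule sigma_sets.Empty)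
  have "alpha_dep M (sigma_gen M Y {1..m}) (sigma_gen M Y {k + m..}) \<le> alpha_mix M Y k"
    unfolding alpha_mix_def
  proof (rule cSUP_upper)
    show "bdd_above ((\<lambda>m. alpha_dep M (sigma_gen M Y {1..m}) (sigma_gen M Y {k + m..})) ` {1..})"
      by (rule bdd_aboveI[of _ 1]) (use le1[OF ne ne] in blast)
  qed (use m in simp)
  then show ?thesis using up[OF A D] by (simp add: abs_minus_commute)
qed

theorem theorem2p5:
  fixes M :: "'a measure" and Y :: "nat \<Rightarrow> 'a \<Rightarrow> real"
    and \<mu> \<sigma> :: "real \<Rightarrow> real" and \<mu>H \<sigma>0 :: real
    and \<rho> \<delta> C s :: real
    and r l b :: "nat \<Rightarrow> nat"
    and N :: "'b measure" and Z Z' :: "'b \<Rightarrow> real"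
    and G :: "real \<Rightarrow> real \<Rightarrow> 'b \<Rightarrow> real"
  assumes "prob_space M"
    and "strictly_stationary M Y"
    and "prob_space.expectation M (Y 1) = 0"
    and "prob_space.variance M (Y 1) = 1"
    and "alpha_mix M Y \<longlonglongrightarrow> 0"
    and "long_run_variance M Y > 0"
    and "cadlag01 \<mu>"
    and "cadlag01 \<sigma>"
    and "piecewise_lipschitz01 \<sigma>"
    and "\<sigma>0 > 0"
    and "\<And>x. x \<in> {0..1} \<Longrightarrow> \<sigma> x \<ge> \<sigma>0"
    \<comment> \<open>\<open>r\<close> enumerates sample sizes \<open>n\<close> for which \<open>l n = n\<^sup>s\<close> and \<open>b n = n\<^sup>1\<^sup>-\<^sup>s\<close> are integers\<close>
    and "1 / 2 < s" and "s < 1"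
    and "strict_mono r"
    and "\<And>k. real (l (r k)) = real (r k) powr s"
    and "\<And>k. real (b (r k)) = real (r k) powr (1 - s)"
    and "\<rho> > 1" and "0 < \<delta>" and "\<delta> \<le> 1"
    and "integrable M (\<lambda>w. \<bar>Y 1 w\<bar> powr (2 + \<delta>))"
    and "\<And>k. k \<ge> 1 \<Longrightarrow>
           alpha_mix M Y k \<le> C * real k powr (- (\<rho> * (2 + \<delta>) * (1 + \<delta>) / \<delta>\<^sup>2))"
    and "s > max (1 / (1 + \<delta> * ((\<rho> - 1) / (\<rho> + 1))))
                 ((1 + \<delta>\<^sup>2 / (\<rho> * (2 + \<delta>) * (1 + \<delta>))) /
                  (2 + \<delta>\<^sup>2 / (\<rho> * (2 + \<delta>) * (1 + \<delta>))))"
    and "AE x in lborel. x \<in> {0..1} \<longrightarrow> \<mu> x = \<mu>H"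
    and "prob_space N"
    and "distributed N lborel Z (\<lambda>x. ennreal (std_normal_density x))"
    and "distributed N lborel Z' (\<lambda>x. ennreal (std_normal_density x))"
    and "prob_space.indep_var N borel Z borel Z'"
    and "cond_exp_version N Z Z' \<sigma> G"
  shows "weak_conv_m
    (\<lambda>k. distr M borel (\<lambda>w.
       sqrt (real (b (r k))) *
         (sqrt (real (l (r k))) / sqrt (long_run_variance M Y) *
            U_stat (observation \<mu> \<sigma> Y (r k)) (l (r k)) (b (r k)) w
          - (LBINT x:{0..1}. LBINT y:{0..1}. sqrt ((\<sigma> x)\<^sup>2 + (\<sigma> y)\<^sup>2)) * sqrt (2 / pi))))
    (density lborel (\<lambda>x. ennreal (normal_density 0 (sqrt (psi_sq N Z Z' \<sigma> G)) x)))"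
proof -
  interpret prob_space M by fact
  note st = assms(2)
  define \<theta> where "\<theta> = \<rho> * (2 + \<delta>) * (1 + \<delta>) / \<delta>\<^sup>2"
  define \<gamma> where "\<gamma> d = expectation (\<lambda>w. Y 1 w * Y (1 + d) w)" for d
  have \<delta>: "0 < \<delta>" "\<delta> \<le> 1" and \<rho>: "1 < \<rho>" by fact+
  have Ym: "Y i \<in> borel_measurable M" if "1 \<le> i" for i using st that unfolding strictly_stationary_def by blast
  \<comment> \<open>\<open>max C 0\<close> provides the nonnegative bound that the trivial past with
    n = 0 requires, since the definition of \<open>alpha_mix\<close> starts at 1.\<close>
  interpret mixing_process M Y \<delta> \<theta> "max C 0" "expectation (\<lambda>w. \<bar>Y 1 w\<bar> powr (2 + \<delta>))" \<gamma>
  proof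
    fix i :: nat assume i: "1 \<le> i"
    show "Y i \<in> borel_measurable M" by (rule Ym[OF i])
    have m: "(\<lambda>(x, y). \<bar>x\<bar> powr (2 + \<delta>) :: real) \<in> borel_measurable (borel \<Otimes>\<^sub>M (borel :: real measure))" by measurable
    note e = stationary_expectation_pair[where d = 0, OF st i m]
    show "integrable M (\<lambda>w. \<bar>Y i w\<bar> powr (2 + \<delta>))" using e(2) assms(20) by simp
    show "expectation (\<lambda>w. \<bar>Y i w\<bar> powr (2 + \<delta>)) \<le> expectation (\<lambda>w. \<bar>Y 1 w\<bar> powr (2 + \<delta>))"
      using e(1) by simp
    show "expectation (Y i) = 0"
      using stationary_expectation_pair(1)[OF st i, of "\<lambda>x y. x" 0] assms(3) by simp
    show "expectation (\<lambda>w. Y i w * Y (i + d) w) = \<gamma> d" for d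
      unfolding \<gamma>_def by (rule stationary_expectation_pair(1)[OF st i]) measurable
  next
    fix k n :: nat and A D
    assume k: "1 \<le> k" and A: "A \<in> sigma_gen M Y {1..n}" and D: "D \<in> sigma_gen M Y {k + n..}"
    show "\<bar>prob (A \<inter> D) - prob A * prob D\<bar> \<le> max C 0 * real k powr - \<theta>"
    \<comment> \<open>The \<sigma>-field generated by no variables contains only the empty set and
      the whole space, and both are independent of every event.\<close>
    proof (cases "n = 0")
      case True
      then have "A = {} \<or> A = space M" using A by (simp add: sigma_gen_def sigma_sets_empty_eq)
      moreover have "D \<subseteq> space M"
        using D unfolding sigma_gen_def by (rule sigma_sets_into_sp[rotated]) auto
      ultimately have "prob (A \<inter> D) - prob A * prob D = 0" by (auto simp: prob_space Int_absorb1)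
      then show ?thesis by simp
    next
      case False
      have "\<bar>prob (A \<inter> D) - prob A * prob D\<bar> \<le> alpha_mix M Y k" using False by (intro alpha_mix_bound[OF _ A D]) simp
      also have "\<dots> \<le> C * real k powr - \<theta>" unfolding \<theta>_def by (rule assms(21)[OF k])
      also have "\<dots> \<le> max C 0 * real k powr - \<theta>" by (intro mult_right_mono) auto
      finally show ?thesis .
    qed
  next
    \<comment> \<open>The decay rate of the covariances is \<rho> * (1 + \<delta>) / \<delta>; it
      exceeds 2 because \<rho> > 1 and 1 + \<delta> is at least 2 * \<delta>.\<close>
    have "\<theta> * \<delta> / (2 + \<delta>) = \<rho> * (1 + \<delta>) / \<delta>"
    proof -
      have "\<rho> * a * c / (\<delta> * \<delta>) * \<delta> / a = \<rho> * c / \<delta>" if "0 < a" for a c using that \<delta> by simp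
      then show ?thesis unfolding \<theta>_def power2_eq_square using \<delta> by simp
    qed
    moreover have "2 * \<delta> < \<rho> * (1 + \<delta>)"
    proof -
      have "2 * \<delta> \<le> 1 * (1 + \<delta>)" using \<delta> by simp
      also have "\<dots> < \<rho> * (1 + \<delta>)" using \<rho> \<delta> by (intro mult_strict_right_mono) auto
      finally show ?thesis .
    qed
    ultimately show "2 < \<theta> * \<delta> / (2 + \<delta>)" using \<delta> by (simp only: less_divide_eq if_True)
  qed (use \<delta> in auto)
  have lrv: "long_run_variance M Y = v"
    unfolding long_run_variance_def v_def covariance_def \<gamma>_def using Y_mean by simp
  obtain S where S: "\<And>x. x \<in> {0..1} \<Longrightarrow> \<bar>\<sigma> x\<bar> \<le> S" using piecewise_lipschitz01_bounded[OF assms(9)] by metis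
  obtain K where K: "0 \<le> K" and osc: "\<And>b. 1 \<le> b \<Longrightarrow> \<exists>d. (\<forall>j. 0 \<le> d j) \<and> (\<Sum>j<b. d j) \<le> K \<and>
       (\<forall>j<b. \<forall>x. real j / real b < x \<and> x \<le> real (Suc j) / real b \<longrightarrow> \<bar>\<sigma> x - \<sigma> (real (Suc j) / real b)\<bar> \<le> d j)"
    using piecewise_lipschitz01_oscillation[OF assms(9)] by metis
  \<comment> \<open>Outside [0,1] nothing is known about \<sigma>; the lower bound
    \<open>\<sigma>0\<close> is a positive value to continue it with.\<close>
  define g where "g x = (if x \<in> {0..1} then \<sigma> x else \<sigma>0)" for x
  have g01: "g x = \<sigma> x" if "x \<in> {0..1}" for x using that by (simp add: g_def)
  interpret gini_clt M Y \<delta> \<theta> "max C 0" "expectation (\<lambda>w. \<bar>Y 1 w\<bar> powr (2 + \<delta>))" \<gamma> g "max S \<sigma>0" \<mu> \<sigma> \<mu>H \<rho> K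
  proof
    show "g \<in> borel_measurable borel" unfolding g_def[abs_def] by (rule piecewise_lipschitz01_borel[OF assms(9)])
    show "0 < g x" for x using assms(10) assms(11)[of x] unfolding g_def by auto
    show "g x \<le> max S \<sigma>0" for x using S[of x] unfolding g_def by auto
    show "0 < v" using assms(6) unfolding lrv .
    show "\<mu> x = \<mu>H" if "0 \<le> x" "x < 1" for x by (rule cadlag01_ae_const[OF assms(7) assms(23) that])
  next
    fix b :: nat assume b: "1 \<le> b"
    obtain d where d: "\<forall>j. 0 \<le> d j" "(\<Sum>j<b. d j) \<le> K"
       "\<And>j x. j < b \<Longrightarrow> real j / real b < x \<and> x \<le> real (Suc j) / real b \<Longrightarrow> \<bar>\<sigma> x - \<sigma> (real (Suc j) / real b)\<bar> \<le> d j"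
      using osc[OF b] by blast
    have "\<bar>g x - g (real (Suc j) / real b)\<bar> \<le> d j"
      if jx: "j < b" "real j / real b < x \<and> x \<le> real (Suc j) / real b" for j x
    proof -
      have le1: "real (Suc j) / real b \<le> 1" using jx(1) by simp
      have "0 \<le> real j / real b" by simp
      then have "x \<in> {0..1}" using jx(2) le1 unfolding atLeastAtMost_iff by linarith
      moreover have "real (Suc j) / real b \<in> {0..1}" using le1 by simp
      ultimately show ?thesis using d(3)[OF jx] by (simp only: g01)
    qed
    then show "\<exists>d. (\<forall>j. 0 \<le> d j) \<and> (\<Sum>j<b. d j) \<le> K \<and>
       (\<forall>j<b. \<forall>x. real j / real b < x \<and> x \<le> real (Suc j) / real b \<longrightarrow> \<bar>g x - g (real (Suc j) / real b)\<bar> \<le> d j)"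
      using d by blast
  qed (use \<rho> K g01 in auto)
  define \<beta> where "\<beta> = (1 - s) / s"
  note \<beta> = block_exponent[OF assms(12) assms(13) \<rho> \<delta>(1) assms(22) \<beta>_def, folded \<theta>_def]
  \<comment> \<open>The blocks exhaust the sample exactly, so the sample size may be written as b *
    l, the form used in \<open>stat\<close>.\<close>
  have rl: "l (r k) * b (r k) = r k" for k
  proof -
    have "real (l (r k) * b (r k)) = real (r k) powr (s + (1 - s))"
      unfolding of_nat_mult assms(15) assms(16) by (rule powr_add[symmetric])
    also have "\<dots> = real (r k)" by simp
    finally show ?thesis by (simp only: of_nat_eq_iff)
  qed
  have "filterlim (\<lambda>k. real (r k) powr s) at_top sequentially"
    using assms(12) by (intro filterlim_compose[OF powr_at_top] filterlim_compose[OF filterlim_real_sequentially] filterlim_subseq assms(14)) auto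
  then have l: "filterlim (\<lambda>k. l (r k)) at_top sequentially"
    unfolding assms(15)[symmetric] filterlim_sequentially_iff_filterlim_real .
  have b: "real (b (r k)) = real (l (r k)) powr \<beta>" for k
    unfolding assms(15) assms(16) powr_powr \<beta>_def using assms(12) by simp
  have "weak_conv_m (\<lambda>k. distr M borel (stat (l (r k)) (b (r k)))) (density lborel (\<lambda>x. ennreal (normal_density 0 (sqrt psi2) x)))"
    by (rule stat_clt_powr[OF \<theta>_def \<beta> l b])
  moreover have "stat (l (r k)) (b (r k)) = (\<lambda>w. sqrt (real (b (r k))) *
         (sqrt (real (l (r k))) / sqrt (long_run_variance M Y) * U_stat (observation \<mu> \<sigma> Y (r k)) (l (r k)) (b (r k)) w
          - (LBINT x:{0..1}. LBINT y:{0..1}. sqrt ((\<sigma> x)\<^sup>2 + (\<sigma> y)\<^sup>2)) * sqrt (2 / pi)))" for k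
  proof -
    have "(\<integral>x. (\<integral>y. gdist2 (g x) (g y) \<partial>unif01) \<partial>unif01)
        = (\<integral>x. (\<integral>y. sqrt ((\<sigma> x)\<^sup>2 + (\<sigma> y)\<^sup>2) * sqrt (2 / pi) \<partial>unif01) \<partial>unif01)"
    proof (intro Bochner_Integration.integral_cong refl)
      fix x y assume "x \<in> space unif01" "y \<in> space unif01"
      then have xy: "x \<in> {0..1}" "y \<in> {0..1}" by (simp_all add: space_restrict_space)
      show "gdist2 (g x) (g y) = sqrt ((\<sigma> x)\<^sup>2 + (\<sigma> y)\<^sup>2) * sqrt (2 / pi)"
        using gdist2_eq[of "g x" "g y"] s_pos[of x] s_pos[of y] unfolding g01[OF xy(1)] g01[OF xy(2)] by simp
    qed
    also have "\<dots> = (LBINT x:{0..1}. LBINT y:{0..1}. sqrt ((\<sigma> x)\<^sup>2 + (\<sigma> y)\<^sup>2)) * sqrt (2 / pi)"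
      unfolding LBINT_unif01 by simp
    finally show ?thesis unfolding stat_def[abs_def] lrv rl[of k, unfolded mult.commute[of "l (r k)"]] by simp
  qed
  moreover have "psi_sq N Z Z' \<sigma> G = psi2"
  proof -
    interpret N: gauss_pair N Z Z' unfolding gauss_pair_def gauss_pair_axioms_def using assms by blast
    show ?thesis unfolding psi2_def by (rule N.psi_sq_eq[OF assms(28) scale_function_axioms g01])
  qed
  ultimately show ?thesis by simp
qed

end
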